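(* Assume that $\nu_w$ is the centered Gaussian law with $\mathbb E[\exp(i\lambda\mathbf W_{ij})]=\exp(-\sigma_w^2\lambda^2/(2n))$ for all $\lambda\in\mathbb R$ (so $\Phi(\lambda)=-\sigma_w^2\lambda^2/2$), and that $\nu_x$ is symmetric with finite moments of all orders and variance $\sigma_x^2$. Assume (A2) and (A3) of the context. Then for every integer $k\ge1$, $\frac1p\operatorname{Tr}M^k$ converges in expectation, as $m,p,n\to\infty$, to $$m_k=\sum_{\pi\in\mathcal{NC}(V)}\frac{\phi^{k-|\pi|}}{\psi^{k-1}}\,\theta_1(f)^{S_\pi}\prod_{i=1}^{R_\pi}\Big(\sum_{\mu_i\in\mathcal{NC}(W_i^\pi)}\psi^{|W_i^\pi|-|\mu_i|}\,\theta_1(f)^{S_{\mu_i}}\,\theta_2(f)^{|W_i^\pi|-S_{\mu_i}}\Big).$$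
   Context: $\mathbf W\in\mathbb R^{p\times n}$ has i.i.d. entries of law $\nu_w$, $\mathbf X\in\mathbb R^{n\times m}$ has i.i.d. entries of law $\nu_x$, and $\mathbf W,\mathbf X$ are independent. $Y_m\in\mathbb R^{p\times m}$ has entries $Y_{ij}=\frac1{\sqrt m}f\big(\sum_{k=1}^n \mathbf W_{ik}\mathbf X_{kj}\big)$ and $M=Y_mY_m^\top$. (A2) $f:\mathbb R\to\mathbb R$ is odd, $C^\infty$, and $f^{(k)}\in L^1(\mathbb R)$ for all $k\ge0$. (A3) $m,p,n\to\infty$ with $n/m\to\phi$, $n/p\to\psi$, $\phi,\psi>0$ constants. $$\theta_1(f)=\int_{\mathbb R}f^2(\sigma_w\sigma_xx)\frac{e^{-x^2/2}}{\sqrt{2\pi}}dx,\qquad \theta_2(f)=\Big(\sigma_w\sigma_x\int_{\mathbb R}f'(\sigma_w\sigma_xx)\frac{e^{-x^2/2}}{\sqrt{2\pi}}dx\Big)^2 .$$ $W=\{w_1,\dots,w_k\}$ and $V=\{v_1,\dots,v_k\}$ are interlaced in the cyclic order $w_1<v_1<w_2<v_2<\dots<w_k<v_k$. $\mathcal{NC}(U)$ is the set of noncrossing partitions of a cyclically ordered set $U$; $|\pi|$ is the number of blocks. For $U=\{x_1<\dots<x_\ell\}$ with $x_{\ell+1}=x_1$ and a partition $\pi$ of $U$, $S_\pi$ is the number of indices $i\in\{1,\dots,\ell\}$ such that $x_i$ and $x_{i+1}$ are in the same block (so $S_\pi=\ell$ for the one-block partition). For $\pi\in\mathcal{NC}(V)$,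 $R_\pi=k-|\pi|+1-S_\pi$. For $\pi\in\mathcal{NC}(V)$, decompose $W$ into $k-|\pi|+1$ disjoint subsets: $w,w'$ are in the same subset iff there are no $v_a\sim_\pi v_b$, $a<b$, such that exactly one of $w,w'$ belongs to $\{w_{a+1},\dots,w_b\}$. Exactly $S_\pi$ of these subsets are singletons, and those with at least two elements are denoted $W_1^\pi,\dots,W_{R_\pi}^\pi$; each is given the induced cyclic order. *)

theory Defs
  imports "HOL-Probability.Probability" "Jordan_Normal_Form.Matrix"
begin

definition trace_mat :: "real mat \<Rightarrow> real"
  where "trace_mat A = (\<Sum>i<dim_row A. A $$ (i, i))"

definition Y_mat ::
  "(real \<Rightarrow> real) \<Rightarrow> nat \<Rightarrow> nat \<Rightarrow> nat \<Rightarrow> (nat \<Rightarrow> nat \<Rightarrow> real) \<Rightarrow> (nat \<Rightarrow> nat \<Rightarrow> real) \<Rightarrow> real mat"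
  where "Y_mat f m p n W X =
    mat p m (\<lambda>(i, j). 1 / sqrt (real m) * f (\<Sum>k<n. W i k * X k j))"

definition M_mat ::
  "(real \<Rightarrow> real) \<Rightarrow> nat \<Rightarrow> nat \<Rightarrow> nat \<Rightarrow> (nat \<Rightarrow> nat \<Rightarrow> real) \<Rightarrow> (nat \<Rightarrow> nat \<Rightarrow> real) \<Rightarrow> real mat"
  where "M_mat f m p n W X = Y_mat f m p n W X * transpose_mat (Y_mat f m p n W X)"

definition C_infinity :: "(real \<Rightarrow> real) \<Rightarrow> bool"
  where "C_infinity f \<longleftrightarrow> (\<forall>k x. (deriv ^^ k) f differentiable (at x))"

definition theta1 :: "real \<Rightarrow> real \<Rightarrow> (real \<Rightarrow> real) \<Rightarrow> real"
  where "theta1 \<sigma>w \<sigma>x f = (LINT x|lborel. (f (\<sigma>w * \<sigma>x * x))\<^sup>2 * std_normal_density x)"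

definition theta2 :: "real \<Rightarrow> real \<Rightarrow> (real \<Rightarrow> real) \<Rightarrow> real"
  where "theta2 \<sigma>w \<sigma>x f =
    (\<sigma>w * \<sigma>x * (LINT x|lborel. deriv f (\<sigma>w * \<sigma>x * x) * std_normal_density x))\<^sup>2"

text \<open>
  Cyclically ordered sets are finite sets of natural numbers with the
  cyclic order induced by the linear order; being noncrossing does not depend on where the
  cycle is cut.
\<close>

definition noncrossing_partitions :: "nat set \<Rightarrow> nat set set set"
  where "noncrossing_partitions U =
    {P. partition_on U P \<and>
        \<not> (\<exists>B\<in>P. \<exists>C\<in>P. B \<noteq> C \<and>
             (\<exists>a b c d. a \<in> B \<and> c \<in> B \<and> b \<in> C \<and> d \<in> C \<and> a < b \<and> b < c \<and> c < d))}"

definition same_block :: "nat set set \<Rightarrow> nat \<Rightarrow> nat \<Rightarrow> bool"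
  where "same_block P x y \<longleftrightarrow> (\<exists>B\<in>P. x \<in> B \<and> y \<in> B)"

text \<open>
  Number of cyclically consecutive pairs of \<open>U\<close> lying in a common block. When \<open>U\<close> is a
  singleton its only element is its own successor, so the value is 1.
\<close>

definition S_count :: "nat set \<Rightarrow> nat set set \<Rightarrow> nat"
  where "S_count U P =
    card {i. i < card U \<and>
      same_block P (sorted_list_of_set U ! i) (sorted_list_of_set U ! (Suc i mod card U))}"

text \<open>
  Both interlaced sets \<open>W = {w\<^sub>1, \<dots>, w\<^sub>k}\<close> and \<open>V = {v\<^sub>1, \<dots>, v\<^sub>k}\<close> are encoded by their indices
  \<open>{1..k}\<close>. The interlacing \<open>w\<^sub>1 < v\<^sub>1 < w\<^sub>2 < v\<^sub>2 < \<dots>\<close> enters through the fact that the elements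
  of \<open>W\<close> between \<open>v\<^sub>a\<close> and \<open>v\<^sub>b\<close> are those with index in \<open>{a+1..b}\<close>.
\<close>

definition W_same :: "nat set set \<Rightarrow> nat \<Rightarrow> nat \<Rightarrow> bool"
  where "W_same P w w' \<longleftrightarrow>
    \<not> (\<exists>a b. a < b \<and> same_block P a b \<and> (w \<in> {a+1..b}) \<noteq> (w' \<in> {a+1..b}))"

definition W_subsets :: "nat \<Rightarrow> nat set set \<Rightarrow> nat set set"
  where "W_subsets k P =
    {1..k} // {(w, w'). w \<in> {1..k} \<and> w' \<in> {1..k} \<and> W_same P w w'}"

text \<open>
  The subsets \<open>W\<^sub>1\<^sup>\<pi>, \<dots>, W\<^sub>R\<^sup>\<pi>\<close>; since exactly \<open>S_count {1..k} \<pi>\<close> of the \<open>k - card \<pi> + 1\<close>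
  members of \<open>W_subsets k \<pi>\<close> are singletons, \<open>R = k - card \<pi> + 1 - S_count {1..k} \<pi>\<close>.
\<close>

definition W_big_subsets :: "nat \<Rightarrow> nat set set \<Rightarrow> nat set set"
  where "W_big_subsets k P = {B \<in> W_subsets k P. 2 \<le> card B}"

definition limit_moment :: "real \<Rightarrow> real \<Rightarrow> real \<Rightarrow> real \<Rightarrow> nat \<Rightarrow> real"
  where "limit_moment \<phi> \<psi> \<theta>1 \<theta>2 k =
    (\<Sum>\<pi>\<in>noncrossing_partitions {1..k}.
       \<phi> ^ (k - card \<pi>) / \<psi> ^ (k - 1) * \<theta>1 ^ S_count {1..k} \<pi> *
       (\<Prod>B\<in>W_big_subsets k \<pi>.
          \<Sum>\<mu>\<in>noncrossing_partitions B.
            \<psi> ^ (card B - card \<mu>) * \<theta>1 ^ S_count B \<mu> * \<theta>2 ^ (card B - S_count B \<mu>)))"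

end

theory Submission
  imports Defs
begin

text \<open>
  The trace of \<open>M\<^sup>k\<close> is a sum over index functions \<open>i\<close>, \<open>j\<close> on \<open>{1..k}\<close>, that is, over closed walks
  of length \<open>2 k\<close> on row and column indices, each contributing the expectation of a product of
  factors \<open>f (\<Sum>l<n. W i l * X l j)\<close> over the edges of the walk. Since the entries are independent and
  identically distributed, only the kernels \<open>\<rho>\<close> of \<open>i\<close> and \<open>\<pi>\<close> of \<open>j\<close> matter.

  Each factor is split into the parts that are odd or even in each summand. As the entries are
  symmetric, a term can survive only if for every \<open>l\<close> the edges that enter oddly form a set in which
  all degrees are even, and an odd occurrence costs a factor of order \<open>1 / \<surd>n\<close> through a derivative
  of \<open>f\<close>. Counting cycles shows that the walk contributes \<open>O (n\<^sup>k \<surd>n / n\<^sup>|\<^sup>V\<^sup>|)\<close>, which is negligible,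
  unless it is a cactus of edge-disjoint cycles and double edges, each cycle carrying its own \<open>l\<close>. A
  Lindeberg replacement then gives \<open>\<theta>\<^sub>1\<close> for every double edge and \<open>\<surd>\<theta>\<^sub>2\<close> for every edge of a cycle.
  These walks are exactly the noncrossing ones: \<open>\<pi>\<close> is noncrossing and \<open>\<rho>\<close> is a noncrossing
  refinement of the subsets \<open>W\<^sup>\<pi>\<close>, so that the sum over \<open>\<rho>\<close> factors over these subsets.
\<close>

section \<open>Closed walks\<close>

text \<open>The obstacle is that nothing is known about the growth of the derivatives of
  \<open>f\<close> with their order, so a parity expansion in all \<open>n\<close> summands cannot
  be estimated term by term. It is therefore carried out one summand at a time, and a branch is
  abandoned as soon as \<open>2 k + 1\<close> summands have entered oddly. Each of these has
  \<open>n\<close> possible positions, but a nonempty edge set with all degrees even in a simple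
  graph has at least three edges and so costs \<open>n\<close> to the power \<open>-3/2\<close>; the
  abandoned branches are small although only boundedly many derivatives were used. In the branches
  that remain every size is a power of \<surd>n, so the power count is an inequality between
  integers, and missing equality costs at least a factor \<surd>n. In the case of equality the
  cycles are determined by the walk alone, and a surviving word only chooses distinct summands for
  them. All constants depend on \<open>k\<close>, \<open>f\<close> and the moments but not on the
  walk, because the number of walks grows with the dimensions.\<close>

definition even_set :: "'v set set \<Rightarrow> bool"
  where "even_set D \<longleftrightarrow> (\<forall>v. even (card {e \<in> D. v \<in> e}))"

text \<open>Connectedness through cuts rather than paths: contracting or deleting an edge is then
  handled by composing or reusing the two-valued function \<open>g\<close>.\<close>

definition connecting :: "'v set \<Rightarrow> 'v set set \<Rightarrow> bool"
  where "connecting V F \<longleftrightarrow>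
    (\<forall>g :: 'v \<Rightarrow> bool. (\<forall>e\<in>F. \<forall>x\<in>e. \<forall>y\<in>e. g x = g y) \<longrightarrow> (\<forall>x\<in>V. \<forall>y\<in>V. g x = g y))"

text \<open>Contract an edge: at most one vertex and at least one edge disappear. Edges only have
  the form \<open>{a, b}\<close>, with \<open>a = b\<close> allowed, because contraction can create
  loops and merge parallel edges.\<close>

lemma connecting_card:
  assumes "finite F" "finite V" "\<And>e. e \<in> F \<Longrightarrow> \<exists>a b. e = {a, b}" "connecting V F"
  shows "card V \<le> card F + 1"
  using assms
proof (induction "card F" arbitrary: F V rule: less_induct)
  case less
  show ?case
  proof (cases "F = {}")
    case True
    have "x = y" if "x \<in> V" "y \<in> V" for x y
      using spec[OF less.prems(4)[unfolded connecting_def], of "\<lambda>z. z = x"] that True by auto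
    then have "card V \<le> 1"
      using card_le_Suc0_iff_eq[OF less.prems(2)] by auto
    then show ?thesis by simp
  next
    case False
    then obtain e where e: "e \<in> F" by auto
    then obtain a b where ab: "e = {a, b}" using less.prems(3) by blast
    define c where "c = (\<lambda>x. if x = b then a else x)"
    define F' where "F' = (\<lambda>e. c ` e) ` (F - {e})"
    have "card F' \<le> card (F - {e})"
      unfolding F'_def using less.prems(1) by (intro card_image_le) auto
    also have "\<dots> < card F" using less.prems(1) e by (rule card_Diff1_less)
    finally have cF: "card F' < card F" .
    have fF: "finite F'" unfolding F'_def using less.prems(1) by simp
    have dF: "\<exists>a b. e = {a, b}" if eF: "e \<in> F'" for e
    proof -
      obtain e0 where e0: "e0 \<in> F" "e = c ` e0" using eF unfolding F'_def by blast
      obtain p q where "e0 = {p, q}" using less.prems(3)[OF e0(1)] by blast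
      then have "e = {c p, c q}" using e0 by auto
      then show ?thesis by blast
    qed
    have conn: "connecting (c ` V) F'"
      unfolding connecting_def
    proof (intro allI impI ballI)
      fix g :: "'a \<Rightarrow> bool" and x y
      assume g: "\<forall>e\<in>F'. \<forall>x\<in>e. \<forall>y\<in>e. g x = g y" and xy: "x \<in> c ` V" "y \<in> c ` V"
      have "\<forall>e\<in>F. \<forall>x\<in>e. \<forall>y\<in>e. (g \<circ> c) x = (g \<circ> c) y"
      proof (intro ballI)
        fix e' x y assume *: "e' \<in> F" "x \<in> e'" "y \<in> e'"
        show "(g \<circ> c) x = (g \<circ> c) y"
        proof (cases "e' = e")
          case True
          then show ?thesis using * ab by (auto simp: c_def)
        next
          case False
          then have "c ` e' \<in> F'" using * F'_def by auto
          then show ?thesis using g * by auto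
        qed
      qed
      then have "\<forall>x\<in>V. \<forall>y\<in>V. (g \<circ> c) x = (g \<circ> c) y"
        using less.prems(4) unfolding connecting_def by blast
      then show "g x = g y" using xy by auto
    qed
    have "card (c ` V) \<le> card F' + 1"
      using less.hyps[OF cF fF _ dF conn] less.prems(2) by blast
    moreover have "V - {b} \<subseteq> c ` V" by (auto simp: c_def)
    then have "card (V - {b}) \<le> card (c ` V)"
      using less.prems(2) by (intro card_mono) auto
    moreover have "card V \<le> card (V - {b}) + 1"
      using card_Diff_singleton_if[of V b] by auto
    ultimately show ?thesis using cF by linarith
  qed
qed

text \<open>Handshake argument: if \<open>g\<close> disagreed across \<open>e\<close> only, the
  degrees in \<open>D\<close> summed over the vertices where \<open>g\<close> holds would be even,
  while \<open>e\<close> alone contributes an odd number of end points.\<close>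

lemma connecting_remove:
  assumes conn: "connecting V F" and D: "D \<subseteq> F" "even_set D" "finite D"
    and two: "\<And>e. e \<in> D \<Longrightarrow> card e = 2" and e: "e \<in> D"
  shows "connecting V (F - {e})"
  unfolding connecting_def
proof (intro allI impI)
  fix g :: "'a \<Rightarrow> bool"
  assume g: "\<forall>e\<in>F - {e}. \<forall>x\<in>e. \<forall>y\<in>e. g x = g y"
  have finU: "finite (\<Union>D)" 
  proof (rule finite_Union)
    show "finite e" if "e \<in> D" for e
      using two[OF that] by (metis card.infinite zero_neq_numeral)
  qed (fact D(3))
  define A where "A = {v \<in> \<Union>D. g v}"
  have finA: "finite A" unfolding A_def by (rule finite_subset[OF _ finU]) auto
  have "even (\<Sum>v\<in>A. card {e \<in> D. v \<in> e})"
    using D(2) unfolding even_set_def by (auto intro: dvd_sum)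
  also have "(\<Sum>v\<in>A. card {e \<in> D. v \<in> e}) = (\<Sum>e\<in>D. card {v \<in> A. v \<in> e})"
    using sum.swap_restrict[OF finA D(3), of "\<lambda>_ _. 1::nat" "\<lambda>v e. v \<in> e"] by simp
  also have "\<dots> = (\<Sum>e'\<in>D - {e}. card {v \<in> A. v \<in> e'}) + card {v \<in> A. v \<in> e}"
    using sum.remove[OF D(3) e, of "\<lambda>e. card {v \<in> A. v \<in> e}"] by simp
  finally have ev: "even ((\<Sum>e'\<in>D - {e}. card {v \<in> A. v \<in> e'}) + card {v \<in> A. v \<in> e})" .
  have "even (card {v \<in> A. v \<in> e'})" if e': "e' \<in> D - {e}" for e'
  proof -
    obtain p q where pq: "e' = {p, q}" "p \<noteq> q"
      using two[of e'] e' unfolding card_2_iff by blast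
    have "e' \<in> F - {e}" using e' D(1) by blast
    moreover have "p \<in> e'" "q \<in> e'" unfolding pq(1) by auto
    ultimately have "g p = g q" by (rule g[rule_format])
    have "{v \<in> A. v \<in> e'} = {v \<in> e'. g v}" using e' unfolding A_def by blast
    also have "\<dots> = (if g p then {p, q} else {})"
      using \<open>g p = g q\<close> unfolding pq(1) by auto
    finally show ?thesis using pq(2) by simp
  qed
  then have "even (\<Sum>e'\<in>D - {e}. card {v \<in> A. v \<in> e'})" by (auto intro: dvd_sum)
  with ev have ev2: "even (card {v \<in> A. v \<in> e})" by simp
  obtain p q where pq: "e = {p, q}" "p \<noteq> q"
    using two[of e] e by (auto simp: card_2_iff)
  have "g p = g q"
  proof (rule ccontr)
    assume "g p \<noteq> g q"
    have "{v \<in> A. v \<in> e} = {v \<in> e. g v}" using e unfolding A_def by blast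
    also have "\<dots> = (if g p then {p} else {q})"
      using \<open>g p \<noteq> g q\<close> unfolding pq(1) by auto
    finally show False using ev2 by (simp split: if_splits)
  qed
  then have "\<forall>x\<in>e. \<forall>y\<in>e. g x = g y" unfolding pq(1) by auto
  then have "\<forall>e\<in>F. \<forall>x\<in>e. \<forall>y\<in>e. g x = g y"
    using g by (metis Diff_iff empty_iff insert_iff)
  then show "\<forall>x\<in>V. \<forall>y\<in>V. g x = g y" using conn unfolding connecting_def by blast
qed

text \<open>Each end of an edge lies on a further edge, and in a simple graph the two further edges
  differ. Three is the value that matters: \<open>n\<close> positions times
  \<open>1 / \<surd>n ^ 3\<close> is small.\<close>

lemma even_set_card_ge_3:
  assumes "even_set D" "finite D" "D \<noteq> {}" "\<And>e. e \<in> D \<Longrightarrow> card e = 2"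
  shows "3 \<le> card D"
proof -
  obtain e where e: "e \<in> D" using assms by auto
  obtain p q where pq: "e = {p, q}" "p \<noteq> q" using assms(4)[OF e] unfolding card_2_iff by blast
  have other: "\<exists>e'\<in>D. v \<in> e' \<and> e' \<noteq> e" if "v \<in> e" for v
  proof (rule ccontr)
    assume "\<not> ?thesis"
    then have "{e \<in> D. v \<in> e} = {e}" using e that by blast
    then have "card {e \<in> D. v \<in> e} = 1" by simp
    moreover have "even (card {e \<in> D. v \<in> e})" using assms(1) unfolding even_set_def by blast
    ultimately show False by simp
  qed
  obtain e1 where e1: "e1 \<in> D" "p \<in> e1" "e1 \<noteq> e" using other[of p] pq by auto
  obtain e2 where e2: "e2 \<in> D" "q \<in> e2" "e2 \<noteq> e" using other[of q] pq by auto
  have "e1 \<noteq> e2"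
  proof
    assume "e1 = e2"
    then have "{p, q} \<subseteq> e1" using e1 e2 by auto
    moreover have "finite e1" using assms(4)[OF e1(1)] by (metis card.infinite zero_neq_numeral)
    moreover have "card {p, q} = card e1" using assms(4)[OF e1(1)] pq by simp
    ultimately have "{p, q} = e1" using card_subset_eq by metis
    then show False using e1 pq by simp
  qed
  then have "card {e, e1, e2} = 3" using e1 e2 by auto
  moreover have "{e, e1, e2} \<subseteq> D" using e e1 e2 by auto
  ultimately show ?thesis using card_mono[OF assms(2), of "{e, e1, e2}"] by simp
qed

text \<open>Otherwise an edge of \<open>D\<close> could be deleted without disconnecting the graph,
  leaving too few edges for its vertices.\<close>

lemma tree_even_set_empty:
  assumes "connecting V F" "finite F" "finite V" "card V = card F + 1"
    and two: "\<And>e. e \<in> F \<Longrightarrow> card e = 2" and D: "D \<subseteq> F" "even_set D"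
  shows "D = {}"
proof (rule ccontr)
  assume "D \<noteq> {}"
  then obtain e where e: "e \<in> D" by auto
  have "connecting V (F - {e})"
    using connecting_remove[OF assms(1) D _ _ e] two D assms(2) finite_subset by blast
  then have "card V \<le> card (F - {e}) + 1"
  proof (rule connecting_card[rotated 3])
    show "\<exists>a b. e' = {a, b}" if "e' \<in> F - {e}" for e'
      using two[of e'] that unfolding card_2_iff by blast
  qed (use assms(2,3) in auto)
  moreover have "card (F - {e}) < card F"
    using e D assms(2) by (intro psubset_card_mono) auto
  ultimately show False using assms(4) by simp
qed

text \<open>Deleting from each set an edge that is not in the later sets keeps the graph connected; a set
  covered by the other ones is paid for by its multiplicity.\<close>

lemma even_family_bound:
  assumes "finite L" "finite V" "finite F" "connecting V F"
    and "\<And>e. e \<in> F \<Longrightarrow> card e = 2"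
    and "\<And>l. l \<in> L \<Longrightarrow> S l \<subseteq> F \<and> even_set (S l) \<and> S l \<noteq> {}"
  shows "2 * card L + 2 * card V + card (\<Union>l\<in>L. S l) \<le> 2 * card F + 2 + (\<Sum>l\<in>L. card (S l)) \<and>
    (2 * card L + 2 * card V + card (\<Union>l\<in>L. S l) = 2 * card F + 2 + (\<Sum>l\<in>L. card (S l))
      \<longrightarrow> disjoint_family_on S L)"
  using assms
proof (induction L arbitrary: F rule: finite_induct)
  case empty
  have "card V \<le> card F + 1"
  proof (rule connecting_card)
    show "\<exists>a b. e' = {a, b}" if "e' \<in> F" for e'
      using empty(4)[OF that] unfolding card_2_iff by blast
  qed (use empty in auto)
  then show ?case by (simp add: disjoint_family_on_def)
next
  case (insert l0 L)
  let ?U = "\<Union>l\<in>L. S l"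
  have fS: "finite (S l)" if "l \<in> insert l0 L" for l
    using insert.prems(2,5) that finite_subset by blast
  have fU: "finite ?U" using fS insert.hyps by auto
  show ?case
  proof (cases "S l0 \<subseteq> ?U")
    case True
    have IH: "2 * card L + 2 * card V + card ?U \<le> 2 * card F + 2 + (\<Sum>l\<in>L. card (S l))"
      using insert.IH[of F] insert.prems by auto
    \<comment> \<open>The set \<open>S l0\<close> adds at least 3 on the right and only 2 on the
      left, so the inequality is strict and the equality clause is vacuous.\<close>
    have "3 \<le> card (S l0)"
      using even_set_card_ge_3[of "S l0"] fS[of l0] insert.prems(4) insert.prems(5)[of l0] by blast
    moreover have "(\<Union>l\<in>insert l0 L. S l) = ?U" using True by auto
    ultimately show ?thesis using IH insert.hyps by simp
  next
    case False
    then obtain e where e: "e \<in> S l0" "e \<notin> ?U" by auto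
    have sF: "S l0 \<subseteq> F" using insert.prems(5) by auto
    have conn: "connecting V (F - {e})"
      by (rule connecting_remove[OF insert.prems(3) sF _ _ _ e(1)])
        (use insert.prems(4) insert.prems(5)[of l0] fS[of l0] sF in auto)
    have IH: "2 * card L + 2 * card V + card ?U \<le> 2 * card (F - {e}) + 2 + (\<Sum>l\<in>L. card (S l)) \<and>
      (2 * card L + 2 * card V + card ?U = 2 * card (F - {e}) + 2 + (\<Sum>l\<in>L. card (S l)) \<longrightarrow>
        disjoint_family_on S L)"
    proof (rule insert.IH)
      show "finite V" "finite (F - {e})" "connecting V (F - {e})" using insert.prems conn by auto
      show "card e' = 2" if "e' \<in> F - {e}" for e' using insert.prems(4) that by auto
      show "S l \<subseteq> F - {e} \<and> even_set (S l) \<and> S l \<noteq> {}" if "l \<in> L" for l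
        using insert.prems(5)[of l] that e(2) by auto
    qed
    have cF: "card F = card (F - {e}) + 1"
      using e sF insert.prems(2) by (metis Suc_eq_plus1 card.remove subsetD)
    have cU: "card (\<Union>l\<in>insert l0 L. S l) + card (S l0 \<inter> ?U) = card (S l0) + card ?U"
      using card_Un_Int[of "S l0" ?U] fS fU by simp
    show ?thesis
    proof (intro conjI impI)
      show "2 * card (insert l0 L) + 2 * card V + card (\<Union>l\<in>insert l0 L. S l)
          \<le> 2 * card F + 2 + (\<Sum>l\<in>insert l0 L. card (S l))"
        using IH cF cU insert.hyps by simp
      assume eq: "2 * card (insert l0 L) + 2 * card V + card (\<Union>l\<in>insert l0 L. S l)
          = 2 * card F + 2 + (\<Sum>l\<in>insert l0 L. card (S l))"
      then have eq2: "2 * card L + 2 * card V + card ?U = 2 * card (F - {e}) + 2 + (\<Sum>l\<in>L. card (S l))"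
        and z: "card (S l0 \<inter> ?U) = 0"
        using IH cF cU insert.hyps by simp_all
      have "finite (S l0 \<inter> ?U)" using fU by blast
      then have "S l0 \<inter> ?U = {}" using z by (simp only: card_0_eq)
      moreover have "disjoint_family_on S L" using IH eq2 by blast
      ultimately show "disjoint_family_on S (insert l0 L)"
        unfolding disjoint_family_on_def by blast
    qed
  qed
qed

section \<open>Bases of the cycle space of a connected graph\<close>

lemma even_set_Union:
  assumes "finite C" "disjoint C" "\<And>c. c \<in> C \<Longrightarrow> even_set c \<and> finite c"
  shows "even_set (\<Union>C)"
  unfolding even_set_def
proof
  fix v
  have eq: "{e \<in> \<Union>C. v \<in> e} = (\<Union>c\<in>C. {e \<in> c. v \<in> e})" by auto
  have "card {e \<in> \<Union>C. v \<in> e} = (\<Sum>c\<in>C. card {e \<in> c. v \<in> e})"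
    unfolding eq using assms by (intro card_UN_disjoint) (auto simp: disjoint_def)
  then show "even (card {e \<in> \<Union>C. v \<in> e})"
    using assms(3) by (auto simp: even_set_def intro!: dvd_sum)
qed

lemma even_set_Diff:
  assumes "even_set A" "even_set B" "B \<subseteq> A" "finite A"
  shows "even_set (A - B)"
  unfolding even_set_def
proof
  fix v
  have eq: "{e \<in> A - B. v \<in> e} = {e \<in> A. v \<in> e} - {e \<in> B. v \<in> e}" by auto
  have "card {e \<in> A - B. v \<in> e} = card {e \<in> A. v \<in> e} - card {e \<in> B. v \<in> e}"
    unfolding eq using assms(3,4) finite_subset[OF assms(3,4)] by (intro card_Diff_subset) auto
  then show "even (card {e \<in> A - B. v \<in> e})" using assms(1,2) by (auto simp: even_set_def)
qed

text \<open>The cardinality condition makes \<open>C\<close> a basis of the cycle space of the connected graph \<open>(V, E)\<close>.\<close>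

definition cycle_family :: "'v set \<Rightarrow> 'v set set \<Rightarrow> 'v set set set \<Rightarrow> bool"
  where "cycle_family V E C \<longleftrightarrow> disjoint C \<and> (\<forall>c\<in>C. c \<noteq> {} \<and> c \<subseteq> E \<and> even_set c) \<and>
    card V + card C = card E + 1"

text \<open>Deleting one edge from each member of \<open>C\<close> leaves a connected graph, which
  the cardinality condition makes a tree. If these edges are chosen outside \<open>D\<close>
  whenever possible, then \<open>D\<close> without the members it contains lies in that tree and is
  an even set, hence empty.\<close>

lemma even_set_cycle_family:
  assumes C: "cycle_family V E C" and fin: "finite E" "finite V" and conn: "connecting V E"
    and two: "\<And>e. e \<in> E \<Longrightarrow> card e = 2" and D: "D \<subseteq> E" "even_set D"
  shows "D = \<Union>{c\<in>C. c \<subseteq> D}"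
proof -
  have dis: "disjoint C" and Cp: "\<And>c. c \<in> C \<Longrightarrow> c \<noteq> {} \<and> c \<subseteq> E \<and> even_set c"
    and cnt: "card V + card C = card E + 1" using C by (auto simp: cycle_family_def)
  have finC: "finite C" using fin Cp by (metis Pow_iff finite_Pow_iff finite_subset subsetI)
  have finc: "finite c" if "c \<in> C" for c using Cp[OF that] fin finite_subset by blast
  define C1 where "C1 = {c\<in>C. c \<subseteq> D}"
  define r where "r = (\<lambda>c. SOME e. e \<in> c \<and> (c \<notin> C1 \<longrightarrow> e \<notin> D))"
  have r: "r c \<in> c \<and> (c \<notin> C1 \<longrightarrow> r c \<notin> D)" if "c \<in> C" for c
    unfolding r_def by (rule someI_ex) (use Cp[OF that] that in \<open>auto simp: C1_def\<close>)
  \<comment> \<open>Members are disjoint, so a member is still intact when its own edge is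
    deleted.\<close>
  have rem: "connecting V (E - r ` C')" if "C' \<subseteq> C" for C'
    using finite_subset[OF that finC] that
  proof (induction C' rule: finite_induct)
    case empty
    then show ?case using conn by simp
  next
    case (insert c C')
    have c: "c \<in> C" using insert by simp
    have "c \<inter> r ` C' = {}"
    proof (rule ccontr)
      assume "c \<inter> r ` C' \<noteq> {}"
      then obtain c' where c': "c' \<in> C'" "r c' \<in> c" by auto
      then have "r c' \<in> c'" "c' \<in> C" "c' \<noteq> c" using r insert by auto
      then show False using dis c c' by (auto simp: disjoint_def)
    qed
    then have "c \<subseteq> E - r ` C'" using Cp[OF c] by auto
    moreover have "connecting V (E - r ` C')" using insert by auto
    ultimately have "connecting V (E - r ` C' - {r c})"
      using connecting_remove[of V "E - r ` C'" c "r c"] Cp[OF c] finc[OF c] two r[OF c]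
      by (metis subsetD)
    moreover have "E - r ` C' - {r c} = E - r ` insert c C'" by auto
    ultimately show ?case by simp
  qed
  have inj: "inj_on r C"
    using r dis by (intro inj_onI) (metis disjoint_def disjoint_iff)
  have rE: "r ` C \<subseteq> E" using r Cp by auto
  have "card (E - r ` C) = card E - card C"
    using card_Diff_subset[of "r ` C" E] rE finC card_image[OF inj] by simp
  moreover have "card C \<le> card E" using card_mono[OF fin(1) rE] card_image[OF inj] by simp
  ultimately have cnt2: "card V = card (E - r ` C) + 1" using cnt by simp
  have evU: "even_set (\<Union>C1)"
    using even_set_Union[of C1] finC dis Cp finc by (auto simp: C1_def disjoint_def)
  have "\<Union>C1 \<subseteq> D" by (auto simp: C1_def)
  then have ev: "even_set (D - \<Union>C1)"
    using even_set_Diff D evU finite_subset[OF D(1) fin(1)] by blast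
  have "D - \<Union>C1 \<subseteq> E - r ` C" using r D(1) by blast
  then have "D - \<Union>C1 = {}"
    using tree_even_set_empty[of V "E - r ` C" "D - \<Union>C1"] rem[OF subset_refl] fin two cnt2 ev by blast
  then show ?thesis using \<open>\<Union>C1 \<subseteq> D\<close> by (auto simp: C1_def)
qed

text \<open>A member of either family contains a member of the other, which contains a member of the
  first; disjointness makes all three equal. The cycles of a walk therefore do not depend on the
  word in which they were found.\<close>

lemma cycle_family_unique:
  assumes C: "cycle_family V E C" "cycle_family V E C'" and fin: "finite E" "finite V"
    and conn: "connecting V E" and two: "\<And>e. e \<in> E \<Longrightarrow> card e = 2"
  shows "C = C'"
proof -
  have sub: "C \<subseteq> C'" if "cycle_family V E C" "cycle_family V E C'" for C C'
  proof
    fix c assume c: "c \<in> C"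
    have p: "c \<noteq> {}" "c \<subseteq> E" "even_set c" using c that(1) by (auto simp: cycle_family_def)
    have "c = \<Union>{d\<in>C'. d \<subseteq> c}" using even_set_cycle_family[OF that(2) fin conn two p(2,3)] by simp
    then obtain d where d: "d \<in> C'" "d \<subseteq> c" using p(1) by blast
    have q: "d \<noteq> {}" "d \<subseteq> E" "even_set d" using d that(2) by (auto simp: cycle_family_def)
    have "d = \<Union>{c\<in>C. c \<subseteq> d}" using even_set_cycle_family[OF that(1) fin conn two q(2,3)] by simp
    then obtain c' where c': "c' \<in> C" "c' \<subseteq> d" using q(1) by blast
    have "c' \<noteq> {}" using c' that(1) by (auto simp: cycle_family_def)
    then have "c' \<inter> c \<noteq> {}" using c'(2) d(2) by blast
    moreover have "disjoint C" using that(1) by (simp add: cycle_family_def)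
    ultimately have "c' = c" using c c'(1) unfolding disjoint_def by blast
    then show "c \<in> C'" using c' d by auto
  qed
  show ?thesis using sub[OF C] sub[OF C(2,1)] by simp
qed

section \<open>Edges and degrees of closed walks\<close>

fun path_edges :: "'v list \<Rightarrow> 'v set list"
  where
    "path_edges [] = []"
  | "path_edges [x] = []"
  | "path_edges (x # y # zs) = {x, y} # path_edges (y # zs)"

definition closed_edges :: "'v list \<Rightarrow> 'v set list"
  where "closed_edges xs = path_edges (xs @ [hd xs])"

definition proper_walk :: "'v list \<Rightarrow> bool"
  where "proper_walk xs \<longleftrightarrow> xs \<noteq> [] \<and> (\<forall>e\<in>set (closed_edges xs). card e = 2)"

definition noncrossing_walk :: "'v list \<Rightarrow> bool"
  where "noncrossing_walk xs \<longleftrightarrow> (\<forall>u v. u \<noteq> v \<longrightarrow> \<not> subseq [u, v, u, v] xs)"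

lemma path_edges_append:
  "path_edges (xs @ u # ys) = path_edges (xs @ [u]) @ path_edges (u # ys)"
  by (induction xs rule: path_edges.induct) auto

lemma path_edges_subset: "e \<in> set (path_edges xs) \<Longrightarrow> e \<subseteq> set xs"
  by (induction xs rule: path_edges.induct) auto

lemma length_path_edges: "length (path_edges xs) = length xs - 1"
  by (induction xs rule: path_edges.induct) auto

lemma length_closed_edges: "length (closed_edges xs) = length xs"
  by (simp add: closed_edges_def length_path_edges)

lemma closed_edges_subset: "xs \<noteq> [] \<Longrightarrow> e \<in> set (closed_edges xs) \<Longrightarrow> e \<subseteq> set xs"
  unfolding closed_edges_def using path_edges_subset[of e "xs @ [hd xs]"] by auto

lemma connecting_path_edges: "connecting (set xs) (set (path_edges xs))"
proof (induction xs rule: path_edges.induct)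
  case (3 x y zs)
  show ?case
    unfolding connecting_def
  proof (intro allI impI)
    fix g :: "'a \<Rightarrow> bool"
    assume g: "\<forall>e\<in>set (path_edges (x # y # zs)). \<forall>x\<in>e. \<forall>y\<in>e. g x = g y"
    have "\<forall>e\<in>set (path_edges (y # zs)). \<forall>x\<in>e. \<forall>y\<in>e. g x = g y"
      using g unfolding path_edges.simps(3) set_simps ball_simps by blast
    then have IH: "g p = g q" if "p \<in> set (y # zs)" "q \<in> set (y # zs)" for p q
      using 3[unfolded connecting_def, rule_format, of g, OF _ that] by blast
    have xy: "g x = g y" by (rule g[rule_format, of "{x, y}"]) auto
    have "g p = g y" if "p \<in> set (x # y # zs)" for p
      using that IH[of p y] xy by (cases "p = x") auto
    then show "\<forall>p\<in>set (x # y # zs). \<forall>q\<in>set (x # y # zs). g p = g q" by metis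
  qed
qed (auto simp: connecting_def)

lemma connecting_closed_edges:
  assumes "xs \<noteq> []"
  shows "connecting (set xs) (set (closed_edges xs))"
proof -
  have "set (xs @ [hd xs]) = set xs" using assms by auto
  then show ?thesis
    unfolding closed_edges_def by (metis connecting_path_edges)
qed

text \<open>Two incidences per visit, one less at each end of the path; the end terms are arranged
  so that no subtraction of natural numbers occurs.\<close>

lemma degree_path_edges:
  assumes "\<forall>e\<in>set (path_edges (x # ys)). card e = 2"
  shows "length (filter (\<lambda>e. v \<in> e) (path_edges (x # ys))) + of_bool (v = last (x # ys))
    = count_list (x # ys) v + count_list ys v"
  using assms
proof (induction ys arbitrary: x)
  case (Cons y zs)
  have "x \<noteq> y" using Cons.prems by auto
  moreover have "length (filter (\<lambda>e. v \<in> e) (path_edges (y # zs))) + of_bool (v = last (y # zs))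
    = count_list (y # zs) v + count_list zs v" using Cons by auto
  ultimately show ?case by auto
qed auto

lemma degree_closed_edges:
  assumes "proper_walk xs"
  shows "length (filter (\<lambda>e. v \<in> e) (closed_edges xs)) = 2 * count_list xs v"
proof -
  obtain x ys where xs: "xs = x # ys" using assms by (auto simp: proper_walk_def neq_Nil_conv)
  show ?thesis
    using degree_path_edges[of x "ys @ [x]" v] assms
    by (auto simp: xs closed_edges_def proper_walk_def split: if_splits)
qed

lemma odd_card_odd_count:
  "odd (card {e. odd (count_list es e) \<and> P e}) \<longleftrightarrow> odd (length (filter P es))"
proof (induction es)
  case (Cons a es)
  let ?A = "{e. odd (count_list es e) \<and> P e}"
  have fin: "finite ?A"
    by (rule finite_subset[of _ "set es"]) (auto simp: count_list_0_iff intro: ccontr)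
  show ?case
  proof (cases "P a")
    case False
    then have "{e. odd (count_list (a # es) e) \<and> P e} = ?A" by auto
    then show ?thesis using Cons False by simp
  next
    case True
    show ?thesis
    proof (cases "a \<in> ?A")
      case ina: True
      then have "{e. odd (count_list (a # es) e) \<and> P e} = ?A - {a}" by auto
      moreover have "card ?A = Suc (card (?A - {a}))" using fin ina by (rule card.remove)
      ultimately show ?thesis using Cons True by simp
    next
      case nin: False
      then have "{e. odd (count_list (a # es) e) \<and> P e} = insert a ?A" using True by auto
      then show ?thesis using Cons True fin nin by simp
    qed
  qed
qed simp

section \<open>Multiplicities modulo two and the counting inequality\<close>

definition odd_edges :: "'v set list \<Rightarrow> 'v set set"
  where "odd_edges es = {e. odd (count_list es e)}"

lemma odd_edges_subset: "odd_edges es \<subseteq> set es"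
  unfolding odd_edges_def using count_notin by fastforce

text \<open>The boundary of a path modulo two consists of its end points, and reducing
  multiplicities modulo two does not change it. The odd edges of a closed part of a walk thus form
  an even set.\<close>

lemma odd_degree_odd_edges:
  assumes "\<forall>e\<in>set (path_edges (x # ys)). card e = 2"
  shows "odd (card {e \<in> odd_edges (path_edges (x # ys)). v \<in> e}) \<longleftrightarrow> (v = x) \<noteq> (v = last (x # ys))"
proof -
  have "odd (card {e \<in> odd_edges (path_edges (x # ys)). v \<in> e})
      \<longleftrightarrow> odd (length (filter (\<lambda>e. v \<in> e) (path_edges (x # ys))))"
    unfolding odd_edges_def using odd_card_odd_count[of "path_edges (x # ys)" "\<lambda>e. v \<in> e"] by simp
  also have "\<dots> \<longleftrightarrow> (v = x) \<noteq> (v = last (x # ys))"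
  proof -
    have "odd (length (filter (\<lambda>e. v \<in> e) (path_edges (x # ys))) + of_bool (v = last (x # ys)))
      \<longleftrightarrow> odd (count_list (x # ys) v + count_list ys v)"
      using degree_path_edges[OF assms, of v] by presburger
    then show ?thesis by (auto split: if_splits)
  qed
  finally show ?thesis .
qed

text \<open>The shape of the extremal walks: a cactus whose cycles are the members of
  \<open>C\<close> and whose remaining edges are traversed exactly twice.\<close>

definition tight_family :: "'v list \<Rightarrow> 'v set set set \<Rightarrow> bool"
  where "tight_family xs C \<longleftrightarrow> cycle_family (set xs) (set (closed_edges xs)) C \<and>
    (\<forall>e. count_list (closed_edges xs) e \<le> 2) \<and> \<Union>C = {e. count_list (closed_edges xs) e = 1}"

text \<open>\<open>even_family_bound\<close> is combined with
  \<open>2 |E| \<le> length xs + |O|\<close>, which holds because an edge of even multiplicity is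
  used at least twice, and the edges \<open>O\<close> of odd multiplicity are covered by the sets
  \<open>S l\<close>. In half powers of \<open>n\<close>, the left side counts the free choices of
  vertices and of summands, the right side what normalisation and derivatives take away.\<close>

lemma walk_bound:
  assumes xs: "proper_walk xs" and L: "finite L"
    and S: "\<And>l. l \<in> L \<Longrightarrow> S l \<subseteq> set (closed_edges xs) \<and> even_set (S l) \<and> S l \<noteq> {}"
    and par: "\<And>e. e \<in> set (closed_edges xs) \<Longrightarrow>
      odd (card {l \<in> L. e \<in> S l}) \<longleftrightarrow> odd (count_list (closed_edges xs) e)"
  shows "2 * card (set xs) + 2 * card L \<le> length xs + 2 + (\<Sum>l\<in>L. card (S l))"
    and "2 * card (set xs) + 2 * card L = length xs + 2 + (\<Sum>l\<in>L. card (S l)) \<Longrightarrow>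
      tight_family xs (S ` L) \<and> inj_on S L"
proof -
  let ?E = "set (closed_edges xs)" and ?d = "count_list (closed_edges xs)"
  let ?U = "\<Union>l\<in>L. S l" and ?O = "{e \<in> set (closed_edges xs). odd (count_list (closed_edges xs) e)}"
  have ne: "xs \<noteq> []" and two: "\<And>e. e \<in> ?E \<Longrightarrow> card e = 2" using xs by (auto simp: proper_walk_def)
  note fb = even_family_bound[OF L _ _ connecting_closed_edges[OF ne] two, of S, OF finite_set finite_set]
  have b1: "2 * card L + 2 * card (set xs) + card ?U \<le> 2 * card ?E + 2 + (\<Sum>l\<in>L. card (S l))"
    and b2: "2 * card L + 2 * card (set xs) + card ?U = 2 * card ?E + 2 + (\<Sum>l\<in>L. card (S l)) \<Longrightarrow>
      disjoint_family_on S L"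
    using fb S by blast+
  have OU: "?O \<subseteq> ?U"
  proof
    fix e assume e: "e \<in> ?O"
    then have "odd (card {l \<in> L. e \<in> S l})" using par by auto
    then have "{l \<in> L. e \<in> S l} \<noteq> {}" by (metis card.empty even_zero)
    then show "e \<in> ?U" by auto
  qed
  have fU: "finite ?U" using S L by (meson List.finite_set finite_UN finite_subset)
  have cOU: "card ?O \<le> card ?U" by (rule card_mono[OF fU OU])
  have len: "(\<Sum>e\<in>?E. ?d e) = length xs"
    using sum_count_set[of "closed_edges xs" ?E] by (simp add: length_closed_edges)
  have d1: "1 \<le> ?d e" if "e \<in> ?E" for e
    using that count_list_0_iff[of "closed_edges xs" e] by linarith
  have d2: "2 \<le> ?d e + of_bool (odd (?d e))" if "e \<in> ?E" for e
    using d1[OF that] by (cases "?d e = 1") auto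
  have cO: "card ?O = (\<Sum>e\<in>?E. of_bool (odd (?d e)))"
    by (simp add: sum.If_cases of_bool_def Int_def)
  have "2 * card ?E = (\<Sum>e\<in>?E. 2)" by simp
  also have "\<dots> \<le> (\<Sum>e\<in>?E. ?d e + of_bool (odd (?d e)))" by (rule sum_mono) (use d2 in auto)
  also have "\<dots> = length xs + card ?O" unfolding cO sum.distrib len ..
  finally have eE: "2 * card ?E \<le> length xs + card ?O" .
  show "2 * card (set xs) + 2 * card L \<le> length xs + 2 + (\<Sum>l\<in>L. card (S l))"
    using b1 eE cOU by linarith
  assume eq: "2 * card (set xs) + 2 * card L = length xs + 2 + (\<Sum>l\<in>L. card (S l))"
  \<comment> \<open>The chain of three inequalities collapses: the sets do not overlap, their union
    consists of edges of odd multiplicity, and no multiplicity exceeds two.\<close>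
  have t1: "2 * card L + 2 * card (set xs) + card ?U = 2 * card ?E + 2 + (\<Sum>l\<in>L. card (S l))"
    and t2: "2 * card ?E = length xs + card ?O" and t3: "card ?O = card ?U"
    using b1 eE cOU eq by linarith+
  have dis: "disjoint_family_on S L" using b2[OF t1] .
  have inj: "inj_on S L"
    using dis S by (intro inj_onI) (metis Int_absorb disjoint_family_onD)
  have "?O = ?U" using card_subset_eq[OF fU OU t3] .
  have tight: "?d e + of_bool (odd (?d e)) = 2" if e: "e \<in> ?E" for e
  proof (rule ccontr)
    assume "?d e + of_bool (odd (?d e)) \<noteq> 2"
    then have "2 < ?d e + of_bool (odd (?d e))" using d2[OF e] by linarith
    then have "(\<Sum>e\<in>?E. 2) < (\<Sum>e\<in>?E. ?d e + of_bool (odd (?d e)))"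
      using d2 e by (intro sum_strict_mono_ex1 bexI[of _ e] ballI) simp_all
    then show False using t2 unfolding sum.distrib len cO by simp
  qed
  have le2: "?d e \<le> 2" for e
    using tight[of e] count_list_0_iff[of "closed_edges xs" e] by (cases "e \<in> ?E") auto
  have U1: "?U = {e. ?d e = 1}"
  proof -
    have "e \<in> ?O \<longleftrightarrow> ?d e = 1" for e
      using tight[of e] count_list_0_iff[of "closed_edges xs" e] by (cases "odd (?d e)") auto
    then show ?thesis using \<open>?O = ?U\<close> by auto
  qed
  have cU: "card ?U = (\<Sum>l\<in>L. card (S l))"
  proof (rule card_UN_disjoint[OF L])
    show "\<forall>l\<in>L. finite (S l)" using S finite_subset by blast
    show "\<forall>i\<in>L. \<forall>j\<in>L. i \<noteq> j \<longrightarrow> S i \<inter> S j = {}" using dis unfolding disjoint_family_on_def by blast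
  qed
  have "card (set xs) + card (S ` L) = card ?E + 1"
    using t1 cU card_image[OF inj] by simp
  moreover have "disjoint (S ` L)"
    unfolding disjoint_def using disjoint_family_onD[OF dis] by blast
  ultimately have "cycle_family (set xs) ?E (S ` L)"
    using S unfolding cycle_family_def by blast
  then show "tight_family xs (S ` L) \<and> inj_on S L"
    using le2 U1 inj unfolding tight_family_def by simp
qed

lemma tight_family_eq:
  assumes xs: "proper_walk xs" and C: "tight_family xs C"
  shows "2 * card (set xs) + 2 * card C = length xs + 2 + card (\<Union>C)"
    and "card (set (closed_edges xs)) = card (\<Union>C) + card {e. count_list (closed_edges xs) e = 2}"
    and "length xs = card (\<Union>C) + 2 * card {e. count_list (closed_edges xs) e = 2}"
proof -
  let ?E = "set (closed_edges xs)" and ?d = "count_list (closed_edges xs)"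
  let ?D = "{e. count_list (closed_edges xs) e = 2}"
  have cy: "card (set xs) + card C = card ?E + 1" and le: "\<And>e. ?d e \<le> 2"
    and U: "\<Union>C = {e. ?d e = 1}"
    using C by (auto simp: tight_family_def cycle_family_def)
  have E: "?E = \<Union>C \<union> ?D"
  proof (intro Set.set_eqI)
    fix e show "e \<in> ?E \<longleftrightarrow> e \<in> \<Union>C \<union> ?D"
      using le[of e] count_list_0_iff[of "closed_edges xs" e] U by (cases "?d e = 0") auto
  qed
  then have fin: "finite (\<Union>C)" "finite ?D" by (metis List.finite_set finite_Un)+
  have dis: "\<Union>C \<inter> ?D = {}" using U by auto
  show cE: "card ?E = card (\<Union>C) + card ?D" unfolding E using card_Un_disjoint[OF fin dis] .
  have "length xs = (\<Sum>e\<in>?E. ?d e)"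
    using sum_count_set[of "closed_edges xs" ?E] by (simp add: length_closed_edges)
  also have "\<dots> = (\<Sum>e\<in>\<Union>C. ?d e) + (\<Sum>e\<in>?D. ?d e)"
    unfolding E using sum.union_disjoint[OF fin dis] .
  also have "(\<Sum>e\<in>\<Union>C. ?d e) = card (\<Union>C)" unfolding U by simp
  also have "(\<Sum>e\<in>?D. ?d e) = 2 * card ?D" by simp
  finally show len: "length xs = card (\<Union>C) + 2 * card ?D" .
  show "2 * card (set xs) + 2 * card C = length xs + 2 + card (\<Union>C)" using cy len cE by simp
qed

text \<open>If the walk visits \<open>u, v, u, v\<close> then the odd edges of its part from the first \<open>v\<close> to the
  second \<open>u\<close> are a union of cycles, contradicting the odd degree at the ends.\<close>

lemma tight_family_noncrossing:
  assumes xs: "proper_walk xs" and C: "tight_family xs C"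
  shows "noncrossing_walk xs"
  unfolding noncrossing_walk_def
proof (intro allI impI notI)
  fix u v assume uv: "u \<noteq> v" and sub: "subseq [u, v, u, v] xs"
  let ?E = "set (closed_edges xs)" and ?d = "count_list (closed_edges xs)"
  have ne: "xs \<noteq> []" and two: "\<And>e. e \<in> ?E \<Longrightarrow> card e = 2" using xs by (auto simp: proper_walk_def)
  have cf: "cycle_family (set xs) ?E C" and le: "\<And>e. ?d e \<le> 2"
    and U: "\<Union>C = {e. ?d e = 1}"
    using C by (auto simp: tight_family_def)
  obtain p1 r1 where 1: "xs = p1 @ u # r1" "subseq [v, u, v] r1" using list_emb_ConsD[OF sub] by auto
  obtain p2 r2 where 2: "r1 = p2 @ v # r2" "subseq [u, v] r2" using list_emb_ConsD[OF 1(2)] by auto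
  obtain p3 r3 where 3: "r2 = p3 @ u # r3" "subseq [v] r3" using list_emb_ConsD[OF 2(2)] by auto
  obtain p4 p5 where 4: "r3 = p4 @ v # p5" using list_emb_ConsD[OF 3(2)] by auto
  \<comment> \<open>The parts from \<open>u\<close> to \<open>v\<close>, back to \<open>u\<close>,
    and again to \<open>v\<close>; the first two together are closed, and so are the last
    two.\<close>
  define A1 A2 A3 where "A1 = path_edges (u # p2 @ [v])" and "A2 = path_edges (v # p3 @ [u])"
    and "A3 = path_edges (u # p4 @ [v])"
  have ce: "closed_edges xs = path_edges (p1 @ [u]) @ A1 @ A2 @ A3 @ path_edges (v # p5 @ [hd xs])"
    unfolding closed_edges_def
    using path_edges_append[of p1 u "p2 @ v # p3 @ u # p4 @ v # p5 @ [hd xs]"]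
      path_edges_append[of "u # p2" v "p3 @ u # p4 @ v # p5 @ [hd xs]"]
      path_edges_append[of "v # p3" u "p4 @ v # p5 @ [hd xs]"]
      path_edges_append[of "u # p4" v "p5 @ [hd xs]"]
    by (simp add: 1 2 3 4 A1_def A2_def A3_def)
  have A12: "A1 @ A2 = path_edges (u # p2 @ v # p3 @ [u])"
    using path_edges_append[of "u # p2" v "p3 @ [u]"] by (simp add: A1_def A2_def)
  have A23: "A2 @ A3 = path_edges (v # p3 @ u # p4 @ [v])"
    using path_edges_append[of "v # p3" u "p4 @ [v]"] by (simp add: A2_def A3_def)
  have sE: "set (A1 @ A2) \<subseteq> ?E" "set (A2 @ A3) \<subseteq> ?E" "set A2 \<subseteq> ?E" using ce by auto
  have cnt: "count_list A1 e + count_list A2 e + count_list A3 e \<le> ?d e" for e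
    by (simp add: ce count_list_append)
  let ?D12 = "odd_edges (A1 @ A2)" and ?D23 = "odd_edges (A2 @ A3)" and ?D2 = "odd_edges A2"
  have e12: "even_set ?D12"
    unfolding even_set_def A12
    using odd_degree_odd_edges[of u "p2 @ v # p3 @ [u]"] two sE(1) unfolding A12 by auto
  have e23: "even_set ?D23"
    unfolding even_set_def A23
    using odd_degree_odd_edges[of v "p3 @ u # p4 @ [v]"] two sE(2) unfolding A23 by auto
  have odd2: "odd (card {e \<in> ?D2. u \<in> e})"
    using odd_degree_odd_edges[of v "p3 @ [u]" u] two sE(3) uv unfolding A2_def by auto
  note un = even_set_cycle_family[OF cf finite_set finite_set connecting_closed_edges[OF ne] two]
  have D12: "?D12 = \<Union>{c\<in>C. c \<subseteq> ?D12}"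
    by (rule un) (use e12 sE(1) odd_edges_subset[of "A1 @ A2"] in blast)+
  have D23: "?D23 = \<Union>{c\<in>C. c \<subseteq> ?D23}"
    by (rule un) (use e23 sE(2) odd_edges_subset[of "A2 @ A3"] in blast)+
  \<comment> \<open>Members of \<open>C\<close> have edges of total multiplicity one, so an edge odd
    in both closed parts occurs in \<open>A2\<close> alone. Conversely, an edge odd in
    \<open>A2\<close> but not in both closed parts would occur in all three parts, against the bound
    two.\<close>
  have "?D2 = ?D12 \<inter> ?D23"
  proof (intro Set.set_eqI)
    fix e
    let ?a1 = "count_list A1 e" and ?a2 = "count_list A2 e" and ?a3 = "count_list A3 e"
    have m12: "e \<in> ?D12 \<Longrightarrow> ?d e = 1" and m23: "e \<in> ?D23 \<Longrightarrow> ?d e = 1" using D12 D23 U by blast+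
    have i12: "e \<in> ?D12 \<longleftrightarrow> odd (?a1 + ?a2)" and i23: "e \<in> ?D23 \<longleftrightarrow> odd (?a2 + ?a3)"
      and i2: "e \<in> ?D2 \<longleftrightarrow> odd ?a2"
      by (auto simp: odd_edges_def count_list_append)
    show "e \<in> ?D2 \<longleftrightarrow> e \<in> ?D12 \<inter> ?D23"
    proof
      assume "e \<in> ?D2"
      then have o: "odd ?a2" using i2 by simp
      show "e \<in> ?D12 \<inter> ?D23"
      proof (rule ccontr)
        assume "e \<notin> ?D12 \<inter> ?D23"
        then have "odd ?a1 \<or> odd ?a3" using o i12 i23 by auto
        moreover have "odd ?a1 \<longleftrightarrow> odd ?a3"
        proof (rule ccontr)
          assume "\<not> (odd ?a1 \<longleftrightarrow> odd ?a3)"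
          then have "e \<in> ?D12 \<or> e \<in> ?D23" using i12 i23 by auto
          then have "?d e = 1" using m12 m23 by blast
          then have "?a1 = 0 \<and> ?a3 = 0" using cnt[of e] odd_pos[OF o] by linarith
          then show False using \<open>\<not> (odd ?a1 \<longleftrightarrow> odd ?a3)\<close> by simp
        qed
        ultimately have "1 \<le> ?a1" "1 \<le> ?a3" "1 \<le> ?a2" using o odd_pos by (simp_all add: Suc_leI)
        then show False using cnt[of e] le[of e] by linarith
      qed
    next
      assume a: "e \<in> ?D12 \<inter> ?D23"
      then have "?d e = 1" using m12 by blast
      then show "e \<in> ?D2" using a i12 i23 i2 cnt[of e] by (cases "?a2 = 0") (auto dest!: odd_pos)
    qed
  qed
  also have "\<dots> = \<Union>{c\<in>C. c \<subseteq> ?D12 \<and> c \<subseteq> ?D23}"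
  proof (intro Set.set_eqI iffI)
    fix e assume e: "e \<in> ?D12 \<inter> ?D23"
    obtain c where c: "c \<in> C" "c \<subseteq> ?D12" "e \<in> c" using D12 e by blast
    obtain c' where c': "c' \<in> C" "c' \<subseteq> ?D23" "e \<in> c'" using D23 e by blast
    have "disjoint C" using cf by (simp add: cycle_family_def)
    then have "c = c'" using c(1,3) c'(1,3) unfolding disjoint_def by blast
    then show "e \<in> \<Union>{c\<in>C. c \<subseteq> ?D12 \<and> c \<subseteq> ?D23}" using c c' by blast
  qed blast
  finally have D2: "?D2 = \<Union>{c\<in>C. c \<subseteq> ?D12 \<and> c \<subseteq> ?D23}" .
  have "even_set (\<Union>{c\<in>C. c \<subseteq> ?D12 \<and> c \<subseteq> ?D23})"
  proof (rule even_set_Union)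
    have "C \<subseteq> Pow ?E" using cf by (auto simp: cycle_family_def)
    then have "finite C" using finite_subset by blast
    then show "finite {c\<in>C. c \<subseteq> ?D12 \<and> c \<subseteq> ?D23}" by simp
    show "disjoint {c\<in>C. c \<subseteq> ?D12 \<and> c \<subseteq> ?D23}"
      using cf by (auto simp: cycle_family_def disjoint_def)
    show "even_set c \<and> finite c" if "c \<in> {c\<in>C. c \<subseteq> ?D12 \<and> c \<subseteq> ?D23}" for c
      using cf that by (auto simp: cycle_family_def intro: finite_subset)
  qed
  then show False using odd2 D2 unfolding even_set_def by metis
qed


section \<open>Noncrossing walks have a tight family\<close>

lemma subseq_noncrossing: "subseq ys xs \<Longrightarrow> noncrossing_walk xs \<Longrightarrow> noncrossing_walk ys"
  unfolding noncrossing_walk_def by (meson subseq_order.trans)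

text \<open>Without repeated vertices the walk is either one step forth and back, a doubled edge
  with no cycle, or a simple cycle. The degrees zero or two will later make each matrix entry occur
  exactly twice.\<close>

lemma tight_family_distinct:
  assumes xs: "proper_walk xs" and dist: "distinct xs"
  shows "\<exists>C. tight_family xs C \<and> (\<forall>c\<in>C. \<forall>v. card {e \<in> c. v \<in> e} \<in> {0, 2})"
proof -
  let ?E = "set (closed_edges xs)"
  obtain x ys where x: "xs = x # ys" using xs by (auto simp: proper_walk_def neq_Nil_conv)
  have "ys \<noteq> []" using xs x by (auto simp: proper_walk_def closed_edges_def)
  then obtain y zs where y: "ys = y # zs" by (auto simp: neq_Nil_conv)
  have xy: "x \<noteq> y" using dist x y by simp
  show ?thesis
  proof (cases "zs = []")
    case True
    have ce: "closed_edges xs = [{x, y}, {x, y}]" by (simp add: closed_edges_def x y True insert_commute)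
    have "tight_family xs {}"
      using xy by (auto simp: tight_family_def cycle_family_def ce[unfolded x y True] x y True)
    then show ?thesis by blast
  next
    case False
    have dp: "distinct (path_edges ws)" if "distinct ws" for ws :: "'a list"
      using that
    proof (induction ws rule: path_edges.induct)
      case (3 a b cs)
      have "{a, b} \<notin> set (path_edges (b # cs))"
        using path_edges_subset[of "{a, b}" "b # cs"] 3(2) by auto
      then show ?case using 3 by simp
    qed auto
    have lz: "last zs \<in> set zs" using False by simp
    have ce: "closed_edges xs = path_edges xs @ [{last zs, x}]"
    proof -
      have 1: "xs @ [hd xs] = (x # y # butlast zs) @ last zs # [x]"
        and 2: "xs = (x # y # butlast zs) @ [last zs]"
        using append_butlast_last_id[OF False] by (simp_all add: x y)
      show ?thesis
        unfolding closed_edges_def 1 path_edges_append[of "x # y # butlast zs"] 2[symmetric] by simp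
    qed
    have "{last zs, x} \<noteq> {x, y}" using lz dist x y by (auto simp: doubleton_eq_iff)
    moreover have "{last zs, x} \<notin> set (path_edges (y # zs))"
      using path_edges_subset[of "{last zs, x}" "y # zs"] dist x y by auto
    ultimately have dce: "distinct (closed_edges xs)"
      using dp[OF dist] unfolding ce by (simp add: x y)
    have cE: "card ?E = length xs" using dce by (simp add: distinct_card length_closed_edges)
    have cV: "card (set xs) = length xs" using dist by (rule distinct_card)
    have deg: "card {e \<in> ?E. v \<in> e} = 2 * count_list xs v" for v
    proof -
      have "{e \<in> ?E. v \<in> e} = set (filter (\<lambda>e. v \<in> e) (closed_edges xs))" by auto
      then have "card {e \<in> ?E. v \<in> e} = length (filter (\<lambda>e. v \<in> e) (closed_edges xs))"
        using dce distinct_card distinct_filter by metis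
      then show ?thesis using degree_closed_edges[OF xs] by simp
    qed
    have cnt: "count_list (closed_edges xs) e = of_bool (e \<in> ?E)" for e
      using dce by (simp add: count_list_eq_length_filter distinct_length_filter Int_def conj_commute
        Collect_conv_if)
    have "tight_family xs {?E}"
      using deg cE cV cnt xs x length_closed_edges[of xs]
      by (auto simp: tight_family_def cycle_family_def even_set_def proper_walk_def)
    moreover have "card {e \<in> ?E. v \<in> e} \<in> {0, 2}" for v
    proof -
      have "count_list xs v = of_bool (v \<in> set xs)"
        using dist by (simp add: count_list_eq_length_filter distinct_length_filter Int_def conj_commute
          Collect_conv_if)
      then show ?thesis using deg[of v] by simp
    qed
    ultimately show ?thesis by (intro exI[of _ "{?E}"]) simp
  qed
qed

text \<open>Cut at a repeated vertex \<open>u\<close> into the loop between two visits and the rest.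
  By the noncrossing condition the two parts share no other vertex, hence no edge, so their cycle
  families and multiplicities simply unite.\<close>

lemma noncrossing_tight_family:
  assumes "proper_walk xs" "noncrossing_walk xs"
  shows "\<exists>C. tight_family xs C \<and> (\<forall>c\<in>C. \<forall>v. card {e \<in> c. v \<in> e} \<in> {0, 2})"
  using assms
proof (induction "length xs" arbitrary: xs rule: less_induct)
  case less
  show ?case
  proof (cases "distinct xs")
    case True
    then show ?thesis using tight_family_distinct less.prems by blast
  next
    case False
    then obtain pre mid post u where xs: "xs = pre @ [u] @ mid @ [u] @ post"
      using not_distinct_decomp by blast
    define lp rs where "lp = u # mid" and "rs = pre @ u # post"
    have ne: "lp \<noteq> []" "rs \<noteq> []" by (auto simp: lp_def rs_def)
    have hd: "hd rs = hd xs" by (cases pre) (auto simp: rs_def xs)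
    have celp: "closed_edges lp = path_edges (u # mid @ [u])"
      by (simp add: closed_edges_def lp_def)
    have cers: "closed_edges rs = path_edges (pre @ [u]) @ path_edges (u # post @ [hd xs])"
      unfolding closed_edges_def hd using path_edges_append[of pre u "post @ [hd xs]"]
      by (simp add: rs_def)
    have cexs: "closed_edges xs
        = path_edges (pre @ [u]) @ path_edges (u # mid @ [u]) @ path_edges (u # post @ [hd xs])"
      unfolding closed_edges_def
      using path_edges_append[of pre u "mid @ u # post @ [hd xs]"]
        path_edges_append[of "u # mid" u "post @ [hd xs]"]
      by (simp add: xs)
    let ?E1 = "set (closed_edges lp)" and ?E2 = "set (closed_edges rs)"
    have cnt: "count_list (closed_edges xs) e
        = count_list (closed_edges lp) e + count_list (closed_edges rs) e" for e
      by (simp add: cexs celp cers)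
    have E: "set (closed_edges xs) = ?E1 \<union> ?E2" by (auto simp: cexs celp cers)
    have prp: "proper_walk lp" "proper_walk rs"
      using less.prems(1) ne E by (auto simp: proper_walk_def)
    have "subseq ([] @ lp @ []) (pre @ lp @ u # post)"
      by (intro list_emb_append_mono) auto
    moreover have "subseq (pre @ [] @ u # post) (pre @ lp @ u # post)"
      by (intro list_emb_append_mono) auto
    ultimately have nc: "noncrossing_walk lp" "noncrossing_walk rs"
      using subseq_noncrossing[OF _ less.prems(2)] by (simp_all add: lp_def rs_def xs)
    obtain C1 where C1: "tight_family lp C1" "\<forall>c\<in>C1. \<forall>v. card {e \<in> c. v \<in> e} \<in> {0, 2}"
      using less.hyps[of lp] prp nc by (auto simp: xs lp_def)
    obtain C2 where C2: "tight_family rs C2" "\<forall>c\<in>C2. \<forall>v. card {e \<in> c. v \<in> e} \<in> {0, 2}"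
      using less.hyps[of rs] prp nc by (auto simp: xs rs_def)
    have V: "set xs = set lp \<union> set rs" by (auto simp: xs lp_def rs_def)
    have Vi: "set lp \<inter> set rs = {u}"
    proof -
      have "w = u" if "w \<in> set lp" "w \<in> set rs" for w
      proof (rule ccontr)
        assume wu: "w \<noteq> u"
        then have m: "w \<in> set mid" and o: "w \<in> set pre \<or> w \<in> set post"
          using that by (auto simp: lp_def rs_def)
        have sm: "subseq [w] mid" using m by (simp add: subseq_singleton_left)
        from o show False
        proof
          assume "w \<in> set pre"
          then have "subseq [w] pre" by (simp add: subseq_singleton_left)
          then have "subseq ([w] @ [u] @ [w] @ [u]) (pre @ [u] @ mid @ [u] @ post)"
            using sm by (intro list_emb_append_mono) auto
          then show False using less.prems(2) wu by (auto simp: noncrossing_walk_def xs)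
        next
          assume "w \<in> set post"
          then have "subseq [w] post" by (simp add: subseq_singleton_left)
          then have "subseq ([] @ [u] @ [w] @ [u] @ [w]) (pre @ [u] @ mid @ [u] @ post)"
            using sm by (intro list_emb_append_mono) auto
          then show False using less.prems(2) wu by (auto simp: noncrossing_walk_def xs)
        qed
      qed
      then show ?thesis by (auto simp: lp_def rs_def)
    qed
    have disE: "?E1 \<inter> ?E2 = {}"
    proof (rule ccontr)
      assume "?E1 \<inter> ?E2 \<noteq> {}"
      then obtain e where e: "e \<in> ?E1" "e \<in> ?E2" by auto
      then have "e \<subseteq> {u}" using closed_edges_subset[OF ne(1) e(1)] closed_edges_subset[OF ne(2) e(2)] Vi
        by blast
      then have "card e \<le> 1" using card_mono[of "{u}" e] by simp
      then show False using prp(1) e(1) by (auto simp: proper_walk_def)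
    qed
    have c1: "disjoint C1" "\<And>c. c \<in> C1 \<Longrightarrow> c \<noteq> {} \<and> c \<subseteq> ?E1 \<and> even_set c"
        "card (set lp) + card C1 = card ?E1 + 1" "\<And>e. count_list (closed_edges lp) e \<le> 2"
        "\<Union>C1 = {e. count_list (closed_edges lp) e = 1}"
      using C1(1) by (auto simp: tight_family_def cycle_family_def)
    have c2: "disjoint C2" "\<And>c. c \<in> C2 \<Longrightarrow> c \<noteq> {} \<and> c \<subseteq> ?E2 \<and> even_set c"
        "card (set rs) + card C2 = card ?E2 + 1" "\<And>e. count_list (closed_edges rs) e \<le> 2"
        "\<Union>C2 = {e. count_list (closed_edges rs) e = 1}"
      using C2(1) by (auto simp: tight_family_def cycle_family_def)
    have "C1 \<subseteq> Pow ?E1" "C2 \<subseteq> Pow ?E2" using c1(2) c2(2) by auto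
    then have finC: "finite C1" "finite C2" using finite_subset by blast+
    have disC: "C1 \<inter> C2 = {}" using c1(2) c2(2) disE by fastforce
    have x: "c \<inter> d = {}" if "c \<in> C1" "d \<in> C2" for c d using c1(2) c2(2) disE that by blast
    have "card (set xs) + 1 = card (set lp) + card (set rs)"
      unfolding V using card_Un_Int[of "set lp" "set rs"] Vi by simp
    moreover have "card (C1 \<union> C2) = card C1 + card C2" using card_Un_disjoint[OF finC disC] .
    moreover have "card (set (closed_edges xs)) = card ?E1 + card ?E2"
      unfolding E using disE by (intro card_Un_disjoint) auto
    ultimately have num: "card (set xs) + card (C1 \<union> C2) = card (set (closed_edges xs)) + 1"
      using c1(3) c2(3) by simp
    have "disjoint (C1 \<union> C2)" using c1(1) c2(1) x unfolding disjoint_def by blast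
    then have "cycle_family (set xs) (set (closed_edges xs)) (C1 \<union> C2)"
      using c1(2) c2(2) num unfolding cycle_family_def E by blast
    moreover have z: "count_list (closed_edges lp) e = 0 \<or> count_list (closed_edges rs) e = 0" for e
      using disE by (metis count_list_0_iff disjoint_iff)
    moreover have "\<Union>(C1 \<union> C2) = {e. count_list (closed_edges xs) e = 1}"
    proof -
      have "count_list (closed_edges xs) e = 1 \<longleftrightarrow>
          count_list (closed_edges lp) e = 1 \<or> count_list (closed_edges rs) e = 1" for e
        using z[of e] cnt[of e] by auto
      then show ?thesis using c1(5) c2(5) by auto
    qed
    moreover have "count_list (closed_edges xs) e \<le> 2" for e
      using z[of e] cnt[of e] c1(4)[of e] c2(4)[of e] by auto
    ultimately have "tight_family xs (C1 \<union> C2)" unfolding tight_family_def by blast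
    then show ?thesis using C1(2) C2(2) by blast
  qed
qed

section \<open>Noncrossing partitions and the Kreweras complement\<close>

definition cyc_succ :: "nat set \<Rightarrow> nat \<Rightarrow> nat"
  where "cyc_succ U a = (if \<exists>x\<in>U. a < x then Min {x \<in> U. a < x} else Min U)"

definition cyc_next :: "nat \<Rightarrow> nat \<Rightarrow> nat"
  where "cyc_next k b = (if b = k then 1 else Suc b)"

text \<open>Replaces positions in a sorted list by the successor map, which can be compared between
  \<open>{1..k}\<close> and its subsets.\<close>

lemma S_count_eq:
  assumes U: "finite U"
  shows "S_count U P = card {a \<in> U. same_block P a (cyc_succ U a)}"
proof -
  let ?xs = "sorted_list_of_set U" and ?N = "card U"
  have len: "length ?xs = ?N" and set: "set ?xs = U" and st: "sorted_wrt (<) ?xs"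
    using U by (simp_all add: sorted_list_of_set.strict_sorted_key_list_of_set)
  have lt: "?xs ! i < ?xs ! l \<longleftrightarrow> i < l" if "i < ?N" "l < ?N" for i l
    using sorted_wrt_nth_less[OF st, of i l] sorted_wrt_nth_less[OF st, of l i] that len
    by (metis nat_neq_iff not_less_iff_gr_or_eq)
  have le: "?xs ! i \<le> ?xs ! l \<longleftrightarrow> i \<le> l" if "i < ?N" "l < ?N" for i l
    using lt[OF that(2,1)] by (simp flip: not_less)
  have mem: "?xs ! i \<in> U" if "i < ?N" for i using that len set nth_mem by metis
  have ex: "\<exists>l<?N. x = ?xs ! l" if "x \<in> U" for x using that len set by (metis in_set_conv_nth)
  have succ: "cyc_succ U (?xs ! i) = ?xs ! (Suc i mod ?N)" if i: "i < ?N" for i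
  proof (cases "Suc i < ?N")
    case True
    have "Min {x \<in> U. ?xs ! i < x} = ?xs ! Suc i"
    proof (rule Min_eqI)
      show "finite {x \<in> U. ?xs ! i < x}" using U by simp
      show "?xs ! Suc i \<in> {x \<in> U. ?xs ! i < x}" using mem[OF True] lt[OF i True] by simp
      show "?xs ! Suc i \<le> y" if y: "y \<in> {x \<in> U. ?xs ! i < x}" for y
      proof -
        obtain l where l: "l < ?N" "y = ?xs ! l" using ex[of y] y by auto
        then have "i < l" using y lt[OF i] by simp
        then show ?thesis using l le[OF True] by simp
      qed
    qed
    moreover have "\<exists>x\<in>U. ?xs ! i < x" using mem[OF True] lt[OF i True] by auto
    ultimately show ?thesis using True by (simp add: cyc_succ_def)
  next
    case False
    then have N: "Suc i = ?N" using i by simp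
    have "\<not> (\<exists>x\<in>U. ?xs ! i < x)"
    proof
      assume "\<exists>x\<in>U. ?xs ! i < x"
      then obtain l where "l < ?N" "?xs ! i < ?xs ! l" using ex by blast
      then show False using lt[OF i] N by simp
    qed
    moreover have "Min U = ?xs ! 0"
    proof (rule Min_eqI[OF U])
      show "?xs ! 0 \<in> U" using i by (intro mem) simp
      show "?xs ! 0 \<le> y" if y: "y \<in> U" for y
      proof -
        obtain l where l: "l < ?N" "y = ?xs ! l" using ex[OF y] by blast
        then show ?thesis using le[of 0 l] i by simp
      qed
    qed
    ultimately show ?thesis unfolding N cyc_succ_def by simp
  qed
  have inj: "inj_on (\<lambda>i. ?xs ! i) {..<?N}"
    using lt by (intro inj_onI) (metis lessThan_iff nat_neq_iff)
  have "(\<lambda>i. ?xs ! i) ` {i. i < ?N \<and> same_block P (?xs ! i) (?xs ! (Suc i mod ?N))}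
      = {a \<in> U. same_block P a (cyc_succ U a)}"
  proof (intro Set.set_eqI iffI)
    fix a assume "a \<in> {a \<in> U. same_block P a (cyc_succ U a)}"
    moreover then obtain l where "l < ?N" "a = ?xs ! l" using ex by blast
    ultimately show "a \<in> (\<lambda>i. ?xs ! i) ` {i. i < ?N \<and> same_block P (?xs ! i) (?xs ! (Suc i mod ?N))}"
      using succ by auto
  qed (use mem succ in auto)
  then have "card {a \<in> U. same_block P a (cyc_succ U a)}
      = card {i. i < ?N \<and> same_block P (?xs ! i) (?xs ! (Suc i mod ?N))}"
    using card_image[OF inj_on_subset[OF inj], of "{i. i < ?N \<and> same_block P (?xs ! i) (?xs ! (Suc i mod ?N))}"]
    by auto
  then show ?thesis by (simp add: S_count_def)
qed

lemma S_count_le: "finite U \<Longrightarrow> S_count U P \<le> card U"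
  unfolding S_count_eq by (intro card_mono) auto

lemma cyc_succ_singleton: "cyc_succ {b} b = b"
  by (simp add: cyc_succ_def)

lemma cyc_succ_interval: "a \<in> {1..k} \<Longrightarrow> cyc_succ {1..k} a = cyc_next k a"
proof -
  assume a: "a \<in> {1..k}"
  show ?thesis
  proof (cases "a = k")
    case True
    moreover have "Min {1..k} = 1" using a by (intro Min_eqI) auto
    ultimately show ?thesis by (auto simp: cyc_succ_def cyc_next_def)
  next
    case False
    then have "Min {x \<in> {1..k}. a < x} = Suc a" using a by (intro Min_eqI) auto
    moreover have "\<exists>x\<in>{1..k}. a < x" using a False by (intro bexI[of _ k]) auto
    ultimately show ?thesis using False by (simp add: cyc_succ_def cyc_next_def)
  qed
qed

lemma finite_noncrossing_partitions: "finite U \<Longrightarrow> finite (noncrossing_partitions U)"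
proof -
  assume U: "finite U"
  have "noncrossing_partitions U \<subseteq> Pow (Pow U)"
    by (auto simp: noncrossing_partitions_def partition_on_def)
  then show ?thesis using U finite_subset by blast
qed

lemma noncrossing_partition_singleton: "noncrossing_partitions {b} = {{{b}}}"
proof -
  have "partition_on {b} P \<longleftrightarrow> P = {{b}}" for P :: "nat set set"
    unfolding partition_on_def disjoint_def by (auto simp: subset_singleton_iff) (metis Union_iff singletonI subset_singleton_iff Union_upper)+
  then show ?thesis by (auto simp: noncrossing_partitions_def)
qed

lemma same_block_noncrossing:
  assumes "\<pi> \<in> noncrossing_partitions U" "same_block \<pi> p q" "same_block \<pi> x y" "p < x" "x < q" "q < y"
  shows "same_block \<pi> p x"
proof -
  obtain B where B: "B \<in> \<pi>" "p \<in> B" "q \<in> B" using assms(2) by (auto simp: same_block_def)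
  obtain C where C: "C \<in> \<pi>" "x \<in> C" "y \<in> C" using assms(3) by (auto simp: same_block_def)
  have "B = C"
  proof (rule ccontr)
    assume "B \<noteq> C"
    then show False using assms(1,4-6) B C unfolding noncrossing_partitions_def by blast
  qed
  then show ?thesis using B C by (auto simp: same_block_def)
qed

lemma partition_same_block:
  assumes "partition_on U \<pi>"
  shows "same_block \<pi> a a \<longleftrightarrow> a \<in> U" "same_block \<pi> a b \<Longrightarrow> same_block \<pi> b a"
    "same_block \<pi> a b \<Longrightarrow> same_block \<pi> b c \<Longrightarrow> same_block \<pi> a c"
    "same_block \<pi> a b \<Longrightarrow> a \<in> U" "same_block \<pi> a b \<Longrightarrow> b \<in> U"
proof -
  have U: "U = \<Union>\<pi>" and d: "\<And>B C. B \<in> \<pi> \<Longrightarrow> C \<in> \<pi> \<Longrightarrow> B \<noteq> C \<Longrightarrow> B \<inter> C = {}"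
    using assms by (auto simp: partition_on_def disjoint_def)
  show "same_block \<pi> a a \<longleftrightarrow> a \<in> U" "same_block \<pi> a b \<Longrightarrow> same_block \<pi> b a"
    "same_block \<pi> a b \<Longrightarrow> a \<in> U" "same_block \<pi> a b \<Longrightarrow> b \<in> U"
    by (auto simp: same_block_def U)
  show "same_block \<pi> a b \<Longrightarrow> same_block \<pi> b c \<Longrightarrow> same_block \<pi> a c"
    unfolding same_block_def using d by blast
qed

section \<open>The Kreweras complement and its cyclic successor\<close>

lemma W_sameI:
  assumes "\<And>x y. x < y \<Longrightarrow> same_block \<pi> x y \<Longrightarrow> (a \<in> {x+1..y}) = (c \<in> {x+1..y})"
  shows "W_same \<pi> a c"
  using assms unfolding W_same_def by metis

lemma W_sameD:
  assumes "W_same \<pi> a c" "x < y" "same_block \<pi> x y"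
  shows "(a \<in> {x+1..y}) = (c \<in> {x+1..y})"
  using assms unfolding W_same_def by metis

lemma W_same_refl: "W_same \<pi> a a"
  and W_same_sym: "W_same \<pi> a b \<Longrightarrow> W_same \<pi> b a"
  and W_same_trans: "W_same \<pi> a b \<Longrightarrow> W_same \<pi> b c \<Longrightarrow> W_same \<pi> a c"
  by (rule W_sameI, simp) (rule W_sameI, drule (2) W_sameD, simp, rule W_sameI, (drule (2) W_sameD)+, simp)

lemma W_subsets_member:
  assumes "B \<in> W_subsets k \<pi>" "a \<in> B"
  shows "B = {c \<in> {1..k}. W_same \<pi> a c}"
  using assms unfolding W_subsets_def quotient_def by (auto intro: W_same_trans W_same_sym)

lemma W_subsets_obtain:
  assumes "a \<in> {1..k}"
  shows "{c \<in> {1..k}. W_same \<pi> a c} \<in> W_subsets k \<pi>"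
  using assms unfolding W_subsets_def quotient_def by (auto intro!: exI[of _ a])

lemma W_subsets_subset: "B \<in> W_subsets k \<pi> \<Longrightarrow> B \<subseteq> {1..k} \<and> B \<noteq> {}"
  unfolding W_subsets_def quotient_def using W_same_refl by auto

lemma W_subsets_disjoint:
  assumes "B \<in> W_subsets k \<pi>" "C \<in> W_subsets k \<pi>" "a \<in> B" "a \<in> C"
  shows "B = C"
  using W_subsets_member[OF assms(1,3)] W_subsets_member[OF assms(2,4)] by simp

lemma Union_W_subsets: "\<Union>(W_subsets k \<pi>) = {1..k}"
proof
  show "\<Union>(W_subsets k \<pi>) \<subseteq> {1..k}" using W_subsets_subset[of _ k \<pi>] by (intro Union_least) simp
  show "{1..k} \<subseteq> \<Union>(W_subsets k \<pi>)"
  proof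
    fix a assume a: "a \<in> {1..k}"
    show "a \<in> \<Union>(W_subsets k \<pi>)"
      using W_subsets_obtain[OF a, of \<pi>] by (rule UnionI) (use a in \<open>simp add: W_same_refl\<close>)
  qed
qed

lemma finite_W_subsets: "finite (W_subsets k \<pi>)"
proof -
  have "W_subsets k \<pi> \<subseteq> Pow {1..k}" using W_subsets_subset by blast
  then show ?thesis using finite_subset by blast
qed

lemma finite_W_subset: "B \<in> W_subsets k \<pi> \<Longrightarrow> finite B"
  using finite_subset[OF conjunct1[OF W_subsets_subset]] by simp

text \<open>A pair in a block of \<open>\<pi>\<close> cuts the circle, and no class is separated by
  the cut. For \<open>a \<le> b\<close> the class \<open>B\<close> has no element in
  \<open>{a+1..b}\<close> and therefore jumps to \<open>b + 1\<close>, or wraps to 1; for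
  \<open>b < a\<close> it lies between \<open>b + 1\<close> and \<open>a\<close>, so
  \<open>a\<close> is its last and \<open>b + 1\<close> its first element.\<close>

lemma cyc_succ_unique:
  assumes pi: "partition_on {1..k} \<pi>" and B: "B \<in> W_subsets k \<pi>" "a \<in> B"
    and b: "same_block \<pi> a b" "cyc_next k b \<in> B"
  shows "cyc_next k b = cyc_succ B a"
proof -
  have aU: "a \<in> {1..k}" and bU: "b \<in> {1..k}"
    using partition_same_block(4,5)[OF pi b(1)] by auto
  have BU: "B \<subseteq> {1..k}" and fB: "finite B" using W_subsets_subset[OF B(1)] finite_W_subset[OF B(1)] by auto
  have sep: "(a \<in> {x+1..y}) = (c \<in> {x+1..y})" if "c \<in> B" "x < y" "same_block \<pi> x y" for c x y
  proof -
    have "W_same \<pi> a c" using W_subsets_member[OF B] that(1) by blast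
    then show ?thesis using that(2,3) by (rule W_sameD)
  qed
  show ?thesis
  proof (cases "a \<le> b")
    case True
    have out: "c \<notin> {a+1..b}" if "c \<in> B" for c
    proof (cases "a = b")
      case False
      then show ?thesis using sep[OF that, of a b] True b(1) by auto
    qed auto
    show ?thesis
    proof (cases "b = k")
      case True
      then have no: "\<not> (\<exists>x\<in>B. a < x)" using out BU by fastforce
      have "Min B = 1" using fB b(2) BU True by (intro Min_eqI) (auto simp: cyc_next_def)
      then show ?thesis using no True by (simp add: cyc_succ_def cyc_next_def)
    next
      case False
      then have nb: "cyc_next k b = Suc b" by (simp add: cyc_next_def)
      have "Suc b \<le> y" if "y \<in> B" "a < y" for y using out[OF that(1)] that(2) by auto
      then have "Min {x \<in> B. a < x} = Suc b"
        using fB b(2) nb True by (intro Min_eqI) auto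
      moreover have "\<exists>x\<in>B. a < x" using b(2) nb True by (intro bexI[of _ "Suc b"]) auto
      ultimately show ?thesis using nb by (simp add: cyc_succ_def)
    qed
  next
    case False
    then have ba: "b < a" by simp
    have sb: "same_block \<pi> b a" using partition_same_block(2)[OF pi b(1)] .
    have inn: "c \<in> {b+1..a}" if "c \<in> B" for c using sep[OF that ba sb] ba by auto
    have nb: "cyc_next k b = Suc b" using ba aU by (auto simp: cyc_next_def)
    have "Min B = Suc b" using fB b(2) nb inn by (intro Min_eqI) auto
    moreover have "\<not> (\<exists>x\<in>B. a < x)" using inn by fastforce
    ultimately show ?thesis using nb by (simp add: cyc_succ_def)
  qed
qed

text \<open>The witness \<open>b\<close> is the cyclic predecessor of \<open>a\<close> in its block of \<open>\<pi>\<close>.\<close>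

lemma cyc_succ_exists:
  assumes pi: "\<pi> \<in> noncrossing_partitions {1..k}" and B: "B \<in> W_subsets k \<pi>" "a \<in> B"
  shows "\<exists>b. same_block \<pi> a b \<and> cyc_next k b = cyc_succ B a"
proof -
  have part: "partition_on {1..k} \<pi>" using pi by (simp add: noncrossing_partitions_def)
  note sb = partition_same_block[OF part]
  note nc = same_block_noncrossing[OF pi]
  have aU: "a \<in> {1..k}" using W_subsets_subset[OF B(1)] B(2) by auto
  let ?A = "{b. same_block \<pi> a b}"
  have A: "?A \<subseteq> {1..k}" using sb(5) by blast
  have finA: "finite ?A" using A finite_subset by blast
  have aA: "a \<in> ?A" using sb(1) aU by simp
  \<comment> \<open>The predecessor is the largest smaller element of the block, or the largest
    element of the block if \<open>a\<close> is the smallest.\<close>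
  have "\<exists>b. same_block \<pi> a b \<and> cyc_next k b \<in> {1..k} \<and> W_same \<pi> a (cyc_next k b)"
  proof (cases "\<exists>b\<in>?A. b < a")
    case True
    define b where "b = Max {b \<in> ?A. b < a}"
    have "b \<in> {b \<in> ?A. b < a}" unfolding b_def using True finA by (intro Max_in) auto
    then have b: "same_block \<pi> a b" "b < a" by auto
    have gap: "\<not> same_block \<pi> a y" if "b < y" "y < a" for y
      using Max_ge[of "{b \<in> ?A. b < a}" y] finA that unfolding b_def[symmetric] by auto
    have nb: "cyc_next k b = Suc b" using b aU by (auto simp: cyc_next_def)
    have "(a \<in> {x+1..y}) = (Suc b \<in> {x+1..y})" if xy: "x < y" "same_block \<pi> x y" for x y
    proof (rule iffI; rule ccontr)
      assume a: "a \<in> {x+1..y}" "Suc b \<notin> {x+1..y}"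
      then have o: "b < x" "x < a" "a \<le> y" using b by auto
      have "same_block \<pi> a x"
      proof (cases "y = a")
        case True then show ?thesis using xy sb(2) by blast
      next
        case False
        then have "same_block \<pi> b x" using nc[of b a x y] sb(2)[OF b(1)] xy(2) o by simp
        then show ?thesis using sb(3)[OF b(1)] by blast
      qed
      then show False using gap o by blast
    next
      assume a: "Suc b \<in> {x+1..y}" "a \<notin> {x+1..y}"
      then have o: "x \<le> b" "b < y" "y < a" using b by auto
      have "same_block \<pi> a y"
      proof (cases "x = b")
        case True then show ?thesis using xy(2) sb(3)[OF b(1)] by blast
      next
        case False
        then have "same_block \<pi> x b" using nc[of x y b a] sb(2)[OF b(1)] xy(2) o by simp
        then have "same_block \<pi> b y" using sb(3)[OF sb(2) xy(2)] by blast
        then show ?thesis using sb(3)[OF b(1)] by blast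
      qed
      then show False using gap o by blast
    qed
    then have "W_same \<pi> a (cyc_next k b)" unfolding nb by (rule W_sameI)
    moreover have "Suc b \<in> {1..k}" using b aU by auto
    ultimately show ?thesis using b nb by auto
  next
    case False
    define b where "b = Max ?A"
    have "b \<in> ?A" unfolding b_def using finA aA by (intro Max_in) auto
    then have b: "same_block \<pi> a b" by simp
    have mx: "y \<le> b" if "same_block \<pi> a y" for y unfolding b_def using finA that by (intro Max_ge) auto
    have mn: "a \<le> y" if "same_block \<pi> a y" for y using False that by (meson mem_Collect_eq not_le)
    have ab: "a \<le> b" using mn b by blast
    have bU: "b \<in> {1..k}" using A b by blast
    \<comment> \<open>\<open>1\<close> and \<open>2\<close> exclude the two ways in which a pair
      could straddle an end of \<open>{a..b}\<close>: by noncrossing such a pair would belong to the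
      block of \<open>a\<close>, beyond its least or greatest element.\<close>
    have 1: False if xy: "x < y" "same_block \<pi> x y" "x < a" "a \<le> y" "y \<le> b" for x y
    proof -
      have "same_block \<pi> a x"
      proof (cases "same_block \<pi> a y")
        case True then show ?thesis using sb(2)[OF xy(2)] sb(3) by blast
      next
        case f: False
        then have "a \<noteq> y" "y \<noteq> b" using sb(1) aU b by auto
        then have "same_block \<pi> x a" using nc[of x y a b] xy b by simp
        then show ?thesis using sb(2) by blast
      qed
      then show False using mn xy by fastforce
    qed
    have 2: False if xy: "x < y" "same_block \<pi> x y" "a \<le> x" "x \<le> b" "b < y" for x y
    proof -
      have "same_block \<pi> a x"
      proof (cases "x = a \<or> x = b")
        case True then show ?thesis using sb(1) aU b by auto
      next
        case f: False
        then show ?thesis using nc[of a b x y] xy b by simp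
      qed
      then have "same_block \<pi> a y" using sb(3) xy(2) by blast
      then show False using mx xy by fastforce
    qed
    have "W_same \<pi> a (cyc_next k b)"
    proof (cases "b = k")
      case True
      have nb: "cyc_next k b = 1" using True by (simp add: cyc_next_def)
      have "(a \<in> {x+1..y}) = (1 \<in> {x+1..y})" if xy: "x < y" "same_block \<pi> x y" for x y
      proof -
        have "1 \<le> x" "y \<le> b" using sb(4,5)[OF xy(2)] True by auto
        moreover have "\<not> (x < a \<and> a \<le> y \<and> y \<le> b)" using 1[OF xy] by blast
        ultimately show ?thesis by auto
      qed
      then show ?thesis unfolding nb by (rule W_sameI)
    next
      case False
      then have nb: "cyc_next k b = Suc b" by (simp add: cyc_next_def)
      have "(a \<in> {x+1..y}) = (Suc b \<in> {x+1..y})" if xy: "x < y" "same_block \<pi> x y" for x y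
      proof -
        have "\<not> (x < a \<and> a \<le> y \<and> y \<le> b)" using 1[OF xy] by blast
        moreover have "\<not> (a \<le> x \<and> x \<le> b \<and> b < y)" using 2[OF xy] by blast
        ultimately show ?thesis using ab by auto
      qed
      then show ?thesis unfolding nb by (rule W_sameI)
    qed
    moreover have "cyc_next k b \<in> {1..k}" using bU by (auto simp: cyc_next_def)
    ultimately show ?thesis using b by blast
  qed
  then obtain b where b: "same_block \<pi> a b" "cyc_next k b \<in> B"
    using W_subsets_member[OF B] by auto
  then show ?thesis using cyc_succ_unique[OF part B b] by blast
qed

text \<open>A class \<open>{c}\<close> is its own cyclic successor, so the index before
  \<open>c\<close> lies in the block of \<open>c\<close> in \<open>\<pi>\<close>; conversely two
  consecutive indices of a block isolate the element of \<open>W\<close> between them.\<close>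

lemma S_count_W_subsets:
  assumes pi: "\<pi> \<in> noncrossing_partitions {1..k}"
  shows "S_count {1..k} \<pi> = card {B \<in> W_subsets k \<pi>. card B = 1}"
proof -
  have part: "partition_on {1..k} \<pi>" using pi by (simp add: noncrossing_partitions_def)
  note sb = partition_same_block[OF part]
  let ?A = "{a \<in> {1..k}. same_block \<pi> a (cyc_next k a)}"
  have eq: "S_count {1..k} \<pi> = card ?A"
  proof -
    have "{a \<in> {1..k}. same_block \<pi> a (cyc_succ {1..k} a)} = ?A"
      using cyc_succ_interval by (intro Collect_cong conj_cong refl) simp
    then show ?thesis using S_count_eq[of "{1..k}" \<pi>] by simp
  qed
  have injn: "x = y" if "cyc_next k x = cyc_next k y" "x \<in> {1..k}" "y \<in> {1..k}" for x y
    using that by (cases "x = k"; cases "y = k") (simp_all add: cyc_next_def)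
  have "bij_betw (\<lambda>a. {cyc_next k a}) ?A {B \<in> W_subsets k \<pi>. card B = 1}"
  proof (rule bij_betwI')
    show "({cyc_next k x} = {cyc_next k y}) = (x = y)" if "x \<in> ?A" "y \<in> ?A" for x y
      using injn that by auto
  next
    fix a assume a: "a \<in> ?A"
    let ?c = "cyc_next k a"
    have c: "?c \<in> {1..k}" using a by (auto simp: cyc_next_def)
    have "d = ?c" if d: "d \<in> {1..k}" "W_same \<pi> ?c d" for d
    proof (cases "a = k")
      case True
      then have c1: "?c = 1" by (simp add: cyc_next_def)
      \<comment> \<open>The pair \<open>1, k\<close> separates index 1 from all of
        \<open>{2..k}\<close>; for \<open>k = 1\<close> there is nothing to separate.\<close>
      have "same_block \<pi> 1 k" using a True c1 sb(2) by auto
      then have "k = 1 \<or> (1 \<in> {1+1..k}) = (d \<in> {1+1..k})"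
        using W_sameD[OF d(2), of 1 k] c unfolding c1 by (cases "k = 1") auto
      then show ?thesis using d(1) c1 by auto
    next
      case False
      then have c1: "?c = Suc a" by (simp add: cyc_next_def)
      then have "(Suc a \<in> {a+1..Suc a}) = (d \<in> {a+1..Suc a})"
      proof -
        have "same_block \<pi> a (Suc a)" using a c1 by simp
        then show ?thesis using W_sameD[OF d(2), of a "Suc a"] unfolding c1 by simp
      qed
      then show ?thesis using c1 by auto
    qed
    then have eqc: "{d \<in> {1..k}. W_same \<pi> ?c d} = {?c}" using c W_same_refl by auto
    show "{?c} \<in> {B \<in> W_subsets k \<pi>. card B = 1}" using W_subsets_obtain[OF c, of \<pi>] unfolding eqc by simp
  next
    fix B assume "B \<in> {B \<in> W_subsets k \<pi>. card B = 1}"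
    then obtain c where B: "B \<in> W_subsets k \<pi>" "B = {c}" by (auto simp: card_1_singleton_iff)
    have "c \<in> B" unfolding B(2) by simp
    from cyc_succ_exists[OF pi B(1) this]
    obtain b where b: "same_block \<pi> c b" "cyc_next k b = c"
      unfolding B(2) cyc_succ_singleton by blast
    have "b \<in> {1..k}" "same_block \<pi> b (cyc_next k b)"
      unfolding b(2) using sb(5)[OF b(1)] sb(2)[OF b(1)] by blast+
    then have "b \<in> ?A" by simp
    moreover have "B = {cyc_next k b}" unfolding B(2) b(2) ..
    ultimately show "\<exists>a\<in>?A. B = {cyc_next k a}" by (rule bexI[rotated])
  qed
  then show ?thesis unfolding eq by (rule bij_betw_same_card)
qed

section \<open>Refinements of the complement and factorisation over its classes\<close>

definition compatible_partitions :: "nat \<Rightarrow> nat set set \<Rightarrow> nat set set set"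
  where "compatible_partitions k \<pi> =
    {\<rho> \<in> noncrossing_partitions {1..k}. \<forall>s t. same_block \<rho> s t \<longrightarrow> W_same \<pi> s t}"

text \<open>If \<open>\<rho>\<close> and \<open>\<pi>\<close> are the kernels of \<open>i\<close>
  and \<open>j\<close>, this counts the steps \<open>(i a, j a)\<close> of the closed walk that
  coincide with a step back \<open>(i (cyc_next k b), j b)\<close>.\<close>

definition return_count :: "nat \<Rightarrow> nat set set \<Rightarrow> nat set set \<Rightarrow> nat"
  where "return_count k \<pi> \<rho> =
    card {a \<in> {1..k}. \<exists>b. same_block \<pi> a b \<and> same_block \<rho> a (cyc_next k b)}"

definition blocks_in :: "nat set set \<Rightarrow> nat set \<Rightarrow> nat set set"
  where "blocks_in \<rho> B = {C \<in> \<rho>. C \<subseteq> B}"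

lemma compatible_part:
  assumes "\<rho> \<in> compatible_partitions k \<pi>"
  shows "partition_on {1..k} \<rho>" "same_block \<rho> s t \<Longrightarrow> W_same \<pi> s t"
  using assms by (auto simp: compatible_partitions_def noncrossing_partitions_def)

lemma compatible_block_subset:
  assumes r: "\<rho> \<in> compatible_partitions k \<pi>" and C: "C \<in> \<rho>" "a \<in> C"
    and B: "B \<in> W_subsets k \<pi>" "a \<in> B"
  shows "C \<subseteq> B"
proof
  fix c assume c: "c \<in> C"
  then have s: "same_block \<rho> a c" using C by (auto simp: same_block_def)
  then have "W_same \<pi> a c" using compatible_part(2)[OF r] by blast
  moreover have "c \<in> {1..k}" using partition_same_block(5)[OF compatible_part(1)[OF r] s] .
  ultimately show "c \<in> B" unfolding W_subsets_member[OF B] by simp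
qed

lemma W_subsets_cover: "a \<in> {1..k} \<Longrightarrow> \<exists>B\<in>W_subsets k \<pi>. a \<in> B"
  using Union_W_subsets by blast

lemma compatible_block_in:
  assumes r: "\<rho> \<in> compatible_partitions k \<pi>" and C: "C \<in> \<rho>"
  shows "\<exists>B\<in>W_subsets k \<pi>. C \<subseteq> B"
proof -
  have "C \<noteq> {}" "C \<subseteq> {1..k}" using compatible_part(1)[OF r] C by (auto simp: partition_on_def)
  then obtain a where a: "a \<in> C" "a \<in> {1..k}" by blast
  obtain B where B: "B \<in> W_subsets k \<pi>" "a \<in> B" using W_subsets_cover[OF a(2)] by blast
  show ?thesis using compatible_block_subset[OF r C a(1) B] B(1) by blast
qed

lemma blocks_in_noncrossing:
  assumes r: "\<rho> \<in> compatible_partitions k \<pi>" and B: "B \<in> W_subsets k \<pi>"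
  shows "blocks_in \<rho> B \<in> noncrossing_partitions B"
proof -
  have part: "partition_on {1..k} \<rho>" using compatible_part[OF r] by simp
  have nc: "\<not> (\<exists>B\<in>\<rho>. \<exists>C\<in>\<rho>. B \<noteq> C \<and> (\<exists>a b c d. a \<in> B \<and> c \<in> B \<and> b \<in> C \<and> d \<in> C \<and> a < b \<and> b < c \<and> c < d))"
    using r by (simp add: compatible_partitions_def noncrossing_partitions_def)
  have "B \<subseteq> \<Union>(blocks_in \<rho> B)"
  proof
    fix b assume b: "b \<in> B"
    then have "b \<in> \<Union>\<rho>" using W_subsets_subset[OF B] part by (auto simp: partition_on_def)
    then obtain C where "C \<in> \<rho>" "b \<in> C" by blast
    then show "b \<in> \<Union>(blocks_in \<rho> B)"
      using compatible_block_subset[OF r _ _ B b] by (auto simp: blocks_in_def)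
  qed
  then have "partition_on B (blocks_in \<rho> B)"
    using part by (auto simp: partition_on_def blocks_in_def disjoint_def)
  moreover have "\<not> (\<exists>C\<in>blocks_in \<rho> B. \<exists>D\<in>blocks_in \<rho> B. C \<noteq> D \<and> (\<exists>a b c d. a \<in> C \<and> c \<in> C \<and> b \<in> D \<and> d \<in> D \<and> a < b \<and> b < c \<and> c < d))"
    using nc unfolding blocks_in_def by blast
  ultimately show ?thesis by (simp add: noncrossing_partitions_def)
qed

lemma blocks_in_same_block:
  assumes r: "\<rho> \<in> compatible_partitions k \<pi>" and B: "B \<in> W_subsets k \<pi>" "a \<in> B"
  shows "same_block (blocks_in \<rho> B) a c \<longleftrightarrow> same_block \<rho> a c"
  unfolding same_block_def blocks_in_def using compatible_block_subset[OF r _ _ B] by blast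

text \<open>By \<open>cyc_succ_unique\<close> and \<open>cyc_succ_exists\<close>, the index
  \<open>cyc_next k b\<close> in the condition can only be the successor of \<open>a\<close> in its
  class, so the count splits into the consecutive pairs counted by \<open>S_count\<close> in each
  class.\<close>

lemma return_count_eq:
  assumes pi: "\<pi> \<in> noncrossing_partitions {1..k}" and r: "\<rho> \<in> compatible_partitions k \<pi>"
  shows "return_count k \<pi> \<rho> = (\<Sum>B\<in>W_subsets k \<pi>. S_count B (blocks_in \<rho> B))"
proof -
  have part: "partition_on {1..k} \<pi>" using pi by (simp add: noncrossing_partitions_def)
  let ?Q = "\<lambda>a. \<exists>b. same_block \<pi> a b \<and> same_block \<rho> a (cyc_next k b)"
  have Q: "?Q a \<longleftrightarrow> same_block (blocks_in \<rho> B) a (cyc_succ B a)" if B: "B \<in> W_subsets k \<pi>" "a \<in> B" for a B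
    unfolding blocks_in_same_block[OF r B]
  proof
    assume "?Q a"
    then obtain b where b: "same_block \<pi> a b" "same_block \<rho> a (cyc_next k b)" by blast
    have "W_same \<pi> a (cyc_next k b)" using compatible_part(2)[OF r b(2)] .
    moreover have "cyc_next k b \<in> {1..k}" using partition_same_block(5)[OF compatible_part(1)[OF r] b(2)] .
    ultimately have "cyc_next k b \<in> B" unfolding W_subsets_member[OF B] by simp
    then show "same_block \<rho> a (cyc_succ B a)" using cyc_succ_unique[OF part B b(1)] b(2) by simp
  next
    assume s: "same_block \<rho> a (cyc_succ B a)"
    obtain b where "same_block \<pi> a b" "cyc_next k b = cyc_succ B a" using cyc_succ_exists[OF pi B] by blast
    then show "?Q a" using s by metis
  qed
  have "{a \<in> {1..k}. ?Q a} = (\<Union>B\<in>W_subsets k \<pi>. {a \<in> B. ?Q a})"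
    unfolding Union_W_subsets[of k \<pi>, symmetric] by blast
  then have "return_count k \<pi> \<rho> = card (\<Union>B\<in>W_subsets k \<pi>. {a \<in> B. ?Q a})"
    by (simp add: return_count_def)
  also have "\<dots> = (\<Sum>B\<in>W_subsets k \<pi>. card {a \<in> B. ?Q a})"
  proof (rule card_UN_disjoint[OF finite_W_subsets])
    show "\<forall>B\<in>W_subsets k \<pi>. finite {a \<in> B. ?Q a}" using finite_W_subset by simp
    show "\<forall>B\<in>W_subsets k \<pi>. \<forall>C\<in>W_subsets k \<pi>. B \<noteq> C \<longrightarrow> {a \<in> B. ?Q a} \<inter> {a \<in> C. ?Q a} = {}"
      using W_subsets_disjoint by blast
  qed
  also have "\<dots> = (\<Sum>B\<in>W_subsets k \<pi>. S_count B (blocks_in \<rho> B))"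
  proof (rule sum.cong[OF refl])
    fix B assume B: "B \<in> W_subsets k \<pi>"
    have "{a \<in> B. ?Q a} = {a \<in> B. same_block (blocks_in \<rho> B) a (cyc_succ B a)}"
      using Q[OF B] by (intro Collect_cong) metis
    then show "card {a \<in> B. ?Q a} = S_count B (blocks_in \<rho> B)"
      using S_count_eq[OF finite_W_subset[OF B]] by simp
  qed
  finally show ?thesis .
qed

lemma card_partition_le:
  assumes "partition_on B P" "finite B"
  shows "card P \<le> card B"
proof -
  have p: "\<Union>P = B" "disjoint P" "{} \<notin> P" using assms(1) by (auto simp: partition_on_def)
  have fC: "finite C" if "C \<in> P" for C using that p(1) assms(2) finite_subset by (metis Union_upper)
  have "card P = (\<Sum>C\<in>P. 1)" by simp
  also have "\<dots> \<le> (\<Sum>C\<in>P. card C)"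
  proof (rule sum_mono)
    fix C assume C: "C \<in> P"
    then have "C \<noteq> {}" using p(3) by blast
    then show "1 \<le> card C" using fC[OF C] by (simp add: Suc_le_eq card_gt_0_iff)
  qed
  also have "\<dots> = card B"
    using card_Union_disjoint[of P] p fC by (simp add: disjoint_def pairwise_def disjnt_def)
  finally show ?thesis .
qed

lemma sum_card_W_subsets: "(\<Sum>B\<in>W_subsets k \<pi>. card B) = k"
proof -
  have "card (\<Union>B\<in>W_subsets k \<pi>. B) = (\<Sum>B\<in>W_subsets k \<pi>. card B)"
    using finite_W_subset W_subsets_disjoint by (intro card_UN_disjoint[OF finite_W_subsets]) (simp, blast)
  then show ?thesis using Union_W_subsets[of k \<pi>] by simp
qed

lemma sum_card_blocks_in:
  assumes r: "\<rho> \<in> compatible_partitions k \<pi>"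
  shows "(\<Sum>B\<in>W_subsets k \<pi>. card (blocks_in \<rho> B)) = card \<rho>"
    and "(\<Union>B\<in>W_subsets k \<pi>. blocks_in \<rho> B) = \<rho>"
proof -
  have part: "partition_on {1..k} \<rho>" using compatible_part[OF r] by simp
  have "\<rho> \<subseteq> Pow {1..k}" using part by (auto simp: partition_on_def)
  then have fin: "finite \<rho>" using finite_subset by blast
  show U: "(\<Union>B\<in>W_subsets k \<pi>. blocks_in \<rho> B) = \<rho>"
    using compatible_block_in[OF r] by (auto simp: blocks_in_def)
  have dis: "blocks_in \<rho> B \<inter> blocks_in \<rho> C = {}" if "B \<in> W_subsets k \<pi>" "C \<in> W_subsets k \<pi>" "B \<noteq> C" for B C
  proof (rule ccontr)
    assume "blocks_in \<rho> B \<inter> blocks_in \<rho> C \<noteq> {}"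
    then obtain D where D: "D \<in> \<rho>" "D \<subseteq> B" "D \<subseteq> C" by (auto simp: blocks_in_def)
    then have "D \<noteq> {}" using part by (auto simp: partition_on_def)
    then obtain a where "a \<in> B" "a \<in> C" using D by blast
    then show False using W_subsets_disjoint that by blast
  qed
  have "card (\<Union>B\<in>W_subsets k \<pi>. blocks_in \<rho> B) = (\<Sum>B\<in>W_subsets k \<pi>. card (blocks_in \<rho> B))"
    using fin dis by (intro card_UN_disjoint[OF finite_W_subsets]) (simp_all add: blocks_in_def)
  then show "(\<Sum>B\<in>W_subsets k \<pi>. card (blocks_in \<rho> B)) = card \<rho>" unfolding U by simp
qed

lemma Union_compatible:
  assumes mu: "\<mu> \<in> PiE (W_subsets k \<pi>) noncrossing_partitions"
  shows "(\<Union>B\<in>W_subsets k \<pi>. \<mu> B) \<in> compatible_partitions k \<pi>"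
    and "B \<in> W_subsets k \<pi> \<Longrightarrow> blocks_in (\<Union>B\<in>W_subsets k \<pi>. \<mu> B) B = \<mu> B"
proof -
  let ?r = "\<Union>B\<in>W_subsets k \<pi>. \<mu> B"
  have m: "partition_on B (\<mu> B)" and
    nc: "\<not> (\<exists>C\<in>\<mu> B. \<exists>D\<in>\<mu> B. C \<noteq> D \<and> (\<exists>a b c d. a \<in> C \<and> c \<in> C \<and> b \<in> D \<and> d \<in> D \<and> a < b \<and> b < c \<and> c < d))"
    if "B \<in> W_subsets k \<pi>" for B
    using PiE_mem[OF mu that] by (simp_all add: noncrossing_partitions_def)
  have sub: "C \<subseteq> B" "C \<noteq> {}" if "B \<in> W_subsets k \<pi>" "C \<in> \<mu> B" for B C
    using m[OF that(1)] that(2) by (auto simp: partition_on_def)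
  have bl: "blocks_in ?r B = \<mu> B" if B: "B \<in> W_subsets k \<pi>" for B
  proof
    show "\<mu> B \<subseteq> blocks_in ?r B" using B sub by (auto simp: blocks_in_def)
    show "blocks_in ?r B \<subseteq> \<mu> B"
    proof
      fix C assume "C \<in> blocks_in ?r B"
      then obtain B' where B': "B' \<in> W_subsets k \<pi>" "C \<in> \<mu> B'" "C \<subseteq> B" by (auto simp: blocks_in_def)
      have "C \<subseteq> B'" "C \<noteq> {}" using sub[OF B'(1,2)] by auto
      then obtain a where "a \<in> B'" "a \<in> B" using B'(3) by blast
      then have "B = B'" using W_subsets_disjoint B B'(1) by blast
      then show "C \<in> \<mu> B" using B' by simp
    qed
  qed
  then show "B \<in> W_subsets k \<pi> \<Longrightarrow> blocks_in ?r B = \<mu> B" .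
  have U: "\<Union>?r = {1..k}"
  proof -
    have "\<Union>?r = (\<Union>B\<in>W_subsets k \<pi>. \<Union>(\<mu> B))" by blast
    also have "\<dots> = (\<Union>B\<in>W_subsets k \<pi>. B)"
      using m by (intro SUP_cong refl) (simp add: partition_on_def)
    also have "\<dots> = {1..k}" using Union_W_subsets by simp
    finally show ?thesis .
  qed
  have dis: "C = D" if C: "C \<in> ?r" and D: "D \<in> ?r" and a: "a \<in> C" "a \<in> D" for C D a
  proof -
    obtain B where B: "B \<in> W_subsets k \<pi>" "C \<in> \<mu> B" using C by blast
    obtain B' where B': "B' \<in> W_subsets k \<pi>" "D \<in> \<mu> B'" using D by blast
    have "B = B'" using W_subsets_disjoint[OF B(1) B'(1), of a] sub(1)[OF B] sub(1)[OF B'] a by blast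
    then show ?thesis using m[OF B(1)] B(2) B'(2) a unfolding partition_on_def disjoint_def by blast
  qed
  have part: "partition_on {1..k} ?r"
  proof (rule partition_onI)
    show "\<Union>?r = {1..k}" by (rule U)
    show "disjnt C D" if "C \<in> ?r" "D \<in> ?r" "C \<noteq> D" for C D
      using dis[OF that(1,2)] that(3) unfolding disjnt_def by blast
    show "{} \<notin> ?r"
    proof
      assume "{} \<in> ?r"
      then obtain B where "B \<in> W_subsets k \<pi>" "{} \<in> \<mu> B" by blast
      then show False using sub(2) by blast
    qed
  qed
  have ws: "W_same \<pi> s t" if st: "same_block ?r s t" for s t
  proof -
    obtain B C where B: "B \<in> W_subsets k \<pi>" "C \<in> \<mu> B" "s \<in> C" "t \<in> C"
      using st unfolding same_block_def by blast
    then have "s \<in> B" "t \<in> B" using sub(1) by blast+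
    then show ?thesis using W_subsets_member[OF B(1), of s] by blast
  qed
  have "C = D" if C: "C \<in> ?r" and D: "D \<in> ?r" and x: "a \<in> C" "c \<in> C" "b \<in> D" "d \<in> D" "a < b" "b < c" "c < d"
    for C D a b c d
  proof -
    obtain B where B: "B \<in> W_subsets k \<pi>" "C \<in> \<mu> B" using C by blast
    obtain B' where B': "B' \<in> W_subsets k \<pi>" "D \<in> \<mu> B'" using D by blast
    have ac: "W_same \<pi> a c" and bd: "W_same \<pi> b d"
      using ws x C D unfolding same_block_def by blast+
    \<comment> \<open>An interval contains both or neither of \<open>a\<close>, \<open>c\<close>,
      and both or neither of \<open>b\<close>, \<open>d\<close>; for \<open>a < b < c < d\<close> it
      cannot tell the two pairs apart. Crossing blocks thus lie in one class, where
      \<open>\<mu>\<close> is noncrossing.\<close>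
    have "W_same \<pi> a b"
    proof (rule W_sameI)
      fix p q assume pq: "p < q" "same_block \<pi> p q"
      have "(a \<in> {p+1..q}) = (c \<in> {p+1..q})" "(b \<in> {p+1..q}) = (d \<in> {p+1..q})"
        using W_sameD[OF ac pq] W_sameD[OF bd pq] by auto
      then show "(a \<in> {p+1..q}) = (b \<in> {p+1..q})" using x(5-7) by auto
    qed
    moreover have "a \<in> B" "b \<in> B'" "b \<in> {1..k}" using sub(1)[OF B] sub(1)[OF B'] x W_subsets_subset[OF B'(1)] by blast+
    ultimately have "b \<in> B" using W_subsets_member[OF B(1), of a] by blast
    then have "B = B'" using W_subsets_disjoint B(1) B'(1) \<open>b \<in> B'\<close> by blast
    then show ?thesis using nc[OF B(1)] B(2) B'(2) x by blast
  qed
  then show "?r \<in> compatible_partitions k \<pi>"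
    unfolding compatible_partitions_def noncrossing_partitions_def using part ws by blast
qed

text \<open>A compatible \<open>\<rho>\<close> amounts to an independent choice of a noncrossing
  partition of each class, and block numbers and return counts add over the classes. Each singleton
  class contributes a factor \<open>t1\<close>, which produces the power in front.\<close>

lemma sum_compatible_partitions:
  fixes \<psi> t1 t2 :: real
  assumes pi: "\<pi> \<in> noncrossing_partitions {1..k}"
  shows "(\<Sum>\<rho>\<in>compatible_partitions k \<pi>. \<psi> ^ (k - card \<rho>) * t1 ^ return_count k \<pi> \<rho> * t2 ^ (k - return_count k \<pi> \<rho>))
    = t1 ^ S_count {1..k} \<pi> * (\<Prod>B\<in>W_big_subsets k \<pi>.
          \<Sum>\<mu>\<in>noncrossing_partitions B.
            \<psi> ^ (card B - card \<mu>) * t1 ^ S_count B \<mu> * t2 ^ (card B - S_count B \<mu>))"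
proof -
  let ?W = "W_subsets k \<pi>"
  let ?F = "\<lambda>B \<mu>. \<psi> ^ (card B - card \<mu>) * t1 ^ S_count B \<mu> * t2 ^ (card B - S_count B \<mu>)"
  have "(\<Sum>\<rho>\<in>compatible_partitions k \<pi>. \<psi> ^ (k - card \<rho>) * t1 ^ return_count k \<pi> \<rho> * t2 ^ (k - return_count k \<pi> \<rho>))
      = (\<Sum>\<rho>\<in>compatible_partitions k \<pi>. \<Prod>B\<in>?W. ?F B (blocks_in \<rho> B))"
  proof (rule sum.cong[OF refl])
    fix \<rho> assume r: "\<rho> \<in> compatible_partitions k \<pi>"
    have c1: "card (blocks_in \<rho> B) \<le> card B" if "B \<in> ?W" for B
      using blocks_in_noncrossing[OF r that] finite_W_subset[OF that] card_partition_le
      by (auto simp: noncrossing_partitions_def)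
    have c2: "S_count B (blocks_in \<rho> B) \<le> card B" if "B \<in> ?W" for B
      using S_count_le[OF finite_W_subset[OF that]] .
    have e1: "k - card \<rho> = (\<Sum>B\<in>?W. card B - card (blocks_in \<rho> B))"
      using sum_subtractf_nat[of ?W "\<lambda>B. card (blocks_in \<rho> B)" card] c1
        sum_card_W_subsets[of k \<pi>] sum_card_blocks_in(1)[OF r] by simp
    have e2: "k - return_count k \<pi> \<rho> = (\<Sum>B\<in>?W. card B - S_count B (blocks_in \<rho> B))"
      using sum_subtractf_nat[of ?W "\<lambda>B. S_count B (blocks_in \<rho> B)" card] c2
        sum_card_W_subsets[of k \<pi>] return_count_eq[OF pi r] by simp
    show "\<psi> ^ (k - card \<rho>) * t1 ^ return_count k \<pi> \<rho> * t2 ^ (k - return_count k \<pi> \<rho>)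
        = (\<Prod>B\<in>?W. ?F B (blocks_in \<rho> B))"
      unfolding e1 e2 unfolding return_count_eq[OF pi r] by (simp add: power_sum prod.distrib)
  qed
  also have "\<dots> = (\<Sum>\<mu>\<in>PiE ?W noncrossing_partitions. \<Prod>B\<in>?W. ?F B (\<mu> B))"
  proof (rule sum.reindex_bij_witness[of _ "\<lambda>\<mu>. \<Union>B\<in>?W. \<mu> B" "\<lambda>\<rho>. \<lambda>B\<in>?W. blocks_in \<rho> B"])
    fix \<rho> assume r: "\<rho> \<in> compatible_partitions k \<pi>"
    show "(\<Union>B\<in>?W. (\<lambda>B\<in>?W. blocks_in \<rho> B) B) = \<rho>"
      using sum_card_blocks_in(2)[OF r] by simp
    show "(\<lambda>B\<in>?W. blocks_in \<rho> B) \<in> PiE ?W noncrossing_partitions"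
      using blocks_in_noncrossing[OF r] by auto
    show "(\<Prod>B\<in>?W. ?F B ((\<lambda>B\<in>?W. blocks_in \<rho> B) B)) = (\<Prod>B\<in>?W. ?F B (blocks_in \<rho> B))"
      by (intro prod.cong) auto
  next
    fix \<mu> assume m: "\<mu> \<in> PiE ?W noncrossing_partitions"
    show "(\<lambda>B\<in>?W. blocks_in (\<Union>B\<in>?W. \<mu> B) B) = \<mu>"
    proof
      fix B show "(\<lambda>B\<in>?W. blocks_in (\<Union>B\<in>?W. \<mu> B) B) B = \<mu> B"
        using Union_compatible(2)[OF m, of B] PiE_arb[OF m, of B] by (cases "B \<in> ?W") simp_all
    qed
    show "(\<Union>B\<in>?W. \<mu> B) \<in> compatible_partitions k \<pi>" using Union_compatible(1)[OF m] .
  qed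
  also have "\<dots> = (\<Prod>B\<in>?W. \<Sum>\<mu>\<in>noncrossing_partitions B. ?F B \<mu>)"
    by (rule prod_sum_PiE[symmetric, OF finite_W_subsets])
      (use finite_noncrossing_partitions finite_W_subset in auto)
  also have "\<dots> = (\<Prod>B\<in>{B \<in> ?W. card B = 1}. \<Sum>\<mu>\<in>noncrossing_partitions B. ?F B \<mu>) *
      (\<Prod>B\<in>W_big_subsets k \<pi>. \<Sum>\<mu>\<in>noncrossing_partitions B. ?F B \<mu>)"
  proof -
    have "card B = 1 \<or> 2 \<le> card B" if "B \<in> ?W" for B
    proof -
      have "card B \<noteq> 0" using W_subsets_subset[OF that] finite_W_subset[OF that] by simp
      then show ?thesis by linarith
    qed
    then have eq: "?W = {B \<in> ?W. card B = 1} \<union> W_big_subsets k \<pi>" by (auto simp: W_big_subsets_def)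
    have dj: "{B \<in> ?W. card B = 1} \<inter> W_big_subsets k \<pi> = {}" by (auto simp: W_big_subsets_def)
    have "finite {B \<in> ?W. card B = 1}" "finite (W_big_subsets k \<pi>)"
      using finite_W_subsets by (simp_all add: W_big_subsets_def)
    from prod.union_disjoint[OF this dj] show ?thesis
      by (rule trans[OF arg_cong[OF eq]])
  qed
  also have "(\<Prod>B\<in>{B \<in> ?W. card B = 1}. \<Sum>\<mu>\<in>noncrossing_partitions B. ?F B \<mu>) = t1 ^ S_count {1..k} \<pi>"
  proof -
    have "(\<Sum>\<mu>\<in>noncrossing_partitions B. ?F B \<mu>) = t1" if B1: "card B = 1" for B
    proof -
      obtain b where b: "B = {b}" using B1 by (auto simp: card_1_singleton_iff)
      have "{a \<in> {b}. same_block {{b}} a (cyc_succ {b} a)} = {b}"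
        by (auto simp: cyc_succ_singleton same_block_def)
      then have "S_count {b} {{b}} = 1" using S_count_eq[of "{b}" "{{b}}"] by simp
      then show ?thesis by (simp add: b noncrossing_partition_singleton)
    qed
    then have "(\<Prod>B\<in>{B \<in> ?W. card B = 1}. \<Sum>\<mu>\<in>noncrossing_partitions B. ?F B \<mu>)
        = (\<Prod>B\<in>{B \<in> ?W. card B = 1}. t1)"
      by (intro prod.cong) auto
    then show ?thesis using S_count_W_subsets[OF pi] by simp
  qed
  finally show ?thesis .
qed

lemma limit_moment_eq:
  "limit_moment \<phi> \<psi> t1 t2 k = (\<Sum>\<pi>\<in>noncrossing_partitions {1..k}. \<Sum>\<rho>\<in>compatible_partitions k \<pi>.
    \<phi> ^ (k - card \<pi>) * (\<psi> ^ (k - card \<rho>) / \<psi> ^ (k - 1)) *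
    (t1 ^ return_count k \<pi> \<rho> * t2 ^ (k - return_count k \<pi> \<rho>)))"
  unfolding limit_moment_def
proof (rule sum.cong[OF refl])
  fix \<pi> assume pi: "\<pi> \<in> noncrossing_partitions {1..k}"
  have "(\<Sum>\<rho>\<in>compatible_partitions k \<pi>. \<phi> ^ (k - card \<pi>) * (\<psi> ^ (k - card \<rho>) / \<psi> ^ (k - 1)) *
      (t1 ^ return_count k \<pi> \<rho> * t2 ^ (k - return_count k \<pi> \<rho>)))
    = \<phi> ^ (k - card \<pi>) / \<psi> ^ (k - 1) * (\<Sum>\<rho>\<in>compatible_partitions k \<pi>.
      \<psi> ^ (k - card \<rho>) * t1 ^ return_count k \<pi> \<rho> * t2 ^ (k - return_count k \<pi> \<rho>))"
    unfolding sum_distrib_left by (intro sum.cong) (auto simp: field_simps)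
  then show "\<phi> ^ (k - card \<pi>) / \<psi> ^ (k - 1) * t1 ^ S_count {1..k} \<pi> *
       (\<Prod>B\<in>W_big_subsets k \<pi>. \<Sum>\<mu>\<in>noncrossing_partitions B.
            \<psi> ^ (card B - card \<mu>) * t1 ^ S_count B \<mu> * t2 ^ (card B - S_count B \<mu>)) =
    (\<Sum>\<rho>\<in>compatible_partitions k \<pi>. \<phi> ^ (k - card \<pi>) * (\<psi> ^ (k - card \<rho>) / \<psi> ^ (k - 1)) *
      (t1 ^ return_count k \<pi> \<rho> * t2 ^ (k - return_count k \<pi> \<rho>)))"
    using sum_compatible_partitions[OF pi, of \<psi> t1 t2] by (simp add: mult.assoc)
qed

section \<open>Smooth bounded functions and parity operators\<close>

definition smooth_bounded :: "(real \<Rightarrow> real) \<Rightarrow> bool"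
  where "smooth_bounded g \<longleftrightarrow> (\<forall>r. (\<forall>x. (deriv ^^ r) g differentiable at x) \<and>
    (\<exists>B. \<forall>x. \<bar>(deriv ^^ r) g x\<bar> \<le> B))"

lemma smooth_bounded_has_deriv:
  "smooth_bounded g \<Longrightarrow> ((deriv ^^ r) g has_field_derivative (deriv ^^ Suc r) g x) (at x)"
  by (simp add: smooth_bounded_def DERIV_deriv_iff_real_differentiable)

lemma smooth_bounded_deriv: "smooth_bounded g \<Longrightarrow> smooth_bounded (deriv g)"
  unfolding smooth_bounded_def by (metis funpow_Suc_right o_apply)

lemma smooth_bounded_continuous: "smooth_bounded g \<Longrightarrow> continuous_on A g"
  using smooth_bounded_has_deriv[of g 0]
  by (intro continuous_at_imp_continuous_on ballI DERIV_isCont) auto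

lemma smooth_bounded_measurable: "smooth_bounded g \<Longrightarrow> g \<in> borel_measurable borel"
  using smooth_bounded_continuous by (rule borel_measurable_continuous_onI)

text \<open>Induction on the order through \<open>(g h)' = g' h + g h'\<close>. The auxiliary
  \<open>P r\<close> isolates one order, because the induction hypothesis for the two products in
  the derivative covers only finitely many orders.\<close>

lemma smooth_bounded_mult:
  assumes "smooth_bounded g" "smooth_bounded h"
  shows "smooth_bounded (\<lambda>x. g x * h x)"
proof -
  have D: "deriv (\<lambda>x. g x * h x) = (\<lambda>x. deriv g x * h x + g x * deriv h x)"
    if "smooth_bounded g" "smooth_bounded h" for g h :: "real \<Rightarrow> real"
    using smooth_bounded_has_deriv[OF that(1), of 0] smooth_bounded_has_deriv[OF that(2), of 0]
    by (intro ext DERIV_imp_deriv) (auto intro!: derivative_eq_intros)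
  define P where "P = (\<lambda>r (u :: real \<Rightarrow> real). (\<forall>x. (deriv ^^ r) u differentiable at x) \<and>
    (\<exists>B. \<forall>x. \<bar>(deriv ^^ r) u x\<bar> \<le> B))"
  have PS: "P (Suc r) u \<longleftrightarrow> P r (deriv u)" for r u by (simp add: P_def funpow_swap1)
  have iff: "smooth_bounded u \<longleftrightarrow> (\<forall>r. P r u)" for u by (simp add: P_def smooth_bounded_def)
  have Padd: "P r (\<lambda>x. u x + v x)" if uv: "\<forall>s\<le>r. P s u \<and> P s v" for r u v
  proof -
    have e: "(deriv ^^ s) (\<lambda>x. u x + v x) = (\<lambda>x. (deriv ^^ s) u x + (deriv ^^ s) v x)" if "s \<le> r" for s
      using that
    proof (induction s)
      case (Suc s)
      have "((deriv ^^ s) u has_field_derivative deriv ((deriv ^^ s) u) x) (at x)"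
        "((deriv ^^ s) v has_field_derivative deriv ((deriv ^^ s) v) x) (at x)" for x
        using \<open>\<forall>s\<le>r. P s u \<and> P s v\<close> Suc.prems
        by (auto simp: P_def DERIV_deriv_iff_real_differentiable)
      then show ?case
        unfolding funpow.simps o_apply Suc.IH[OF Suc_leD[OF Suc.prems]]
        by (intro ext DERIV_imp_deriv) (auto intro!: derivative_eq_intros)
    qed simp
    obtain B C where "\<And>x. \<bar>(deriv ^^ r) u x\<bar> \<le> B" "\<And>x. \<bar>(deriv ^^ r) v x\<bar> \<le> C"
      using uv[rule_format, OF order_refl] unfolding P_def by blast
    then have "\<forall>x. \<bar>(deriv ^^ r) u x + (deriv ^^ r) v x\<bar> \<le> B + C"
      by (metis abs_triangle_ineq add_mono order_trans)
    then show ?thesis using uv unfolding P_def e[OF order_refl] by auto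
  qed
  have "\<forall>s\<le>r. P s (\<lambda>x. g x * h x)" if "smooth_bounded g" "smooth_bounded h" for r g h
    using that
  proof (induction r arbitrary: g h)
    case 0
    obtain B C where BC: "\<And>x. \<bar>g x\<bar> \<le> B" "\<And>x. \<bar>h x\<bar> \<le> C"
      using 0 unfolding smooth_bounded_def by (metis funpow_0)
    then have "\<bar>g x * h x\<bar> \<le> B * C" for x
      unfolding abs_mult by (intro mult_mono) (auto intro: order_trans[OF abs_ge_zero])
    moreover have "(\<lambda>x. g x * h x) differentiable at x" for x
      using smooth_bounded_has_deriv[OF 0(1), of 0] smooth_bounded_has_deriv[OF 0(2), of 0]
      using DERIV_mult[of g "deriv g x" x UNIV h "deriv h x"] by (auto simp: real_differentiable_def)
    ultimately show ?case by (auto simp: P_def)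
  next
    case (Suc r)
    have 1: "\<forall>s\<le>r. P s (\<lambda>x. deriv g x * h x)" and 2: "\<forall>s\<le>r. P s (\<lambda>x. g x * deriv h x)"
      using Suc smooth_bounded_deriv by blast+
    have "P s (\<lambda>x. deriv g x * h x + g x * deriv h x)" if "s \<le> r" for s
      by (rule Padd) (use 1 2 that in auto)
    then have "P (Suc s) (\<lambda>x. g x * h x)" if "s \<le> r" for s
      unfolding PS D[OF Suc.prems] using that by blast
    moreover have "P 0 (\<lambda>x. g x * h x)" using Suc by blast
    ultimately show ?case by (metis Suc_le_mono not0_implies_Suc)
  qed
  then show ?thesis using assms unfolding iff by blast
qed

lemma smooth_bounded_power:
  assumes "smooth_bounded g" "1 \<le> d"
  shows "smooth_bounded (\<lambda>x. g x ^ d)"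
  using assms(2)
proof (induction d rule: dec_induct)
  case base
  then show ?case using assms(1) by simp
next
  case (step d)
  then show ?case using smooth_bounded_mult[OF assms(1) step.IH] by simp
qed

lemma smooth_bounded_bound:
  assumes "smooth_bounded g"
  shows "\<exists>B\<ge>1. \<forall>r\<le>R. \<forall>x. \<bar>(deriv ^^ r) g x\<bar> \<le> B"
proof -
  have "\<forall>r. \<exists>B. \<forall>x. \<bar>(deriv ^^ r) g x\<bar> \<le> B" using assms by (auto simp: smooth_bounded_def)
  then obtain b where b: "\<And>r x. \<bar>(deriv ^^ r) g x\<bar> \<le> b r" by metis
  have b0: "0 \<le> b r" for r using b[of r 0] by linarith
  have "\<bar>(deriv ^^ r) g x\<bar> \<le> 1 + (\<Sum>r\<le>R. b r)" if "r \<le> R" for r x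
    using b[of r x] member_le_sum[of r "{..R}" b] b0 that by fastforce
  moreover have "1 \<le> 1 + (\<Sum>r\<le>R. b r)" using b0 by (simp add: sum_nonneg)
  ultimately show ?thesis by blast
qed

text \<open>The integral of the modulus of the next derivative bounds the oscillation of each
  derivative.\<close>

lemma L1_derivatives_smooth_bounded:
  assumes diff: "\<And>r x. (deriv ^^ r) g differentiable (at x)"
    and int: "\<And>r. integrable lborel ((deriv ^^ r) g)"
  shows "smooth_bounded g"
  unfolding smooth_bounded_def
proof (intro allI conjI)
  fix r
  let ?G = "(deriv ^^ r) g" and ?H = "(deriv ^^ Suc r) g"
  show "?G differentiable at x" for x using diff .
  have D: "(?G has_real_derivative ?H x) (at x)" for x
    using diff[of r x] by (simp add: DERIV_deriv_iff_real_differentiable)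
  have cH: "isCont ?H x" for x
    using diff[of "Suc r" x] real_differentiable_def DERIV_isCont by blast
  have ftc: "\<bar>?G b - ?G a\<bar> \<le> (LINT x|lborel. \<bar>?H x\<bar>)" if "a \<le> b" for a b
  proof -
    have "(LINT x|lborel. ?H x * indicator {a..b} x) = ?G b - ?G a"
      using that D cH by (intro integral_FTC_Icc_real) auto
    then have "\<bar>?G b - ?G a\<bar> = \<bar>LINT x|lborel. ?H x * indicator {a..b} x\<bar>" by simp
    also have "\<dots> \<le> (LINT x|lborel. \<bar>?H x * indicator {a..b} x\<bar>)" by (rule integral_abs_bound)
    also have "\<dots> \<le> (LINT x|lborel. \<bar>?H x\<bar>)"
      using int[of "Suc r"] by (intro integral_mono_AE integrable_abs integrable_real_mult_indicator)
        (auto simp: indicator_def)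
    finally show ?thesis .
  qed
  have "\<bar>?G x\<bar> \<le> \<bar>?G 0\<bar> + (LINT x|lborel. \<bar>?H x\<bar>)" for x
    using ftc[of 0 x] ftc[of x 0] by (cases "0 \<le> x") linarith+
  then show "\<exists>B. \<forall>x. \<bar>?G x\<bar> \<le> B" by blast
qed

section \<open>Odd and even parts in the summands\<close>

definition shift_part :: "bool \<Rightarrow> real \<Rightarrow> (real \<Rightarrow> real) \<Rightarrow> real \<Rightarrow> real"
  where "shift_part b x g z = (g (z + x) + (if b then - g (z - x) else g (z - x))) / 2"

text \<open>The part of \<open>(x 0, \<dots>, x (r - 1)) \<mapsto> g (z + x 0 + \<dots> + x (r - 1))\<close> that is odd in the
  variables \<open>x l\<close> with \<open>b l\<close> and even in the others.\<close>

fun parity_part :: "nat \<Rightarrow> (real \<Rightarrow> real) \<Rightarrow> (nat \<Rightarrow> bool) \<Rightarrow> (nat \<Rightarrow> real) \<Rightarrow> real \<Rightarrow> real"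
  where
    "parity_part 0 g b x = g"
  | "parity_part (Suc r) g b x = shift_part (b r) (x r) (parity_part r g b x)"

lemma parity_part_cong:
  "(\<And>l. l < r \<Longrightarrow> b l = b' l) \<Longrightarrow> (\<And>l. l < r \<Longrightarrow> x l = x' l) \<Longrightarrow>
    parity_part r g b x = parity_part r g b' x'"
  by (induction r) auto

lemma parity_part_split:
  "parity_part r g b x (z + x r) =
    parity_part (Suc r) g (b(r := True)) x z + parity_part (Suc r) g (b(r := False)) x z"
proof -
  have "parity_part r g (b(r := c)) x = parity_part r g b x" for c
    by (rule parity_part_cong) auto
  then show ?thesis by (simp add: shift_part_def field_simps)
qed

lemma parity_part_flip:
  assumes "l < r"
  shows "parity_part r g b (x(l := - x l)) z = (if b l then -1 else 1) * parity_part r g b x z"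
  using assms
proof (induction r arbitrary: z)
  case (Suc r)
  show ?case
  proof (cases "l = r")
    case True
    have eq: "parity_part r g b (x(l := - x l)) = parity_part r g b x"
      using True by (intro parity_part_cong) auto
    show ?thesis unfolding parity_part.simps shift_part_def eq using True by simp
  next
    case False
    then have "l < r" using Suc.prems by simp
    note IH = Suc.IH[OF this]
    show ?thesis using False unfolding parity_part.simps shift_part_def IH by (simp add: field_simps)
  qed
qed simp

lemma parity_part_reflect:
  assumes "\<And>x. g (- x) = s * g x"
  shows "parity_part r g b x (- z) = s * (-1) ^ card {l. l < r \<and> b l} * parity_part r g b x z"
proof (induction r arbitrary: z)
  case (Suc r)
  have c: "{l. l < Suc r \<and> b l} = (if b r then insert r {l. l < r \<and> b l} else {l. l < r \<and> b l})"
    by (auto simp: less_Suc_eq)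
  have e: "parity_part r g b x (- z + y) = s * (-1) ^ card {l. l < r \<and> b l} * parity_part r g b x (z - y)"
    "parity_part r g b x (- z - y) = s * (-1) ^ card {l. l < r \<and> b l} * parity_part r g b x (z + y)" for y
    using Suc[of "z - y"] Suc[of "z + y"] by simp_all
  show ?case unfolding parity_part.simps shift_part_def c e by (simp add: field_simps)
qed (use assms in simp)

text \<open>Reflecting the base point multiplies by the parity of \<open>g\<close> and by a sign for
  each odd variable, and the base point 0 is fixed. For a power of the odd function \<open>f\<close>
  this makes an edge enter oddly as often, modulo two, as the walk uses it.\<close>

lemma parity_part_zero:
  assumes "\<And>x. g (- x) = (-1) ^ d * g x" "odd (card {l. l < r \<and> b l}) \<noteq> odd d"
  shows "parity_part r g b x 0 = 0"
proof -
  have "parity_part r g b x 0 = (-1) ^ (d + card {l. l < r \<and> b l}) * parity_part r g b x 0"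
    using parity_part_reflect[of g "(-1) ^ d" r b x 0] assms(1) by (simp add: power_add)
  moreover have "odd (d + card {l. l < r \<and> b l})" using assms(2) by auto
  ultimately show ?thesis by simp
qed

lemma parity_part_has_deriv:
  assumes "smooth_bounded g"
  shows "(parity_part r g b x has_field_derivative parity_part r (deriv g) b x z) (at z)"
proof (induction r arbitrary: z)
  case 0
  then show ?case using smooth_bounded_has_deriv[OF assms, of 0] by simp
next
  case (Suc r)
  have 1: "((\<lambda>z. parity_part r g b x (z + y)) has_field_derivative parity_part r (deriv g) b x (z + y)) (at z)"
    for y z using Suc[of "z + y"] by (simp add: DERIV_shift)
  have 2: "((\<lambda>z. parity_part r g b x (z - y)) has_field_derivative parity_part r (deriv g) b x (z - y)) (at z)"
    for y z using 1[of "-y" z] by simp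
  show ?case
    unfolding parity_part.simps shift_part_def
    by (auto intro!: derivative_eq_intros 1 2 simp: if_distrib)
qed

text \<open>In an odd variable the part is half a difference, which the mean value theorem turns
  into one derivative of \<open>g\<close> and a factor \<open>\<bar>x l\<bar>\<close>; even
  variables only average.\<close>

lemma parity_part_bound:
  assumes "smooth_bounded g" "\<And>x. \<bar>(deriv ^^ card {l. l < r \<and> b l}) g x\<bar> \<le> B"
  shows "\<bar>parity_part r g b x z\<bar> \<le> B * (\<Prod>l | l < r \<and> b l. \<bar>x l\<bar>)"
  using assms
proof (induction r arbitrary: g z)
  case (Suc r)
  have c: "{l. l < Suc r \<and> b l} = (if b r then insert r {l. l < r \<and> b l} else {l. l < r \<and> b l})"
    by (auto simp: less_Suc_eq)
  show ?case
  proof (cases "b r")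
    case True
    let ?M = "B * (\<Prod>l | l < r \<and> b l. \<bar>x l\<bar>)"
    have "\<bar>(deriv ^^ card {l. l < r \<and> b l}) (deriv g) y\<bar> \<le> B" for y
      using Suc.prems(2)[of y] True by (simp add: c funpow_swap1)
    then have d: "\<bar>parity_part r (deriv g) b x y\<bar> \<le> ?M" for y
      using Suc.IH[OF smooth_bounded_deriv[OF Suc.prems(1)]] by blast
    have "\<bar>parity_part r g b x (z + x r) - parity_part r g b x (z - x r)\<bar> \<le> ?M * \<bar>(z + x r) - (z - x r)\<bar>"
      using field_differentiable_bound[of UNIV "parity_part r g b x" "parity_part r (deriv g) b x" ?M
          "z - x r" "z + x r"] parity_part_has_deriv[OF Suc.prems(1)] d
      by (auto simp: has_field_derivative_at_within)
    then have "\<bar>parity_part (Suc r) g b x z\<bar> \<le> ?M * \<bar>x r\<bar>"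
      using True by (simp add: shift_part_def)
    then show ?thesis using True by (simp add: c mult_ac)
  next
    case False
    have "\<bar>parity_part r g b x y\<bar> \<le> B * (\<Prod>l | l < r \<and> b l. \<bar>x l\<bar>)" for y
      by (rule Suc.IH[OF Suc.prems(1)]) (use Suc.prems(2) False in \<open>simp add: c\<close>)
    from this[of "z + x r"] this[of "z - x r"] show ?thesis
      using False by (simp add: c shift_part_def)
  qed
qed simp

text \<open>The derivatives are given as a sequence \<open>D\<close>, so that the estimate also
  applies to parity parts, whose derivatives are the parity parts of the derivatives of
  \<open>g\<close>.\<close>

lemma taylor_bound:
  assumes D: "\<And>m z. (D m has_real_derivative D (Suc m) z) (at z)"
    and B: "\<And>z. \<bar>D n z\<bar> \<le> B"
  shows "\<bar>D 0 (z + h) - (\<Sum>m<n. D m z / fact m * h ^ m)\<bar> \<le> B / fact n * \<bar>h\<bar> ^ n"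
proof -
  have "\<forall>m x. ((\<lambda>t. D m (z + t)) has_real_derivative D (Suc m) (z + x)) (at x)"
    using DERIV_shift[THEN iffD1, OF D] by (simp add: add.commute[of z])
  from Maclaurin_all_le[of "\<lambda>m t. D m (z + t)", OF refl this, of h n]
  obtain t where t: "D 0 (z + h) = (\<Sum>m<n. D m z / fact m * h ^ m) + D n (z + t) / fact n * h ^ n"
    by auto
  have "\<bar>D n (z + t) / fact n * h ^ n\<bar> \<le> B / fact n * \<bar>h\<bar> ^ n"
    unfolding abs_mult power_abs by (intro mult_right_mono) (auto simp: divide_right_mono B)
  then show ?thesis using t by simp
qed

lemma shift_part_even_approx:
  assumes D: "\<And>m z. (D m has_real_derivative D (Suc m) z) (at z)"
    and B: "\<And>z. \<bar>D 4 z\<bar> \<le> B"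
  shows "\<bar>shift_part False x (D 0) z - (D 0 z + x\<^sup>2 / 2 * D 2 z)\<bar> \<le> B / 24 * x ^ 4"
proof -
  have 1: "\<bar>D 0 (z + x) - (D 0 z + D 1 z * x + D 2 z / 2 * x\<^sup>2 + D 3 z / 6 * x ^ 3)\<bar> \<le> B / 24 * x ^ 4"
    using taylor_bound[of D 4 B z x, OF D B] by (simp add: eval_nat_numeral)
  have 2: "\<bar>D 0 (z - x) - (D 0 z - D 1 z * x + D 2 z / 2 * x\<^sup>2 - D 3 z / 6 * x ^ 3)\<bar> \<le> B / 24 * x ^ 4"
    using taylor_bound[of D 4 B z "-x", OF D B] by (simp add: eval_nat_numeral)
  have "D 2 z / 2 * x\<^sup>2 = x\<^sup>2 / 2 * D 2 z" by simp
  then show ?thesis using 1 2 unfolding shift_part_def abs_le_iff by (simp add: field_simps)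
qed

text \<open>The comparison is with the even part of the derivative rather than with the derivative
  itself: afterwards \<open>x\<close> enters like every other variable, and the Gaussian replacement
  can treat all summands alike. The cubic error is small relative to the factor
  \<open>x\<close>.\<close>

lemma shift_part_odd_approx:
  assumes D: "\<And>m z. (D m has_real_derivative D (Suc m) z) (at z)"
    and B: "\<And>z. \<bar>D 3 z\<bar> \<le> B"
  shows "\<bar>shift_part True x (D 0) z - x * shift_part False x (D 1) z\<bar> \<le> B * \<bar>x\<bar> ^ 3"
proof -
  have B0: "0 \<le> B" using B[of 0] by linarith
  have 1: "\<bar>D 0 (z + x) - (D 0 z + D 1 z * x + D 2 z / 2 * x\<^sup>2)\<bar> \<le> B / 6 * \<bar>x\<bar> ^ 3"
    using taylor_bound[of D 3 B z x, OF D B] by (simp add: eval_nat_numeral)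
  have 2: "\<bar>D 0 (z - x) - (D 0 z - D 1 z * x + D 2 z / 2 * x\<^sup>2)\<bar> \<le> B / 6 * \<bar>x\<bar> ^ 3"
    using taylor_bound[of D 3 B z "-x", OF D B] by (simp add: eval_nat_numeral)
  have 3: "\<bar>D 1 (z + x) - (D 1 z + D 2 z * x)\<bar> \<le> B / 2 * \<bar>x\<bar>\<^sup>2"
    using taylor_bound[of "\<lambda>m. D (Suc m)" 2 B z x] D B by (simp add: eval_nat_numeral)
  have 4: "\<bar>D 1 (z - x) - (D 1 z - D 2 z * x)\<bar> \<le> B / 2 * \<bar>x\<bar>\<^sup>2"
    using taylor_bound[of "\<lambda>m. D (Suc m)" 2 B z "-x"] D B by (simp add: eval_nat_numeral)
  have "\<bar>shift_part False x (D 1) z - D 1 z\<bar> \<le> B / 2 * \<bar>x\<bar>\<^sup>2"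
    using 3 4 unfolding shift_part_def abs_le_iff by (auto simp: field_simps)
  then have "\<bar>x\<bar> * \<bar>shift_part False x (D 1) z - D 1 z\<bar> \<le> \<bar>x\<bar> * (B / 2 * \<bar>x\<bar>\<^sup>2)"
    by (rule mult_left_mono) simp
  then have 5: "\<bar>x * shift_part False x (D 1) z - x * D 1 z\<bar> \<le> B / 2 * \<bar>x\<bar> ^ 3"
    unfolding abs_mult[symmetric] right_diff_distrib by (simp add: power2_eq_square power3_eq_cube mult_ac)
  have 6: "\<bar>shift_part True x (D 0) z - x * D 1 z\<bar> \<le> B / 6 * \<bar>x\<bar> ^ 3"
    using 1 2 unfolding shift_part_def abs_le_iff by (simp add: field_simps)
  have "0 \<le> B * \<bar>x\<bar> ^ 3" using B0 by simp
  then show ?thesis using 5 6 unfolding abs_le_iff by linarith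
qed

lemma parity_part_even_bound:
  assumes "smooth_bounded g" "\<And>x. \<bar>g x\<bar> \<le> B"
  shows "\<bar>parity_part r g (\<lambda>_. False) x z\<bar> \<le> B"
  using parity_part_bound[OF assms(1), of r "\<lambda>_. False" B x z] assms(2) by simp

lemma smooth_bounded_funpow: "smooth_bounded g \<Longrightarrow> smooth_bounded ((deriv ^^ m) g)"
  by (induction m) (auto intro: smooth_bounded_deriv)

text \<open>The estimate arises at the step \<open>l\<close> and survives the later steps, which
  only average it.\<close>

lemma parity_part_single:
  assumes g: "smooth_bounded g" and B: "\<And>x. \<bar>(deriv ^^ 3) g x\<bar> \<le> B" and l: "l < r"
  shows "\<bar>parity_part r g (\<lambda>j. j = l) x z - x l * parity_part r (deriv g) (\<lambda>_. False) x z\<bar> \<le> B * \<bar>x l\<bar> ^ 3"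
  using l
proof (induction r arbitrary: z)
  case (Suc r)
  show ?case
  proof (cases "l = r")
    case True
    have eq: "parity_part r g (\<lambda>j. j = l) x = parity_part r g (\<lambda>_. False) x"
      using True by (intro parity_part_cong) auto
    define D where "D m = parity_part r ((deriv ^^ m) g) (\<lambda>_. False) x" for m
    have "(D m has_real_derivative D (Suc m) z) (at z)" for m z
      unfolding D_def using parity_part_has_deriv[OF smooth_bounded_funpow[OF g, of m]] by simp
    moreover have "\<bar>D 3 z\<bar> \<le> B" for z
      unfolding D_def by (rule parity_part_even_bound[OF smooth_bounded_funpow[OF g] B])
    ultimately have "\<bar>shift_part True (x r) (D 0) z - x r * shift_part False (x r) (D 1) z\<bar> \<le> B * \<bar>x r\<bar> ^ 3"
      by (rule shift_part_odd_approx)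
    then show ?thesis using True eq by (simp add: D_def)
  next
    case False
    then have IH: "\<bar>parity_part r g (\<lambda>j. j = l) x y - x l * parity_part r (deriv g) (\<lambda>_. False) x y\<bar>
        \<le> B * \<bar>x l\<bar> ^ 3" for y
      using Suc by simp
    show ?thesis using IH[of "z + x r"] IH[of "z - x r"] False
      unfolding parity_part.simps shift_part_def abs_le_iff by (simp add: field_simps)
  qed
qed simp

section \<open>Gaussian averages\<close>

definition gauss :: "real \<Rightarrow> (real \<Rightarrow> real) \<Rightarrow> real \<Rightarrow> real"
  where "gauss s g z = (LINT y|std_normal_distribution. g (z + sqrt s * y))"

interpretation std_normal: real_distribution std_normal_distribution
  by (rule real_dist_normal_dist)

lemma prob_UNIV_std_normal: "std_normal.prob UNIV = 1"
  using std_normal.prob_space by simp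

lemma integrable_bounded_std_normal:
  assumes "g \<in> borel_measurable borel" "\<And>x. \<bar>g x\<bar> \<le> (B :: real)"
  shows "integrable std_normal_distribution (\<lambda>y. g (z + c * y))"
  using assms by (intro std_normal.integrable_const_bound[of _ B]) auto

text \<open>Both sides have the same characteristic function; image measures are used so that zero
  variances are included.\<close>

lemma distr_add_std_normal:
  assumes "0 \<le> s" "0 \<le> t"
  shows "distr (std_normal_distribution \<Otimes>\<^sub>M std_normal_distribution) borel
      (\<lambda>(a, b). sqrt s * a + sqrt t * b) = distr std_normal_distribution borel (\<lambda>y. sqrt (s + t) * y)"
    (is "?L = ?R")
proof (rule Levy_uniqueness)
  interpret P: pair_prob_space std_normal_distribution std_normal_distribution ..
  show L: "real_distribution ?L" by (rule P.real_distribution_distr) measurable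
  show R: "real_distribution ?R" by (rule std_normal.real_distribution_distr) measurable
  show "char ?L = char ?R"
  proof
    fix u :: real
    have c: "(CLINT y|std_normal_distribution. iexp (v * y)) = complex_of_real (exp (- (v\<^sup>2) / 2))" for v
      using char_std_normal_distribution unfolding char_def by metis
    have int: "integrable (std_normal_distribution \<Otimes>\<^sub>M std_normal_distribution)
        (\<lambda>(a, b). iexp (u * sqrt s * a) * iexp (u * sqrt t * b))"
      by (rule P.integrable_const_bound[of _ 1]) (auto simp: norm_mult)
    have "char ?L u = (CLINT p|(std_normal_distribution \<Otimes>\<^sub>M std_normal_distribution).
        (case p of (a, b) \<Rightarrow> iexp (u * sqrt s * a) * iexp (u * sqrt t * b)))"
      unfolding char_def
      by (subst integral_distr) (auto simp: case_prod_beta' exp_add[symmetric] algebra_simps)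
    also have "\<dots> = (CLINT a|std_normal_distribution. CLINT b|std_normal_distribution.
        iexp (u * sqrt s * a) * iexp (u * sqrt t * b))"
      using P.integral_fst'[OF int] by simp
    also have "\<dots> = (CLINT a|std_normal_distribution. iexp (u * sqrt s * a)) *
        (CLINT b|std_normal_distribution. iexp (u * sqrt t * b))"
      by (simp only: integral_mult_right_zero integral_mult_left_zero)
    also have "\<dots> = complex_of_real (exp (- ((u * sqrt s)\<^sup>2) / 2)) * complex_of_real (exp (- ((u * sqrt t)\<^sup>2) / 2))"
      by (simp only: c)
    also have "\<dots> = complex_of_real (exp (- ((u * sqrt (s + t))\<^sup>2) / 2))"
      using assms by (simp add: power_mult_distrib exp_add[symmetric] flip: of_real_mult) (simp add: field_simps)
    also have "\<dots> = (CLINT y|std_normal_distribution. iexp (u * sqrt (s + t) * y))"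
      by (simp only: c)
    also have "\<dots> = char ?R u"
      unfolding char_def by (subst integral_distr) (auto simp: mult.assoc)
    finally show "char ?L u = char ?R u" .
  qed
qed

text \<open>The semigroup law of Gaussian averages, which lets the replacement argument exchange one
  summand at a time.\<close>

lemma gauss_add:
  assumes "0 \<le> s" "0 \<le> t" and g: "g \<in> borel_measurable borel" "\<And>x. \<bar>g x\<bar> \<le> B"
  shows "gauss (s + t) g z = gauss s (gauss t g) z"
proof -
  interpret P: pair_prob_space std_normal_distribution std_normal_distribution ..
  note [measurable] = g(1)
  have int: "integrable (std_normal_distribution \<Otimes>\<^sub>M std_normal_distribution)
      (\<lambda>(a, b). g (z + (sqrt s * a + sqrt t * b)))"
    by (rule P.integrable_const_bound[of _ B]) (auto simp: g)
  have "gauss (s + t) g z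
      = (LINT w|(distr std_normal_distribution borel (\<lambda>y. sqrt (s + t) * y)). g (z + w))"
    unfolding gauss_def by (subst integral_distr) auto
  also have "\<dots> = (LINT p|(std_normal_distribution \<Otimes>\<^sub>M std_normal_distribution).
      (case p of (a, b) \<Rightarrow> g (z + (sqrt s * a + sqrt t * b))))"
    unfolding distr_add_std_normal[OF assms(1,2), symmetric]
    by (subst integral_distr) (auto simp: case_prod_beta')
  also have "\<dots> = gauss s (gauss t g) z"
    unfolding gauss_def using P.integral_fst'[OF int] by (simp add: add.assoc)
  finally show ?thesis .
qed

lemma gauss_measurable:
  assumes [measurable]: "g \<in> borel_measurable borel"
  shows "gauss t g \<in> borel_measurable borel"
  unfolding gauss_def by measurable

lemma abs_integral_std_normal_le:
  assumes "\<And>y. \<bar>g y\<bar> \<le> (B :: real)" "g \<in> borel_measurable borel"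
  shows "\<bar>LINT y|std_normal_distribution. g y\<bar> \<le> B"
proof -
  have "\<bar>LINT y|std_normal_distribution. g y\<bar> \<le> (LINT y|std_normal_distribution. \<bar>g y\<bar>)"
    by (rule integral_abs_bound)
  also have "\<dots> \<le> (LINT y|std_normal_distribution. B)"
    using assms order_trans[OF abs_ge_zero assms(1)]
    by (intro integral_mono std_normal.integrable_const_bound[of _ B]) auto
  finally show ?thesis using prob_UNIV_std_normal by simp
qed

lemma gauss_bound:
  "\<lbrakk>\<And>y. \<bar>g y\<bar> \<le> B; g \<in> borel_measurable borel\<rbrakk> \<Longrightarrow> \<bar>gauss t g z\<bar> \<le> B"
  unfolding gauss_def by (rule abs_integral_std_normal_le) auto

lemma gauss_diff:
  assumes "g \<in> borel_measurable borel" "\<And>x. \<bar>g x\<bar> \<le> B" "h \<in> borel_measurable borel" "\<And>x. \<bar>h x\<bar> \<le> C"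
  shows "gauss t g z - gauss t h z = gauss t (\<lambda>w. g w - h w) z"
  unfolding gauss_def using integrable_bounded_std_normal[OF assms(1,2)] integrable_bounded_std_normal[OF assms(3,4)]
  by simp

lemma std_normal_moments:
  "(LINT y|std_normal_distribution. y) = 0" "(LINT y|std_normal_distribution. y\<^sup>2) = 1"
  "(LINT y|std_normal_distribution. y ^ 3) = 0" "(LINT y|std_normal_distribution. y ^ 4) = 3"
  using integral_std_normal_distribution_moment_odd[of 1] integral_std_normal_distribution_moment_odd[of 3]
    std_normal_distribution_even_moments(1)[of 1] std_normal_distribution_even_moments(1)[of 2]
  by (simp_all add: fact_numeral)

lemma gauss_near_0:
  assumes g: "smooth_bounded g" and B: "\<And>z. \<bar>(deriv ^^ 2) g z\<bar> \<le> B" and t: "0 \<le> t"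
  shows "\<bar>gauss t g z - g z\<bar> \<le> B * t"
proof -
  have B0: "0 \<le> B" using B[of 0] by linarith
  obtain C where C: "\<And>x. \<bar>g x\<bar> \<le> C" using smooth_bounded_bound[OF g, of 0] by auto
  have i1: "integrable std_normal_distribution (\<lambda>y. y)" and i2: "integrable std_normal_distribution (\<lambda>y. y\<^sup>2)"
    using integrable_std_normal_distribution_moment[of 1] integrable_std_normal_distribution_moment[of 2] by simp_all
  have ig: "integrable std_normal_distribution (\<lambda>y. g (z + sqrt t * y))"
    by (rule integrable_bounded_std_normal[OF smooth_bounded_measurable[OF g] C])
  have eq: "gauss t g z - g z = (LINT y|std_normal_distribution. g (z + sqrt t * y) - (g z + deriv g z * (sqrt t * y)))"
    unfolding gauss_def using i1 ig
    by (simp add: std_normal_moments prob_UNIV_std_normal)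
  have "\<bar>gauss t g z - g z\<bar> \<le> (LINT y|std_normal_distribution. B / 2 * t * y\<^sup>2)"
    unfolding eq
  proof (rule order_trans[OF integral_abs_bound], rule integral_mono)
    show "integrable std_normal_distribution (\<lambda>y. \<bar>g (z + sqrt t * y) - (g z + deriv g z * (sqrt t * y))\<bar>)"
      using i1 ig by (intro integrable_abs Bochner_Integration.integrable_diff Bochner_Integration.integrable_add
        integrable_mult_right) auto
    show "integrable std_normal_distribution (\<lambda>y. B / 2 * t * y\<^sup>2)" using i2 by (intro integrable_mult_right) auto
    show "\<bar>g (z + sqrt t * y) - (g z + deriv g z * (sqrt t * y))\<bar> \<le> B / 2 * t * y\<^sup>2" for y
      using taylor_bound[of "\<lambda>m. (deriv ^^ m) g" 2 B z "sqrt t * y"] smooth_bounded_has_deriv[OF g] B t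
      by (simp add: eval_nat_numeral power_mult_distrib real_sqrt_mult_self mult.assoc)
        (simp add: power2_eq_square[symmetric] abs_mult_self_eq power_mult_distrib mult_ac)
  qed
  also have "\<dots> = B / 2 * t" by (simp add: std_normal_moments)
  also have "\<dots> \<le> B * t" using B0 t by (simp add: mult_right_mono)
  finally show ?thesis .
qed

text \<open>The symmetric two-point step of size \<open>x\<close> and the normal step of variance
  \<open>x\<^sup>2\<close> have the same first three moments. The remainders of order
  \<open>x ^ 4\<close> have the coefficient \<open>B / 24\<close> for the former and, the fourth
  normal moment being 3, \<open>B / 8\<close> for the latter.\<close>

lemma gauss_shift_part:
  assumes g: "smooth_bounded g" and B: "\<And>z. \<bar>(deriv ^^ 4) g z\<bar> \<le> B"
  shows "\<bar>shift_part False x g z - gauss (x\<^sup>2) g z\<bar> \<le> B * x ^ 4"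
proof -
  have B0: "0 \<le> B" using B[of 0] by linarith
  obtain C where C: "\<And>x. \<bar>g x\<bar> \<le> C" using smooth_bounded_bound[OF g, of 0] by auto
  have i: "integrable std_normal_distribution (\<lambda>y. c * y ^ m)" for m and c :: real
    using integrable_std_normal_distribution_moment[of m] by simp
  have ig: "integrable std_normal_distribution (\<lambda>y. g (z + \<bar>x\<bar> * y))"
    by (rule integrable_bounded_std_normal[OF smooth_bounded_measurable[OF g] C])
  let ?D = "\<lambda>m. (deriv ^^ m) g"
  let ?T = "\<lambda>y. ((g z + (?D 1 z * \<bar>x\<bar>) * y ^ 1) + (?D 2 z / 2 * x\<^sup>2) * y ^ 2) + (?D 3 z / 6 * \<bar>x\<bar> ^ 3) * y ^ 3"
  have iT: "integrable std_normal_distribution ?T"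
    by (intro Bochner_Integration.integrable_add i std_normal.integrable_const)
  have IT: "(LINT y|std_normal_distribution. ?T y) = g z + x\<^sup>2 / 2 * ?D 2 z"
    by (subst Bochner_Integration.integral_add[OF _ i]
          | intro Bochner_Integration.integrable_add i std_normal.integrable_const)+
      (simp add: std_normal_moments prob_UNIV_std_normal)
  have eq: "gauss (x\<^sup>2) g z - (g z + x\<^sup>2 / 2 * ?D 2 z) = (LINT y|std_normal_distribution. g (z + \<bar>x\<bar> * y) - ?T y)"
    unfolding gauss_def using IT Bochner_Integration.integral_diff[OF ig iT] by simp
  have "\<bar>gauss (x\<^sup>2) g z - (g z + x\<^sup>2 / 2 * ?D 2 z)\<bar>
      \<le> (LINT y|std_normal_distribution. (B / 24 * x ^ 4) * y ^ 4)"
    unfolding eq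
  proof (rule order_trans[OF integral_abs_bound], rule integral_mono)
    show "integrable std_normal_distribution (\<lambda>y. \<bar>g (z + \<bar>x\<bar> * y) - ?T y\<bar>)"
      by (intro integrable_abs Bochner_Integration.integrable_diff ig iT)
    show "integrable std_normal_distribution (\<lambda>y. (B / 24 * x ^ 4) * y ^ 4)" by (rule i)
    fix y
    have 1: "\<bar>g (z + \<bar>x\<bar> * y) - (\<Sum>m<4. ?D m z / fact m * (\<bar>x\<bar> * y) ^ m)\<bar> \<le> B / fact 4 * \<bar>\<bar>x\<bar> * y\<bar> ^ 4"
      using taylor_bound[of ?D 4 B z "\<bar>x\<bar> * y"] smooth_bounded_has_deriv[OF g] B by simp
    have 2: "(\<Sum>m<4. ?D m z / fact m * (\<bar>x\<bar> * y) ^ m) = ?T y"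
      by (simp add: eval_nat_numeral field_simps)
    have 3: "B / fact 4 * \<bar>\<bar>x\<bar> * y\<bar> ^ 4 = (B / 24 * x ^ 4) * y ^ 4"
      by (simp add: abs_mult power_mult_distrib fact_numeral)
    show "\<bar>g (z + \<bar>x\<bar> * y) - ?T y\<bar> \<le> (B / 24 * x ^ 4) * y ^ 4" using 1 unfolding 2 3 .
  qed
  also have "\<dots> = B / 8 * x ^ 4" by (simp add: std_normal_moments)
  finally have 1: "\<bar>gauss (x\<^sup>2) g z - (g z + x\<^sup>2 / 2 * ?D 2 z)\<bar> \<le> B / 8 * x ^ 4" .
  have 2: "\<bar>shift_part False x g z - (g z + x\<^sup>2 / 2 * ?D 2 z)\<bar> \<le> B / 24 * x ^ 4"
    using shift_part_even_approx[of ?D B x z] smooth_bounded_has_deriv[OF g] B by simp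
  have "0 \<le> B * x ^ 4" using B0 by simp
  then show ?thesis using 1 2 unfolding abs_le_iff by linarith
qed

text \<open>Lindeberg replacement of the symmetrised steps \<open>x l\<close> by Gaussian steps of the same variance.\<close>

lemma parity_part_even_gauss:
  assumes g: "smooth_bounded g" and B: "\<And>z. \<bar>(deriv ^^ 4) g z\<bar> \<le> B"
  shows "\<bar>parity_part r g (\<lambda>_. False) x z - gauss (\<Sum>l<r. (x l)\<^sup>2) g z\<bar> \<le> B * (\<Sum>l<r. x l ^ 4)"
proof (induction r arbitrary: z)
  case 0
  then show ?case by (simp add: gauss_def prob_UNIV_std_normal)
next
  case (Suc r)
  obtain C where C: "\<And>x. \<bar>g x\<bar> \<le> C" using smooth_bounded_bound[OF g, of 0] by auto
  have m[measurable]: "g \<in> borel_measurable borel" using smooth_bounded_measurable[OF g] .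
  define s where "s = (\<Sum>l<r. (x l)\<^sup>2)"
  have s0: "0 \<le> s" by (simp add: s_def sum_nonneg)
  have 1: "\<bar>parity_part (Suc r) g (\<lambda>_. False) x z - shift_part False (x r) (gauss s g) z\<bar>
      \<le> B * (\<Sum>l<r. x l ^ 4)"
    using Suc[of "z + x r"] Suc[of "z - x r"]
    unfolding parity_part.simps shift_part_def s_def[symmetric] abs_le_iff by (auto simp: field_simps)
  have bs: "\<bar>shift_part False (x r) g w\<bar> \<le> C" for w
    using C[of "w + x r"] C[of "w - x r"] unfolding shift_part_def by simp
  have ms: "shift_part False (x r) g \<in> borel_measurable borel"
    unfolding shift_part_def by measurable
  \<comment> \<open>Averaging over the last step commutes with the Gaussian average over the earlier
    ones, so the exchange can be made inside that average.\<close>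
  have 2: "shift_part False (x r) (gauss s g) z = gauss s (shift_part False (x r) g) z"
  proof -
    have i: "integrable std_normal_distribution (\<lambda>y. g (w + sqrt s * y))" for w
      by (rule integrable_bounded_std_normal[OF m C])
    show ?thesis
      unfolding shift_part_def gauss_def using i[of "z + x r"] i[of "z - x r"]
      by (simp add: add_ac diff_add_eq)
  qed
  have 3: "gauss (s + (x r)\<^sup>2) g z = gauss s (gauss ((x r)\<^sup>2) g) z"
    using s0 by (intro gauss_add[OF _ _ m C]) auto
  have "gauss s (shift_part False (x r) g) z - gauss s (gauss ((x r)\<^sup>2) g) z
      = gauss s (\<lambda>w. shift_part False (x r) g w - gauss ((x r)\<^sup>2) g w) z"
    by (rule gauss_diff[OF ms bs gauss_measurable[OF m] gauss_bound[OF C m]])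
  moreover have "\<bar>gauss s (\<lambda>w. shift_part False (x r) g w - gauss ((x r)\<^sup>2) g w) z\<bar> \<le> B * x r ^ 4"
    using gauss_measurable[OF m] ms by (intro gauss_bound gauss_shift_part[OF g B]) measurable
  ultimately have "\<bar>shift_part False (x r) (gauss s g) z - gauss (s + (x r)\<^sup>2) g z\<bar> \<le> B * x r ^ 4"
    using 2 3 by simp
  with 1 have "\<bar>parity_part (Suc r) g (\<lambda>_. False) x z - gauss (s + (x r)\<^sup>2) g z\<bar>
      \<le> B * (\<Sum>l<r. x l ^ 4) + B * x r ^ 4" by linarith
  then show ?case by (simp add: s_def algebra_simps)
qed

text \<open>By the semigroup law the difference is a Gaussian average of
  \<open>gauss (s - t) g - g\<close> for \<open>t \<le> s\<close>, which is of order
  \<open>s - t\<close> because the normal law is centred.\<close>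

lemma gauss_lipschitz:
  assumes g: "smooth_bounded g" and B: "\<And>z. \<bar>(deriv ^^ 2) g z\<bar> \<le> B" and st: "0 \<le> s" "0 \<le> t"
  shows "\<bar>gauss s g z - gauss t g z\<bar> \<le> B * \<bar>s - t\<bar>"
proof -
  obtain C where C: "\<And>x. \<bar>g x\<bar> \<le> C" using smooth_bounded_bound[OF g, of 0] by auto
  have m[measurable]: "g \<in> borel_measurable borel" using smooth_bounded_measurable[OF g] .
  have *: "\<bar>gauss s g z - gauss t g z\<bar> \<le> B * \<bar>s - t\<bar>" if "0 \<le> t" "t \<le> s" for s t
  proof -
    have "gauss s g z = gauss t (gauss (s - t) g) z"
      using gauss_add[of t "s - t" g C z] that m C by simp
    then have eq: "gauss s g z - gauss t g z = gauss t (\<lambda>w. gauss (s - t) g w - g w) z"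
      using gauss_diff[OF gauss_measurable[OF m] gauss_bound[OF C m] m C] by simp
    have "\<bar>gauss s g z - gauss t g z\<bar> \<le> B * (s - t)"
      unfolding eq using m gauss_measurable[OF m] that by (intro gauss_bound gauss_near_0[OF g B]) measurable
    then show ?thesis using that by simp
  qed
  show ?thesis using *[of t s] *[of s t] st by (cases "t \<le> s") (auto simp: abs_minus_commute)
qed

text \<open>In the application the variance \<open>\<Sum>l<r. (x l)\<^sup>2\<close> is random; its
  deviation from the limit \<open>s\<close> enters through the Lipschitz bound.\<close>

lemma parity_part_even_limit:
  assumes g: "smooth_bounded g" and B: "\<And>r z. r \<le> 4 \<Longrightarrow> \<bar>(deriv ^^ r) g z\<bar> \<le> B" and s: "0 \<le> s"
  shows "\<bar>parity_part r g (\<lambda>_. False) x 0 - gauss s g 0\<bar>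
    \<le> B * ((\<Sum>l<r. x l ^ 4) + \<bar>(\<Sum>l<r. (x l)\<^sup>2) - s\<bar>)"
proof -
  have "\<bar>parity_part r g (\<lambda>_. False) x 0 - gauss (\<Sum>l<r. (x l)\<^sup>2) g 0\<bar> \<le> B * (\<Sum>l<r. x l ^ 4)"
    by (rule parity_part_even_gauss[OF g]) (simp add: B)
  moreover have "\<bar>gauss (\<Sum>l<r. (x l)\<^sup>2) g 0 - gauss s g 0\<bar> \<le> B * \<bar>(\<Sum>l<r. (x l)\<^sup>2) - s\<bar>"
    by (rule gauss_lipschitz[OF g]) (auto simp: B s sum_nonneg)
  ultimately show ?thesis unfolding distrib_left by linarith
qed

section \<open>Expectations over independent symmetric entries\<close>

text \<open>The product is at most a power of its largest factor. This crude substitute for the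
  Hoelder inequality reduces mixed moments to moments of a single product of two entries.\<close>

lemma prod_abs_le_sum_power:
  fixes y :: "'a \<Rightarrow> real"
  assumes "finite T" "T \<noteq> {}" "\<And>a. a \<in> T \<Longrightarrow> 0 \<le> y a"
  shows "(\<Prod>a\<in>T. y a) \<le> (\<Sum>a\<in>T. y a ^ card T)"
proof -
  define M where "M = Max (y ` T)"
  have "M \<in> y ` T" unfolding M_def using assms by (intro Max_in) auto
  then obtain b where b: "b \<in> T" "y b = M" by auto
  have "y a \<le> M" if "a \<in> T" for a unfolding M_def using assms that by (intro Max_ge) auto
  then have "(\<Prod>a\<in>T. y a) \<le> (\<Prod>a\<in>T. M)" using assms by (intro prod_mono) auto
  also have "\<dots> = y b ^ card T" using b by simp
  also have "\<dots> \<le> (\<Sum>a\<in>T. y a ^ card T)"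
    using assms b by (intro member_le_sum) auto
  finally show ?thesis .
qed

text \<open>Telescoping with relative errors \<open>d\<close>: the common weights \<open>y\<close>
  are kept as a full product, since they carry the small factors of the cycle edges.\<close>

lemma abs_prod_diff_le:
  fixes a b y d :: "'a \<Rightarrow> real"
  assumes "finite E" "0 \<le> B" and y: "\<And>e. e \<in> E \<Longrightarrow> 0 \<le> y e" and d: "\<And>e. e \<in> E \<Longrightarrow> 0 \<le> d e"
    and a: "\<And>e. e \<in> E \<Longrightarrow> \<bar>a e\<bar> \<le> B * y e" and b: "\<And>e. e \<in> E \<Longrightarrow> \<bar>b e\<bar> \<le> B * y e"
    and ab: "\<And>e. e \<in> E \<Longrightarrow> \<bar>a e - b e\<bar> \<le> B * y e * d e"
  shows "\<bar>(\<Prod>e\<in>E. a e) - (\<Prod>e\<in>E. b e)\<bar> \<le> B ^ card E * (\<Prod>e\<in>E. y e) * (\<Sum>e\<in>E. d e)"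
  using assms(1) y d a b ab
proof (induction E rule: finite_induct)
  case (insert e E)
  let ?A = "\<Prod>e\<in>E. a e" and ?B = "\<Prod>e\<in>E. b e" and ?Y = "\<Prod>e\<in>E. y e"
  have A: "\<bar>?A\<bar> \<le> B ^ card E * ?Y"
    unfolding abs_prod using insert.prems(3) prod_mono[of E "\<lambda>e. \<bar>a e\<bar>" "\<lambda>e. B * y e"]
    by (simp add: prod.distrib)
  have IH: "\<bar>?A - ?B\<bar> \<le> B ^ card E * ?Y * (\<Sum>e\<in>E. d e)"
    using insert by blast
  have "a e * ?A - b e * ?B = (a e - b e) * ?A + b e * (?A - ?B)" by (simp add: algebra_simps)
  then have "\<bar>a e * ?A - b e * ?B\<bar> \<le> \<bar>a e - b e\<bar> * \<bar>?A\<bar> + \<bar>b e\<bar> * \<bar>?A - ?B\<bar>"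
    by (metis abs_mult abs_triangle_ineq)
  also have "\<dots> \<le> (B * y e * d e) * (B ^ card E * ?Y) + (B * y e) * (B ^ card E * ?Y * (\<Sum>e\<in>E. d e))"
    using insert.prems assms(2) A IH by (intro add_mono mult_mono) auto
  also have "\<dots> = B ^ card (insert e E) * (\<Prod>e\<in>insert e E. y e) * (\<Sum>e\<in>insert e E. d e)"
    using insert.hyps by (simp add: algebra_simps)
  finally show ?case using insert.hyps by simp
qed simp

lemma parity_part_bound_0:
  assumes "\<And>x. \<bar>g x\<bar> \<le> B"
  shows "\<bar>parity_part r g b x z\<bar> \<le> B"
proof (induction r arbitrary: z)
  case (Suc r)
  show ?case
    using Suc[of "z + x r"] Suc[of "z - x r"] unfolding parity_part.simps shift_part_def abs_le_iff
    by (cases "b r") (auto simp: field_simps)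
qed (use assms in simp)

lemma parity_part_measurable:
  assumes [measurable]: "g \<in> borel_measurable borel"
    and "\<And>l. l < r \<Longrightarrow> (\<lambda>u. x u l) \<in> borel_measurable M" "z \<in> borel_measurable M"
  shows "(\<lambda>u. parity_part r g b (x u) (z u)) \<in> borel_measurable M"
  using assms(2,3)
proof (induction r arbitrary: z)
  case 0
  then show ?case by simp
next
  case (Suc r)
  have [measurable]: "(\<lambda>u. x u r) \<in> borel_measurable M" "z \<in> borel_measurable M" using Suc by auto
  have "(\<lambda>u. parity_part r g b (x u) (z u + x u r)) \<in> borel_measurable M"
    "(\<lambda>u. parity_part r g b (x u) (z u - x u r)) \<in> borel_measurable M"
    using Suc.prems(1) by (auto intro!: Suc.IH)
  then show ?case unfolding parity_part.simps shift_part_def by (cases "b r") simp_all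
qed

section \<open>Independent symmetric entries\<close>

type_synonym entry = "nat \<times> nat + nat \<times> nat"

text \<open>\<open>\<mu>w\<close> is meant as the law of \<open>sqrt n\<close> times a weight entry,
  so that the laws do not depend on \<open>n\<close>. The key \<open>Inl (i, l)\<close> stands for
  \<open>W i l\<close> and \<open>Inr (l, j)\<close> for \<open>X l j\<close>.\<close>

locale entry_laws =
  fixes \<mu>w \<mu>x :: "real measure" and sw sx :: real
  assumes dist_w: "real_distribution \<mu>w" and dist_x: "real_distribution \<mu>x"
    and symm_w: "distr \<mu>w borel uminus = \<mu>w" and symm_x: "distr \<mu>x borel uminus = \<mu>x"
    and moments_w: "\<And>r::nat. integrable \<mu>w (\<lambda>x. x ^ r)"
    and moments_x: "\<And>r::nat. integrable \<mu>x (\<lambda>x. x ^ r)"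
    and var_w: "(LINT x|\<mu>w. x\<^sup>2) = sw\<^sup>2" and var_x: "(LINT x|\<mu>x. x\<^sup>2) = sx\<^sup>2"
begin

definition law :: "entry \<Rightarrow> real measure"
  where "law \<kappa> = (case \<kappa> of Inl _ \<Rightarrow> \<mu>w | Inr _ \<Rightarrow> \<mu>x)"

definition mom :: "nat \<Rightarrow> real"
  where "mom d = (LINT x|\<mu>w. \<bar>x\<bar> ^ d) * (LINT x|\<mu>x. \<bar>x\<bar> ^ d)"

lemma law_simps [simp]: "law (Inl a) = \<mu>w" "law (Inr b) = \<mu>x"
  by (simp_all add: law_def)

lemma law_dist: "real_distribution (law \<kappa>)"
  using dist_w dist_x by (cases \<kappa>) auto

lemma prob_space_law: "prob_space (law \<kappa>)"
  using law_dist real_distribution.axioms(1) by blast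

lemma sets_law [measurable_cong, simp]: "sets (law \<kappa>) = sets borel"
  using real_distribution.events_eq_borel[OF law_dist] .

lemma space_law [simp]: "space (law \<kappa>) = UNIV"
  using real_distribution.space_eq_univ[OF law_dist] .

lemma law_symm: "distr (law \<kappa>) borel uminus = law \<kappa>"
  using symm_w symm_x by (cases \<kappa>) auto

lemma law_moments: "integrable (law \<kappa>) (\<lambda>x. x ^ r)" "integrable (law \<kappa>) (\<lambda>x. \<bar>x\<bar> ^ r)"
proof -
  show 1: "integrable (law \<kappa>) (\<lambda>x. x ^ r)" using moments_w moments_x by (cases \<kappa>) auto
  show "integrable (law \<kappa>) (\<lambda>x. \<bar>x\<bar> ^ r)" using integrable_abs[OF 1] by (simp add: power_abs)
qed

lemma mom_nonneg: "0 \<le> mom d"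
  by (simp add: mom_def)

abbreviation entries :: "entry set \<Rightarrow> (entry \<Rightarrow> real) measure"
  where "entries K \<equiv> PiM K law"

sublocale product_sigma_finite law
  unfolding product_sigma_finite_def by (intro allI prob_space_imp_sigma_finite prob_space_law)

lemma prob_space_entries: "prob_space (entries K)"
  by (rule prob_space_PiM) (rule prob_space_law)

lemma entry_measurable [measurable]: "\<kappa> \<in> K \<Longrightarrow> (\<lambda>u. u \<kappa>) \<in> borel_measurable (entries K)"
  using measurable_component_singleton[of \<kappa> K law] by simp

lemma expectation_prod:
  assumes K: "finite K" "A \<subseteq> K" and g: "\<And>\<kappa>. \<kappa> \<in> A \<Longrightarrow> integrable (law \<kappa>) (g \<kappa>)"
  shows "(LINT u|(entries K). (\<Prod>\<kappa>\<in>A. g \<kappa> (u \<kappa>))) = (\<Prod>\<kappa>\<in>A. integral\<^sup>L (law \<kappa>) (g \<kappa>) :: real)"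
    and "integrable (entries K) (\<lambda>u. \<Prod>\<kappa>\<in>A. g \<kappa> (u \<kappa>))"
proof -
  define g' where "g' \<kappa> = (if \<kappa> \<in> A then g \<kappa> else (\<lambda>_. 1))" for \<kappa>
  have i: "integrable (law \<kappa>) (g' \<kappa>)" for \<kappa>
    using g prob_space.finite_measure[OF prob_space_law] by (auto simp: g'_def intro!: finite_measure.integrable_const)
  have eq: "(\<Prod>\<kappa>\<in>K. g' \<kappa> (u \<kappa>)) = (\<Prod>\<kappa>\<in>A. g \<kappa> (u \<kappa>))" for u
    using K by (intro prod.mono_neutral_cong_right) (auto simp: g'_def)
  have eq2: "(\<Prod>\<kappa>\<in>K. integral\<^sup>L (law \<kappa>) (g' \<kappa>)) = (\<Prod>\<kappa>\<in>A. integral\<^sup>L (law \<kappa>) (g \<kappa>))"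
    using K prob_space.prob_space[OF prob_space_law]
    by (intro prod.mono_neutral_cong_right) (auto simp: g'_def)
  show "(LINT u|(entries K). (\<Prod>\<kappa>\<in>A. g \<kappa> (u \<kappa>))) = (\<Prod>\<kappa>\<in>A. integral\<^sup>L (law \<kappa>) (g \<kappa>))"
    using product_integral_prod[OF K(1) i] unfolding eq eq2 .
  show "integrable (entries K) (\<lambda>u. \<Prod>\<kappa>\<in>A. g \<kappa> (u \<kappa>))"
    using product_integrable_prod[OF K(1) i] unfolding eq .
qed

lemma integrable_bounded_entries:
  fixes F :: "(entry \<Rightarrow> real) \<Rightarrow> real"
  assumes "F \<in> borel_measurable (entries K)" "\<And>u. \<bar>F u\<bar> \<le> C"
  shows "integrable (entries K) F"
  using assms prob_space.finite_measure[OF prob_space_entries]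
  by (intro finite_measure.integrable_const_bound[of _ _ C]) auto

text \<open>Integrating first over the single coordinate \<open>\<kappa>\<close>, the symmetric law
  cancels an odd integrand.\<close>

lemma expectation_odd:
  assumes K: "finite K" "\<kappa> \<in> K" and F: "F \<in> borel_measurable (entries K)" "\<And>u. \<bar>F u\<bar> \<le> (C :: real)"
    and odd: "\<And>u. F (u(\<kappa> := - u \<kappa>)) = - F u"
  shows "(LINT u|(entries K). F u) = 0"
proof -
  define K' where "K' = K - {\<kappa>}"
  have K': "finite K'" "\<kappa> \<notin> K'" "insert \<kappa> K' = K" using K by (auto simp: K'_def)
  have int: "integrable (entries (insert \<kappa> K')) F"
    using integrable_bounded_entries[OF F] K' by simp
  have eq: "(LINT u|(entries K). F u) = (LINT x|(entries K'). LINT y|(law \<kappa>). F (x(\<kappa> := y)))"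
    using product_integral_insert[OF K'(1,2) int] K'(3) by simp
  have "(LINT y|(law \<kappa>). F (x(\<kappa> := y))) = 0" if x: "x \<in> space (entries K')" for x
  proof -
    have m: "(\<lambda>y. F (x(\<kappa> := y))) \<in> borel_measurable borel"
      using measurable_compose[OF measurable_component_update[OF x K'(2)], of F borel] F(1) K'(3) by simp
    have mu: "uminus \<in> measurable (law \<kappa>) borel"
      using borel_measurable_uminus[OF measurable_ident_sets[OF sets_law[of \<kappa>]]] by simp
    have fl: "F (x(\<kappa> := - y)) = - F (x(\<kappa> := y))" for y
      using odd[of "x(\<kappa> := y)"] by simp
    have "(LINT y|(law \<kappa>). F (x(\<kappa> := y))) = (LINT y|(distr (law \<kappa>) borel uminus). F (x(\<kappa> := y)))"
      by (simp add: law_symm)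
    also have "\<dots> = (LINT y|(law \<kappa>). F (x(\<kappa> := - y)))"
      by (rule integral_distr[OF mu m])
    also have "\<dots> = (LINT y|(law \<kappa>). - F (x(\<kappa> := y)))"
      unfolding fl ..
    finally show ?thesis by simp
  qed
  then show ?thesis unfolding eq by (subst Bochner_Integration.integral_cong[OF refl, of _ _ "\<lambda>_. 0"]) auto
qed

lemma expectation_entry_product:
  assumes K: "finite K" "Inl a \<in> K" "Inr b \<in> K"
  shows "(LINT u|(entries K). \<bar>u (Inl a) * u (Inr b)\<bar> ^ d) = mom d"
    and "integrable (entries K) (\<lambda>u. \<bar>u (Inl a) * u (Inr b)\<bar> ^ d)"
  using expectation_prod[of K "{Inl a, Inr b}" "\<lambda>_ x. \<bar>x\<bar> ^ d"] K law_moments(2)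
  by (simp_all add: mom_def abs_mult power_mult_distrib)

end

section \<open>Parity expansion over an edge set\<close>

locale edge_system = entry_laws +
  fixes n :: nat and K :: "entry set" and E :: "'e set" and row col :: "'e \<Rightarrow> nat"
    and h :: "'e \<Rightarrow> real \<Rightarrow> real"
  assumes n_pos: "n \<ge> 1" and fin_K: "finite K" and fin_E: "finite E"
    and K_row: "\<And>e l. e \<in> E \<Longrightarrow> l < n \<Longrightarrow> Inl (row e, l) \<in> K"
    and K_col: "\<And>e l. e \<in> E \<Longrightarrow> l < n \<Longrightarrow> Inr (l, col e) \<in> K"
    and h_smooth: "\<And>e. e \<in> E \<Longrightarrow> smooth_bounded (h e)"
begin

definition zeta :: "(entry \<Rightarrow> real) \<Rightarrow> nat \<Rightarrow> 'e \<Rightarrow> real"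
  where "zeta u l e = u (Inl (row e, l)) * u (Inr (l, col e))"

definition xi :: "(entry \<Rightarrow> real) \<Rightarrow> nat \<Rightarrow> 'e \<Rightarrow> real"
  where "xi u l e = zeta u l e / sqrt (real n)"

text \<open>The words \<open>s 0, \<dots>, s (r - 1)\<close> record the edges in which the first \<open>r\<close> summands enter oddly.\<close>

definition Psi :: "nat \<Rightarrow> (nat \<Rightarrow> 'e set) \<Rightarrow> (entry \<Rightarrow> real) \<Rightarrow> real"
  where "Psi r s u =
    (\<Prod>e\<in>E. parity_part r (h e) (\<lambda>l. e \<in> s l) (\<lambda>l. xi u l e) (\<Sum>l=r..<n. xi u l e))"

definition EPsi :: "nat \<Rightarrow> (nat \<Rightarrow> 'e set) \<Rightarrow> real"
  where "EPsi r s = (LINT u|(entries K). Psi r s u)"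

definition even_edges :: "'e set \<Rightarrow> bool"
  where "even_edges S \<longleftrightarrow> (\<forall>i. even (card {e \<in> S. row e = i})) \<and> (\<forall>j. even (card {e \<in> S. col e = j}))"

definition evens :: "'e set set"
  where "evens = {S. S \<subseteq> E \<and> even_edges S}"

lemma finite_evens: "finite evens"
  unfolding evens_def using fin_E by simp

lemma card_evens_le: "card evens \<le> 2 ^ card E"
  using card_mono[of "Pow E" evens] fin_E by (auto simp: evens_def card_Pow)

lemma empty_in_evens: "{} \<in> evens"
  by (simp add: evens_def even_edges_def)

lemma zeta_measurable: "e \<in> E \<Longrightarrow> l < n \<Longrightarrow> (\<lambda>u. zeta u l e) \<in> borel_measurable (entries K)"
  unfolding zeta_def using K_row K_col by (intro borel_measurable_times entry_measurable) auto

lemma xi_measurable: "e \<in> E \<Longrightarrow> l < n \<Longrightarrow> (\<lambda>u. xi u l e) \<in> borel_measurable (entries K)"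
  unfolding xi_def using zeta_measurable by (intro borel_measurable_divide) auto

lemma Psi_measurable:
  assumes "r \<le> n"
  shows "Psi r s \<in> borel_measurable (entries K)"
  unfolding Psi_def
  using assms by (intro borel_measurable_prod parity_part_measurable smooth_bounded_measurable h_smooth
      borel_measurable_sum xi_measurable) auto

lemma Psi_bounded: "\<exists>C. \<forall>r s u. \<bar>Psi r s u\<bar> \<le> C"
proof -
  have "\<forall>e\<in>E. \<exists>B. \<forall>x. \<bar>h e x\<bar> \<le> B"
    using smooth_bounded_bound[OF h_smooth, of _ 0] by (metis funpow_0 le_refl)
  then obtain B where B: "\<And>e x. e \<in> E \<Longrightarrow> \<bar>h e x\<bar> \<le> B e" by metis
  have "\<bar>Psi r s u\<bar> \<le> (\<Prod>e\<in>E. B e)" for r s u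
    unfolding Psi_def abs_prod by (intro prod_mono conjI abs_ge_zero parity_part_bound_0 B)
  then show ?thesis by blast
qed

lemma Psi_integrable: "r \<le> n \<Longrightarrow> integrable (entries K) (Psi r s)"
  using Psi_bounded integrable_bounded_entries[OF Psi_measurable] by metis

text \<open>Each factor is the sum of its odd and even parts in summand \<open>r\<close>;
  multiplying out selects the set \<open>S\<close> of edges that take the odd part.\<close>

lemma Psi_split:
  assumes "r < n"
  shows "Psi r s u = (\<Sum>S\<in>Pow E. Psi (Suc r) (s(r := S)) u)"
proof -
  let ?z = "\<lambda>e. \<Sum>l=Suc r..<n. xi u l e"
  let ?p = "\<lambda>c e. parity_part (Suc r) (h e) ((\<lambda>l. e \<in> s l)(r := c)) (\<lambda>l. xi u l e) (?z e)"
  have "Psi r s u = (\<Prod>e\<in>E. ?p True e + ?p False e)"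
    unfolding Psi_def
  proof (rule prod.cong[OF refl])
    fix e
    have "(\<Sum>l=r..<n. xi u l e) = ?z e + xi u r e"
      using assms by (simp add: sum.atLeast_Suc_lessThan)
    then show "parity_part r (h e) (\<lambda>l. e \<in> s l) (\<lambda>l. xi u l e) (\<Sum>l=r..<n. xi u l e) = ?p True e + ?p False e"
      using parity_part_split by metis
  qed
  also have "\<dots> = (\<Sum>S\<in>Pow E. (\<Prod>e\<in>S. ?p True e) * (\<Prod>e\<in>E - S. ?p False e))"
    by (rule prod_add[OF fin_E])
  also have "\<dots> = (\<Sum>S\<in>Pow E. Psi (Suc r) (s(r := S)) u)"
  proof (rule sum.cong[OF refl])
    fix S assume "S \<in> Pow E"
    then have S: "S \<subseteq> E" by simp
    have c: "(\<lambda>l. e \<in> (s(r := S)) l) = (\<lambda>l. e \<in> s l)(r := (e \<in> S))" for e by auto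
    have "Psi (Suc r) (s(r := S)) u = (\<Prod>e\<in>E. ?p (e \<in> S) e)"
      unfolding Psi_def c ..
    also have "\<dots> = (\<Prod>e\<in>E - S. ?p (e \<in> S) e) * (\<Prod>e\<in>S. ?p (e \<in> S) e)"
      by (rule prod.subset_diff[OF S fin_E])
    also have "\<dots> = (\<Prod>e\<in>S. ?p True e) * (\<Prod>e\<in>E - S. ?p False e)"
      by (subst mult.commute, intro arg_cong2[where f="(*)"] prod.cong) auto
    finally show "(\<Prod>e\<in>S. ?p True e) * (\<Prod>e\<in>E - S. ?p False e) = Psi (Suc r) (s(r := S)) u" ..
  qed
  finally show ?thesis .
qed

lemma Psi_flip:
  assumes l: "l < r" and sl: "s l \<subseteq> E"
    and x: "\<And>e j. e \<in> E \<Longrightarrow> xi u' j e = (if j = l \<and> P e then - xi u j e else xi u j e)"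
    and odd: "odd (card {e \<in> s l. P e})"
  shows "Psi r s u' = - Psi r s u"
proof -
  have "Psi r s u' = (\<Prod>e\<in>E. (if e \<in> s l \<and> P e then -1 else 1) *
      parity_part r (h e) (\<lambda>l. e \<in> s l) (\<lambda>l. xi u l e) (\<Sum>l=r..<n. xi u l e))"
    unfolding Psi_def
  proof (rule prod.cong[OF refl])
    fix e assume e: "e \<in> E"
    have z: "(\<Sum>j=r..<n. xi u' j e) = (\<Sum>j=r..<n. xi u j e)"
      using l by (intro sum.cong) (auto simp: x[OF e])
    show "parity_part r (h e) (\<lambda>l. e \<in> s l) (\<lambda>l. xi u' l e) (\<Sum>l=r..<n. xi u' l e)
      = (if e \<in> s l \<and> P e then -1 else 1) *
        parity_part r (h e) (\<lambda>l. e \<in> s l) (\<lambda>l. xi u l e) (\<Sum>l=r..<n. xi u l e)"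
    proof (cases "P e")
      case True
      have "(\<lambda>l. xi u' l e) = (\<lambda>l. xi u l e)(l := - xi u l e)" using True by (auto simp: x[OF e])
      then show ?thesis
        unfolding z using True parity_part_flip[OF l, of "h e" "\<lambda>l. e \<in> s l" "\<lambda>l. xi u l e"] by simp
    next
      case False
      then have "(\<lambda>l. xi u' l e) = (\<lambda>l. xi u l e)" by (auto simp: x[OF e])
      then show ?thesis unfolding z using False by simp
    qed
  qed
  also have "\<dots> = (\<Prod>e\<in>E. (if e \<in> s l \<and> P e then -1 else 1)) * Psi r s u"
    unfolding Psi_def prod.distrib ..
  also have "(\<Prod>e\<in>E. (if e \<in> s l \<and> P e then -1 else 1)) = (\<Prod>e\<in>{e \<in> s l. P e}. (-1 :: real))"
    using sl fin_E by (intro prod.mono_neutral_cong_right) auto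
  also have "\<dots> = -1" using odd by simp
  finally show ?thesis by simp
qed

text \<open>Changing the sign of the entry \<open>Inl (i, l)\<close> changes the sign of
  \<open>xi u l e\<close> for exactly the edges in row \<open>i\<close>, hence that of
  \<open>Psi\<close> if \<open>s l\<close> has an odd number of them; likewise for columns.\<close>

lemma EPsi_eq_0:
  assumes r: "l < r" "r \<le> n" and sl: "s l \<subseteq> E" and ne: "\<not> even_edges (s l)"
  shows "EPsi r s = 0"
proof -
  obtain C where C: "\<And>u. \<bar>Psi r s u\<bar> \<le> C" using Psi_bounded by metis
  consider i where "odd (card {e \<in> s l. row e = i})" | j where "odd (card {e \<in> s l. col e = j})"
    using ne by (auto simp: even_edges_def)
  then show ?thesis
  proof cases
    case 1
    then have "{e \<in> s l. row e = i} \<noteq> {}" by (metis card.empty even_zero)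
    then have "Inl (i, l) \<in> K" using K_row sl r by fastforce
    moreover have "Psi r s (u(Inl (i, l) := - u (Inl (i, l)))) = - Psi r s u" for u
      using r(1) sl 1 by (intro Psi_flip[where l = l and P = "\<lambda>e. row e = i"]) (auto simp: xi_def zeta_def)
    ultimately show ?thesis
      unfolding EPsi_def by (rule expectation_odd[OF fin_K _ Psi_measurable[OF r(2)] C])
  next
    case 2
    then have "{e \<in> s l. col e = j} \<noteq> {}" by (metis card.empty even_zero)
    then have "Inr (l, j) \<in> K" using K_col sl r by fastforce
    moreover have "Psi r s (u(Inr (l, j) := - u (Inr (l, j)))) = - Psi r s u" for u
      using r(1) sl 2 by (intro Psi_flip[where l = l and P = "\<lambda>e. col e = j"]) (auto simp: xi_def zeta_def)
    ultimately show ?thesis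
      unfolding EPsi_def by (rule expectation_odd[OF fin_K _ Psi_measurable[OF r(2)] C])
  qed
qed

lemma EPsi_split:
  assumes "r < n"
  shows "EPsi r s = (\<Sum>S\<in>evens. EPsi (Suc r) (s(r := S)))"
proof -
  have "EPsi r s = (\<Sum>S\<in>Pow E. EPsi (Suc r) (s(r := S)))"
    unfolding EPsi_def Psi_split[OF assms]
    using assms Psi_integrable by (intro Bochner_Integration.integral_sum) auto
  also have "\<dots> = (\<Sum>S\<in>evens. EPsi (Suc r) (s(r := S)))"
  proof (rule sum.mono_neutral_right)
    show "\<forall>S\<in>Pow E - evens. EPsi (Suc r) (s(r := S)) = 0"
      using assms by (auto simp: evens_def intro!: EPsi_eq_0[of r])
  qed (use fin_E in \<open>auto simp: evens_def\<close>)
  finally show ?thesis .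
qed

end

context edge_system
begin

lemma zeta_power:
  assumes "e \<in> E" "l < n"
  shows "(LINT u|(entries K). \<bar>zeta u l e\<bar> ^ d) = mom d" "integrable (entries K) (\<lambda>u. \<bar>zeta u l e\<bar> ^ d)"
  unfolding zeta_def using expectation_entry_product[OF fin_K K_row[OF assms] K_col[OF assms]] by auto

text \<open>An instance of \<open>prod_abs_le_sum_power\<close>; the extra 1 covers the empty
  product.\<close>

lemma prod_xi_integrable_bound:
  assumes T: "T \<subseteq> {..<n} \<times> E"
  shows "integrable (entries K) (\<lambda>u. \<Prod>(l, e)\<in>T. \<bar>xi u l e\<bar>)" (is ?i)
    and "(LINT u|(entries K). (\<Prod>(l, e)\<in>T. \<bar>xi u l e\<bar>)) \<le> (1 + card T * mom (card T)) / sqrt n ^ card T" (is ?b)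
proof -
  interpret prob_space "entries K" by (rule prob_space_entries)
  have finT: "finite T" using T fin_E finite_subset by blast
  let ?d = "card T"
  have x: "(LINT u|(entries K). \<bar>xi u l e\<bar> ^ ?d) = mom ?d / sqrt n ^ ?d"
    "integrable (entries K) (\<lambda>u. \<bar>xi u l e\<bar> ^ ?d)" if "(l, e) \<in> T" for l e
    using zeta_power[of e l ?d] that T by (auto simp: xi_def power_divide)
  have meas: "(\<lambda>u. \<Prod>(l, e)\<in>T. \<bar>xi u l e\<bar>) \<in> borel_measurable (entries K)"
    unfolding split_beta using T by (intro borel_measurable_prod borel_measurable_abs xi_measurable) auto
  have "?i \<and> ?b"
  proof (cases "T = {}")
    case True
    then show ?thesis using prob_space by simp
  next
    case False
    have le: "(\<Prod>(l, e)\<in>T. \<bar>xi u l e\<bar>) \<le> (\<Sum>(l, e)\<in>T. \<bar>xi u l e\<bar> ^ ?d)" for u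
      using prod_abs_le_sum_power[OF finT False, of "\<lambda>(l, e). \<bar>xi u l e\<bar>"] by (simp add: split_beta)
    have pos: "0 \<le> (\<Prod>(l, e)\<in>T. \<bar>xi u l e\<bar>)" for u by (intro prod_nonneg) auto
    have int: "integrable (entries K) (\<lambda>u. \<Sum>(l, e)\<in>T. \<bar>xi u l e\<bar> ^ ?d)"
      using x(2) by (intro Bochner_Integration.integrable_sum) (auto simp: split_beta)
    have i: ?i
    proof (rule Bochner_Integration.integrable_bound[OF int meas], intro always_eventually allI)
      fix u show "norm (\<Prod>(l, e)\<in>T. \<bar>xi u l e\<bar>) \<le> norm (\<Sum>(l, e)\<in>T. \<bar>xi u l e\<bar> ^ ?d)"
        using le[of u] pos[of u] by simp
    qed
    have "(LINT u|(entries K). (\<Prod>(l, e)\<in>T. \<bar>xi u l e\<bar>)) \<le> (LINT u|(entries K). (\<Sum>(l, e)\<in>T. \<bar>xi u l e\<bar> ^ ?d))"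
      using le by (intro integral_mono i int) auto
    also have "\<dots> = (\<Sum>p\<in>T. LINT u|(entries K). \<bar>xi u (fst p) (snd p)\<bar> ^ ?d)"
      unfolding split_beta using x(2) by (intro Bochner_Integration.integral_sum) auto
    also have "\<dots> = (\<Sum>p\<in>T. mom ?d / sqrt n ^ ?d)"
      using x(1) by (intro sum.cong) auto
    also have "\<dots> = (card T * mom ?d) / sqrt n ^ ?d" by simp
    also have "\<dots> \<le> (1 + card T * mom ?d) / sqrt n ^ ?d" by (intro divide_right_mono) auto
    finally show ?thesis using i by blast
  qed
  then show ?i ?b by auto
qed

text \<open>One constant for all degrees up to \<open>D\<close>, monotone in \<open>D\<close>, so
  that bounds become uniform over words and walks.\<close>

definition mom_bound :: "nat \<Rightarrow> real"
  where "mom_bound D = 1 + (\<Sum>d\<le>D. d * mom d)"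

lemma mom_bound:
  assumes "d \<le> D"
  shows "1 + d * mom d \<le> mom_bound D"
  unfolding mom_bound_def
  using member_le_sum[of d "{..D}" "\<lambda>d. d * mom d"] mom_nonneg assms by auto

lemma mom_bound_ge_1: "1 \<le> mom_bound D"
  unfolding mom_bound_def using mom_nonneg by (simp add: sum_nonneg)

lemma sqrt_n_ge_1: "1 \<le> sqrt (real n)"
  using n_pos by simp

text \<open>\<open>parity_part_bound\<close> on each edge, followed by regrouping the factors by
  summand \<open>l\<close>. The number \<open>R\<close> limits how many derivatives fall on one
  edge.\<close>

lemma Psi_bound:
  assumes B: "\<And>e r x. e \<in> E \<Longrightarrow> r \<le> R \<Longrightarrow> \<bar>(deriv ^^ r) (h e) x\<bar> \<le> B"
    and s: "\<And>l. s l \<subseteq> E" and a: "\<And>e. e \<in> E \<Longrightarrow> card {l. l < r \<and> e \<in> s l} \<le> R"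
  shows "\<bar>Psi r s u\<bar> \<le> B ^ card E * (\<Prod>(l, e)\<in>Sigma {..<r} s. \<bar>xi u l e\<bar>)"
proof -
  have "\<bar>Psi r s u\<bar> \<le> (\<Prod>e\<in>E. B * (\<Prod>l | l < r \<and> e \<in> s l. \<bar>xi u l e\<bar>))"
    unfolding Psi_def abs_prod
    by (intro prod_mono conjI abs_ge_zero parity_part_bound h_smooth B a)
  also have "\<dots> = B ^ card E * (\<Prod>e\<in>E. \<Prod>l | l < r \<and> e \<in> s l. \<bar>xi u l e\<bar>)"
    by (simp add: prod.distrib)
  also have "(\<Prod>e\<in>E. \<Prod>l | l < r \<and> e \<in> s l. \<bar>xi u l e\<bar>) = (\<Prod>l<r. \<Prod>e | e \<in> E \<and> e \<in> s l. \<bar>xi u l e\<bar>)"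
    using prod.swap_restrict[OF fin_E finite_lessThan, of "\<lambda>e l. \<bar>xi u l e\<bar>" r "\<lambda>e l. e \<in> s l"] by simp
  also have "\<dots> = (\<Prod>l<r. \<Prod>e\<in>s l. \<bar>xi u l e\<bar>)"
    using s by (intro prod.cong) auto
  also have "\<dots> = (\<Prod>(l, e)\<in>Sigma {..<r} s. \<bar>xi u l e\<bar>)"
    using s fin_E by (intro prod.Sigma) (auto intro: finite_subset)
  finally show ?thesis .
qed

lemma EPsi_bound:
  assumes B: "\<And>e r x. e \<in> E \<Longrightarrow> r \<le> R \<Longrightarrow> \<bar>(deriv ^^ r) (h e) x\<bar> \<le> B" "1 \<le> B"
    and s: "\<And>l. s l \<subseteq> E" and a: "\<And>e. e \<in> E \<Longrightarrow> card {l. l < r \<and> e \<in> s l} \<le> R"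
    and r: "r \<le> n" and D: "(\<Sum>l<r. card (s l)) \<le> D"
  shows "\<bar>EPsi r s\<bar> \<le> B ^ card E * mom_bound D / sqrt n ^ (\<Sum>l<r. card (s l))"
proof -
  let ?T = "Sigma {..<r} s"
  have cT: "card ?T = (\<Sum>l<r. card (s l))"
    using s finite_subset[OF s fin_E] by (subst card_SigmaI) auto
  have T: "?T \<subseteq> {..<n} \<times> E" using s r by auto
  note ib = prod_xi_integrable_bound[OF T]
  have "\<bar>EPsi r s\<bar> \<le> (LINT u|(entries K). \<bar>Psi r s u\<bar>)" unfolding EPsi_def by (rule integral_abs_bound)
  also have "\<dots> \<le> (LINT u|(entries K). B ^ card E * (\<Prod>(l, e)\<in>?T. \<bar>xi u l e\<bar>))"
    using ib(1) Psi_bound[OF B(1) s a] Psi_integrable[OF r] by (intro integral_mono) auto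
  also have "\<dots> = B ^ card E * (LINT u|(entries K). (\<Prod>(l, e)\<in>?T. \<bar>xi u l e\<bar>))"
    by (rule integral_mult_right_zero)
  also have "\<dots> \<le> B ^ card E * ((1 + card ?T * mom (card ?T)) / sqrt n ^ card ?T)"
    using B(2) by (intro mult_left_mono[OF ib(2)]) auto
  also have "\<dots> \<le> B ^ card E * (mom_bound D / sqrt n ^ card ?T)"
    using mom_bound[of "card ?T" D] D B(2) unfolding cT
    by (intro mult_left_mono divide_right_mono) auto
  finally show ?thesis by (simp add: cT)
qed

section \<open>Words with few nonempty letters\<close>

definition words :: "nat \<Rightarrow> nat \<Rightarrow> (nat \<Rightarrow> 'e set) set"
  where "words r q = {s. (\<forall>l. s l \<in> evens) \<and> (\<forall>l\<ge>r. s l = {}) \<and> card {l. s l \<noteq> {}} = q}"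

definition short_words :: "nat \<Rightarrow> nat \<Rightarrow> (nat \<Rightarrow> 'e set) set"
  where "short_words r q = {s. (\<forall>l. s l \<in> evens) \<and> (\<forall>l\<ge>r. s l = {}) \<and> card {l. s l \<noteq> {}} < q}"

lemma word_support: "(\<forall>l\<ge>r. s l = {}) \<Longrightarrow> {l. s l \<noteq> {}} \<subseteq> {..<r}" for r :: nat
  by (rule subsetI, rule ccontr) (simp add: not_less)

text \<open>A word is coded by the list of its \<open>q\<close> nonempty letters with their
  positions; everything else is empty.\<close>

lemma words_finite_card: "finite (words r q)" "card (words r q) \<le> (r * card evens) ^ q"
proof -
  let ?L = "{xs. set xs \<subseteq> {..<r} \<times> evens \<and> length xs = q}"
  let ?f = "\<lambda>xs l. case map_of xs l of None \<Rightarrow> {} | Some S \<Rightarrow> S"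
  have finL: "finite ?L" by (rule finite_lists_length_eq) (simp add: finite_evens)
  have sub: "words r q \<subseteq> ?f ` ?L"
  proof
    fix s assume s: "s \<in> words r q"
    let ?A = "{l. s l \<noteq> {}}"
    have A: "?A \<subseteq> {..<r}" using s word_support unfolding words_def by blast
    then have finA: "finite ?A" using finite_subset by blast
    let ?xs = "map (\<lambda>l. (l, s l)) (sorted_list_of_set ?A)"
    have "?f ?xs = s"
      using finA by (auto simp: map_of_map_restrict restrict_map_def fun_eq_iff)
    moreover have "?xs \<in> ?L" using s A finA by (auto simp: words_def)
    ultimately show "s \<in> ?f ` ?L" using image_eqI[of s ?f ?xs ?L] by simp
  qed
  show "finite (words r q)" using finite_subset[OF sub] finL by blast
  have "card (words r q) \<le> card ?L"
    using card_mono[OF finite_imageI[OF finL] sub] card_image_le[OF finL, of ?f] by linarith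
  also have "\<dots> = (r * card evens) ^ q"
    by (subst card_lists_length_eq) (auto simp: finite_evens card_cartesian_product)
  finally show "card (words r q) \<le> (r * card evens) ^ q" .
qed

lemma short_words_eq: "short_words r Q = (\<Union>q<Q. words r q)"
  by (auto simp: short_words_def words_def)

lemma sum_short_words: "(\<Sum>s\<in>short_words r Q. F s) = (\<Sum>q<Q. \<Sum>s\<in>words r q. F s)"
  unfolding short_words_eq
proof (rule sum.UNION_disjoint)
  show "\<forall>q\<in>{..<Q}. finite (words r q)" using words_finite_card by blast
  show "\<forall>q\<in>{..<Q}. \<forall>q'\<in>{..<Q}. q \<noteq> q' \<longrightarrow> words r q \<inter> words r q' = {}" by (auto simp: words_def)
qed simp

text \<open>A branch is expanded only while it has fewer than \<open>Q\<close> nonempty letters.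
  When the last of \<open>Q\<close> appears, in position \<open>r'\<close>, the branch is left as
  \<open>EPsi (Suc r')\<close> with the later summands untouched, so that an edge function is
  differentiated at most \<open>Q\<close> times in the bounds.\<close>

lemma EPsi_expand:
  assumes "r \<le> n" "0 < Q"
  shows "EPsi 0 (\<lambda>_. {}) = (\<Sum>s\<in>short_words r Q. EPsi r s) +
    (\<Sum>r'<r. \<Sum>s\<in>{s \<in> words (Suc r') Q. s r' \<noteq> {}}. EPsi (Suc r') s)"
  using assms(1)
proof (induction r)
  case 0
  have "short_words 0 Q = {\<lambda>_. {}}"
    using assms(2) empty_in_evens by (auto simp: short_words_def)
  then show ?case by simp
next
  case (Suc r)
  have r: "r < n" using Suc by simp
  let ?stop = "{s \<in> words (Suc r) Q. s r \<noteq> {}}"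
  have fin: "finite (short_words r' Q)" for r' unfolding short_words_eq using words_finite_card by blast
  have "(\<Sum>s\<in>short_words r Q. EPsi r s) = (\<Sum>(s, S)\<in>short_words r Q \<times> evens. EPsi (Suc r) (s(r := S)))"
    unfolding EPsi_split[OF r] by (rule sum.cartesian_product)
  \<comment> \<open>Appending the letter in position \<open>r\<close> either keeps the word short or
    supplies exactly its \<open>Q\<close>-th nonempty letter.\<close>
  also have "\<dots> = (\<Sum>t\<in>short_words (Suc r) Q \<union> ?stop. EPsi (Suc r) t)"
  proof (rule sum.reindex_bij_witness[of _ "\<lambda>t. (t(r := {}), t r)" "\<lambda>(s, S). s(r := S)"])
    fix p assume "p \<in> short_words r Q \<times> evens"
    then obtain s S where p: "p = (s, S)" "s \<in> short_words r Q" "S \<in> evens" by auto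
    have sr: "s r = {}" and sup: "{l. s l \<noteq> {}} \<subseteq> {..<r}"
      using p word_support by (auto simp: short_words_def)
    then have fs: "finite {l. s l \<noteq> {}}" using finite_subset by blast
    show "((case p of (s, S) \<Rightarrow> s(r := S))(r := {}), (case p of (s, S) \<Rightarrow> s(r := S)) r) = p"
      using sr p by (simp add: fun_upd_idem)
    show "(case p of (s, S) \<Rightarrow> s(r := S)) \<in> short_words (Suc r) Q \<union> ?stop"
    proof (cases "S = {}")
      case True
      then have "s(r := S) = s" using sr by (simp add: fun_upd_idem)
      then show ?thesis using p by (auto simp: short_words_def)
    next
      case False
      have "{l. (s(r := S)) l \<noteq> {}} = insert r {l. s l \<noteq> {}}" using False by auto
      then have "card {l. (s(r := S)) l \<noteq> {}} = Suc (card {l. s l \<noteq> {}})" using fs sr by simp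
      then have c: "card {l. (s(r := S)) l \<noteq> {}} \<le> Q"
        using p by (auto simp: short_words_def)
      have ev: "\<forall>l. (s(r := S)) l \<in> evens" and out: "\<forall>l\<ge>Suc r. (s(r := S)) l = {}"
        using p by (simp_all add: short_words_def)
      have nz: "(s(r := S)) r \<noteq> {}" using False by simp
      show ?thesis
      proof (cases "card {l. (s(r := S)) l \<noteq> {}} = Q")
        case True
        then have "s(r := S) \<in> words (Suc r) Q"
          unfolding words_def by (intro CollectI conjI ev out)
        then show ?thesis unfolding p using nz by simp
      next
        case False
        then have "card {l. (s(r := S)) l \<noteq> {}} < Q" using c by simp
        then have "s(r := S) \<in> short_words (Suc r) Q"
          unfolding short_words_def by (intro CollectI conjI ev out)
        then show ?thesis unfolding p by simp
      qed
    qed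
    show "EPsi (Suc r) (case p of (s, S) \<Rightarrow> s(r := S)) = (case p of (s, S) \<Rightarrow> EPsi (Suc r) (s(r := S)))"
      by (simp add: p)
  next
    fix t assume t: "t \<in> short_words (Suc r) Q \<union> ?stop"
    have ev: "\<forall>l. t l \<in> evens" and out: "\<forall>l\<ge>Suc r. t l = {}"
      using t by (auto simp: short_words_def words_def)
    have "{l. t l \<noteq> {}} \<subseteq> {..<Suc r}" using word_support[OF out] .
    then have ft: "finite {l. t l \<noteq> {}}" using finite_subset by blast
    have "card {l. (t(r := {})) l \<noteq> {}} < Q"
    proof (cases "t r = {}")
      case True
      then have "t(r := {}) = t" by (simp add: fun_upd_idem)
      then show ?thesis using t True by (auto simp: short_words_def)
    next
      case False
      have "{l. (t(r := {})) l \<noteq> {}} = {l. t l \<noteq> {}} - {r}" by auto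
      moreover have "card ({l. t l \<noteq> {}} - {r}) < card {l. t l \<noteq> {}}"
        using ft False by (intro card_Diff1_less) auto
      ultimately show ?thesis using t by (auto simp: short_words_def words_def)
    qed
    moreover have "\<forall>l\<ge>r. (t(r := {})) l = {}" 
    proof (intro allI impI)
      fix l assume "r \<le> l"
      then show "(t(r := {})) l = {}" using out by (cases "l = r") simp_all
    qed
    moreover have "\<forall>l. (t(r := {})) l \<in> evens" using ev empty_in_evens by auto
    ultimately have "t(r := {}) \<in> short_words r Q"
      unfolding short_words_def by (intro CollectI conjI)
    then show "(t(r := {}), t r) \<in> short_words r Q \<times> evens" using ev by auto
    show "(case (t(r := {}), t r) of (s, S) \<Rightarrow> s(r := S)) = t" by auto
  qed
  also have "\<dots> = (\<Sum>t\<in>short_words (Suc r) Q. EPsi (Suc r) t) + (\<Sum>t\<in>?stop. EPsi (Suc r) t)"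
  proof (rule sum.union_disjoint[OF fin])
    show "finite ?stop" using words_finite_card(1)[of "Suc r" Q] by simp
    show "short_words (Suc r) Q \<inter> ?stop = {}" by (auto simp: short_words_def words_def)
  qed
  finally show ?case using Suc by simp
qed

lemma word_degree_bounds:
  assumes s: "s \<in> words r q" and ev3: "\<And>S. S \<in> evens \<Longrightarrow> S \<noteq> {} \<Longrightarrow> 3 \<le> card S"
  shows "3 * q \<le> (\<Sum>l<r. card (s l))" "(\<Sum>l<r. card (s l)) \<le> q * card E"
    "card {l. l < r \<and> e \<in> s l} \<le> q"
proof -
  let ?A = "{l. s l \<noteq> {}}"
  have A: "?A \<subseteq> {..<r}" and cA: "card ?A = q" and ev: "\<And>l. s l \<in> evens"
    using s word_support unfolding words_def by blast+
  have finA: "finite ?A" using A finite_subset by blast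
  have eq: "(\<Sum>l<r. card (s l)) = (\<Sum>l\<in>?A. card (s l))"
    using A by (intro sum.mono_neutral_right) auto
  have "3 * q = (\<Sum>l\<in>?A. 3)" using cA by simp
  also have "\<dots> \<le> (\<Sum>l\<in>?A. card (s l))" using ev ev3 by (intro sum_mono) auto
  finally show "3 * q \<le> (\<Sum>l<r. card (s l))" using eq by simp
  have "(\<Sum>l\<in>?A. card (s l)) \<le> (\<Sum>l\<in>?A. card E)"
    using ev fin_E by (intro sum_mono card_mono) (auto simp: evens_def)
  then show "(\<Sum>l<r. card (s l)) \<le> q * card E" using eq cA by simp
  have "{l. l < r \<and> e \<in> s l} \<subseteq> ?A" by auto
  then show "card {l. l < r \<and> e \<in> s l} \<le> q" using card_mono[OF finA] cA by blast
qed

lemma word_EPsi_bound: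
  assumes B: "\<And>e r x. e \<in> E \<Longrightarrow> r \<le> R \<Longrightarrow> \<bar>(deriv ^^ r) (h e) x\<bar> \<le> B" "1 \<le> B"
    and s: "s \<in> words r q" and ev3: "\<And>S. S \<in> evens \<Longrightarrow> S \<noteq> {} \<Longrightarrow> 3 \<le> card S"
    and q: "q \<le> R" and r: "r \<le> n" and D: "(\<Sum>l<r. card (s l)) \<le> D"
  shows "\<bar>EPsi r s\<bar> \<le> B ^ card E * mom_bound D / sqrt n ^ (\<Sum>l<r. card (s l))"
  using s q word_degree_bounds(3)[OF s ev3]
  by (intro EPsi_bound[OF B _ _ r D]) (auto simp: words_def evens_def intro: order_trans)

text \<open>There are \<open>n\<close> stopping positions and at most \<open>(n 2^|E|)^Q\<close>
  words for each, all of order \<open>n\<close> to the power \<open>-3 Q / 2\<close> since every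
  nonempty letter has at least three edges. The position of the last letter is counted twice here,
  which a larger \<open>Q\<close> makes up for.\<close>

lemma EPsi_expand_bound:
  assumes B: "\<And>e r x. e \<in> E \<Longrightarrow> r \<le> R \<Longrightarrow> \<bar>(deriv ^^ r) (h e) x\<bar> \<le> B" "1 \<le> B"
    and ev3: "\<And>S. S \<in> evens \<Longrightarrow> S \<noteq> {} \<Longrightarrow> 3 \<le> card S" and Q: "0 < Q" "Q \<le> R"
  shows "\<bar>EPsi 0 (\<lambda>_. {}) - (\<Sum>s\<in>short_words n Q. EPsi n s)\<bar>
    \<le> n * (n * 2 ^ card E) ^ Q * (B ^ card E * mom_bound (Q * card E)) / sqrt n ^ (3 * Q)"
proof -
  let ?C = "B ^ card E * mom_bound (Q * card E) / sqrt n ^ (3 * Q)"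
  have C0: "0 \<le> ?C" using B(2) mom_bound_ge_1[of "Q * card E"] by simp
  have b: "\<bar>EPsi (Suc r) s\<bar> \<le> ?C" if "r < n" "s \<in> words (Suc r) Q" for r s
  proof -
    let ?d = "\<Sum>l<Suc r. card (s l)"
    note d = word_degree_bounds[OF that(2) ev3]
    have "\<bar>EPsi (Suc r) s\<bar> \<le> B ^ card E * mom_bound (Q * card E) / sqrt n ^ ?d"
      by (rule word_EPsi_bound[OF B that(2) ev3 Q(2) _ d(2)]) (use that in auto)
    also have "\<dots> \<le> ?C"
      using d(1) sqrt_n_ge_1 B(2) mom_bound_ge_1[of "Q * card E"]
      by (intro divide_left_mono power_increasing mult_nonneg_nonneg mult_pos_pos) auto
    finally show ?thesis .
  qed
  have "\<bar>\<Sum>r'<n. \<Sum>s\<in>{s \<in> words (Suc r') Q. s r' \<noteq> {}}. EPsi (Suc r') s\<bar>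
      \<le> (\<Sum>r'<n. \<Sum>s\<in>{s \<in> words (Suc r') Q. s r' \<noteq> {}}. ?C)"
    by (rule order_trans[OF sum_abs], rule sum_mono, rule order_trans[OF sum_abs], rule sum_mono)
      (use b in auto)
  also have "\<dots> \<le> (\<Sum>r'<n. (n * 2 ^ card E) ^ Q * ?C)"
  proof (rule sum_mono)
    fix r' assume r': "r' \<in> {..<n}"
    have "card {s \<in> words (Suc r') Q. s r' \<noteq> {}} \<le> card (words (Suc r') Q)"
      using words_finite_card by (intro card_mono) auto
    also have "\<dots> \<le> (Suc r' * card evens) ^ Q" by (rule words_finite_card)
    also have "\<dots> \<le> (n * 2 ^ card E) ^ Q"
      using r' card_evens_le by (intro power_mono mult_mono) auto
    finally have "real (card {s \<in> words (Suc r') Q. s r' \<noteq> {}}) \<le> real ((n * 2 ^ card E) ^ Q)"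
      by (rule of_nat_mono)
    then have "real (card {s \<in> words (Suc r') Q. s r' \<noteq> {}}) * ?C \<le> real ((n * 2 ^ card E) ^ Q) * ?C"
      using C0 by (rule mult_right_mono)
    then show "(\<Sum>s\<in>{s \<in> words (Suc r') Q. s r' \<noteq> {}}. ?C) \<le> (n * 2 ^ card E) ^ Q * ?C" by simp
  qed
  also have "\<dots> = n * (n * 2 ^ card E) ^ Q * (B ^ card E * mom_bound (Q * card E)) / sqrt n ^ (3 * Q)"
    by simp
  finally show ?thesis using EPsi_expand[OF order_refl Q(1)] by simp
qed

end

section \<open>The limit of a word made of disjoint cycles\<close>

lemma prod_double_fibres:
  fixes u :: "'k \<Rightarrow> real" and f :: "'e \<Rightarrow> 'k"
  assumes Od: "finite Od" and two: "\<And>x. x \<in> Od \<Longrightarrow> card {e \<in> Od. f e = f x} = 2"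
  shows "(\<Prod>e\<in>Od. u (f e)) = (\<Prod>\<kappa>\<in>f ` Od. (u \<kappa>)\<^sup>2)" "2 * card (f ` Od) = card Od"
proof -
  have "(\<Prod>e\<in>Od. u (f e)) = (\<Prod>\<kappa>\<in>f ` Od. \<Prod>e | e \<in> Od \<and> f e = \<kappa>. u (f e))"
    by (rule prod.image_gen[OF Od])
  also have "\<dots> = (\<Prod>\<kappa>\<in>f ` Od. (u \<kappa>)\<^sup>2)"
    using two by (intro prod.cong) auto
  finally show "(\<Prod>e\<in>Od. u (f e)) = (\<Prod>\<kappa>\<in>f ` Od. (u \<kappa>)\<^sup>2)" .
  have "card Od = (\<Sum>\<kappa>\<in>f ` Od. card {e \<in> Od. f e = \<kappa>})"
    using sum.image_gen[OF Od, of "\<lambda>_. 1::nat" f] by simp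
  also have "\<dots> = (\<Sum>\<kappa>\<in>f ` Od. 2)" using two by (intro sum.cong) auto
  finally show "2 * card (f ` Od) = card Od" by simp
qed

context edge_system
begin

text \<open>For each label, every row and column that is met is met in exactly two edges, so every
  entry is squared. With \<open>card Od / 2\<close> entries of each kind the expectation is a
  product of variances.\<close>

lemma prod_zeta_expectation:
  assumes Od: "Od \<subseteq> E" and lab: "\<And>e. e \<in> E \<Longrightarrow> lab e < n"
    and row2: "\<And>l i. card {e \<in> Od. lab e = l \<and> row e = i} \<in> {0, 2}"
    and col2: "\<And>l j. card {e \<in> Od. lab e = l \<and> col e = j} \<in> {0, 2}"
  shows "(LINT u|(entries K). (\<Prod>e\<in>Od. zeta u (lab e) e)) = (sw * sx) ^ card Od"
    and "integrable (entries K) (\<lambda>u. \<Prod>e\<in>Od. zeta u (lab e) e)"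
proof -
  have finO: "finite Od" using Od fin_E finite_subset by blast
  let ?a = "\<lambda>e. Inl (row e, lab e) :: entry" and ?b = "\<lambda>e. Inr (lab e, col e) :: entry"
  have a2: "card {e \<in> Od. ?a e = ?a x} = 2" if "x \<in> Od" for x
  proof -
    have "{e \<in> Od. ?a e = ?a x} = {e \<in> Od. lab e = lab x \<and> row e = row x}" by auto
    moreover have "card {e \<in> Od. lab e = lab x \<and> row e = row x} \<noteq> 0" using that finO by auto
    ultimately show ?thesis using row2[of "lab x" "row x"] by auto
  qed
  have b2: "card {e \<in> Od. ?b e = ?b x} = 2" if "x \<in> Od" for x
  proof -
    have "{e \<in> Od. ?b e = ?b x} = {e \<in> Od. lab e = lab x \<and> col e = col x}" by auto
    moreover have "card {e \<in> Od. lab e = lab x \<and> col e = col x} \<noteq> 0" using that finO by auto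
    ultimately show ?thesis using col2[of "lab x" "col x"] by auto
  qed
  let ?A = "?a ` Od \<union> ?b ` Od"
  have disj: "?a ` Od \<inter> ?b ` Od = {}" by auto
  have eq: "(\<Prod>e\<in>Od. zeta u (lab e) e) = (\<Prod>\<kappa>\<in>?A. (u \<kappa>)\<^sup>2)" for u
  proof -
    have "(\<Prod>e\<in>Od. zeta u (lab e) e) = (\<Prod>e\<in>Od. u (?a e)) * (\<Prod>e\<in>Od. u (?b e))"
      by (simp add: zeta_def prod.distrib)
    also have "\<dots> = (\<Prod>\<kappa>\<in>?a ` Od. (u \<kappa>)\<^sup>2) * (\<Prod>\<kappa>\<in>?b ` Od. (u \<kappa>)\<^sup>2)"
      using prod_double_fibres(1)[OF finO a2, of u] prod_double_fibres(1)[OF finO b2, of u] by simp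
    also have "\<dots> = (\<Prod>\<kappa>\<in>?A. (u \<kappa>)\<^sup>2)"
      using finO disj by (intro prod.union_disjoint[symmetric]) auto
    finally show ?thesis .
  qed
  have AK: "?A \<subseteq> K" using Od lab K_row K_col by auto
  note ep = expectation_prod[OF fin_K AK, of "\<lambda>_ x. x\<^sup>2", OF law_moments(1)]
  show "integrable (entries K) (\<lambda>u. \<Prod>e\<in>Od. zeta u (lab e) e)" unfolding eq by (rule ep(2))
  have "(LINT u|(entries K). (\<Prod>e\<in>Od. zeta u (lab e) e)) = (\<Prod>\<kappa>\<in>?A. LINT x|(law \<kappa>). x\<^sup>2)"
    unfolding eq by (rule ep(1))
  also have "\<dots> = (\<Prod>\<kappa>\<in>?a ` Od. LINT x|(law \<kappa>). x\<^sup>2) * (\<Prod>\<kappa>\<in>?b ` Od. LINT x|(law \<kappa>). x\<^sup>2)"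
    using finO disj by (intro prod.union_disjoint) auto
  also have "(\<Prod>\<kappa>\<in>?a ` Od. LINT x|(law \<kappa>). x\<^sup>2) = (\<Prod>\<kappa>\<in>?a ` Od. sw\<^sup>2)"
    by (intro prod.cong) (auto simp: var_w)
  also have "\<dots> = sw ^ card Od"
    using prod_double_fibres(2)[OF finO a2] by (simp flip: power_mult)
  also have "(\<Prod>\<kappa>\<in>?b ` Od. LINT x|(law \<kappa>). x\<^sup>2) = (\<Prod>\<kappa>\<in>?b ` Od. sx\<^sup>2)"
    by (intro prod.cong) (auto simp: var_x)
  also have "\<dots> = sx ^ card Od"
    using prod_double_fibres(2)[OF finO b2] by (simp flip: power_mult)
  finally show "(LINT u|(entries K). (\<Prod>e\<in>Od. zeta u (lab e) e)) = (sw * sx) ^ card Od"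
    by (simp add: power_mult_distrib)
qed

lemma mom_2: "mom 2 = (sw * sx)\<^sup>2"
  using var_w var_x by (simp add: mom_def power_mult_distrib)

text \<open>Squares for different \<open>l\<close> involve disjoint sets of entries, so only the
  \<open>n\<close> diagonal covariances remain, and the division by \<open>n\<^sup>2\<close> leaves
  order \<open>1 / n\<close>.\<close>

lemma zeta_variance:
  assumes e: "e \<in> E"
  shows "integrable (entries K) (\<lambda>u. ((\<Sum>l<n. (xi u l e)\<^sup>2) - (sw * sx)\<^sup>2)\<^sup>2)"
    and "(LINT u|(entries K). ((\<Sum>l<n. (xi u l e)\<^sup>2) - (sw * sx)\<^sup>2)\<^sup>2) \<le> mom 4 / n"
proof -
  interpret prob_space "entries K" by (rule prob_space_entries)
  let ?s = "(sw * sx)\<^sup>2"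
  let ?q = "\<lambda>l u. (zeta u l e)\<^sup>2"
  have q: "(LINT u|(entries K). ?q l u) = ?s" "integrable (entries K) (?q l)" if "l < n" for l
    using zeta_power[OF e that, of 2] by (simp_all add: mom_2)
  have q2: "(LINT u|(entries K). ?q l u * ?q l' u) = (if l = l' then mom 4 else ?s\<^sup>2)
      \<and> integrable (entries K) (\<lambda>u. ?q l u * ?q l' u)" if l: "l < n" "l' < n" for l l'
  proof (cases "l = l'")
    case True
    have "?q l u * ?q l u = \<bar>zeta u l e\<bar> ^ 4" for u
      by (simp add: power4_eq_xxxx power2_eq_square mult.assoc flip: power_even_abs[of 4])
    then show ?thesis using zeta_power[OF e l(1), of 4] True by simp
  next
    case False
    let ?A = "{Inl (row e, l), Inr (l, col e), Inl (row e, l'), Inr (l', col e)}"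
    have "?A \<subseteq> K" using K_row[OF e] K_col[OF e] l by auto
    note ep = expectation_prod[OF fin_K this, of "\<lambda>_ x. x\<^sup>2", OF law_moments(1)]
    have "(\<Prod>\<kappa>\<in>?A. (u \<kappa>)\<^sup>2) = ?q l u * ?q l' u" for u
      using False by (simp add: zeta_def power_mult_distrib mult_ac)
    moreover have "(\<Prod>\<kappa>\<in>?A. LINT x|(law \<kappa>). x\<^sup>2) = ?s\<^sup>2"
      using False by (simp add: var_w var_x) (simp add: power_mult_distrib power4_eq_xxxx power2_eq_square mult_ac)
    ultimately show ?thesis using ep False by simp
  qed
  let ?c = "\<lambda>l l' u. (?q l u - ?s) * (?q l' u - ?s)"
  have c: "(LINT u|(entries K). ?c l l' u) = (if l = l' then mom 4 - ?s\<^sup>2 else 0)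
      \<and> integrable (entries K) (?c l l')" if l: "l < n" "l' < n" for l l'
  proof -
    have eq: "?c l l' = (\<lambda>u. (?q l u * ?q l' u - ?s * ?q l u) - (?s * ?q l' u - ?s * ?s))"
      by (auto simp: algebra_simps)
    show ?thesis
      unfolding eq using q[OF l(1)] q[OF l(2)] q2[OF l]
      by (simp add: prob_space power2_eq_square)
  qed
  have eq: "((\<Sum>l<n. (xi u l e)\<^sup>2) - ?s)\<^sup>2 = (\<Sum>l<n. \<Sum>l'<n. ?c l l' u) / (real n)\<^sup>2" for u
  proof -
    have "(\<Sum>l<n. (xi u l e)\<^sup>2) - ?s = (\<Sum>l<n. ?q l u - ?s) / n"
      using n_pos by (simp add: xi_def power_divide sum_subtractf diff_divide_distrib flip: sum_divide_distrib)
    then have "((\<Sum>l<n. (xi u l e)\<^sup>2) - ?s)\<^sup>2 = (\<Sum>l<n. ?q l u - ?s) * (\<Sum>l<n. ?q l u - ?s) / (real n)\<^sup>2"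
      by (simp add: power2_eq_square)
    then show ?thesis unfolding sum_product .
  qed
  show "integrable (entries K) (\<lambda>u. ((\<Sum>l<n. (xi u l e)\<^sup>2) - ?s)\<^sup>2)"
    unfolding eq using c by (intro integrable_divide Bochner_Integration.integrable_sum) auto
  have "(LINT u|(entries K). ((\<Sum>l<n. (xi u l e)\<^sup>2) - ?s)\<^sup>2)
      = (\<Sum>l<n. \<Sum>l'<n. LINT u|(entries K). ?c l l' u) / (real n)\<^sup>2"
    unfolding eq integral_divide_zero
  proof (rule arg_cong2[where f="(/)", OF _ refl])
    have "(LINT u|(entries K). (\<Sum>l<n. \<Sum>l'<n. ?c l l' u)) = (\<Sum>l<n. LINT u|(entries K). (\<Sum>l'<n. ?c l l' u))"
      by (rule Bochner_Integration.integral_sum) (use c in \<open>auto intro!: Bochner_Integration.integrable_sum\<close>)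
    also have "\<dots> = (\<Sum>l<n. \<Sum>l'<n. LINT u|(entries K). ?c l l' u)"
      by (intro sum.cong refl Bochner_Integration.integral_sum) (use c in auto)
    finally show "(LINT u|(entries K). (\<Sum>l<n. \<Sum>l'<n. ?c l l' u)) = (\<Sum>l<n. \<Sum>l'<n. LINT u|(entries K). ?c l l' u)" .
  qed
  also have "\<dots> = (\<Sum>l<n. \<Sum>l'<n. if l = l' then mom 4 - ?s\<^sup>2 else 0) / (real n)\<^sup>2"
    using c by (intro arg_cong2[where f="(/)"] sum.cong refl) auto
  also have "\<dots> = n * (mom 4 - ?s\<^sup>2) / (real n)\<^sup>2" by simp
  also have "\<dots> \<le> n * mom 4 / (real n)\<^sup>2"
    by (intro divide_right_mono mult_left_mono) auto
  also have "\<dots> = mom 4 / n" using n_pos by (simp add: power2_eq_square)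
  finally show "(LINT u|(entries K). ((\<Sum>l<n. (xi u l e)\<^sup>2) - ?s)\<^sup>2) \<le> mom 4 / n" .
qed

lemma prod_zeta_square:
  assumes Od: "Od \<subseteq> E" and lab: "\<And>e. e \<in> E \<Longrightarrow> lab e < n"
  shows "integrable (entries K) (\<lambda>u. (\<Prod>e\<in>Od. \<bar>zeta u (lab e) e\<bar>)\<^sup>2)" (is ?i)
    and "(LINT u|(entries K). (\<Prod>e\<in>Od. \<bar>zeta u (lab e) e\<bar>)\<^sup>2) \<le> mom_bound (2 * card Od)" (is ?b)
proof -
  interpret prob_space "entries K" by (rule prob_space_entries)
  have finO: "finite Od" using Od fin_E finite_subset by blast
  let ?d = "card Od"
  let ?Z = "\<lambda>u. (\<Prod>e\<in>Od. \<bar>zeta u (lab e) e\<bar>)\<^sup>2"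
  have m: "?Z \<in> borel_measurable (entries K)"
    using Od lab by (intro borel_measurable_power borel_measurable_prod borel_measurable_abs zeta_measurable) auto
  have "?i \<and> ?b"
  proof (cases "Od = {}")
    case True
    then show ?thesis using mom_bound_ge_1 by (simp add: prob_space)
  next
    case False
    have le: "?Z u \<le> (\<Sum>e\<in>Od. \<bar>zeta u (lab e) e\<bar> ^ (2 * ?d))" for u
      using prod_abs_le_sum_power[OF finO False, of "\<lambda>e. \<bar>zeta u (lab e) e\<bar>\<^sup>2"]
      by (simp only: prod_power_distrib power_mult) simp
    have z: "integrable (entries K) (\<lambda>u. \<bar>zeta u (lab e) e\<bar> ^ (2 * ?d))"
      "(LINT u|(entries K). \<bar>zeta u (lab e) e\<bar> ^ (2 * ?d)) = mom (2 * ?d)" if "e \<in> Od" for e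
      using zeta_power[of e "lab e"] that Od lab by auto
    have int: "integrable (entries K) (\<lambda>u. \<Sum>e\<in>Od. \<bar>zeta u (lab e) e\<bar> ^ (2 * ?d))"
      using z by (intro Bochner_Integration.integrable_sum)
    have i: ?i
    proof (rule Bochner_Integration.integrable_bound[OF int m], intro always_eventually allI)
      fix u show "norm (?Z u) \<le> norm (\<Sum>e\<in>Od. \<bar>zeta u (lab e) e\<bar> ^ (2 * ?d))"
        using le[of u] by simp
    qed
    have "(LINT u|(entries K). ?Z u) \<le> (LINT u|(entries K). (\<Sum>e\<in>Od. \<bar>zeta u (lab e) e\<bar> ^ (2 * ?d)))"
      using le by (intro integral_mono i int) auto
    also have "\<dots> = ?d * mom (2 * ?d)"
      using z by (subst Bochner_Integration.integral_sum) auto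
    also have "\<dots> \<le> real (2 * ?d) * mom (2 * ?d)" using mom_nonneg by (intro mult_right_mono) auto
    also have "\<dots> \<le> mom_bound (2 * ?d)" using mom_bound[of "2 * ?d" "2 * ?d"] by simp
    finally show ?thesis using i by blast
  qed
  then show ?i ?b by auto
qed

text \<open>The weight \<open>prod |zeta|\<close> times the error of one factor, bounded by weighted AM-GM.\<close>

lemma weighted_error:
  fixes Od :: "'e set" and lab :: "'e \<Rightarrow> nat"
  assumes Od: "Od \<subseteq> E" and lab: "\<And>e. e \<in> E \<Longrightarrow> lab e < n" and e: "e \<in> E"
  defines "Z \<equiv> \<lambda>u. \<Prod>e\<in>Od. \<bar>zeta u (lab e) e\<bar>"
    and "d \<equiv> \<lambda>u. (xi u (lab e) e)\<^sup>2 + ((\<Sum>l<n. xi u l e ^ 4) + \<bar>(\<Sum>l<n. (xi u l e)\<^sup>2) - (sw * sx)\<^sup>2\<bar>)"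
  shows "integrable (entries K) (\<lambda>u. Z u * d u)"
    and "(LINT u|(entries K). Z u * d u) \<le> (3 * mom_bound (2 * card E) + 2 * mom 4 + mom 8) / sqrt n"
proof -
  let ?M = "mom_bound (2 * card E)"
  let ?v = "\<lambda>u. (\<Sum>l<n. (xi u l e)\<^sup>2) - (sw * sx)\<^sup>2"
  \<comment> \<open>One part for each summand of \<open>d\<close>, from
    \<open>a b \<le> a\<^sup>2 + b\<^sup>2\<close>. In the last part the weights
    \<open>1 / sqrt n\<close> and \<open>sqrt n\<close> balance a variance of order
    \<open>1 / n\<close>, which fixes the order \<open>1 / sqrt n\<close> of the whole
    bound.\<close>
  let ?F = "\<lambda>u. ((Z u)\<^sup>2 / n + \<bar>zeta u (lab e) e\<bar> ^ 4 / n) +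
    ((\<Sum>l<n. ((Z u)\<^sup>2 + \<bar>zeta u l e\<bar> ^ 8) / (real n)\<^sup>2) + ((Z u)\<^sup>2 / sqrt n + sqrt n * (?v u)\<^sup>2))"
  have cO: "card Od \<le> card E" using Od fin_E by (rule card_mono[rotated])
  have Zi: "integrable (entries K) (\<lambda>u. (Z u)\<^sup>2)"
    unfolding Z_def by (rule prod_zeta_square(1)[OF Od lab])
  have Z: "(LINT u|(entries K). (Z u)\<^sup>2) \<le> ?M"
  proof -
    have "(LINT u|(entries K). (Z u)\<^sup>2) \<le> mom_bound (2 * card Od)"
      unfolding Z_def by (rule prod_zeta_square(2)[OF Od lab])
    also have "\<dots> \<le> ?M"
      unfolding mom_bound_def using cO mom_nonneg by (intro add_left_mono sum_mono2) auto
    finally show ?thesis .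
  qed
  have Z0: "0 \<le> Z u" for u unfolding Z_def by (intro prod_nonneg) auto
  have amgm: "a * b \<le> a\<^sup>2 + b\<^sup>2" for a b :: real
  proof -
    have "2 * (a * b) \<le> a\<^sup>2 + b\<^sup>2" using sum_squares_bound[of a b] by (simp add: mult.assoc)
    moreover have "0 \<le> a\<^sup>2 + b\<^sup>2" by simp
    ultimately show ?thesis by linarith
  qed
  have le: "Z u * d u \<le> ?F u" for u
  proof -
    have n0: "0 < real n" using n_pos by simp
    have 1: "Z u * (xi u (lab e) e)\<^sup>2 \<le> (Z u)\<^sup>2 / n + \<bar>zeta u (lab e) e\<bar> ^ 4 / n"
    proof -
      have "Z u * (zeta u (lab e) e)\<^sup>2 \<le> (Z u)\<^sup>2 + ((zeta u (lab e) e)\<^sup>2)\<^sup>2" by (rule amgm)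
      then have "Z u * (zeta u (lab e) e)\<^sup>2 / n \<le> ((Z u)\<^sup>2 + ((zeta u (lab e) e)\<^sup>2)\<^sup>2) / n"
        using n0 by (intro divide_right_mono) auto
      then show ?thesis by (simp add: xi_def power_divide add_divide_distrib flip: power_mult)
    qed
    have 2: "Z u * (\<Sum>l<n. xi u l e ^ 4) \<le> (\<Sum>l<n. ((Z u)\<^sup>2 + \<bar>zeta u l e\<bar> ^ 8) / (real n)\<^sup>2)"
      unfolding sum_distrib_left
    proof (rule sum_mono)
      fix l
      have s4: "sqrt (real n) ^ 4 = (real n)\<^sup>2"
        using power_mult[of "sqrt (real n)" 2 2] by simp
      have "Z u * zeta u l e ^ 4 \<le> (Z u)\<^sup>2 + (zeta u l e ^ 4)\<^sup>2" by (rule amgm)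
      then have "Z u * zeta u l e ^ 4 / (real n)\<^sup>2 \<le> ((Z u)\<^sup>2 + (zeta u l e ^ 4)\<^sup>2) / (real n)\<^sup>2"
        by (intro divide_right_mono) auto
      then show "Z u * xi u l e ^ 4 \<le> ((Z u)\<^sup>2 + \<bar>zeta u l e\<bar> ^ 8) / (real n)\<^sup>2"
        by (simp add: xi_def power_divide s4 flip: power_mult)
    qed
    have 3: "Z u * \<bar>?v u\<bar> \<le> (Z u)\<^sup>2 / sqrt n + sqrt n * (?v u)\<^sup>2"
    proof -
      have s: "0 < sqrt (real n)" using n0 by simp
      have "Z u * (sqrt n * \<bar>?v u\<bar>) \<le> (Z u)\<^sup>2 + (sqrt n * \<bar>?v u\<bar>)\<^sup>2" by (rule amgm)
      then have "Z u * (sqrt n * \<bar>?v u\<bar>) / sqrt n \<le> ((Z u)\<^sup>2 + (sqrt n * \<bar>?v u\<bar>)\<^sup>2) / sqrt n"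
        using s by (intro divide_right_mono) auto
      moreover have "Z u * (sqrt n * \<bar>?v u\<bar>) / sqrt n = Z u * \<bar>?v u\<bar>" using s by simp
      moreover have "(sqrt n * \<bar>?v u\<bar>)\<^sup>2 / sqrt n = sqrt n * (?v u)\<^sup>2"
        using s by (simp add: power_mult_distrib power2_eq_square)
      ultimately show ?thesis by (simp add: add_divide_distrib)
    qed
    show ?thesis using 1 2 3 unfolding d_def distrib_left by linarith
  qed
  note z4 = zeta_power[OF e lab[OF e], of 4]
  have z8: "integrable (entries K) (\<lambda>u. \<bar>zeta u l e\<bar> ^ 8)" "(LINT u|(entries K). \<bar>zeta u l e\<bar> ^ 8) = mom 8"
    if "l < n" for l using zeta_power[OF e that, of 8] by auto
  note v = zeta_variance[OF e]
  have i1: "integrable (entries K) (\<lambda>u. (Z u)\<^sup>2 / n + \<bar>zeta u (lab e) e\<bar> ^ 4 / n)"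
    using Zi z4 by (intro Bochner_Integration.integrable_add integrable_divide) auto
  have i2: "integrable (entries K) (\<lambda>u. \<Sum>l<n. ((Z u)\<^sup>2 + \<bar>zeta u l e\<bar> ^ 8) / (real n)\<^sup>2)"
    using Zi z8 by (intro Bochner_Integration.integrable_sum integrable_divide Bochner_Integration.integrable_add) auto
  have i3: "integrable (entries K) (\<lambda>u. (Z u)\<^sup>2 / sqrt n + sqrt n * (?v u)\<^sup>2)"
    using Zi v by (intro Bochner_Integration.integrable_add integrable_divide integrable_mult_right) auto
  have iF: "integrable (entries K) ?F"
    by (intro Bochner_Integration.integrable_add i1 i2 i3)
  have Zm: "Z \<in> borel_measurable (entries K)"
    unfolding Z_def using Od lab by (intro borel_measurable_prod borel_measurable_abs zeta_measurable) auto
  have dm: "d \<in> borel_measurable (entries K)"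
    unfolding d_def using e lab
    by (intro borel_measurable_add borel_measurable_power borel_measurable_sum borel_measurable_abs
        borel_measurable_diff xi_measurable borel_measurable_const) auto
  have d0: "0 \<le> d u" for u
    unfolding d_def by (intro add_nonneg_nonneg sum_nonneg) auto
  have m: "(\<lambda>u. Z u * d u) \<in> borel_measurable (entries K)" using Zm dm by (rule borel_measurable_times)
  show i: "integrable (entries K) (\<lambda>u. Z u * d u)"
  proof (rule Bochner_Integration.integrable_bound[OF iF m], intro always_eventually allI)
    fix u show "norm (Z u * d u) \<le> norm (?F u)" using le[of u] Z0[of u] d0[of u] by simp
  qed
  have n1: "1 / real n \<le> 1 / sqrt n"
  proof -
    have "sqrt (real n) * 1 \<le> sqrt (real n) * sqrt (real n)"
      using sqrt_n_ge_1 by (intro mult_left_mono) auto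
    then have "sqrt (real n) \<le> real n" by simp
    then show ?thesis using n_pos by (intro divide_left_mono) auto
  qed
  have I1: "(LINT u|(entries K). (Z u)\<^sup>2 / n + \<bar>zeta u (lab e) e\<bar> ^ 4 / n) \<le> (?M + mom 4) * (1 / sqrt n)"
  proof -
    have "(LINT u|(entries K). (Z u)\<^sup>2 / n + \<bar>zeta u (lab e) e\<bar> ^ 4 / n)
        = ((LINT u|(entries K). (Z u)\<^sup>2) + mom 4) * (1 / n)"
      using Zi z4 by (simp add: add_divide_distrib)
    also have "\<dots> \<le> (?M + mom 4) * (1 / sqrt n)"
      using Z n1 mom_nonneg mom_bound_ge_1[of "2 * card E"] by (intro mult_mono) (auto intro: order_trans[of 0 1])
    finally show ?thesis .
  qed
  have I2: "(LINT u|(entries K). (\<Sum>l<n. ((Z u)\<^sup>2 + \<bar>zeta u l e\<bar> ^ 8) / (real n)\<^sup>2)) \<le> (?M + mom 8) * (1 / sqrt n)"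
  proof -
    have "(LINT u|(entries K). (\<Sum>l<n. ((Z u)\<^sup>2 + \<bar>zeta u l e\<bar> ^ 8) / (real n)\<^sup>2))
        = (\<Sum>l<n. ((LINT u|(entries K). (Z u)\<^sup>2) + mom 8) / (real n)\<^sup>2)"
      using Zi z8 by (subst Bochner_Integration.integral_sum) auto
    also have "\<dots> = ((LINT u|(entries K). (Z u)\<^sup>2) + mom 8) * (1 / n)"
      using n_pos by (simp add: power2_eq_square)
    also have "\<dots> \<le> (?M + mom 8) * (1 / sqrt n)"
      using Z n1 mom_nonneg mom_bound_ge_1[of "2 * card E"] by (intro mult_mono) (auto intro: order_trans[of 0 1])
    finally show ?thesis .
  qed
  have I3: "(LINT u|(entries K). (Z u)\<^sup>2 / sqrt n + sqrt n * (?v u)\<^sup>2) \<le> (?M + mom 4) * (1 / sqrt n)"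
  proof -
    have "(LINT u|(entries K). (Z u)\<^sup>2 / sqrt n + sqrt n * (?v u)\<^sup>2)
        = (LINT u|(entries K). (Z u)\<^sup>2) / sqrt n + sqrt n * (LINT u|(entries K). (?v u)\<^sup>2)"
      using Zi v by simp
    also have "\<dots> \<le> ?M / sqrt n + sqrt n * (mom 4 / n)"
      using Z v(2) by (intro add_mono divide_right_mono mult_left_mono) auto
    also have "sqrt n * (mom 4 / n) = mom 4 / sqrt n"
      using n_pos by (simp add: field_simps)
    finally show ?thesis by (simp add: add_divide_distrib)
  qed
  have "(LINT u|(entries K). Z u * d u) \<le> (LINT u|(entries K). ?F u)"
    using le by (intro integral_mono i iF) auto
  also have "\<dots> = (LINT u|(entries K). (Z u)\<^sup>2 / n + \<bar>zeta u (lab e) e\<bar> ^ 4 / n) +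
      ((LINT u|(entries K). (\<Sum>l<n. ((Z u)\<^sup>2 + \<bar>zeta u l e\<bar> ^ 8) / (real n)\<^sup>2)) +
       (LINT u|(entries K). (Z u)\<^sup>2 / sqrt n + sqrt n * (?v u)\<^sup>2))"
    using Bochner_Integration.integral_add[OF i1 Bochner_Integration.integrable_add[OF i2 i3]]
      Bochner_Integration.integral_add[OF i2 i3] by simp
  also have "\<dots> \<le> (?M + mom 4) * (1 / sqrt n) + ((?M + mom 8) * (1 / sqrt n) + (?M + mom 4) * (1 / sqrt n))"
    by (intro add_mono I1 I2 I3)
  also have "\<dots> = (3 * ?M + 2 * mom 4 + mom 8) / sqrt n" by (simp add: add_divide_distrib distrib_right)
  finally show "(LINT u|(entries K). Z u * d u) \<le> (3 * ?M + 2 * mom 4 + mom 8) / sqrt n" .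
qed

text \<open>On an edge of \<open>Od\<close> the factor behaves like \<open>xi\<close> times the
  Gaussian average of the derivative, elsewhere like the Gaussian average of the function. These
  averages are deterministic, and what remains is the expectation in
  \<open>prod_zeta_expectation\<close>.\<close>

lemma EPsi_limit:
  assumes Od: "Od \<subseteq> E" and lab: "\<And>e. e \<in> E \<Longrightarrow> lab e < n"
    and row2: "\<And>l i. card {e \<in> Od. lab e = l \<and> row e = i} \<in> {0, 2}"
    and col2: "\<And>l j. card {e \<in> Od. lab e = l \<and> col e = j} \<in> {0, 2}"
    and B: "\<And>e r x. e \<in> E \<Longrightarrow> r \<le> 5 \<Longrightarrow> \<bar>(deriv ^^ r) (h e) x\<bar> \<le> B"
    and B1: "1 \<le> B"
  shows "\<bar>sqrt n ^ card Od * EPsi n (\<lambda>l. {e \<in> Od. lab e = l}) - (sw * sx) ^ card Od *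
      ((\<Prod>e\<in>Od. gauss ((sw * sx)\<^sup>2) (deriv (h e)) 0) * (\<Prod>e\<in>E - Od. gauss ((sw * sx)\<^sup>2) (h e) 0))\<bar>
    \<le> (2 * B) ^ card E * card E * (3 * mom_bound (2 * card E) + 2 * mom 4 + mom 8) / sqrt n"
proof -
  let ?s = "(sw * sx)\<^sup>2" and ?M = "3 * mom_bound (2 * card E) + 2 * mom 4 + mom 8"
  have finO: "finite Od" using Od fin_E finite_subset by blast
  let ?g = "\<lambda>e. if e \<in> Od then gauss ?s (deriv (h e)) 0 else gauss ?s (h e) 0"
  define a where "a u e = parity_part n (h e) (\<lambda>l. e \<in> {e \<in> Od. lab e = l}) (\<lambda>l. xi u l e) 0" for u e
  define b where "b u e = (if e \<in> Od then xi u (lab e) e else 1) * ?g e" for u e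
  \<comment> \<open>\<open>y\<close> is the common size of \<open>a\<close> and \<open>b\<close>.
    The relative error \<open>d\<close> collects the cubic error of the odd variable, the
    replacement error and the fluctuation of the variance.\<close>
  define y where "y u e = (if e \<in> Od then \<bar>xi u (lab e) e\<bar> else 1)" for u e
  define d where "d u e = (xi u (lab e) e)\<^sup>2 +
    ((\<Sum>l<n. xi u l e ^ 4) + \<bar>(\<Sum>l<n. (xi u l e)\<^sup>2) - (sw * sx)\<^sup>2\<bar>)" for u e
  define Z where "Z u = (\<Prod>e\<in>Od. \<bar>zeta u (lab e) e\<bar>)" for u
  have Psi: "Psi n (\<lambda>l. {e \<in> Od. lab e = l}) u = (\<Prod>e\<in>E. a u e)" for u
    by (simp add: Psi_def a_def)
  have B0: "\<bar>h e x\<bar> \<le> B" and B1': "\<bar>deriv (h e) x\<bar> \<le> B" if "e \<in> E" for e x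
    using B[OF that, of 0 x] B[OF that, of 1 x] by auto
  have sm: "smooth_bounded (h e)" "smooth_bounded (deriv (h e))" if "e \<in> E" for e
    using h_smooth[OF that] smooth_bounded_deriv by auto
  have gb: "\<bar>?g e\<bar> \<le> B" if "e \<in> E" for e
    using gauss_bound[OF B0[OF that] smooth_bounded_measurable[OF sm(1)[OF that]], of ?s 0]
      gauss_bound[OF B1'[OF that] smooth_bounded_measurable[OF sm(2)[OF that]], of ?s 0] by simp
  have y0: "0 \<le> y u e" for u e by (simp add: y_def)
  have d0: "0 \<le> d u e" for u e unfolding d_def by (intro add_nonneg_nonneg sum_nonneg) auto
  have bb: "\<bar>b u e\<bar> \<le> (2 * B) * y u e" if "e \<in> E" for u e
  proof -
    have "\<bar>b u e\<bar> = y u e * \<bar>?g e\<bar>" by (simp add: b_def y_def abs_mult)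
    also have "\<dots> \<le> y u e * (2 * B)" using gb[OF that] B1 y0 by (intro mult_left_mono) auto
    finally show ?thesis by (simp add: mult.commute)
  qed
  have ab: "\<bar>a u e\<bar> \<le> (2 * B) * y u e \<and> \<bar>a u e - b u e\<bar> \<le> (2 * B) * y u e * d u e" if e: "e \<in> E" for u e
  proof (cases "e \<in> Od")
    case True
    let ?x = "xi u (lab e) e" and ?p = "parity_part n (deriv (h e)) (\<lambda>_. False) (\<lambda>l. xi u l e) 0"
    have aeq: "a u e = parity_part n (h e) (\<lambda>l. l = lab e) (\<lambda>l. xi u l e) 0"
      unfolding a_def using True by (intro arg_cong[where f="\<lambda>b. parity_part n (h e) b (\<lambda>l. xi u l e) 0"]) auto
    have set: "{l. l < n \<and> l = lab e} = {lab e}" using lab[OF e] by auto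
    have 0: "\<bar>a u e\<bar> \<le> B * \<bar>?x\<bar>"
      using parity_part_bound[OF sm(1)[OF e], of n "\<lambda>l. l = lab e" B "\<lambda>l. xi u l e" 0] B1'[OF e]
      unfolding aeq set by simp
    have 1: "\<bar>a u e - ?x * ?p\<bar> \<le> B * \<bar>?x\<bar> ^ 3"
      unfolding aeq by (rule parity_part_single[OF sm(1)[OF e] _ lab[OF e]]) (use B[OF e, of 3] in simp)
    \<comment> \<open>Four derivatives of \<open>deriv (h e)\<close> account for the order 5 in the
      hypothesis.\<close>
    have pd: "\<bar>(deriv ^^ r) (deriv (h e)) z\<bar> \<le> B" if "r \<le> 4" for r z
      using B[OF e, of "Suc r" z] that by (simp add: funpow_swap1)
    have 2: "\<bar>?p - ?g e\<bar> \<le> B * ((\<Sum>l<n. xi u l e ^ 4) + \<bar>(\<Sum>l<n. (xi u l e)\<^sup>2) - ?s\<bar>)"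
      using True parity_part_even_limit[OF sm(2)[OF e] pd, of ?s n "\<lambda>l. xi u l e"] by simp
    have "a u e - b u e = (a u e - ?x * ?p) + ?x * (?p - ?g e)"
      using True by (simp add: b_def algebra_simps)
    then have "\<bar>a u e - b u e\<bar> \<le> \<bar>a u e - ?x * ?p\<bar> + \<bar>?x\<bar> * \<bar>?p - ?g e\<bar>"
      by (metis abs_mult abs_triangle_ineq)
    also have "\<dots> \<le> B * \<bar>?x\<bar> ^ 3 + \<bar>?x\<bar> * (B * ((\<Sum>l<n. xi u l e ^ 4) + \<bar>(\<Sum>l<n. (xi u l e)\<^sup>2) - ?s\<bar>))"
      using 1 2 by (intro add_mono mult_left_mono) auto
    also have "\<dots> = B * \<bar>?x\<bar> * d u e"
      unfolding d_def by (simp add: algebra_simps power3_eq_cube power2_eq_square abs_mult_self_eq)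
    also have "\<dots> \<le> 2 * B * \<bar>?x\<bar> * d u e"
      using B1 d0[of u e] by (intro mult_right_mono) auto
    finally have 3: "\<bar>a u e - b u e\<bar> \<le> 2 * B * \<bar>?x\<bar> * d u e" .
    have "B * \<bar>?x\<bar> \<le> 2 * B * \<bar>?x\<bar>" using B1 by (intro mult_right_mono) auto
    then show ?thesis using 0 3 True by (simp add: y_def)
  next
    case False
    have aeq: "a u e = parity_part n (h e) (\<lambda>_. False) (\<lambda>l. xi u l e) 0"
      using False by (simp add: a_def)
    have 1: "\<bar>a u e\<bar> \<le> B" unfolding aeq by (rule parity_part_even_bound[OF sm(1)[OF e] B0[OF e]])
    have "\<bar>a u e - b u e\<bar> \<le> B * ((\<Sum>l<n. xi u l e ^ 4) + \<bar>(\<Sum>l<n. (xi u l e)\<^sup>2) - ?s\<bar>)"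
      unfolding aeq b_def using False B[OF e]
        parity_part_even_limit[OF sm(1)[OF e], of B ?s n "\<lambda>l. xi u l e"] by simp
    also have "\<dots> \<le> B * d u e"
      using B1 by (intro mult_left_mono) (auto simp: d_def)
    also have "\<dots> \<le> 2 * B * d u e" using B1 d0[of u e] by (intro mult_right_mono) auto
    finally show ?thesis using 1 False B1 by (simp add: y_def)
  qed
  have prody: "sqrt n ^ card Od * (\<Prod>e\<in>E. y u e) = Z u" for u
  proof -
    have "(\<Prod>e\<in>E. y u e) = (\<Prod>e\<in>Od. \<bar>xi u (lab e) e\<bar>)"
      using Od fin_E by (intro prod.mono_neutral_cong_right) (auto simp: y_def)
    also have "\<dots> = Z u / sqrt n ^ card Od"
      by (simp add: xi_def Z_def abs_divide prod_dividef)
    finally show ?thesis using n_pos by simp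
  qed
  have prodb: "sqrt n ^ card Od * (\<Prod>e\<in>E. b u e) = (\<Prod>e\<in>Od. zeta u (lab e) e) * (\<Prod>e\<in>E. ?g e)" for u
  proof -
    have "(\<Prod>e\<in>E. b u e) = (\<Prod>e\<in>E. if e \<in> Od then xi u (lab e) e else 1) * (\<Prod>e\<in>E. ?g e)"
      unfolding b_def by (rule prod.distrib)
    also have "(\<Prod>e\<in>E. if e \<in> Od then xi u (lab e) e else 1) = (\<Prod>e\<in>Od. xi u (lab e) e)"
      using Od fin_E by (intro prod.mono_neutral_cong_right) auto
    also have "\<dots> = (\<Prod>e\<in>Od. zeta u (lab e) e) / sqrt n ^ card Od"
      by (simp add: xi_def prod_dividef)
    finally show ?thesis using n_pos by simp
  qed
  have prodg: "(\<Prod>e\<in>E. ?g e) = (\<Prod>e\<in>Od. gauss ?s (deriv (h e)) 0) * (\<Prod>e\<in>E - Od. gauss ?s (h e) 0)"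
    using prod.subset_diff[OF Od fin_E, of ?g] by (simp add: mult.commute)
  have pz1: "(LINT u|(entries K). (\<Prod>e\<in>Od. zeta u (lab e) e)) = (sw * sx) ^ card Od"
    by (rule prod_zeta_expectation(1)[OF Od lab row2 col2])
  have pz2: "integrable (entries K) (\<lambda>u. \<Prod>e\<in>Od. zeta u (lab e) e)"
    by (rule prod_zeta_expectation(2)[OF Od lab row2 col2])
  have pt: "\<bar>sqrt n ^ card Od * Psi n (\<lambda>l. {e \<in> Od. lab e = l}) u - (\<Prod>e\<in>Od. zeta u (lab e) e) * (\<Prod>e\<in>E. ?g e)\<bar>
      \<le> (2 * B) ^ card E * (\<Sum>e\<in>E. Z u * d u e)" for u
  proof -
    have "\<bar>(\<Prod>e\<in>E. a u e) - (\<Prod>e\<in>E. b u e)\<bar> \<le> (2 * B) ^ card E * (\<Prod>e\<in>E. y u e) * (\<Sum>e\<in>E. d u e)"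
      using abs_prod_diff_le[of E "2 * B" "y u" "d u" "a u" "b u"] fin_E B1 y0 d0 ab bb by simp
    then have "sqrt n ^ card Od * \<bar>(\<Prod>e\<in>E. a u e) - (\<Prod>e\<in>E. b u e)\<bar>
        \<le> sqrt n ^ card Od * ((2 * B) ^ card E * (\<Prod>e\<in>E. y u e) * (\<Sum>e\<in>E. d u e))"
      by (rule mult_left_mono) simp
    moreover have "sqrt n ^ card Od * \<bar>(\<Prod>e\<in>E. a u e) - (\<Prod>e\<in>E. b u e)\<bar>
        = \<bar>sqrt n ^ card Od * (\<Prod>e\<in>E. a u e) - sqrt n ^ card Od * (\<Prod>e\<in>E. b u e)\<bar>"
      by (simp add: abs_mult flip: right_diff_distrib)
    moreover have "sqrt n ^ card Od * ((2 * B) ^ card E * (\<Prod>e\<in>E. y u e) * (\<Sum>e\<in>E. d u e))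
        = (2 * B) ^ card E * ((sqrt n ^ card Od * (\<Prod>e\<in>E. y u e)) * (\<Sum>e\<in>E. d u e))"
      by (simp add: mult_ac)
    ultimately show ?thesis unfolding Psi prodb prody sum_distrib_left by simp
  qed
  have we: "integrable (entries K) (\<lambda>u. Z u * d u e)"
    "(LINT u|(entries K). Z u * d u e) \<le> ?M / sqrt n" if "e \<in> E" for e
    unfolding Z_def d_def using weighted_error[where lab = lab, OF Od lab that] by auto
  have iP: "integrable (entries K) (\<lambda>u. sqrt n ^ card Od * Psi n (\<lambda>l. {e \<in> Od. lab e = l}) u)"
    by (intro integrable_mult_right Psi_integrable) simp
  have iz: "integrable (entries K) (\<lambda>u. (\<Prod>e\<in>Od. zeta u (lab e) e) * (\<Prod>e\<in>E. ?g e))"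
    using pz2 by (rule integrable_mult_left)
  have eq: "sqrt n ^ card Od * EPsi n (\<lambda>l. {e \<in> Od. lab e = l}) - (sw * sx) ^ card Od * (\<Prod>e\<in>E. ?g e)
      = (LINT u|(entries K). sqrt n ^ card Od * Psi n (\<lambda>l. {e \<in> Od. lab e = l}) u
          - (\<Prod>e\<in>Od. zeta u (lab e) e) * (\<Prod>e\<in>E. ?g e))"
    unfolding Bochner_Integration.integral_diff[OF iP iz] integral_mult_right_zero integral_mult_left_zero
      EPsi_def by (simp only: pz1)
  have "\<bar>sqrt n ^ card Od * EPsi n (\<lambda>l. {e \<in> Od. lab e = l}) - (sw * sx) ^ card Od * (\<Prod>e\<in>E. ?g e)\<bar>
      \<le> (LINT u|(entries K). \<bar>sqrt n ^ card Od * Psi n (\<lambda>l. {e \<in> Od. lab e = l}) u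
          - (\<Prod>e\<in>Od. zeta u (lab e) e) * (\<Prod>e\<in>E. ?g e)\<bar>)"
    unfolding eq by (rule integral_abs_bound)
  also have "\<dots> \<le> (LINT u|(entries K). (2 * B) ^ card E * (\<Sum>e\<in>E. Z u * d u e))"
    using pt we(1) iP iz
    by (intro integral_mono integrable_abs Bochner_Integration.integrable_diff integrable_mult_right
        Bochner_Integration.integrable_sum) auto
  also have "\<dots> = (2 * B) ^ card E * (\<Sum>e\<in>E. LINT u|(entries K). Z u * d u e)"
    unfolding integral_mult_right_zero using we(1) by (subst Bochner_Integration.integral_sum) auto
  also have "\<dots> \<le> (2 * B) ^ card E * (\<Sum>e\<in>E. ?M / sqrt n)"
    using we(2) B1 by (intro mult_left_mono sum_mono) auto
  also have "\<dots> = (2 * B) ^ card E * card E * ?M / sqrt n" by simp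
  finally show ?thesis unfolding prodg .
qed

end

section \<open>The closed walk of a pair of index functions\<close>

text \<open>Rows and columns alternate as \<open>i 1, j 1, i 2, j 2, ...\<close>, which is the
  interlacing of \<open>W\<close> and \<open>V\<close>; the sum type keeps a row and a column apart
  even if their numbers agree.\<close>

definition walk :: "nat \<Rightarrow> (nat \<Rightarrow> nat) \<Rightarrow> (nat \<Rightarrow> nat) \<Rightarrow> (nat + nat) list"
  where "walk k i j = map (\<lambda>q. if even q then Inl (i (Suc (q div 2))) else Inr (j (Suc (q div 2)))) [0..<2 * k]"

definition kern :: "nat \<Rightarrow> (nat \<Rightarrow> nat) \<Rightarrow> nat set set"
  where "kern k i = (\<lambda>x. {s \<in> {1..k}. i s = x}) ` i ` {1..k}"

lemma length_walk [simp]: "length (walk k i j) = 2 * k"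
  by (simp add: walk_def)

lemma walk_nth:
  "a \<in> {1..k} \<Longrightarrow> walk k i j ! (2 * (a - 1)) = Inl (i a)"
  "a \<in> {1..k} \<Longrightarrow> walk k i j ! (2 * (a - 1) + 1) = Inr (j a)"
  by (auto simp: walk_def nth_append)

lemma walk_position:
  assumes "q < 2 * k"
  obtains a where "a \<in> {1..k}" "q = 2 * (a - 1)" "walk k i j ! q = Inl (i a)"
  | a where "a \<in> {1..k}" "q = 2 * (a - 1) + 1" "walk k i j ! q = Inr (j a)"
proof (cases "even q")
  case True
  then obtain r where r: "q = 2 * r" by (elim evenE)
  have "Suc r \<in> {1..k}" "q = 2 * (Suc r - 1)" using assms r by auto
  then show ?thesis using that(1)[of "Suc r"] walk_nth(1)[of "Suc r" k i j] by simp
next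
  case False
  then obtain r where r: "q = 2 * r + 1" by (elim oddE)
  have "Suc r \<in> {1..k}" "q = 2 * (Suc r - 1) + 1" using assms r by auto
  then show ?thesis using that(2)[of "Suc r"] walk_nth(2)[of "Suc r" k i j] by simp
qed

lemma set_walk: "set (walk k i j) = Inl ` i ` {1..k} \<union> Inr ` j ` {1..k}"
proof
  show "set (walk k i j) \<subseteq> Inl ` i ` {1..k} \<union> Inr ` j ` {1..k}"
  proof
    fix x assume "x \<in> set (walk k i j)"
    then obtain q where q: "q < 2 * k" "x = walk k i j ! q" by (auto simp: in_set_conv_nth)
    show "x \<in> Inl ` i ` {1..k} \<union> Inr ` j ` {1..k}"
      by (rule walk_position[OF q(1), of i j]) (use q(2) in auto)
  qed
  have "Inl (i a) \<in> set (walk k i j) \<and> Inr (j a) \<in> set (walk k i j)" if a: "a \<in> {1..k}" for a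
  proof -
    have "2 * (a - 1) + 1 < length (walk k i j)" using a by auto
    then show ?thesis
      using walk_nth[OF a, of i j] nth_mem[of "2 * (a - 1) + 1" "walk k i j"] nth_mem[of "2 * (a - 1)" "walk k i j"]
      by simp
  qed
  then show "Inl ` i ` {1..k} \<union> Inr ` j ` {1..k} \<subseteq> set (walk k i j)" by auto
qed

lemma card_kern: "card (kern k i) = card (i ` {1..k})"
  unfolding kern_def
proof (intro card_image inj_onI)
  fix x y assume "x \<in> i ` {1..k}" and eq: "{s \<in> {1..k}. i s = x} = {s \<in> {1..k}. i s = y}"
  then obtain a where "a \<in> {1..k}" "i a = x" by blast
  then have "a \<in> {s \<in> {1..k}. i s = y}" unfolding eq[symmetric] by simp
  then show "x = y" using \<open>i a = x\<close> by simp
qed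

lemma card_set_walk: "card (set (walk k i j)) = card (kern k i) + card (kern k j)"
  unfolding set_walk card_kern by (subst card_Un_disjoint) (auto simp: card_image inj_on_def)

lemma kern_same_block: "same_block (kern k i) s t \<longleftrightarrow> s \<in> {1..k} \<and> t \<in> {1..k} \<and> i s = i t"
  by (auto simp: same_block_def kern_def)

lemma kern_partition: "partition_on {1..k} (kern k i)"
proof (rule partition_onI)
  show "\<Union>(kern k i) = {1..k}" by (auto simp: kern_def)
  show "disjnt B C" if BC: "B \<in> kern k i" "C \<in> kern k i" "B \<noteq> C" for B C
  proof -
    obtain x y where xy: "B = {s \<in> {1..k}. i s = x}" "C = {s \<in> {1..k}. i s = y}"
      using BC(1,2) unfolding kern_def by blast
    then have "x \<noteq> y" using BC(3) by auto
    then show ?thesis unfolding xy disjnt_def by auto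
  qed
  show "{} \<notin> kern k i" unfolding kern_def by blast
qed

lemma kern_noncrossing:
  "kern k i \<in> noncrossing_partitions {1..k} \<longleftrightarrow>
    (\<forall>a\<in>{1..k}. \<forall>b\<in>{1..k}. \<forall>c\<in>{1..k}. \<forall>d\<in>{1..k}. a < b \<longrightarrow> b < c \<longrightarrow> c < d \<longrightarrow>
      i a = i c \<longrightarrow> i b = i d \<longrightarrow> i a = i b)" (is "_ \<longleftrightarrow> ?R")
proof
  assume nc: "kern k i \<in> noncrossing_partitions {1..k}"
  show ?R
  proof (intro ballI impI)
    fix a b c d assume x: "a \<in> {1..k}" "b \<in> {1..k}" "c \<in> {1..k}" "d \<in> {1..k}" "a < b" "b < c" "c < d"
      "i a = i c" "i b = i d"
    have "same_block (kern k i) a b"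
      by (rule same_block_noncrossing[OF nc, of a c b d]) (use x in \<open>auto simp: kern_same_block\<close>)
    then show "i a = i b" by (simp add: kern_same_block)
  qed
next
  assume R: ?R
  have "B = C" if BC: "B \<in> kern k i" "C \<in> kern k i"
    and x: "a \<in> B" "c \<in> B" "b \<in> C" "d \<in> C" "a < b" "b < c" "c < d" for B C a b c d
  proof -
    obtain x y where xy: "B = {s \<in> {1..k}. i s = x}" "C = {s \<in> {1..k}. i s = y}"
      using BC by (auto simp: kern_def)
    have "i a = i b" using R[rule_format, of a b c d] x xy by simp
    then show ?thesis using x xy by simp
  qed
  then show "kern k i \<in> noncrossing_partitions {1..k}"
    unfolding noncrossing_partitions_def using kern_partition by blast
qed

lemma subseq_Cons_nth: "subseq (x # ys) zs \<longleftrightarrow> (\<exists>a<length zs. zs ! a = x \<and> subseq ys (drop (Suc a) zs))"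
proof
  assume "subseq (x # ys) zs"
  then obtain us vs where "zs = us @ x # vs" "subseq ys vs" by (auto dest!: list_emb_ConsD)
  then show "\<exists>a<length zs. zs ! a = x \<and> subseq ys (drop (Suc a) zs)"
    by (intro exI[of _ "length us"]) auto
next
  assume "\<exists>a<length zs. zs ! a = x \<and> subseq ys (drop (Suc a) zs)"
  then obtain a where a: "a < length zs" "zs ! a = x" "subseq ys (drop (Suc a) zs)" by blast
  have "zs = take a zs @ x # drop (Suc a) zs" using a id_take_nth_drop by blast
  moreover have "subseq (x # ys) (take a zs @ x # drop (Suc a) zs)"
    using a(3) by (intro list_emb_append2) simp
  ultimately show "subseq (x # ys) zs" by simp
qed

lemma noncrossing_walk_nth:
  "noncrossing_walk xs \<longleftrightarrow> (\<forall>a b c d. a < b \<longrightarrow> b < c \<longrightarrow> c < d \<longrightarrow> d < length xs \<longrightarrow>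
    xs ! a = xs ! c \<longrightarrow> xs ! b = xs ! d \<longrightarrow> xs ! a = xs ! b)" (is "_ \<longleftrightarrow> ?R")
proof
  assume nc: "noncrossing_walk xs"
  show ?R
  proof (intro allI impI)
    fix a b c d assume x: "a < b" "b < c" "c < d" "d < length xs" "xs ! a = xs ! c" "xs ! b = xs ! d"
    have "subseq [xs ! a, xs ! b, xs ! c, xs ! d] xs"
      unfolding subseq_Cons_nth[of "xs ! a"]
    proof (intro exI[of _ a] conjI)
      show "subseq [xs ! b, xs ! c, xs ! d] (drop (Suc a) xs)"
        unfolding subseq_Cons_nth[of "xs ! b"]
      proof (intro exI[of _ "b - Suc a"] conjI)
        show "subseq [xs ! c, xs ! d] (drop (Suc (b - Suc a)) (drop (Suc a) xs))"
          unfolding subseq_Cons_nth[of "xs ! c"]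
        proof (intro exI[of _ "c - Suc b"] conjI)
          show "subseq [xs ! d] (drop (Suc (c - Suc b)) (drop (Suc (b - Suc a)) (drop (Suc a) xs)))"
            unfolding subseq_Cons_nth[of "xs ! d"]
            by (intro exI[of _ "d - Suc c"] conjI) (use x in auto)
        qed (use x in auto)
      qed (use x in auto)
    qed (use x in auto)
    then show "xs ! a = xs ! b" using nc x unfolding noncrossing_walk_def by metis
  qed
next
  assume R: ?R
  show "noncrossing_walk xs"
    unfolding noncrossing_walk_def
  proof (intro allI impI notI)
    fix u v assume uv: "u \<noteq> v" and "subseq [u, v, u, v] xs"
    then obtain a b c d where a: "a < length xs" "xs ! a = u"
      and b: "b < length (drop (Suc a) xs)" "drop (Suc a) xs ! b = v"
      and c: "c < length (drop (Suc b) (drop (Suc a) xs))" "drop (Suc b) (drop (Suc a) xs) ! c = u"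
      and d: "d < length (drop (Suc c) (drop (Suc b) (drop (Suc a) xs)))"
        "drop (Suc c) (drop (Suc b) (drop (Suc a) xs)) ! d = v"
      unfolding subseq_Cons_nth by blast
    let ?b = "Suc a + b" and ?c = "Suc (Suc a + b) + c" and ?d = "Suc (Suc (Suc a + b) + c) + d"
    have "xs ! a = xs ! ?b"
      by (rule R[rule_format, of a ?b ?c ?d]) (use a b c d in \<open>auto simp: add_ac\<close>)
    then show False using a b uv by simp
  qed
qed

text \<open>A crossing of two row pairs or two column pairs is one in the respective kernel. A
  crossing of a row pair \<open>s, t\<close> with a column pair \<open>x, y\<close> is excluded
  outright, as rows and columns never coincide, and it means precisely that \<open>{x+1..y}\<close>
  contains just one of \<open>s\<close>, \<open>t\<close>.\<close>

lemma W_same_iff_walk: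
  "noncrossing_walk (walk k i j) \<longleftrightarrow>
    kern k j \<in> noncrossing_partitions {1..k} \<and> kern k i \<in> compatible_partitions k (kern k j)"
    (is "?L \<longleftrightarrow> ?R")
proof
  assume ?L
  then have nc: "walk k i j ! a = walk k i j ! b"
    if "a < b" "b < c" "c < d" "d < 2 * k" "walk k i j ! a = walk k i j ! c" "walk k i j ! b = walk k i j ! d"
    for a b c d
    using that unfolding noncrossing_walk_nth length_walk by blast
  have 1: "kern k j \<in> noncrossing_partitions {1..k}"
    unfolding kern_noncrossing
  proof (intro ballI impI)
    fix a b c d assume x: "a \<in> {1..k}" "b \<in> {1..k}" "c \<in> {1..k}" "d \<in> {1..k}" "a < b" "b < c" "c < d"
      "j a = j c" "j b = j d"
    have "walk k i j ! (2 * (a - 1) + 1) = walk k i j ! (2 * (b - 1) + 1)"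
      by (rule nc[of _ _ "2 * (c - 1) + 1" "2 * (d - 1) + 1"]) (use x walk_nth(2) in auto)
    then show "j a = j b" using x walk_nth(2) by simp
  qed
  have 2: "kern k i \<in> noncrossing_partitions {1..k}"
    unfolding kern_noncrossing
  proof (intro ballI impI)
    fix a b c d assume x: "a \<in> {1..k}" "b \<in> {1..k}" "c \<in> {1..k}" "d \<in> {1..k}" "a < b" "b < c" "c < d"
      "i a = i c" "i b = i d"
    have "walk k i j ! (2 * (a - 1)) = walk k i j ! (2 * (b - 1))"
      by (rule nc[of _ _ "2 * (c - 1)" "2 * (d - 1)"]) (use x walk_nth(1) in auto)
    then show "i a = i b" using x walk_nth(1) by simp
  qed
  \<comment> \<open>On the walk \<open>i s\<close> precedes \<open>j x\<close> exactly if
    \<open>s \<le> x\<close>, hence the mixture of weak and strict inequalities.\<close>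
  have 3: False if st: "s \<in> {1..k}" "t \<in> {1..k}" "i s = i t" and xy: "x \<in> {1..k}" "y \<in> {1..k}" "j x = j y"
    and o: "s \<le> x \<and> x < t \<and> t \<le> y \<or> x < s \<and> s \<le> y \<and> y < t" for s t x y
    using o
  proof
    assume o: "s \<le> x \<and> x < t \<and> t \<le> y"
    have "walk k i j ! (2 * (s - 1)) = walk k i j ! (2 * (x - 1) + 1)"
      by (rule nc[of _ _ "2 * (t - 1)" "2 * (y - 1) + 1"]) (use st xy o walk_nth in auto)
    then show False using st xy walk_nth by simp
  next
    assume o: "x < s \<and> s \<le> y \<and> y < t"
    have "walk k i j ! (2 * (x - 1) + 1) = walk k i j ! (2 * (s - 1))"
      by (rule nc[of _ _ "2 * (y - 1) + 1" "2 * (t - 1)"]) (use st xy o walk_nth in auto)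
    then show False using st xy walk_nth by simp
  qed
  have "W_same (kern k j) s t" if st: "same_block (kern k i) s t" for s t
  proof (rule W_sameI)
    fix x y assume xy: "x < y" "same_block (kern k j) x y"
    note st' = st[unfolded kern_same_block] and xy' = xy(2)[unfolded kern_same_block]
    have "\<not> (s \<le> x \<and> x < t \<and> t \<le> y \<or> x < s \<and> s \<le> y \<and> y < t)" using 3[of s t x y] st' xy' by blast
    moreover have "\<not> (t \<le> x \<and> x < s \<and> s \<le> y \<or> x < t \<and> t \<le> y \<and> y < s)" using 3[of t s x y] st' xy' by force
    ultimately show "(s \<in> {x+1..y}) = (t \<in> {x+1..y})" by auto
  qed
  then show ?R using 1 2 by (simp add: compatible_partitions_def)
next
  assume R: ?R
  then have j: "kern k j \<in> noncrossing_partitions {1..k}" and i: "kern k i \<in> noncrossing_partitions {1..k}"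
    and ws: "\<And>s t. same_block (kern k i) s t \<Longrightarrow> W_same (kern k j) s t"
    by (auto simp: compatible_partitions_def)
  have no: False if "s \<in> {1..k}" "t \<in> {1..k}" "i s = i t" "x \<in> {1..k}" "y \<in> {1..k}" "j x = j y" "x < y"
    "(s \<in> {x+1..y}) \<noteq> (t \<in> {x+1..y})" for s t x y
    using W_sameD[OF ws, of s t x y] that by (simp add: kern_same_block)
  show ?L
    unfolding noncrossing_walk_nth length_walk
  proof (intro allI impI)
    fix a b c d assume x: "a < b" "b < c" "c < d" "d < 2 * k"
      "walk k i j ! a = walk k i j ! c" "walk k i j ! b = walk k i j ! d"
    have l: "a < 2 * k" "b < 2 * k" "c < 2 * k" using x by auto
    show "walk k i j ! a = walk k i j ! b"
    proof (rule walk_position[OF l(1), of i j])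
      fix a' assume a': "a' \<in> {1..k}" "a = 2 * (a' - 1)" "walk k i j ! a = Inl (i a')"
      then obtain c' where c': "c' \<in> {1..k}" "c = 2 * (c' - 1)" "i a' = i c'"
        by (rule_tac walk_position[OF l(3), of i j]) (use x(5) in auto)
      show ?thesis
      proof (rule walk_position[OF l(2), of i j])
        fix b' assume b': "b' \<in> {1..k}" "b = 2 * (b' - 1)" "walk k i j ! b = Inl (i b')"
        then obtain d' where d': "d' \<in> {1..k}" "d = 2 * (d' - 1)" "i b' = i d'"
          by (rule_tac walk_position[OF x(4), of i j]) (use x(6) in auto)
        have o: "2 * (a' - 1) < 2 * (b' - 1)" "2 * (b' - 1) < 2 * (c' - 1)" "2 * (c' - 1) < 2 * (d' - 1)"
          using x(1-3) unfolding a'(2) b'(2) c'(2) d'(2) .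
        have "i a' = i b'"
          using i[unfolded kern_noncrossing, rule_format, OF a'(1) b'(1) c'(1) d'(1)] o c'(3) d'(3) by simp
        then show ?thesis using a' b' by simp
      next
        fix b' assume b': "b' \<in> {1..k}" "b = 2 * (b' - 1) + 1" "walk k i j ! b = Inr (j b')"
        then obtain d' where d': "d' \<in> {1..k}" "d = 2 * (d' - 1) + 1" "j b' = j d'"
          by (rule_tac walk_position[OF x(4), of i j]) (use x(6) in auto)
        have o: "2 * (a' - 1) < 2 * (b' - 1) + 1" "2 * (b' - 1) + 1 < 2 * (c' - 1)" "2 * (c' - 1) < 2 * (d' - 1) + 1"
          using x(1-3) unfolding a'(2) b'(2) c'(2) d'(2) .
        have p: "1 \<le> a'" "1 \<le> b'" "1 \<le> c'" "1 \<le> d'" using a'(1) b'(1) c'(1) d'(1) by auto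
        have "a' \<le> b'" "b' < c'" "c' \<le> d'" using o p by arith+
        then have False using no[OF a'(1) c'(1,3) b'(1) d'(1,3)] by simp
        then show ?thesis ..
      qed
    next
      fix a' assume a': "a' \<in> {1..k}" "a = 2 * (a' - 1) + 1" "walk k i j ! a = Inr (j a')"
      then obtain c' where c': "c' \<in> {1..k}" "c = 2 * (c' - 1) + 1" "j a' = j c'"
        by (rule_tac walk_position[OF l(3), of i j]) (use x(5) in auto)
      show ?thesis
      proof (rule walk_position[OF l(2), of i j])
        fix b' assume b': "b' \<in> {1..k}" "b = 2 * (b' - 1) + 1" "walk k i j ! b = Inr (j b')"
        then obtain d' where d': "d' \<in> {1..k}" "d = 2 * (d' - 1) + 1" "j b' = j d'"
          by (rule_tac walk_position[OF x(4), of i j]) (use x(6) in auto)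
        have o: "2 * (a' - 1) + 1 < 2 * (b' - 1) + 1" "2 * (b' - 1) + 1 < 2 * (c' - 1) + 1" "2 * (c' - 1) + 1 < 2 * (d' - 1) + 1"
          using x(1-3) unfolding a'(2) b'(2) c'(2) d'(2) .
        have "j a' = j b'"
          using j[unfolded kern_noncrossing, rule_format, OF a'(1) b'(1) c'(1) d'(1)] o c'(3) d'(3) by simp
        then show ?thesis using a' b' by simp
      next
        fix b' assume b': "b' \<in> {1..k}" "b = 2 * (b' - 1)" "walk k i j ! b = Inl (i b')"
        then obtain d' where d': "d' \<in> {1..k}" "d = 2 * (d' - 1)" "i b' = i d'"
          by (rule_tac walk_position[OF x(4), of i j]) (use x(6) in auto)
        have o: "2 * (a' - 1) + 1 < 2 * (b' - 1)" "2 * (b' - 1) < 2 * (c' - 1) + 1" "2 * (c' - 1) + 1 < 2 * (d' - 1)"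
          using x(1-3) unfolding a'(2) b'(2) c'(2) d'(2) .
        have p: "1 \<le> a'" "1 \<le> b'" "1 \<le> c'" "1 \<le> d'" using a'(1) b'(1) c'(1) d'(1) by auto
        have "a' < b'" "b' \<le> c'" "c' < d'" using o p by arith+
        then have False using no[OF b'(1) d'(1,3) a'(1) c'(1,3)] by simp
        then show ?thesis ..
      qed
    qed
  qed
qed

section \<open>Steps of the walk and their multiplicities\<close>

lemma path_edges_nth: "Suc q < length xs \<Longrightarrow> path_edges xs ! q = {xs ! q, xs ! Suc q}"
proof (induction xs arbitrary: q rule: path_edges.induct)
  case (3 x y zs)
  then show ?case by (cases q) auto
qed auto

lemma closed_edges_nth:
  assumes "q < length xs"
  shows "closed_edges xs ! q = {xs ! q, xs ! (Suc q mod length xs)}"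
proof -
  have ne: "xs \<noteq> []" using assms by auto
  have "closed_edges xs ! q = {(xs @ [hd xs]) ! q, (xs @ [hd xs]) ! Suc q}"
    unfolding closed_edges_def using assms by (intro path_edges_nth) simp
  also have "(xs @ [hd xs]) ! q = xs ! q" using assms by (simp add: nth_append)
  also have "(xs @ [hd xs]) ! Suc q = xs ! (Suc q mod length xs)"
  proof (cases "Suc q = length xs")
    case True
    then show ?thesis using ne by (simp add: nth_append hd_conv_nth)
  next
    case False
    then show ?thesis using assms by (simp add: nth_append)
  qed
  finally show ?thesis .
qed

definition edge_out :: "(nat \<Rightarrow> nat) \<Rightarrow> (nat \<Rightarrow> nat) \<Rightarrow> nat \<Rightarrow> (nat + nat) set"
  where "edge_out i j a = {Inl (i a), Inr (j a)}"

definition edge_back :: "nat \<Rightarrow> (nat \<Rightarrow> nat) \<Rightarrow> (nat \<Rightarrow> nat) \<Rightarrow> nat \<Rightarrow> (nat + nat) set"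
  where "edge_back k i j a = {Inl (i (cyc_next k a)), Inr (j a)}"

lemma closed_edges_walk_nth:
  assumes a: "a \<in> {1..k}"
  shows "closed_edges (walk k i j) ! (2 * (a - 1)) = edge_out i j a"
    and "closed_edges (walk k i j) ! (2 * (a - 1) + 1) = edge_back k i j a"
proof -
  have "Suc (2 * (a - 1)) mod (2 * k) = 2 * (a - 1) + 1" using a by auto
  then show "closed_edges (walk k i j) ! (2 * (a - 1)) = edge_out i j a"
    using a walk_nth[OF a, of i j] by (subst closed_edges_nth) (auto simp: edge_out_def)
  have "Suc (2 * (a - 1) + 1) mod (2 * k) = 2 * (cyc_next k a - 1) \<and> cyc_next k a \<in> {1..k}"
  proof -
    have "Suc (2 * (a - 1) + 1) = 2 * a" using a by (cases a) auto
    then show ?thesis using a by (cases "a = k") (auto simp: cyc_next_def)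
  qed
  then show "closed_edges (walk k i j) ! (2 * (a - 1) + 1) = edge_back k i j a"
    using a walk_nth(2)[OF a, of i j] walk_nth(1)[of "cyc_next k a" k i j]
    by (subst closed_edges_nth) (auto simp: edge_back_def)
qed

lemma sum_pairs: "(\<Sum>q<2 * k. g q) = (\<Sum>a=1..k. g (2 * (a - 1)) + g (2 * (a - 1) + 1))"
  for g :: "nat \<Rightarrow> 'b :: comm_monoid_add"
  by (induction k) (auto simp: add_ac)

lemma prod_pairs: "(\<Prod>q<2 * k. g q) = (\<Prod>a=1..k. g (2 * (a - 1)) * g (2 * (a - 1) + 1))"
  for g :: "nat \<Rightarrow> 'b :: comm_monoid_mult"
  by (induction k) (auto simp: mult_ac)

lemma count_list_sum: "count_list xs e = (\<Sum>q<length xs. of_bool (xs ! q = e))"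
  by (induction xs) (auto simp: sum.lessThan_Suc_shift simp del: sum.lessThan_Suc)

lemma prod_count_list: "(\<Prod>q<length xs. F (xs ! q)) = (\<Prod>e\<in>set xs. F e ^ count_list xs e)"
  for F :: "'b \<Rightarrow> real"
proof -
  have "(\<Prod>q<length xs. F (xs ! q)) = (\<Prod>e\<in>set xs. \<Prod>q | q \<in> {..<length xs} \<and> xs ! q = e. F (xs ! q))"
    by (rule prod.group[symmetric]) auto
  also have "\<dots> = (\<Prod>e\<in>set xs. F e ^ count_list xs e)"
  proof (rule prod.cong[OF refl])
    fix e
    have "(\<Prod>q | q \<in> {..<length xs} \<and> xs ! q = e. F (xs ! q)) = (\<Prod>q | q \<in> {..<length xs} \<and> xs ! q = e. F e)"
      by (intro prod.cong) auto
    also have "\<dots> = F e ^ card {q. q < length xs \<and> xs ! q = e}" by simp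
    also have "card {q. q < length xs \<and> xs ! q = e} = count_list xs e"
      by (simp add: count_list_eq_length_filter length_filter_conv_card eq_commute)
    finally show "(\<Prod>q | q \<in> {..<length xs} \<and> xs ! q = e. F (xs ! q)) = F e ^ count_list xs e" .
  qed
  finally show ?thesis .
qed

lemma count_walk_edges:
  "count_list (closed_edges (walk k i j)) e =
    card {a \<in> {1..k}. edge_out i j a = e} + card {a \<in> {1..k}. edge_back k i j a = e}"
proof -
  have "count_list (closed_edges (walk k i j)) e
      = (\<Sum>q<2 * k. of_bool (closed_edges (walk k i j) ! q = e))"
    using count_list_sum[of "closed_edges (walk k i j)" e] by (simp add: length_closed_edges)
  also have "\<dots> = (\<Sum>a=1..k. of_bool (edge_out i j a = e) + of_bool (edge_back k i j a = e))"
    unfolding sum_pairs by (intro sum.cong refl) (simp only: closed_edges_walk_nth)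
  also have "\<dots> = card {a \<in> {1..k}. edge_out i j a = e} + card {a \<in> {1..k}. edge_back k i j a = e}"
    by (simp add: sum.distrib of_bool_def sum.If_cases Int_def)
  finally show ?thesis .
qed

lemma prod_walk_edges:
  fixes F :: "(nat + nat) set \<Rightarrow> real"
  shows "(\<Prod>e\<in>set (closed_edges (walk k i j)). F e ^ count_list (closed_edges (walk k i j)) e)
    = (\<Prod>a=1..k. F (edge_out i j a) * F (edge_back k i j a))"
proof -
  have "(\<Prod>e\<in>set (closed_edges (walk k i j)). F e ^ count_list (closed_edges (walk k i j)) e)
      = (\<Prod>q<2 * k. F (closed_edges (walk k i j) ! q))"
    using prod_count_list[of F "closed_edges (walk k i j)"] by (simp add: length_closed_edges)
  also have "\<dots> = (\<Prod>a=1..k. F (edge_out i j a) * F (edge_back k i j a))"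
    unfolding prod_pairs by (intro prod.cong refl) (simp only: closed_edges_walk_nth)
  finally show ?thesis .
qed

lemma cyc_next_in: "a \<in> {1..k} \<Longrightarrow> cyc_next k a \<in> {1..k}"
  by (auto simp: cyc_next_def)

lemma set_walk_edges:
  "set (closed_edges (walk k i j)) = edge_out i j ` {1..k} \<union> edge_back k i j ` {1..k}"
proof (intro Set.set_eqI)
  fix e
  have "e \<in> set (closed_edges (walk k i j)) \<longleftrightarrow> count_list (closed_edges (walk k i j)) e \<noteq> 0"
    by (simp add: count_list_0_iff)
  also have "\<dots> \<longleftrightarrow> e \<in> edge_out i j ` {1..k} \<union> edge_back k i j ` {1..k}"
    unfolding count_walk_edges by auto
  finally show "e \<in> set (closed_edges (walk k i j)) \<longleftrightarrow> e \<in> edge_out i j ` {1..k} \<union> edge_back k i j ` {1..k}" .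
qed

lemma walk_edge_form:
  assumes "e \<in> set (closed_edges (walk k i j))"
  obtains a b where "e = {Inl (i a), Inr (j b)}" "a \<in> {1..k}" "b \<in> {1..k}"
  using assms cyc_next_in unfolding set_walk_edges edge_out_def edge_back_def by blast

lemma proper_walk_walk: "1 \<le> k \<Longrightarrow> proper_walk (walk k i j)"
  unfolding proper_walk_def
proof
  assume "1 \<le> k"
  then show "walk k i j \<noteq> []" using length_walk[of k i j] by fastforce
  show "\<forall>e\<in>set (closed_edges (walk k i j)). card e = 2"
    by (auto elim!: walk_edge_form)
qed

text \<open>Compatibility makes the outgoing steps pairwise distinct, and likewise the returning
  ones: a repetition at \<open>a < b\<close> would put exactly one of the two row indices into
  \<open>{a+1..b}\<close>. Multiplicity two thus means one outgoing and one returning step.\<close>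

lemma double_edges_return_count:
  assumes comp: "kern k i \<in> compatible_partitions k (kern k j)"
  shows "card {e. count_list (closed_edges (walk k i j)) e = 2} = return_count k (kern k j) (kern k i)"
proof -
  let ?A = "edge_out i j" and ?B = "edge_back k i j"
  let ?R = "{a \<in> {1..k}. \<exists>b\<in>{1..k}. ?A a = ?B b}"
  have AA: "?A a = ?A b \<longleftrightarrow> i a = i b \<and> j a = j b" for a b by (auto simp: edge_out_def doubleton_eq_iff)
  have BB: "?B a = ?B b \<longleftrightarrow> i (cyc_next k a) = i (cyc_next k b) \<and> j a = j b" for a b
    by (auto simp: edge_back_def doubleton_eq_iff)
  have AB: "?A a = ?B b \<longleftrightarrow> i a = i (cyc_next k b) \<and> j a = j b" for a b
    by (auto simp: edge_back_def edge_out_def doubleton_eq_iff)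
  have R: "{a \<in> {1..k}. \<exists>b. same_block (kern k j) a b \<and> same_block (kern k i) a (cyc_next k b)} = ?R"
    unfolding kern_same_block AB using cyc_next_in by blast
  have sep: "(s \<in> {x+1..y}) = (t \<in> {x+1..y})"
    if "s \<in> {1..k}" "t \<in> {1..k}" "i s = i t" "x \<in> {1..k}" "y \<in> {1..k}" "j x = j y" "x < y" for s t x y
    by (rule W_sameD[OF compatible_part(2)[OF comp]]) (use that in \<open>auto simp: kern_same_block\<close>)
  have noAA: False if "a \<in> {1..k}" "b \<in> {1..k}" "a < b" "?A a = ?A b" for a b
    using sep[of a b a b] that AA by auto
  have noBB: False if "a \<in> {1..k}" "b \<in> {1..k}" "a < b" "?B a = ?B b" for a b
  proof -
    \<comment> \<open>Here \<open>cyc_next k a\<close> is \<open>a + 1\<close>, inside the interval,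
      while \<open>cyc_next k b\<close> is \<open>b + 1\<close> or 1, outside.\<close>
    have "(cyc_next k a \<in> {a+1..b}) = (cyc_next k b \<in> {a+1..b})"
      using sep[of "cyc_next k a" "cyc_next k b" a b] that BB cyc_next_in by blast
    then show False using that by (auto simp: cyc_next_def split: if_splits)
  qed
  have injA: "inj_on ?A {1..k}" using noAA by (intro inj_onI) (metis nat_neq_iff)
  have injB: "inj_on ?B {1..k}" using noBB by (intro inj_onI) (metis nat_neq_iff)
  have fib: "card {a \<in> {1..k}. F a = e} = of_bool (e \<in> F ` {1..k})" if inj: "inj_on F {1..k}"
    for F :: "nat \<Rightarrow> (nat + nat) set" and e
  proof (cases "e \<in> F ` {1..k}")
    case True
    then obtain a where "a \<in> {1..k}" "e = F a" by blast
    then have "{a \<in> {1..k}. F a = e} = {a}" using inj by (auto dest: inj_onD)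
    then show ?thesis using True by simp
  next
    case False
    then have "{a \<in> {1..k}. F a = e} = {}" by auto
    then show ?thesis using False by simp
  qed
  have "count_list (closed_edges (walk k i j)) e = 2 \<longleftrightarrow> e \<in> ?A ` ?R" for e
  proof -
    have "count_list (closed_edges (walk k i j)) e = 2 \<longleftrightarrow> e \<in> ?A ` {1..k} \<and> e \<in> ?B ` {1..k}"
      unfolding count_walk_edges fib[OF injA] fib[OF injB] by auto
    also have "\<dots> \<longleftrightarrow> e \<in> ?A ` ?R" by blast
    finally show ?thesis .
  qed
  then have "{e. count_list (closed_edges (walk k i j)) e = 2} = ?A ` ?R" by blast
  moreover have "card (?A ` ?R) = card ?R"
    by (rule card_image[OF inj_on_subset[OF injA]]) auto
  ultimately show ?thesis unfolding return_count_def R by simp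
qed

section \<open>Expectation along a closed walk\<close>

definition edge_row :: "(nat + nat) set \<Rightarrow> nat"
  where "edge_row e = (THE r. Inl r \<in> e)"

definition edge_col :: "(nat + nat) set \<Rightarrow> nat"
  where "edge_col e = (THE c. Inr c \<in> e)"

lemma edge_row_col [simp]: "edge_row {Inl a, Inr b} = a" "edge_col {Inl a, Inr b} = b"
  by (auto simp: edge_row_def edge_col_def)

text \<open>For \<open>q > n\<close> a factor is 0, as it should be for the number of
  injections.\<close>

definition falling :: "nat \<Rightarrow> nat \<Rightarrow> nat"
  where "falling n q = (\<Prod>i = 0..<q. n - i)"

lemma falling_le: "falling n q \<le> n ^ q"
proof -
  have "falling n q \<le> (\<Prod>i = 0..<q. n)" unfolding falling_def by (intro prod_mono) auto
  then show ?thesis by simp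
qed

text \<open>Multiplied by \<open>n\<close> and written with sums to avoid subtraction: relative to
  \<open>n ^ q\<close> the defect of the falling factorial is at most
  \<open>q\<^sup>2 / n\<close>.\<close>

lemma falling_ge: "n * n ^ q \<le> n * falling n q + q\<^sup>2 * n ^ q"
proof (induction q)
  case (Suc q)
  have "n * n ^ Suc q = n * (n * n ^ q)" by simp
  also have "\<dots> \<le> n * (n * falling n q + q\<^sup>2 * n ^ q)" using Suc by simp
  also have "\<dots> = n * (n * falling n q) + q\<^sup>2 * n ^ Suc q" by (simp add: algebra_simps)
  also have "n * (n * falling n q) \<le> n * (falling n (Suc q) + q * falling n q)"
  proof -
    have "n * falling n q \<le> (n - q) * falling n q + q * falling n q"
      unfolding distrib_right[symmetric] by (intro mult_right_mono) auto
    then show ?thesis by (simp add: falling_def mult.commute)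
  qed
  also have "\<dots> \<le> n * falling n (Suc q) + q * n ^ Suc q"
    using falling_le[of n q] by (simp add: algebra_simps)
  finally have "n * n ^ Suc q \<le> n * falling n (Suc q) + (q + q\<^sup>2) * n ^ Suc q" by (simp add: algebra_simps)
  also have "\<dots> \<le> n * falling n (Suc q) + (Suc q)\<^sup>2 * n ^ Suc q"
    by (intro add_left_mono mult_right_mono) (auto simp: power2_eq_square)
  finally show ?case .
qed (simp add: falling_def)

lemma card_injections:
  assumes "finite A"
  shows "card {g \<in> A \<rightarrow>\<^sub>E {..<n}. inj_on g A} = falling n (card A)"
  using card_inj_on_subset_funcset[OF assms finite_lessThan[of n] subset_refl] by (simp add: falling_def)

text \<open>The bound \<open>B\<close> covers the powers \<open>d \<le> 2 * k\<close> that repeated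
  steps can produce. Order \<open>2 * k + 5\<close> is enough both for words with up to
  \<open>2 * k + 1\<close> letters and for the five derivatives in the Gaussian limit.\<close>

locale walk_system = entry_laws +
  fixes n :: nat and K :: "entry set" and f :: "real \<Rightarrow> real" and k :: nat and i j :: "nat \<Rightarrow> nat" and B :: real
  assumes n1: "n \<ge> 1" and finK: "finite K"
    and K_in: "\<And>a l. a \<in> {1..k} \<Longrightarrow> l < n \<Longrightarrow> Inl (i a, l) \<in> K \<and> Inr (l, j a) \<in> K"
    and f_smooth: "smooth_bounded f" and f_odd: "\<And>x. f (- x) = - f x" and k1: "k \<ge> 1"
    and B1: "1 \<le> B"
    and B_bound: "\<And>d r x. d \<in> {1..2 * k} \<Longrightarrow> r \<le> 2 * k + 5 \<Longrightarrow> \<bar>(deriv ^^ r) (\<lambda>x. f x ^ d) x\<bar> \<le> B"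
begin

abbreviation "xs \<equiv> walk k i j"

abbreviation "edges \<equiv> set (closed_edges (walk k i j))"

abbreviation "emult \<equiv> count_list (closed_edges (walk k i j))"

text \<open>With at most \<open>2 k\<close> vertices, the abandoned branches contribute at most
  order \<open>n\<close> to the power \<open>2 k + (Q + 1) - 3 Q / 2\<close>; this exponent is at
  most \<open>k + 1/2\<close> once \<open>Q \<ge> 2 k + 1\<close>.\<close>

abbreviation "Q \<equiv> 2 * k + 1"

lemma mult_range: "e \<in> edges \<Longrightarrow> emult e \<in> {1..2 * k}"
  using count_le_length[of "closed_edges xs" e] count_list_0_iff[of "closed_edges xs" e]
  by (auto simp: length_closed_edges Suc_le_eq)

text \<open>A step that occurs \<open>d\<close> times is one edge with the function
  \<open>f ^ d\<close>, so that the edges form a simple graph.\<close>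

sublocale edge_system \<mu>w \<mu>x sw sx n K edges edge_row edge_col "\<lambda>e x. f x ^ emult e"
proof
  show "n \<ge> 1" by (rule n1)
  show "finite K" by (rule finK)
  show "finite edges" by simp
  show "Inl (edge_row e, l) \<in> K" if "e \<in> edges" "l < n" for e l
    using that(1) by (rule walk_edge_form) (use K_in that(2) in auto)
  show "Inr (l, edge_col e) \<in> K" if "e \<in> edges" "l < n" for e l
    using that(1) by (rule walk_edge_form) (use K_in that(2) in auto)
  show "smooth_bounded (\<lambda>x. f x ^ emult e)" if "e \<in> edges" for e
    using mult_range[OF that] by (intro smooth_bounded_power f_smooth) auto
qed

lemma proper: "proper_walk xs"
  by (rule proper_walk_walk[OF k1])

lemma xs_ne: "xs \<noteq> []"
  using proper by (simp add: proper_walk_def)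

lemma edges_two: "e \<in> edges \<Longrightarrow> card e = 2"
  using proper by (simp add: proper_walk_def)

lemma card_edges_le: "card edges \<le> 2 * k"
  using card_length[of "closed_edges xs"] by (simp add: length_closed_edges)

lemma card_vertices_le: "card (set xs) \<le> 2 * k"
  using card_length[of xs] by simp

lemma h_bound: "e \<in> edges \<Longrightarrow> r \<le> 2 * k + 5 \<Longrightarrow> \<bar>(deriv ^^ r) (\<lambda>x. f x ^ emult e) x\<bar> \<le> B"
  using B_bound[OF mult_range] by blast

lemma edge_member:
  assumes "e \<in> edges"
  shows "Inl r \<in> e \<longleftrightarrow> edge_row e = r" "Inr c \<in> e \<longleftrightarrow> edge_col e = c"
  using assms by (auto elim!: walk_edge_form)

lemma evens_iff: "S \<in> evens \<longleftrightarrow> S \<subseteq> edges \<and> even_set S"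
proof (cases "S \<subseteq> edges")
  case True
  have 1: "{e \<in> S. Inl r \<in> e} = {e \<in> S. edge_row e = r}" for r
    using True edge_member(1) by blast
  have 2: "{e \<in> S. Inr c \<in> e} = {e \<in> S. edge_col e = c}" for c
    using True edge_member(2) by blast
  have "even_set S \<longleftrightarrow> (\<forall>r. even (card {e \<in> S. Inl r \<in> e})) \<and> (\<forall>c. even (card {e \<in> S. Inr c \<in> e}))"
    unfolding even_set_def by (metis old.sum.exhaust)
  then show ?thesis using True unfolding 1 2 evens_def even_edges_def by simp
qed (simp add: evens_def)

lemma evens_card_ge_3: "S \<in> evens \<Longrightarrow> S \<noteq> {} \<Longrightarrow> 3 \<le> card S"
  using even_set_card_ge_3[of S] edges_two unfolding evens_iff by (metis List.finite_set finite_subset subsetD)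

lemma mom_bound_mono: "a \<le> b \<Longrightarrow> mom_bound a \<le> mom_bound b"
  unfolding mom_bound_def using mom_nonneg by (intro add_left_mono sum_mono2) auto

section \<open>Power counting for words of a walk\<close>

definition term_const :: real
  where "term_const = B ^ (2 * k) * mom_bound (Q * (2 * k))"

lemma term_const_nonneg: "0 \<le> term_const"
  unfolding term_const_def using B1 mom_bound_ge_1[of "Q * (2 * k)"] by simp

lemma term_const_le: "B ^ card edges * mom_bound (Q * card edges) \<le> term_const"
  unfolding term_const_def
  using B1 card_edges_le mom_bound_ge_1[of "Q * card edges"]
  by (intro mult_mono power_increasing mom_bound_mono) auto

lemma term_bound:
  assumes s: "s \<in> words n q" and q: "q \<le> Q"
  shows "sqrt n ^ (\<Sum>l<n. card (s l)) * \<bar>EPsi n s\<bar> \<le> term_const"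
proof -
  let ?d = "\<Sum>l<n. card (s l)"
  have "?d \<le> q * card edges" using word_degree_bounds(2)[OF s evens_card_ge_3] .
  then have D: "?d \<le> Q * card edges" using q by (meson le_trans mult_le_mono1)
  have "\<bar>EPsi n s\<bar> \<le> B ^ card edges * mom_bound (Q * card edges) / sqrt n ^ ?d"
    by (rule word_EPsi_bound[OF h_bound B1 s evens_card_ge_3 _ order_refl D]) (use q in auto)
  also have "\<dots> \<le> term_const / sqrt n ^ ?d"
    by (intro divide_right_mono term_const_le) simp
  finally show ?thesis using n1 by (simp add: field_simps)
qed

definition tight :: "(nat \<Rightarrow> (nat + nat) set set) \<Rightarrow> bool"
  where "tight s \<longleftrightarrow> tight_family xs (s ` {l. s l \<noteq> {}}) \<and> inj_on s {l. s l \<noteq> {}}"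

text \<open>After all \<open>n\<close> summands have been expanded the base point is 0, and
  \<open>parity_part_zero\<close> applies to \<open>f ^ emult e\<close>.\<close>

lemma EPsi_parity:
  assumes e: "e \<in> edges" and par: "odd (card {l. l < n \<and> e \<in> s l}) \<noteq> odd (emult e)"
  shows "EPsi n s = 0"
proof -
  have "f (- x) ^ emult e = (-1) ^ emult e * f x ^ emult e" for x
    unfolding f_odd by (rule power_minus)
  then have "parity_part n (\<lambda>x. f x ^ emult e) (\<lambda>l. e \<in> s l) (\<lambda>l. xi u l e) 0 = 0" for u
    using par by (intro parity_part_zero) auto
  then have "Psi n s u = 0" for u
    unfolding Psi_def using e by (intro prod_zero) auto
  then show ?thesis by (simp add: EPsi_def)
qed

text \<open>If some parity is wrong the term vanishes. Otherwise \<open>walk_bound\<close> applies,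
  and since its two sides are integers, failing equality gains a whole unit, that is a factor
  \<open>sqrt n\<close>.\<close>

lemma nontight_bound:
  assumes s: "s \<in> words n q" and q: "q < Q" and nt: "\<not> tight s"
  shows "real n ^ card (set xs) * \<bar>EPsi n s\<bar> * real n ^ q \<le> term_const * sqrt n ^ (2 * k + 1)"
proof (cases "\<exists>e\<in>edges. odd (card {l. l < n \<and> e \<in> s l}) \<noteq> odd (emult e)")
  case True
  then have "EPsi n s = 0" using EPsi_parity by blast
  then show ?thesis using term_const_nonneg by simp
next
  case False
  let ?L = "{l. s l \<noteq> {}}" and ?d = "\<Sum>l<n. card (s l)" and ?V = "card (set xs)"
  have ev: "s l \<in> evens" and out: "\<forall>l\<ge>n. s l = {}" and cL: "card ?L = q" for l
    using s by (simp_all add: words_def)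
  have L: "?L \<subseteq> {..<n}" using word_support[OF out] .
  then have finL: "finite ?L" using finite_subset by blast
  have par: "odd (card {l \<in> ?L. e \<in> s l}) \<longleftrightarrow> odd (emult e)" if "e \<in> edges" for e
  proof -
    have "{l \<in> ?L. e \<in> s l} = {l. l < n \<and> e \<in> s l}" using L by auto
    then show ?thesis using False that by auto
  qed
  have dL: "(\<Sum>l\<in>?L. card (s l)) = ?d"
    using L by (intro sum.mono_neutral_left) auto
  have Sl: "s l \<subseteq> edges \<and> even_set (s l) \<and> s l \<noteq> {}" if "l \<in> ?L" for l
    using ev[of l] that evens_iff by auto
  have le: "2 * ?V + 2 * q \<le> 2 * k + 2 + ?d"
    using walk_bound(1)[OF proper finL Sl par] unfolding dL cL by simp
  have "2 * ?V + 2 * q \<noteq> 2 * k + 2 + ?d"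
    using walk_bound(2)[OF proper finL Sl par] nt unfolding dL cL tight_def by auto
  with le have le2: "2 * ?V + 2 * q \<le> 2 * k + 1 + ?d" by simp
  have N: "real n ^ a = sqrt n ^ (2 * a)" for a by (simp add: power_mult)
  have "real n ^ ?V * \<bar>EPsi n s\<bar> * real n ^ q = sqrt n ^ (2 * ?V + 2 * q) * \<bar>EPsi n s\<bar>"
    unfolding N by (simp add: power_add)
  also have "\<dots> \<le> sqrt n ^ (2 * k + 1 + ?d) * \<bar>EPsi n s\<bar>"
    using sqrt_n_ge_1 le2 by (intro mult_right_mono power_increasing) auto
  also have "\<dots> = sqrt n ^ (2 * k + 1) * (sqrt n ^ ?d * \<bar>EPsi n s\<bar>)" by (simp add: power_add)
  also have "\<dots> \<le> sqrt n ^ (2 * k + 1) * term_const"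
    using term_bound[OF s] q by (intro mult_left_mono) auto
  finally show ?thesis by (simp only: mult.commute)
qed

lemma finite_short_words: "finite (short_words r q)"
  unfolding short_words_eq using words_finite_card(1) by blast

text \<open>The number of words with \<open>q\<close> letters is of order at most
  \<open>n ^ q\<close>, exactly the factor available in \<open>nontight_bound\<close>.\<close>

lemma sum_nontight:
  "(\<Sum>s\<in>{s \<in> short_words n Q. \<not> tight s}. real n ^ card (set xs) * \<bar>EPsi n s\<bar>)
    \<le> Q * (2 ^ (2 * k * Q) * term_const) * sqrt n ^ (2 * k + 1)"
proof -
  let ?V = "card (set xs)" and ?r = "sqrt n ^ (2 * k + 1)"
  let ?t = "\<lambda>s. if tight s then 0 else real n ^ card (set xs) * \<bar>EPsi n s\<bar>"
  have N0: "0 < real n" using n1 by simp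
  have r0: "0 \<le> ?r" by simp
  have "(\<Sum>s\<in>{s \<in> short_words n Q. \<not> tight s}. real n ^ ?V * \<bar>EPsi n s\<bar>) = (\<Sum>s\<in>short_words n Q. ?t s)"
    using finite_short_words by (intro sum.mono_neutral_cong_left) auto
  also have "\<dots> = (\<Sum>q<Q. \<Sum>s\<in>words n q. ?t s)" by (rule sum_short_words)
  also have "\<dots> \<le> (\<Sum>q<Q. 2 ^ (2 * k * Q) * term_const * ?r)"
  proof (rule sum_mono)
    fix q assume "q \<in> {..<Q}"
    then have q: "q < Q" by simp
    have t: "?t s \<le> term_const * ?r / real n ^ q" if "s \<in> words n q" for s
      using nontight_bound[OF that q] N0 term_const_nonneg by (auto simp: field_simps)
    have "(\<Sum>s\<in>words n q. ?t s) \<le> (\<Sum>s\<in>words n q. term_const * ?r / real n ^ q)"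
      by (rule sum_mono) (rule t)
    also have "\<dots> = real (card (words n q)) * (term_const * ?r / real n ^ q)" by simp
    also have "\<dots> \<le> real ((n * 2 ^ (2 * k)) ^ q) * (term_const * ?r / real n ^ q)"
    proof (intro mult_right_mono of_nat_mono)
      have "card (words n q) \<le> (n * card evens) ^ q" by (rule words_finite_card)
      also have "\<dots> \<le> (n * 2 ^ (2 * k)) ^ q"
        using card_evens_le card_edges_le
        by (intro power_mono mult_left_mono order_trans[OF card_evens_le] power_increasing) auto
      finally show "card (words n q) \<le> (n * 2 ^ (2 * k)) ^ q" .
      show "0 \<le> term_const * ?r / real n ^ q" using term_const_nonneg by simp
    qed
    also have "\<dots> = 2 ^ (2 * k * q) * term_const * ?r"
      using N0 by (simp add: power_mult_distrib power_mult)
    also have "\<dots> \<le> 2 ^ (2 * k * Q) * term_const * ?r"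
      using q term_const_nonneg by (intro mult_right_mono power_increasing mult_left_mono) auto
    finally show "(\<Sum>s\<in>words n q. ?t s) \<le> 2 ^ (2 * k * Q) * term_const * ?r" .
  qed
  also have "\<dots> = Q * (2 ^ (2 * k * Q) * term_const) * ?r" by simp
  finally show ?thesis .
qed

lemma remainder_bound:
  "\<bar>real n ^ card (set xs) * EPsi 0 (\<lambda>_. {}) - real n ^ card (set xs) * (\<Sum>s\<in>short_words n Q. EPsi n s)\<bar>
    \<le> 2 ^ (2 * k * Q) * term_const * sqrt n ^ (2 * k + 1)"
proof -
  let ?V = "card (set xs)" and ?D = "EPsi 0 (\<lambda>_. {}) - (\<Sum>s\<in>short_words n Q. EPsi n s)"
  have N: "real n ^ a = sqrt n ^ (2 * a)" for a by (simp add: power_mult)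
  have s0: "0 < sqrt (real n)" using n1 by simp
  have "\<bar>?D\<bar> \<le> n * (n * 2 ^ card edges) ^ Q * (B ^ card edges * mom_bound (Q * card edges)) / sqrt n ^ (3 * Q)"
    by (rule EPsi_expand_bound[OF h_bound B1 evens_card_ge_3]) auto
  also have "\<dots> \<le> n * (n * 2 ^ (2 * k)) ^ Q * term_const / sqrt n ^ (3 * Q)"
  proof -
    have "(2 :: real) ^ card edges \<le> 2 ^ (2 * k)" by (intro power_increasing card_edges_le) simp
    then have "(real n * 2 ^ card edges) ^ Q \<le> (real n * 2 ^ (2 * k)) ^ Q"
      by (intro power_mono mult_left_mono) auto
    then have "real n * (real n * 2 ^ card edges) ^ Q \<le> real n * (real n * 2 ^ (2 * k)) ^ Q"
      by (rule mult_left_mono) simp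
    then have "real n * (real n * 2 ^ card edges) ^ Q * (B ^ card edges * mom_bound (Q * card edges))
        \<le> real n * (real n * 2 ^ (2 * k)) ^ Q * term_const"
      by (rule mult_mono[OF _ term_const_le]) (use B1 mom_bound_ge_1[of "Q * card edges"] in auto)
    from divide_right_mono[OF this, of "sqrt n ^ (3 * Q)"] show ?thesis by simp
  qed
  also have "\<dots> = real n ^ (Q + 1) * 2 ^ (2 * k * Q) * term_const / sqrt n ^ (3 * Q)"
  proof -
    have "(real n * 2 ^ (2 * k)) ^ Q = real n ^ Q * 2 ^ (2 * k * Q)"
      by (simp only: power_mult_distrib power_mult[symmetric])
    then have "real n * (real n * 2 ^ (2 * k)) ^ Q = real n ^ (Q + 1) * 2 ^ (2 * k * Q)"
      by (simp only: power_add power_one_right mult_ac)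
    then show ?thesis by (simp only: of_nat_mult of_nat_power of_nat_numeral)
  qed
  finally have D: "\<bar>?D\<bar> \<le> real n ^ (Q + 1) * 2 ^ (2 * k * Q) * term_const / sqrt n ^ (3 * Q)" .
  have "\<bar>real n ^ ?V * ?D\<bar> = real n ^ ?V * \<bar>?D\<bar>" by (simp add: abs_mult)
  also have "\<dots> \<le> real n ^ (2 * k) * (real n ^ (Q + 1) * 2 ^ (2 * k * Q) * term_const / sqrt n ^ (3 * Q))"
    using D card_vertices_le n1 by (intro mult_mono power_increasing) auto
  also have "\<dots> = 2 ^ (2 * k * Q) * term_const * (sqrt n ^ (2 * (2 * k) + 2 * (Q + 1)) / sqrt n ^ (3 * Q))"
    unfolding N by (simp only: power_add times_divide_eq_right mult_ac)
  also have "sqrt n ^ (2 * (2 * k) + 2 * (Q + 1)) / sqrt n ^ (3 * Q) = sqrt n ^ (2 * k + 1)"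
  proof -
    \<comment> \<open>Here the choice \<open>Q = 2 * k + 1\<close> balances the exponents.\<close>
    have "2 * (2 * k) + 2 * (Q + 1) = (2 * k + 1) + 3 * Q" by simp
    then have "sqrt n ^ (2 * (2 * k) + 2 * (Q + 1)) = sqrt n ^ (2 * k + 1) * sqrt n ^ (3 * Q)"
      by (metis power_add)
    then show ?thesis using s0 by simp
  qed
  finally show ?thesis by (simp add: right_diff_distrib)
qed

definition limit_value :: real
  where "limit_value = (if noncrossing_walk xs
    then gauss ((sw * sx)\<^sup>2) (\<lambda>x. (f x)\<^sup>2) 0 ^ return_count k (kern k j) (kern k i) *
      ((sw * sx * gauss ((sw * sx)\<^sup>2) (deriv f) 0)\<^sup>2) ^ (k - return_count k (kern k j) (kern k i))
    else 0)"

definition lim_const :: real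
  where "lim_const = (2 * B) ^ (2 * k) * (2 * k) * (3 * mom_bound (4 * k) + 2 * mom 4 + mom 8)"

section \<open>Tight words of a fixed noncrossing walk\<close>

context
  fixes C
  assumes C: "tight_family xs C" and C2: "\<And>c v. c \<in> C \<Longrightarrow> card {e \<in> c. v \<in> e} \<in> {0, 2}"
begin

lemma C_props:
  shows "finite C" "\<And>c. c \<in> C \<Longrightarrow> c \<noteq> {} \<and> c \<in> evens" "\<Union>C \<subseteq> edges" "disjoint C" "card C < Q"
proof -
  have cf: "disjoint C" "\<And>c. c \<in> C \<Longrightarrow> c \<noteq> {} \<and> c \<subseteq> edges \<and> even_set c"
    "card (set xs) + card C = card edges + 1"
    using C by (auto simp: tight_family_def cycle_family_def)
  show "\<And>c. c \<in> C \<Longrightarrow> c \<noteq> {} \<and> c \<in> evens" using cf(2) evens_iff by blast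
  show "\<Union>C \<subseteq> edges" using cf(2) by blast
  then show "finite C" using finite_UnionD finite_subset by blast
  show "disjoint C" by (rule cf(1))
  have "card (set xs) \<noteq> 0" using xs_ne by simp
  then show "card C < Q" using cf(3) card_edges_le by linarith
qed

text \<open>By \<open>cycle_family_unique\<close> the set of nonempty letters is prescribed by the
  walk; only their positions are free.\<close>

lemma tight_range:
  assumes "tight s"
  shows "s ` {l. s l \<noteq> {}} = C" "inj_on s {l. s l \<noteq> {}}"
proof -
  have cf: "cycle_family (set xs) edges (s ` {l. s l \<noteq> {}})" "cycle_family (set xs) edges C"
    using assms C by (simp_all add: tight_def tight_family_def)
  show "s ` {l. s l \<noteq> {}} = C"
    by (rule cycle_family_unique[OF cf finite_set finite_set connecting_closed_edges[OF xs_ne] edges_two])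
  show "inj_on s {l. s l \<noteq> {}}" using assms by (simp add: tight_def)
qed

lemma compatible_kern: "kern k i \<in> compatible_partitions k (kern k j)"
  using tight_family_noncrossing[OF proper C] W_same_iff_walk by blast

lemma card_double: "card {e. emult e = 2} = return_count k (kern k j) (kern k i)"
  by (rule double_edges_return_count[OF compatible_kern])

lemma edges_diff: "edges - \<Union>C = {e. emult e = 2}"
proof (intro Set.set_eqI)
  fix e
  have le: "emult e \<le> 2" and U: "e \<in> \<Union>C \<longleftrightarrow> emult e = 1"
    using C unfolding tight_family_def by blast+
  have "e \<in> edges - \<Union>C \<longleftrightarrow> emult e \<noteq> 0 \<and> emult e \<noteq> 1"
    unfolding Diff_iff U count_list_0_iff by simp
  also have "\<dots> \<longleftrightarrow> emult e = 2" using le by arith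
  finally show "e \<in> edges - \<Union>C \<longleftrightarrow> e \<in> {e. emult e = 2}" by simp
qed

text \<open>Cycle edges are used once and carry \<open>f\<close>, the others are used twice and
  carry its square. The number of cycle edges is twice \<open>k\<close> minus the return count,
  which turns single factors into powers of the squared quantity in
  \<open>limit_value\<close>.\<close>

lemma limit_value_eq:
  "(sw * sx) ^ card (\<Union>C) * ((\<Prod>e\<in>\<Union>C. gauss ((sw * sx)\<^sup>2) (deriv (\<lambda>x. f x ^ emult e)) 0) *
    (\<Prod>e\<in>edges - \<Union>C. gauss ((sw * sx)\<^sup>2) (\<lambda>x. f x ^ emult e) 0)) = limit_value"
proof -
  let ?g1 = "gauss ((sw * sx)\<^sup>2) (deriv f) 0" and ?g2 = "gauss ((sw * sx)\<^sup>2) (\<lambda>x. (f x)\<^sup>2) 0"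
  let ?D = "return_count k (kern k j) (kern k i)"
  have m1: "emult e = 1" if "e \<in> \<Union>C" for e using that C unfolding tight_family_def by blast
  have p1: "(\<Prod>e\<in>\<Union>C. gauss ((sw * sx)\<^sup>2) (deriv (\<lambda>x. f x ^ emult e)) 0) = (\<Prod>e\<in>\<Union>C. ?g1)"
    by (intro prod.cong refl) (simp only: m1 power_one_right)
  have p2: "(\<Prod>e\<in>edges - \<Union>C. gauss ((sw * sx)\<^sup>2) (\<lambda>x. f x ^ emult e) 0) = (\<Prod>e\<in>edges - \<Union>C. ?g2)"
    by (intro prod.cong refl) (simp add: edges_diff)
  have "2 * k = card (\<Union>C) + 2 * ?D"
    using tight_family_eq(3)[OF proper C] card_double by simp
  then have cU: "card (\<Union>C) = 2 * (k - ?D)" by simp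
  have eq: "(sw * sx) ^ card (\<Union>C) * (?g1 ^ card (\<Union>C) * ?g2 ^ ?D)
      = ?g2 ^ ?D * ((sw * sx * ?g1)\<^sup>2) ^ (k - ?D)"
    unfolding cU power_mult[symmetric] by (simp add: power_mult_distrib)
  have nc: "noncrossing_walk xs" by (rule tight_family_noncrossing[OF proper C])
  show ?thesis
    unfolding p1 p2 unfolding prod_constant edges_diff card_double limit_value_def if_P[OF nc] by (rule eq)
qed

lemma tight_limit:
  assumes s: "s \<in> short_words n Q" and t: "tight s"
  shows "\<bar>sqrt n ^ card (\<Union>C) * EPsi n s - limit_value\<bar> \<le> lim_const / sqrt n"
proof -
  note tr = tight_range[OF t]
  have out: "\<forall>l\<ge>n. s l = {}" using s by (simp add: short_words_def)
  have sl: "l < n" if "s l \<noteq> {}" for l using out that by (meson not_le)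
  have uniq: "l = l'" if "e \<in> s l" "e \<in> s l'" for e l l'
  proof -
    have "s l \<in> C" "s l' \<in> C" using tr(1) that by blast+
    then have "s l = s l'" using C_props(4) that unfolding disjoint_def by blast
    then show ?thesis using tr(2) that by (auto dest: inj_onD)
  qed
  have ex: "\<exists>l. e \<in> s l" if "e \<in> \<Union>C" for e using that tr(1) by blast
  \<comment> \<open>The position of the cycle through \<open>e\<close>. Off the cycles the default 0
    is a legal position because \<open>n \<ge> 1\<close>, and \<open>EPsi_limit\<close> asks for a
    position at every edge.\<close>
  define lab where "lab = (\<lambda>e. if e \<in> \<Union>C then THE l. e \<in> s l else 0)"
  have lab: "lab e = l" if "e \<in> s l" for e l
  proof -
    have "e \<in> \<Union>C" using that tr(1) by blast
    moreover have "(THE l. e \<in> s l) = l" using that uniq by (intro the_equality) auto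
    ultimately show ?thesis by (simp add: lab_def)
  qed
  have seq: "s = (\<lambda>l. {e \<in> \<Union>C. lab e = l})"
  proof
    fix l
    show "s l = {e \<in> \<Union>C. lab e = l}"
    proof (intro Set.set_eqI iffI)
      fix e assume e: "e \<in> s l"
      then have "e \<in> \<Union>C" using tr(1) by blast
      then show "e \<in> {e \<in> \<Union>C. lab e = l}" using lab[OF e] by simp
    next
      fix e assume e: "e \<in> {e \<in> \<Union>C. lab e = l}"
      then obtain l' where "e \<in> s l'" using ex by blast
      then show "e \<in> s l" using lab e by auto
    qed
  qed
  have labn: "lab e < n" for e
  proof (cases "e \<in> \<Union>C")
    case True
    then obtain l where "e \<in> s l" using ex by blast
    then show ?thesis using lab sl by auto
  next
    case False
    then show ?thesis using n1 by (simp add: lab_def)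
  qed
  have deg: "card {e \<in> s l. v \<in> e} \<in> {0, 2}" for l v
  proof (cases "s l = {}")
    case False
    then have "s l \<in> C" using tr(1) by blast
    then show ?thesis using C2 by blast
  qed simp
  have row2: "card {e \<in> \<Union>C. lab e = l \<and> edge_row e = r} \<in> {0, 2}" for l r
  proof -
    have "{e \<in> \<Union>C. lab e = l \<and> edge_row e = r} = {e \<in> {e \<in> \<Union>C. lab e = l}. Inl r \<in> e}"
      using C_props(3) edge_member(1) by blast
    also have "{e \<in> \<Union>C. lab e = l} = s l" unfolding seq ..
    finally show ?thesis using deg by simp
  qed
  have col2: "card {e \<in> \<Union>C. lab e = l \<and> edge_col e = c} \<in> {0, 2}" for l c
  proof -
    have "{e \<in> \<Union>C. lab e = l \<and> edge_col e = c} = {e \<in> {e \<in> \<Union>C. lab e = l}. Inr c \<in> e}"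
      using C_props(3) edge_member(2) by blast
    also have "{e \<in> \<Union>C. lab e = l} = s l" unfolding seq ..
    finally show ?thesis using deg by simp
  qed
  have hb: "\<bar>(deriv ^^ r) (\<lambda>x. f x ^ emult e) x\<bar> \<le> B" if "e \<in> edges" "r \<le> 5" for e r x
    using h_bound[OF that(1)] that(2) by simp
  have "\<bar>sqrt n ^ card (\<Union>C) * EPsi n s - limit_value\<bar>
      \<le> (2 * B) ^ card edges * card edges * (3 * mom_bound (2 * card edges) + 2 * mom 4 + mom 8) / sqrt n"
    using EPsi_limit[OF C_props(3), of lab B, OF labn row2 col2 hb B1]
    unfolding limit_value_eq seq[symmetric] .
  also have "\<dots> \<le> lim_const / sqrt n"
  proof (rule divide_right_mono)
    let ?m = "\<lambda>d. 3 * mom_bound d + 2 * mom 4 + mom 8"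
    have "mom_bound (2 * card edges) \<le> mom_bound (4 * k)"
      using card_edges_le by (intro mom_bound_mono) simp
    then have m: "?m (2 * card edges) \<le> ?m (4 * k)" by simp
    have m0: "0 \<le> ?m (2 * card edges)"
      using mom_bound_ge_1[of "2 * card edges"] mom_nonneg[of 4] mom_nonneg[of 8] by linarith
    have c: "real (card edges) \<le> real (2 * k)" using card_edges_le by (rule of_nat_mono)
    have p: "(2 * B) ^ card edges \<le> (2 * B) ^ (2 * k)"
      using card_edges_le B1 by (intro power_increasing) auto
    have h: "(2 * B) ^ card edges * card edges \<le> (2 * B) ^ (2 * k) * real (2 * k)"
      by (rule mult_mono[OF p c]) (use B1 in auto)
    have "(2 * B) ^ card edges * card edges * ?m (2 * card edges) \<le> (2 * B) ^ (2 * k) * real (2 * k) * ?m (4 * k)"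
      by (rule mult_mono[OF h m _ m0]) (use B1 in simp)
    then show "(2 * B) ^ card edges * card edges * ?m (2 * card edges) \<le> lim_const"
      by (simp add: lim_const_def)
  qed simp
  finally show ?thesis .
qed

text \<open>A tight word gives each cycle a position of its own, so tight words correspond to
  injections of \<open>C\<close> into the \<open>n\<close> positions.\<close>

lemma card_tight: "card {s \<in> short_words n Q. tight s} = falling n (card C)"
proof -
  let ?T = "{s \<in> short_words n Q. tight s}" and ?G = "{g \<in> C \<rightarrow>\<^sub>E {..<n}. inj_on g C}"
  define pos_of where "pos_of = (\<lambda>s :: nat \<Rightarrow> (nat + nat) set set. \<lambda>c\<in>C. THE l. s l = c)"
  define word_of where
    "word_of = (\<lambda>(g :: (nat + nat) set set \<Rightarrow> nat) l. if l \<in> g ` C then inv_into C g l else {})"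
  have pos_of: "pos_of s (s l) = l" if s: "s \<in> ?T" and l: "s l \<noteq> {}" for s l
  proof -
    have t: "tight s" using s by simp
    have "s l \<in> C" using tight_range(1)[OF t] l by blast
    moreover have "(THE l'. s l' = s l) = l"
      using tight_range(2)[OF t] l by (intro the_equality) (auto dest: inj_onD)
    ultimately show ?thesis by (simp add: pos_of_def)
  qed
  have C_ex: "\<exists>l. c = s l \<and> s l \<noteq> {}" if "s \<in> ?T" "c \<in> C" for s c
    using tight_range(1)[of s] that by blast
  have "bij_betw pos_of ?T ?G"
  proof (rule bij_betw_byWitness[where f' = word_of])
    show "\<forall>s\<in>?T. word_of (pos_of s) = s"
    proof
      fix s assume s: "s \<in> ?T"
      have inj: "inj_on (pos_of s) C"
      proof (rule inj_onI)
        fix c c' assume "c \<in> C" "c' \<in> C" "pos_of s c = pos_of s c'"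
        then show "c = c'" using C_ex[OF s] pos_of[OF s] by metis
      qed
      show "word_of (pos_of s) = s"
      proof
        fix l show "word_of (pos_of s) l = s l"
        proof (cases "s l = {}")
          case True
          have "l \<notin> pos_of s ` C"
          proof
            assume "l \<in> pos_of s ` C"
            then obtain c where c: "c \<in> C" "l = pos_of s c" by blast
            obtain l' where "c = s l'" "s l' \<noteq> {}" using C_ex[OF s c(1)] by blast
            then show False using c(2) pos_of[OF s] True by simp
          qed
          then show ?thesis using True by (simp add: word_of_def)
        next
          case False
          have c: "s l \<in> C" using tight_range(1)[of s] s False by blast
          have "inv_into C (pos_of s) l = s l"
            using inv_into_f_f[OF inj c] pos_of[OF s False] by simp
          moreover have "l \<in> pos_of s ` C" using pos_of[OF s False] c by (metis image_eqI)
          ultimately show ?thesis by (simp add: word_of_def)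
        qed
      qed
    qed
    show "\<forall>g\<in>?G. pos_of (word_of g) = g"
    proof
      fix g assume g: "g \<in> ?G"
      show "pos_of (word_of g) = g"
      proof
        fix c show "pos_of (word_of g) c = g c"
        proof (cases "c \<in> C")
          case True
          have "(THE l. word_of g l = c) = g c"
          proof (rule the_equality)
            show "word_of g (g c) = c" using g True by (auto simp: word_of_def)
            show "l = g c" if "word_of g l = c" for l
              using that C_props(2)[OF True] by (auto simp: word_of_def f_inv_into_f split: if_splits)
          qed
          then show ?thesis using True by (simp add: pos_of_def)
        next
          case False
          then show ?thesis using g by (auto simp: pos_of_def PiE_def extensional_def)
        qed
      qed
    qed
    show "pos_of ` ?T \<subseteq> ?G"
    proof
      fix g assume "g \<in> pos_of ` ?T"
      then obtain s where s: "s \<in> ?T" "g = pos_of s" by blast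
      have "pos_of s c < n" if "c \<in> C" for c
      proof -
        obtain l where l: "c = s l" "s l \<noteq> {}" using C_ex[OF s(1) \<open>c \<in> C\<close>] by blast
        have "\<forall>l\<ge>n. s l = {}" using s(1) by (simp add: short_words_def)
        then have "l < n" using l(2) by (meson not_le)
        then show ?thesis using pos_of[OF s(1) l(2)] l(1) by simp
      qed
      moreover have "inj_on (pos_of s) C"
      proof (rule inj_onI)
        fix c c' assume "c \<in> C" "c' \<in> C" "pos_of s c = pos_of s c'"
        then show "c = c'" using C_ex[OF s(1)] pos_of[OF s(1)] by metis
      qed
      ultimately show "g \<in> ?G" using s(2) by (auto simp: pos_of_def)
    qed
    show "word_of ` ?G \<subseteq> ?T"
    proof
      fix s assume "s \<in> word_of ` ?G"
      then obtain g where g: "g \<in> C \<rightarrow>\<^sub>E {..<n}" "inj_on g C" "s = word_of g" by blast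
      have sg: "s (g c) = c" if "c \<in> C" for c using g that by (auto simp: word_of_def)
      have s0: "s l = {}" if "l \<notin> g ` C" for l using g(3) that by (simp add: word_of_def)
      have sup: "{l. s l \<noteq> {}} = g ` C"
        using sg s0 C_props(2) by (metis (mono_tags, lifting) Collect_mem_eq Collect_cong image_iff)
      have "card {l. s l \<noteq> {}} < Q"
        unfolding sup card_image[OF g(2)] by (rule C_props(5))
      moreover have "s l \<in> evens" for l
        using sg C_props(2) s0 empty_in_evens by (cases "l \<in> g ` C") auto
      moreover have "s l = {}" if "n \<le> l" for l
      proof (rule s0)
        show "l \<notin> g ` C" using PiE_mem[OF g(1)] that by fastforce
      qed
      ultimately have "s \<in> short_words n Q" by (simp add: short_words_def)
      moreover have "s ` {l. s l \<noteq> {}} = C" unfolding sup using sg by (auto simp: image_image)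
      moreover have "inj_on s {l. s l \<noteq> {}}" unfolding sup using sg by (intro inj_onI) auto
      ultimately show "s \<in> ?T" using C by (simp add: tight_def)
    qed
  qed
  then have "card ?T = card ?G" by (rule bij_betw_same_card)
  then show ?thesis unfolding card_injections[OF C_props(1)] .
qed

text \<open>By \<open>tight_family_eq\<close>, \<open>n\<close> to the power
  \<open>card (set xs) + card C\<close>, divided by one \<open>sqrt n\<close> for each cycle edge,
  is exactly \<open>n ^ (k + 1)\<close>. The errors come from the limit of each word, of relative
  order \<open>1 / sqrt n\<close>, and from replacing the falling factorial by a power, of relative
  order \<open>1 / n\<close>.\<close>

lemma sum_tight:
  "\<bar>real n ^ card (set xs) * (\<Sum>s\<in>{s \<in> short_words n Q. tight s}. EPsi n s) - real n ^ (k + 1) * limit_value\<bar>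
    \<le> (lim_const + (2 * k)\<^sup>2 * \<bar>limit_value\<bar>) * sqrt n ^ (2 * k + 1)"
proof -
  let ?T = "{s \<in> short_words n Q. tight s}" and ?q = "card C" and ?d = "card (\<Union>C)" and ?V = "card (set xs)"
  let ?F = "real (falling n (card C))"
  have N: "real n ^ a = sqrt n ^ (2 * a)" for a by (simp add: power_mult)
  have N0: "0 < real n" and s0: "0 < sqrt (real n)" using n1 by simp_all
  have lc0: "0 \<le> lim_const"
    unfolding lim_const_def using B1 mom_nonneg mom_bound_ge_1[of "4 * k"] by simp
  have "2 * ?V + 2 * ?q = 2 * (k + 1) + ?d" using tight_family_eq(1)[OF proper C] by simp
  then have "sqrt n ^ (2 * ?V) * sqrt n ^ (2 * ?q) = sqrt n ^ (2 * (k + 1)) * sqrt n ^ ?d"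
    unfolding power_add[symmetric] by simp
  then have e: "real n ^ ?V * real n ^ ?q = real n ^ (k + 1) * sqrt n ^ ?d" unfolding N .
  have "real n ^ ?V = real n ^ ?V * real n ^ ?q / real n ^ ?q" using N0 by simp
  also have "\<dots> = real n ^ (k + 1) / real n ^ ?q * sqrt n ^ ?d"
    unfolding e by (rule times_divide_eq_left[symmetric])
  finally have Vq: "real n ^ ?V = real n ^ (k + 1) / real n ^ ?q * sqrt n ^ ?d" .
  have Fle: "?F \<le> real n ^ ?q" using falling_le[of n ?q] by (metis of_nat_le_iff of_nat_power)
  have Fge: "real n * real n ^ ?q \<le> real n * ?F + (real ?q)\<^sup>2 * real n ^ ?q"
  proof -
    have "real (n * n ^ ?q) \<le> real (n * falling n ?q + ?q\<^sup>2 * n ^ ?q)"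
      using falling_ge[of n ?q] of_nat_le_iff by blast
    then show ?thesis by simp
  qed
  have ratio: "\<bar>?F / real n ^ ?q - 1\<bar> \<le> (2 * k)\<^sup>2 / real n"
  proof -
    have "1 - ?F / real n ^ ?q \<le> (real ?q)\<^sup>2 / real n"
      using Fge N0 by (simp add: field_simps)
    also have "\<dots> \<le> (2 * k)\<^sup>2 / real n"
    proof (rule divide_right_mono)
      have "real ?q \<le> 2 * real k" using C_props(5) by simp
      from power_mono[OF this, of 2] show "(real ?q)\<^sup>2 \<le> (2 * k)\<^sup>2" by simp
    qed simp
    finally show ?thesis using Fle N0 by (simp add: abs_if)
  qed
  have e1: "real n ^ ?V * (\<Sum>s\<in>?T. EPsi n s) - real n ^ (k + 1) * limit_value
      = real n ^ (k + 1) / real n ^ ?q * (\<Sum>s\<in>?T. sqrt n ^ ?d * EPsi n s - limit_value)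
        + real n ^ (k + 1) * limit_value * (?F / real n ^ ?q - 1)"
    unfolding Vq sum_subtractf sum_constant card_tight sum_distrib_left[symmetric]
    using N0 by (simp add: field_simps)
  have "\<bar>\<Sum>s\<in>?T. sqrt n ^ ?d * EPsi n s - limit_value\<bar> \<le> (\<Sum>s\<in>?T. lim_const / sqrt n)"
    by (rule order_trans[OF sum_abs], rule sum_mono) (use tight_limit in auto)
  also have "\<dots> = ?F * (lim_const / sqrt n)" by (simp only: sum_constant card_tight)
  also have "\<dots> \<le> real n ^ ?q * (lim_const / sqrt n)" using Fle lc0 by (intro mult_right_mono) auto
  finally have b1: "\<bar>\<Sum>s\<in>?T. sqrt n ^ ?d * EPsi n s - limit_value\<bar> \<le> real n ^ ?q * (lim_const / sqrt n)" .
  have "\<bar>real n ^ (k + 1) / real n ^ ?q * (\<Sum>s\<in>?T. sqrt n ^ ?d * EPsi n s - limit_value)\<bar>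
      = real n ^ (k + 1) / real n ^ ?q * \<bar>\<Sum>s\<in>?T. sqrt n ^ ?d * EPsi n s - limit_value\<bar>"
    by (simp add: abs_mult)
  also have "\<dots> \<le> real n ^ (k + 1) / real n ^ ?q * (real n ^ ?q * (lim_const / sqrt n))"
    by (intro mult_left_mono b1) simp
  also have "\<dots> = lim_const * (sqrt n ^ (2 * (k + 1)) / sqrt n)" using N0 unfolding N by simp
  also have "sqrt n ^ (2 * (k + 1)) / sqrt n = sqrt n ^ (2 * k + 1)" using s0 by simp
  finally have 1: "\<bar>real n ^ (k + 1) / real n ^ ?q * (\<Sum>s\<in>?T. sqrt n ^ ?d * EPsi n s - limit_value)\<bar>
      \<le> lim_const * sqrt n ^ (2 * k + 1)" .
  have "\<bar>real n ^ (k + 1) * limit_value * (?F / real n ^ ?q - 1)\<bar>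
      = real n ^ (k + 1) * \<bar>limit_value\<bar> * \<bar>?F / real n ^ ?q - 1\<bar>" by (simp add: abs_mult)
  also have "\<dots> \<le> real n ^ (k + 1) * \<bar>limit_value\<bar> * ((2 * k)\<^sup>2 / real n)"
    by (intro mult_left_mono ratio) simp
  also have "\<dots> = (2 * k)\<^sup>2 * \<bar>limit_value\<bar> * sqrt n ^ (2 * k)" using N0 unfolding N[symmetric] by simp
  also have "\<dots> \<le> (2 * k)\<^sup>2 * \<bar>limit_value\<bar> * sqrt n ^ (2 * k + 1)"
    using sqrt_n_ge_1 by (intro mult_left_mono power_increasing) auto
  finally have 2: "\<bar>real n ^ (k + 1) * limit_value * (?F / real n ^ ?q - 1)\<bar>
      \<le> (2 * k)\<^sup>2 * \<bar>limit_value\<bar> * sqrt n ^ (2 * k + 1)" .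
  show ?thesis unfolding e1 distrib_right using 1 2 by (intro order_trans[OF abs_triangle_ineq] add_mono)
qed

end

text \<open>The contributions are the abandoned branches, the nontight words and the tight words. A
  crossing walk has no tight word, in agreement with the value 0 of
  \<open>limit_value\<close>.\<close>

lemma walk_EPsi_bound:
  "\<bar>real n ^ card (set xs) * EPsi 0 (\<lambda>_. {}) - real n ^ (k + 1) * limit_value\<bar>
    \<le> ((Q + 1) * (2 ^ (2 * k * Q) * term_const) + lim_const + (2 * k)\<^sup>2 * \<bar>limit_value\<bar>) * sqrt n ^ (2 * k + 1)"
proof -
  let ?V = "card (set xs)" and ?r = "sqrt n ^ (2 * k + 1)" and ?N = "real n"
  let ?T = "{s \<in> short_words n Q. tight s}" and ?U = "{s \<in> short_words n Q. \<not> tight s}"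
  have lc0: "0 \<le> lim_const"
    unfolding lim_const_def using B1 mom_nonneg mom_bound_ge_1[of "4 * k"] by simp
  have U: "\<bar>?N ^ ?V * (\<Sum>s\<in>?U. EPsi n s)\<bar> \<le> Q * (2 ^ (2 * k * Q) * term_const) * ?r"
  proof -
    have "\<bar>?N ^ ?V * (\<Sum>s\<in>?U. EPsi n s)\<bar> \<le> (\<Sum>s\<in>?U. \<bar>?N ^ ?V * EPsi n s\<bar>)"
      unfolding sum_distrib_left by (rule sum_abs)
    also have "\<dots> = (\<Sum>s\<in>?U. ?N ^ ?V * \<bar>EPsi n s\<bar>)" by (simp add: abs_mult)
    finally show ?thesis using sum_nontight by (rule order_trans)
  qed
  have T: "\<bar>?N ^ ?V * (\<Sum>s\<in>?T. EPsi n s) - ?N ^ (k + 1) * limit_value\<bar>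
      \<le> (lim_const + (2 * k)\<^sup>2 * \<bar>limit_value\<bar>) * ?r"
  proof (cases "noncrossing_walk xs")
    case True
    then obtain C where C: "tight_family xs C" "\<forall>c\<in>C. \<forall>v. card {e \<in> c. v \<in> e} \<in> {0, 2}"
      using noncrossing_tight_family[OF proper] by blast
    show ?thesis by (rule sum_tight[OF C(1)]) (use C(2) in blast)
  next
    case False
    then have "\<not> tight s" for s using tight_family_noncrossing[OF proper] unfolding tight_def by blast
    then have T0: "?T = {}" by blast
    show ?thesis unfolding T0 using False lc0 by (simp add: limit_value_def)
  qed
  have "(\<Sum>s\<in>short_words n Q. EPsi n s) = (\<Sum>s\<in>?T. EPsi n s) + (\<Sum>s\<in>?U. EPsi n s)"
  proof -
    have "short_words n Q = ?T \<union> ?U" by blast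
    moreover have "(\<Sum>s\<in>?T \<union> ?U. EPsi n s) = (\<Sum>s\<in>?T. EPsi n s) + (\<Sum>s\<in>?U. EPsi n s)"
      using finite_short_words by (intro sum.union_disjoint) auto
    ultimately show ?thesis by simp
  qed
  then have eq: "?N ^ ?V * EPsi 0 (\<lambda>_. {}) - ?N ^ (k + 1) * limit_value
      = (?N ^ ?V * EPsi 0 (\<lambda>_. {}) - ?N ^ ?V * (\<Sum>s\<in>short_words n Q. EPsi n s))
        + (?N ^ ?V * (\<Sum>s\<in>?U. EPsi n s))
        + (?N ^ ?V * (\<Sum>s\<in>?T. EPsi n s) - ?N ^ (k + 1) * limit_value)"
    by (simp add: algebra_simps)
  have "\<bar>?N ^ ?V * EPsi 0 (\<lambda>_. {}) - ?N ^ (k + 1) * limit_value\<bar>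
      \<le> 2 ^ (2 * k * Q) * term_const * ?r + Q * (2 ^ (2 * k * Q) * term_const) * ?r
      + (lim_const + (2 * k)\<^sup>2 * \<bar>limit_value\<bar>) * ?r"
    unfolding eq by (intro order_trans[OF abs_triangle_ineq] add_mono remainder_bound U T)
  also have "\<dots> = ((Q + 1) * (2 ^ (2 * k * Q) * term_const) + lim_const + (2 * k)\<^sup>2 * \<bar>limit_value\<bar>) * ?r"
    by (simp add: algebra_simps)
  finally show ?thesis .
qed

lemma EPsi_walk:
  "EPsi 0 (\<lambda>_. {}) = (LINT u|(entries K). (\<Prod>a=1..k.
      f (\<Sum>l<n. u (Inl (i a, l)) * u (Inr (l, j a)) / sqrt n) *
      f (\<Sum>l<n. u (Inl (i (cyc_next k a), l)) * u (Inr (l, j a)) / sqrt n)))"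
proof -
  have "Psi 0 (\<lambda>_. {}) u = (\<Prod>a=1..k.
      f (\<Sum>l<n. u (Inl (i a, l)) * u (Inr (l, j a)) / sqrt n) *
      f (\<Sum>l<n. u (Inl (i (cyc_next k a), l)) * u (Inr (l, j a)) / sqrt n))" for u
  proof -
    have "Psi 0 (\<lambda>_. {}) u = (\<Prod>e\<in>edges. f (\<Sum>l<n. xi u l e) ^ emult e)"
      by (simp add: Psi_def atLeast0LessThan)
    also have "\<dots> = (\<Prod>a=1..k. f (\<Sum>l<n. xi u l (edge_out i j a)) * f (\<Sum>l<n. xi u l (edge_back k i j a)))"
      by (rule prod_walk_edges)
    finally show ?thesis by (simp add: xi_def zeta_def edge_out_def edge_back_def)
  qed
  then show ?thesis by (simp add: EPsi_def)
qed

end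

section \<open>Moments of the nonlinear random matrix\<close>

lemma sum_PiE_insert:
  assumes "x \<notin> S"
  shows "(\<Sum>g\<in>PiE (insert x S) T. F g) = (\<Sum>y\<in>T x. \<Sum>g\<in>PiE S T. F (g(x := y)))"
proof -
  have "(\<Sum>g\<in>PiE (insert x S) T. F g) = (\<Sum>(y, g)\<in>T x \<times> PiE S T. F (g(x := y)))"
    unfolding PiE_insert_eq
    by (subst sum.reindex[OF inj_combinator[OF assms]]) (simp add: case_prod_unfold)
  then show ?thesis by (simp add: sum.cartesian_product)
qed

text \<open>The end points sit at positions 1 and \<open>Suc (Suc r)\<close> of the index function;
  closing the path in \<open>trace_power\<close> then only identifies the last position with the
  first.\<close>

lemma power_mat_entry:
  fixes A :: "real mat"
  assumes A: "A \<in> carrier_mat p p" and x: "x < p" "y < p"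
  shows "(A ^\<^sub>m Suc r) $$ (x, y) = (\<Sum>i\<in>PiE {2..Suc r} (\<lambda>_. {..<p}).
    \<Prod>a=1..Suc r. A $$ ((i(1 := x, Suc (Suc r) := y)) a, (i(1 := x, Suc (Suc r) := y)) (Suc a)))"
  using x(2)
proof (induction r arbitrary: y)
  case 0
  have "{2..Suc 0} = {}" by auto
  then show ?case using A x 0 by (simp add: PiE_empty_domain)
next
  case (Suc r)
  let ?P = "\<lambda>i k. \<Prod>a=1..k. A $$ (i a, i (Suc a))"
  have Ar: "A ^\<^sub>m Suc r \<in> carrier_mat p p" using A by (rule pow_carrier_mat)
  have ins: "{2..Suc (Suc r)} = insert (Suc (Suc r)) {2..Suc r}" by auto
  have "(A ^\<^sub>m Suc (Suc r)) $$ (x, y) = (\<Sum>z<p. (A ^\<^sub>m Suc r) $$ (x, z) * A $$ (z, y))"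
  proof -
    have "(A ^\<^sub>m Suc (Suc r)) $$ (x, y) = (A ^\<^sub>m Suc r * A) $$ (x, y)" by simp
    also have "\<dots> = row (A ^\<^sub>m Suc r) x \<bullet> col A y"
      using A Ar x Suc.prems by (intro index_mult_mat(1)) auto
    also have "\<dots> = (\<Sum>z<p. (A ^\<^sub>m Suc r) $$ (x, z) * A $$ (z, y))"
      using A Ar x Suc.prems unfolding scalar_prod_def atLeast0LessThan
      by (intro sum.cong) (auto simp del: pow_mat.simps)
    finally show ?thesis .
  qed
  also have "\<dots> = (\<Sum>z<p. \<Sum>i\<in>PiE {2..Suc r} (\<lambda>_. {..<p}).
      ?P ((i(Suc (Suc r) := z))(1 := x, Suc (Suc (Suc r)) := y)) (Suc (Suc r)))"
  proof (rule sum.cong[OF refl])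
    fix z assume "z \<in> {..<p}"
    then have z: "z < p" by simp
    have "?P (i(1 := x, Suc (Suc r) := z)) (Suc r) * A $$ (z, y)
        = ?P ((i(Suc (Suc r) := z))(1 := x, Suc (Suc (Suc r)) := y)) (Suc (Suc r))" for i
    proof -
      have "?P (i(1 := x, Suc (Suc r) := z)) (Suc r)
          = ?P ((i(Suc (Suc r) := z))(1 := x, Suc (Suc (Suc r)) := y)) (Suc r)"
        by (intro prod.cong refl) auto
      then show ?thesis by simp
    qed
    then show "(A ^\<^sub>m Suc r) $$ (x, z) * A $$ (z, y) = (\<Sum>i\<in>PiE {2..Suc r} (\<lambda>_. {..<p}).
      ?P ((i(Suc (Suc r) := z))(1 := x, Suc (Suc (Suc r)) := y)) (Suc (Suc r)))"
      unfolding Suc.IH[OF z] sum_distrib_right by (intro sum.cong refl)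
  qed
  also have "\<dots> = (\<Sum>i\<in>PiE {2..Suc (Suc r)} (\<lambda>_. {..<p}). ?P (i(1 := x, Suc (Suc (Suc r)) := y)) (Suc (Suc r)))"
    unfolding ins by (rule sum_PiE_insert[symmetric]) simp
  finally show ?case .
qed

lemma trace_power:
  assumes A: "A \<in> carrier_mat p p" and k: "1 \<le> k"
  shows "trace_mat (A ^\<^sub>m k) = (\<Sum>i\<in>PiE {1..k} (\<lambda>_. {..<p}). \<Prod>a=1..k. A $$ (i a, i (cyc_next k a)))"
proof -
  obtain r where r: "k = Suc r" using k by (cases k) auto
  have Ak: "A ^\<^sub>m k \<in> carrier_mat p p" using A by (rule pow_carrier_mat)
  have ins: "{1..k} = insert 1 {2..k}" using k by auto
  have "trace_mat (A ^\<^sub>m k) = (\<Sum>x<p. (A ^\<^sub>m k) $$ (x, x))"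
    using A Ak by (simp add: trace_mat_def)
  also have "\<dots> = (\<Sum>x<p. \<Sum>i\<in>PiE {2..k} (\<lambda>_. {..<p}). \<Prod>a=1..k. A $$ ((i(1 := x)) a, (i(1 := x)) (cyc_next k a)))"
  proof (rule sum.cong[OF refl])
    fix x assume "x \<in> {..<p}"
    then have x: "x < p" by simp
    have "(i(1 := x, Suc k := x)) a = (i(1 := x)) a \<and> (i(1 := x, Suc k := x)) (Suc a) = (i(1 := x)) (cyc_next k a)"
      if "a \<in> {1..k}" for a and i :: "nat \<Rightarrow> nat"
      using that by (auto simp: cyc_next_def)
    then show "(A ^\<^sub>m k) $$ (x, x) = (\<Sum>i\<in>PiE {2..k} (\<lambda>_. {..<p}). \<Prod>a=1..k. A $$ ((i(1 := x)) a, (i(1 := x)) (cyc_next k a)))"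
      unfolding r power_mat_entry[OF A x x] by (intro sum.cong prod.cong refl) (simp add: r)
  qed
  also have "\<dots> = (\<Sum>i\<in>PiE {1..k} (\<lambda>_. {..<p}). \<Prod>a=1..k. A $$ (i a, i (cyc_next k a)))"
    unfolding ins by (subst sum_PiE_insert) auto
  finally show ?thesis .
qed

lemma trace_M_mat:
  assumes k: "1 \<le> k" and m: "1 \<le> m"
  shows "trace_mat (M_mat f m p n W X ^\<^sub>m k) =
    (\<Sum>i\<in>PiE {1..k} (\<lambda>_. {..<p}). \<Sum>j\<in>PiE {1..k} (\<lambda>_. {..<m}).
      \<Prod>a=1..k. f (\<Sum>l<n. W (i a) l * X l (j a)) * f (\<Sum>l<n. W (i (cyc_next k a)) l * X l (j a))) / real m ^ k"
proof -
  let ?Z = "\<lambda>r c. f (\<Sum>l<n. W r l * X l c)"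
  have M: "M_mat f m p n W X \<in> carrier_mat p p"
    unfolding M_mat_def Y_mat_def by (rule mult_carrier_mat[of _ p m]) simp_all
  have e: "M_mat f m p n W X $$ (r, s) = (\<Sum>c<m. ?Z r c * ?Z s c) / real m" if "r < p" "s < p" for r s
  proof -
    have "M_mat f m p n W X $$ (r, s) = (\<Sum>c<m. (1 / sqrt (real m) * ?Z r c) * (1 / sqrt (real m) * ?Z s c))"
      using that by (simp add: M_mat_def Y_mat_def scalar_prod_def atLeast0LessThan)
    also have "\<dots> = (\<Sum>c<m. ?Z r c * ?Z s c / real m)"
      by (intro sum.cong refl) (simp add: field_simps)
    finally show ?thesis by (simp add: sum_divide_distrib)
  qed
  have "(\<Prod>a=1..k. M_mat f m p n W X $$ (i a, i (cyc_next k a)))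
      = (\<Sum>j\<in>PiE {1..k} (\<lambda>_. {..<m}). \<Prod>a=1..k. ?Z (i a) (j a) * ?Z (i (cyc_next k a)) (j a)) / real m ^ k"
    if i: "i \<in> PiE {1..k} (\<lambda>_. {..<p})" for i
  proof -
    have ip: "i a < p" "i (cyc_next k a) < p" if "a \<in> {1..k}" for a
      using PiE_mem[OF i that] PiE_mem[OF i cyc_next_in[OF that]] by auto
    have "(\<Prod>a=1..k. M_mat f m p n W X $$ (i a, i (cyc_next k a)))
        = (\<Prod>a=1..k. (\<Sum>c<m. ?Z (i a) c * ?Z (i (cyc_next k a)) c) / real m)"
      by (intro prod.cong refl e ip)
    also have "\<dots> = (\<Prod>a=1..k. \<Sum>c<m. ?Z (i a) c * ?Z (i (cyc_next k a)) c) / real m ^ k"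
      by (simp add: prod_dividef)
    also have "(\<Prod>a=1..k. \<Sum>c<m. ?Z (i a) c * ?Z (i (cyc_next k a)) c)
        = (\<Sum>j\<in>PiE {1..k} (\<lambda>_. {..<m}). \<Prod>a=1..k. ?Z (i a) (j a) * ?Z (i (cyc_next k a)) (j a))"
      by (rule prod_sum_PiE) auto
    finally show ?thesis .
  qed
  then show ?thesis
    unfolding trace_power[OF M k] sum_divide_distrib by (intro sum.cong refl)
qed

section \<open>Index functions with a given kernel\<close>

lemma kern_image_blocks:
  assumes "partition_on {1..k} \<rho>" "g \<in> \<rho> \<rightarrow>\<^sub>E {..<p}" "inj_on g \<rho>"
    "\<And>C s. C \<in> \<rho> \<Longrightarrow> s \<in> C \<Longrightarrow> i s = g C"
  shows "kern k i = \<rho>"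
proof -
  have U: "\<Union>\<rho> = {1..k}" and ne: "\<And>C. C \<in> \<rho> \<Longrightarrow> C \<noteq> {}"
    using assms(1) by (auto simp: partition_on_def)
  have fib: "{s \<in> {1..k}. i s = g C} = C" if C: "C \<in> \<rho>" for C
  proof (intro Set.set_eqI iffI)
    fix s assume s: "s \<in> {s \<in> {1..k}. i s = g C}"
    then obtain D where D: "D \<in> \<rho>" "s \<in> D" using U by blast
    then have "g D = g C" using assms(4) s by simp
    then have "D = C" using assms(3) C D(1) by (auto dest: inj_onD)
    then show "s \<in> C" using D by simp
  next
    fix s assume "s \<in> C"
    then show "s \<in> {s \<in> {1..k}. i s = g C}" using assms(4) C U by auto
  qed
  have im: "i ` {1..k} = g ` \<rho>"
  proof
    show "i ` {1..k} \<subseteq> g ` \<rho>" unfolding U[symmetric] using assms(4) by auto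
    show "g ` \<rho> \<subseteq> i ` {1..k}"
    proof
      fix x assume "x \<in> g ` \<rho>"
      then obtain C where C: "C \<in> \<rho>" "x = g C" by blast
      then obtain s where "s \<in> C" using ne by blast
      then show "x \<in> i ` {1..k}" using assms(4) C U by (metis UnionI image_eqI)
    qed
  qed
  have "kern k i = (\<lambda>C. {s \<in> {1..k}. i s = g C}) ` \<rho>" unfolding kern_def im image_image ..
  also have "\<dots> = (\<lambda>C. C) ` \<rho>" by (rule image_cong[OF refl]) (rule fib)
  finally show ?thesis by simp
qed

text \<open>An index function with kernel \<open>\<rho>\<close> is the same as an injective
  labelling of the blocks of \<open>\<rho>\<close>.\<close>

lemma card_kern_fibre:
  assumes part: "partition_on {1..k} \<rho>"
  shows "card {i \<in> PiE {1..k} (\<lambda>_. {..<p}). kern k i = \<rho>} = falling p (card \<rho>)"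
proof -
  let ?I = "{i \<in> PiE {1..k} (\<lambda>_. {..<p}). kern k i = \<rho>}" and ?G = "{g \<in> \<rho> \<rightarrow>\<^sub>E {..<p}. inj_on g \<rho>}"
  have U: "\<Union>\<rho> = {1..k}" and ne: "\<And>C. C \<in> \<rho> \<Longrightarrow> C \<noteq> {}"
    and dis: "\<And>C D s. C \<in> \<rho> \<Longrightarrow> D \<in> \<rho> \<Longrightarrow> s \<in> C \<Longrightarrow> s \<in> D \<Longrightarrow> C = D"
    using part unfolding partition_on_def disjoint_def by blast+
  have fin: "finite \<rho>" using U by (metis finite_UnionD finite_atLeastAtMost)
  define rep where "rep C = (SOME s. s \<in> C)" for C :: "nat set"
  have rep: "rep C \<in> C" if "C \<in> \<rho>" for C unfolding rep_def using ne[OF that] by (simp add: some_in_eq)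
  define blk where "blk s = (THE C. C \<in> \<rho> \<and> s \<in> C)" for s
  have blk: "blk s = C" if "C \<in> \<rho>" "s \<in> C" for s C
    unfolding blk_def using that dis by (intro the_equality) blast+
  have const: "i s = i (rep C)" if "i \<in> ?I" "C \<in> \<rho>" "s \<in> C" for i C s
  proof -
    have "same_block (kern k i) s (rep C)" using that rep unfolding same_block_def by blast
    then show ?thesis by (simp add: kern_same_block)
  qed
  have "bij_betw (\<lambda>i. \<lambda>C\<in>\<rho>. i (rep C)) ?I ?G"
  proof (rule bij_betw_byWitness[where f' = "\<lambda>g. \<lambda>s\<in>{1..k}. g (blk s)"])
    show "\<forall>i\<in>?I. (\<lambda>s\<in>{1..k}. (\<lambda>C\<in>\<rho>. i (rep C)) (blk s)) = i"
    proof
      fix i assume i: "i \<in> ?I"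
      show "(\<lambda>s\<in>{1..k}. (\<lambda>C\<in>\<rho>. i (rep C)) (blk s)) = i"
      proof
        fix s
        show "(\<lambda>s\<in>{1..k}. (\<lambda>C\<in>\<rho>. i (rep C)) (blk s)) s = i s"
        proof (cases "s \<in> {1..k}")
          case True
          then obtain C where C: "C \<in> \<rho>" "s \<in> C" using U by blast
          then show ?thesis using True const[OF i C] blk[OF C] by simp
        next
          case False
          have "i \<in> PiE {1..k} (\<lambda>_. {..<p})" using i by simp
          from PiE_arb[OF this False] False show ?thesis by (simp del: atLeastAtMost_iff)
        qed
      qed
    qed
    show "\<forall>g\<in>?G. (\<lambda>C\<in>\<rho>. (\<lambda>s\<in>{1..k}. g (blk s)) (rep C)) = g"
    proof
      fix g assume g: "g \<in> ?G"
      show "(\<lambda>C\<in>\<rho>. (\<lambda>s\<in>{1..k}. g (blk s)) (rep C)) = g"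
      proof
        fix C
        show "(\<lambda>C\<in>\<rho>. (\<lambda>s\<in>{1..k}. g (blk s)) (rep C)) C = g C"
        proof (cases "C \<in> \<rho>")
          case True
          then have "rep C \<in> {1..k}" "blk (rep C) = C" using rep[OF True] U blk by blast+
          then show ?thesis using True by simp
        next
          case False
          have "g \<in> \<rho> \<rightarrow>\<^sub>E {..<p}" using g by simp
          from PiE_arb[OF this False] False show ?thesis by simp
        qed
      qed
    qed
    show "(\<lambda>i. \<lambda>C\<in>\<rho>. i (rep C)) ` ?I \<subseteq> ?G"
    proof
      fix g assume "g \<in> (\<lambda>i. \<lambda>C\<in>\<rho>. i (rep C)) ` ?I"
      then obtain i where i: "i \<in> ?I" "g = (\<lambda>C\<in>\<rho>. i (rep C))" by blast
      have ip: "i \<in> PiE {1..k} (\<lambda>_. {..<p})" using i(1) by simp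
      have rk: "rep C \<in> {1..k}" if "C \<in> \<rho>" for C using rep[OF that] U that by blast
      have "g \<in> \<rho> \<rightarrow>\<^sub>E {..<p}" unfolding i(2) using PiE_mem[OF ip rk] by auto
      moreover have "inj_on g \<rho>"
      proof (rule inj_onI)
        fix C D assume CD: "C \<in> \<rho>" "D \<in> \<rho>" "g C = g D"
        then have "i (rep C) = i (rep D)" by (simp add: i(2))
        then have "same_block (kern k i) (rep C) (rep D)" using rk CD by (simp add: kern_same_block)
        then have "same_block \<rho> (rep C) (rep D)" using i(1) by simp
        then obtain B where "B \<in> \<rho>" "rep C \<in> B" "rep D \<in> B" by (auto simp: same_block_def)
        then show "C = D" using dis rep CD by blast
      qed
      ultimately show "g \<in> ?G" by simp
    qed
    show "(\<lambda>g. \<lambda>s\<in>{1..k}. g (blk s)) ` ?G \<subseteq> ?I"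
    proof
      fix i assume "i \<in> (\<lambda>g. \<lambda>s\<in>{1..k}. g (blk s)) ` ?G"
      then obtain g where g: "g \<in> \<rho> \<rightarrow>\<^sub>E {..<p}" "inj_on g \<rho>" "i = (\<lambda>s\<in>{1..k}. g (blk s))" by blast
      have ig: "i s = g C" if "C \<in> \<rho>" "s \<in> C" for C s
      proof -
        have "s \<in> {1..k}" using that U by blast
        then show ?thesis using blk[OF that] by (simp add: g(3))
      qed
      have "i \<in> PiE {1..k} (\<lambda>_. {..<p})"
      proof (rule PiE_I)
        fix s assume "s \<in> {1..k}"
        then obtain C where C: "C \<in> \<rho>" "s \<in> C" using U by blast
        then show "i s \<in> {..<p}" using ig[OF C] PiE_mem[OF g(1) C(1)] by simp
      next
        fix s assume "s \<notin> {1..k}"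
        then show "i s = undefined" by (auto simp: g(3))
      qed
      moreover have "kern k i = \<rho>" by (rule kern_image_blocks[OF part g(1,2) ig])
      ultimately show "i \<in> ?I" by simp
    qed
  qed
  then have "card ?I = card ?G" by (rule bij_betw_same_card)
  then show ?thesis unfolding card_injections[OF fin] .
qed

definition index_partitions :: "nat \<Rightarrow> nat set set set"
  where "index_partitions k = {P. partition_on {1..k} P}"

lemma finite_index_partitions: "finite (index_partitions k)"
proof -
  have "index_partitions k \<subseteq> Pow (Pow {1..k})" by (auto simp: index_partitions_def partition_on_def)
  then show ?thesis using finite_subset by blast
qed

lemma sum_kern:
  "(\<Sum>i\<in>PiE {1..k} (\<lambda>_. {..<p}). G (kern k i)) = (\<Sum>\<rho>\<in>index_partitions k. real (falling p (card \<rho>)) * G \<rho>)"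
proof -
  let ?I = "PiE {1..k} (\<lambda>_. {..<p})"
  have "(\<Sum>i\<in>?I. G (kern k i)) = (\<Sum>\<rho>\<in>index_partitions k. \<Sum>i | i \<in> ?I \<and> kern k i = \<rho>. G (kern k i))"
    by (rule sum.group[symmetric])
      (use finite_index_partitions kern_partition in \<open>auto simp: index_partitions_def intro!: finite_PiE\<close>)
  also have "\<dots> = (\<Sum>\<rho>\<in>index_partitions k. real (card {i \<in> ?I. kern k i = \<rho>}) * G \<rho>)"
    by (intro sum.cong refl) simp
  also have "\<dots> = (\<Sum>\<rho>\<in>index_partitions k. real (falling p (card \<rho>)) * G \<rho>)"
    by (intro sum.cong refl) (simp add: card_kern_fibre index_partitions_def del: One_nat_def)
  finally show ?thesis .
qed

section \<open>Asymptotics of the sum over kernels\<close>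

lemma falling_ratio_tendsto:
  assumes "filterlim p at_top sequentially"
  shows "(\<lambda>N. real (falling (p N) r) / real (p N) ^ r) \<longlonglongrightarrow> 1"
proof -
  have pr: "filterlim (\<lambda>N. real (p N)) at_top sequentially"
    using assms filterlim_compose[OF filterlim_real_sequentially] by blast
  have ev: "eventually (\<lambda>N. 1 \<le> p N) sequentially"
    using assms by (simp add: filterlim_at_top)
  have lo: "(\<lambda>N. 1 - (real r)\<^sup>2 / real (p N)) \<longlonglongrightarrow> 1 - 0"
    by (intro tendsto_diff tendsto_const tendsto_divide_0[OF tendsto_const]
        filterlim_at_top_imp_at_infinity[OF pr])
  show ?thesis
  proof (rule tendsto_sandwich[OF _ _ lo[simplified] tendsto_const])
    show "eventually (\<lambda>N. 1 - (real r)\<^sup>2 / real (p N) \<le> real (falling (p N) r) / real (p N) ^ r) sequentially"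
      using ev
    proof eventually_elim
      case (elim N)
      then have P0: "0 < real (p N)" by simp
      have "real (p N * p N ^ r) \<le> real (p N * falling (p N) r + r\<^sup>2 * p N ^ r)"
        using falling_ge[of "p N" r] of_nat_le_iff by blast
      then show ?case using P0 by (simp add: field_simps)
    qed
    show "eventually (\<lambda>N. real (falling (p N) r) / real (p N) ^ r \<le> 1) sequentially"
      using ev
    proof eventually_elim
      case (elim N)
      have "real (falling (p N) r) \<le> real (p N ^ r)" using falling_le of_nat_le_iff by blast
      then show ?case using elim by simp
    qed
  qed
qed

definition kern_limit :: "real \<Rightarrow> real \<Rightarrow> nat \<Rightarrow> nat set set \<Rightarrow> nat set set \<Rightarrow> real"
  where "kern_limit t1 t2 k \<pi> \<rho> =
    (if \<pi> \<in> noncrossing_partitions {1..k} \<and> \<rho> \<in> compatible_partitions k \<pi>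
     then t1 ^ return_count k \<pi> \<rho> * t2 ^ (k - return_count k \<pi> \<rho>) else 0)"

lemma partition_card_le: "\<pi> \<in> index_partitions k \<Longrightarrow> card \<pi> \<le> k"
  using card_partition_le[of "{1..k}" \<pi>] by (simp add: index_partitions_def)

text \<open>The weight is the limit of
  \<open>p^|\<rho>| m^|\<pi>| n^(k+1-|\<rho>|-|\<pi>|) / (p m^k)\<close>, expressed through
  \<open>n / p\<close> and \<open>n / m\<close>; crossing pairs drop out through
  \<open>kern_limit\<close>.\<close>

lemma limit_moment_kern:
  assumes k: "1 \<le> k" and pos: "\<phi> > 0" "\<psi> > 0"
  shows "limit_moment \<phi> \<psi> t1 t2 k = (\<Sum>\<rho>\<in>index_partitions k. \<Sum>\<pi>\<in>index_partitions k.
    \<psi> * \<phi> ^ k / (\<psi> ^ card \<rho> * \<phi> ^ card \<pi>) * kern_limit t1 t2 k \<pi> \<rho>)"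
proof -
  have sub1: "noncrossing_partitions {1..k} \<subseteq> index_partitions k"
    by (auto simp: noncrossing_partitions_def index_partitions_def)
  have sub2: "compatible_partitions k \<pi> \<subseteq> index_partitions k" for \<pi>
    using sub1 by (auto simp: compatible_partitions_def)
  have c: "\<psi> * \<phi> ^ k / (\<psi> ^ card \<rho> * \<phi> ^ card \<pi>) = \<phi> ^ (k - card \<pi>) * (\<psi> ^ (k - card \<rho>) / \<psi> ^ (k - 1))"
    if "\<pi> \<in> index_partitions k" "\<rho> \<in> index_partitions k" for \<pi> \<rho>
  proof -
    have p: "\<phi> ^ (k - card \<pi>) = \<phi> ^ k / \<phi> ^ card \<pi>" "\<psi> ^ (k - card \<rho>) = \<psi> ^ k / \<psi> ^ card \<rho>"
      using partition_card_le[OF that(1)] partition_card_le[OF that(2)] pos by (simp_all add: power_diff)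
    have "\<psi> ^ k = \<psi> * \<psi> ^ (k - 1)" using k by (metis Suc_pred' less_eq_Suc_le power_Suc One_nat_def)
    then show ?thesis unfolding p using pos by (simp add: mult_ac)
  qed
  have "(\<Sum>\<rho>\<in>index_partitions k. \<Sum>\<pi>\<in>index_partitions k.
      \<psi> * \<phi> ^ k / (\<psi> ^ card \<rho> * \<phi> ^ card \<pi>) * kern_limit t1 t2 k \<pi> \<rho>)
    = (\<Sum>\<pi>\<in>index_partitions k. \<Sum>\<rho>\<in>index_partitions k.
      \<phi> ^ (k - card \<pi>) * (\<psi> ^ (k - card \<rho>) / \<psi> ^ (k - 1)) * kern_limit t1 t2 k \<pi> \<rho>)"
    by (subst sum.swap) (intro sum.cong refl, simp only: c)
  also have "\<dots> = (\<Sum>\<pi>\<in>noncrossing_partitions {1..k}. \<Sum>\<rho>\<in>compatible_partitions k \<pi>.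
      \<phi> ^ (k - card \<pi>) * (\<psi> ^ (k - card \<rho>) / \<psi> ^ (k - 1)) *
      (t1 ^ return_count k \<pi> \<rho> * t2 ^ (k - return_count k \<pi> \<rho>)))"
  proof (rule sum.mono_neutral_cong_right[OF finite_index_partitions sub1])
    show "\<forall>\<pi>\<in>index_partitions k - noncrossing_partitions {1..k}. (\<Sum>\<rho>\<in>index_partitions k.
        \<phi> ^ (k - card \<pi>) * (\<psi> ^ (k - card \<rho>) / \<psi> ^ (k - 1)) * kern_limit t1 t2 k \<pi> \<rho>) = 0"
      by (simp add: kern_limit_def)
    fix \<pi> assume pi: "\<pi> \<in> noncrossing_partitions {1..k}"
    show "(\<Sum>\<rho>\<in>index_partitions k. \<phi> ^ (k - card \<pi>) * (\<psi> ^ (k - card \<rho>) / \<psi> ^ (k - 1)) * kern_limit t1 t2 k \<pi> \<rho>)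
      = (\<Sum>\<rho>\<in>compatible_partitions k \<pi>. \<phi> ^ (k - card \<pi>) * (\<psi> ^ (k - card \<rho>) / \<psi> ^ (k - 1)) *
      (t1 ^ return_count k \<pi> \<rho> * t2 ^ (k - return_count k \<pi> \<rho>)))"
      by (rule sum.mono_neutral_cong_right[OF finite_index_partitions sub2])
        (use pi in \<open>auto simp: kern_limit_def\<close>)
  qed
  finally show ?thesis unfolding limit_moment_eq by simp
qed

context entry_laws
begin

definition walk_expectation :: "(real \<Rightarrow> real) \<Rightarrow> nat \<Rightarrow> nat \<Rightarrow> entry set \<Rightarrow> (nat \<Rightarrow> nat) \<Rightarrow> (nat \<Rightarrow> nat) \<Rightarrow> real"
  where "walk_expectation f k n K i j = (LINT u|(entries K). (\<Prod>a=1..k.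
      f (\<Sum>l<n. u (Inl (i a, l)) * u (Inr (l, j a)) / sqrt n) *
      f (\<Sum>l<n. u (Inl (i (cyc_next k a), l)) * u (Inr (l, j a)) / sqrt n)))"

text \<open>One constant serves all \<open>n\<close>, \<open>K\<close>, \<open>i\<close> and
  \<open>j\<close>; this uniformity is what allows summing over the growing number of walks.\<close>

lemma walk_expectation_bound:
  assumes f: "smooth_bounded f" "\<And>x. f (- x) = - f x" and k: "1 \<le> k"
  defines "t1 \<equiv> gauss ((sw * sx)\<^sup>2) (\<lambda>x. (f x)\<^sup>2) 0"
    and "t2 \<equiv> (sw * sx * gauss ((sw * sx)\<^sup>2) (deriv f) 0)\<^sup>2"
  shows "\<exists>C\<ge>0. \<forall>n\<ge>1. \<forall>K i j. finite K \<longrightarrow> (\<forall>a\<in>{1..k}. \<forall>l<n. Inl (i a, l) \<in> K \<and> Inr (l, j a) \<in> K) \<longrightarrow>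
    \<bar>real n ^ (card (kern k i) + card (kern k j)) * walk_expectation f k n K i j
      - real n ^ (k + 1) * kern_limit t1 t2 k (kern k j) (kern k i)\<bar> \<le> C * sqrt (real n) ^ (2 * k + 1)"
proof -
  have "\<forall>d\<in>{1..2 * k}. \<exists>B\<ge>1. \<forall>r\<le>2 * k + 5. \<forall>x. \<bar>(deriv ^^ r) (\<lambda>x. f x ^ d) x\<bar> \<le> B"
    using smooth_bounded_bound smooth_bounded_power[OF f(1)] by simp
  then obtain b where b: "\<And>d. d \<in> {1..2 * k} \<Longrightarrow> 1 \<le> b d"
    "\<And>d r x. d \<in> {1..2 * k} \<Longrightarrow> r \<le> 2 * k + 5 \<Longrightarrow> \<bar>(deriv ^^ r) (\<lambda>x. f x ^ d) x\<bar> \<le> b d"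
    by metis
  define B where "B = (\<Sum>d\<in>{1..2 * k}. b d)"
  have bB: "b d \<le> B" if "d \<in> {1..2 * k}" for d
    unfolding B_def using b(1) that by (intro member_le_sum) (auto intro: order_trans[of 0 1])
  have B1: "1 \<le> B" using b(1)[of 1] bB[of 1] k by simp
  have Bb: "\<bar>(deriv ^^ r) (\<lambda>x. f x ^ d) x\<bar> \<le> B" if "d \<in> {1..2 * k}" "r \<le> 2 * k + 5" for d r x
    using b(2)[OF that] bB[OF that(1)] by (rule order_trans)
  \<comment> \<open>\<open>Lmax\<close> and \<open>V\<close> reproduce the constants of the locale
    before \<open>n\<close>, \<open>K\<close>, \<open>i\<close> and \<open>j\<close> are fixed; the
    return count is at most \<open>k\<close>, so finitely many values suffice.\<close>
  define Lmax where "Lmax = (\<Sum>D\<le>k. \<bar>t1 ^ D * t2 ^ (k - D)\<bar>)"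
  define V where "V D = 1 + (\<Sum>d\<le>D. real d * mom d)" for D :: nat
  define C where "C = real (2 * k + 1 + 1) * (2 ^ (2 * k * (2 * k + 1)) * (B ^ (2 * k) * V ((2 * k + 1) * (2 * k))))
    + (2 * B) ^ (2 * k) * (2 * k) * (3 * V (4 * k) + 2 * mom 4 + mom 8) + (2 * k)\<^sup>2 * Lmax"
  have mb: "1 \<le> V r" for r unfolding V_def using mom_nonneg by (simp add: sum_nonneg)
  have C0: "0 \<le> C"
    unfolding C_def Lmax_def using B1 mb[of "(2 * k + 1) * (2 * k)"] mb[of "4 * k"] mom_nonneg
    by (intro add_nonneg_nonneg mult_nonneg_nonneg sum_nonneg) auto
  show ?thesis
  proof (intro exI[of _ C] conjI C0 allI impI)
    fix n :: nat and K :: "entry set" and i j :: "nat \<Rightarrow> nat"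
    assume n: "1 \<le> n" and K: "finite K"
      and m: "\<forall>a\<in>{1..k}. \<forall>l<n. Inl (i a, l) \<in> K \<and> Inr (l, j a) \<in> K"
    interpret walk_system \<mu>w \<mu>x sw sx n K f k i j B
      by (unfold_locales; (rule n K f k B1 Bb | use m in blast); assumption?)
    have V: "mom_bound = V" unfolding fun_eq_iff mom_bound_def V_def by simp
    have lv: "limit_value = kern_limit t1 t2 k (kern k j) (kern k i)"
      unfolding limit_value_def kern_limit_def W_same_iff_walk t1_def t2_def ..
    have "\<bar>limit_value\<bar> \<le> Lmax"
    proof (cases "noncrossing_walk (walk k i j)")
      case True
      let ?D = "return_count k (kern k j) (kern k i)"
      have "?D \<le> card {1..k}" unfolding return_count_def by (intro card_mono) auto
      then have "\<bar>t1 ^ ?D * t2 ^ (k - ?D)\<bar> \<le> Lmax"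
        unfolding Lmax_def by (intro member_le_sum[where f = "\<lambda>D. \<bar>t1 ^ D * t2 ^ (k - D)\<bar>"]) auto
      then show ?thesis using True unfolding limit_value_def t1_def t2_def by simp
    next
      case False
      then show ?thesis unfolding limit_value_def Lmax_def by (simp add: sum_nonneg)
    qed
    then have "(Q + 1) * (2 ^ (2 * k * Q) * term_const) + lim_const + (2 * k)\<^sup>2 * \<bar>limit_value\<bar> \<le> C"
      unfolding C_def term_const_def lim_const_def V by (intro add_mono mult_left_mono) auto
    then have "((Q + 1) * (2 ^ (2 * k * Q) * term_const) + lim_const + (2 * k)\<^sup>2 * \<bar>limit_value\<bar>)
        * sqrt (real n) ^ (2 * k + 1) \<le> C * sqrt (real n) ^ (2 * k + 1)"
      by (intro mult_right_mono) auto
    with walk_EPsi_bound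
    show "\<bar>real n ^ (card (kern k i) + card (kern k j)) * walk_expectation f k n K i j
      - real n ^ (k + 1) * kern_limit t1 t2 k (kern k j) (kern k i)\<bar> \<le> C * sqrt (real n) ^ (2 * k + 1)"
      unfolding card_set_walk EPsi_walk walk_expectation_def lv by (rule order_trans)
  qed
qed

end

lemma sum_kern2:
  "(\<Sum>i\<in>PiE {1..k} (\<lambda>_. {..<p}). \<Sum>j\<in>PiE {1..k} (\<lambda>_. {..<m}). G (kern k i) (kern k j))
    = (\<Sum>\<rho>\<in>index_partitions k. \<Sum>\<pi>\<in>index_partitions k.
        real (falling p (card \<rho>)) * real (falling m (card \<pi>)) * G \<rho> \<pi>)"
  unfolding sum_kern[where G = "G _"]
  by (subst sum_kern[where G = "\<lambda>\<rho>. \<Sum>\<pi>\<in>index_partitions k. real (falling m (card \<pi>)) * G \<rho> \<pi>"])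
    (simp add: sum_distrib_left mult.assoc)

text \<open>The error of each walk is at most \<open>C / sqrt n\<close> times its weight
  \<open>?q\<close>. After division by \<open>p m^k\<close> the weights have a convergent sum, so
  the total error tends to 0.\<close>

lemma kern_sum_tendsto:
  fixes m p n :: "nat \<Rightarrow> nat" and w :: "nat \<Rightarrow> (nat \<Rightarrow> nat) \<Rightarrow> (nat \<Rightarrow> nat) \<Rightarrow> real"
  assumes lim: "filterlim m at_top sequentially" "filterlim p at_top sequentially" "filterlim n at_top sequentially"
    and pos: "\<phi> > 0" "\<psi> > 0"
    and ratio: "(\<lambda>N. real (n N) / real (m N)) \<longlonglongrightarrow> \<phi>" "(\<lambda>N. real (n N) / real (p N)) \<longlonglongrightarrow> \<psi>"
    and bound: "\<And>N i j. 1 \<le> n N \<Longrightarrow> i \<in> PiE {1..k} (\<lambda>_. {..<p N}) \<Longrightarrow> j \<in> PiE {1..k} (\<lambda>_. {..<m N}) \<Longrightarrow>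
      \<bar>real (n N) ^ (card (kern k i) + card (kern k j)) * w N i j - real (n N) ^ (k + 1) * L (kern k j) (kern k i)\<bar>
        \<le> C * sqrt (real (n N)) ^ (2 * k + 1)"
  shows "(\<lambda>N. (\<Sum>i\<in>PiE {1..k} (\<lambda>_. {..<p N}). \<Sum>j\<in>PiE {1..k} (\<lambda>_. {..<m N}). w N i j) / (real (p N) * real (m N) ^ k))
    \<longlonglongrightarrow> (\<Sum>\<rho>\<in>index_partitions k. \<Sum>\<pi>\<in>index_partitions k.
        \<psi> * \<phi> ^ k / (\<psi> ^ card \<rho> * \<phi> ^ card \<pi>) * L \<pi> \<rho>)"
proof -
  let ?A = "index_partitions k"
  let ?I = "\<lambda>N. PiE {1..k} (\<lambda>_. {..<p N})" and ?J = "\<lambda>N. PiE {1..k} (\<lambda>_. {..<m N})"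
  define S where "S N = (\<Sum>i\<in>?I N. \<Sum>j\<in>?J N. w N i j) / (real (p N) * real (m N) ^ k)" for N
  define c where "c N \<rho> \<pi> = real (falling (p N) (card \<rho>)) * real (falling (m N) (card \<pi>)) *
    (real (n N) ^ (k + 1) / real (n N) ^ (card \<rho> + card \<pi>)) / (real (p N) * real (m N) ^ k)"
    for N and \<rho> \<pi> :: "nat set set"
  define T where "T N = (\<Sum>\<rho>\<in>?A. \<Sum>\<pi>\<in>?A. c N \<rho> \<pi> * L \<pi> \<rho>)" for N
  define R where "R N = (\<Sum>\<rho>\<in>?A. \<Sum>\<pi>\<in>?A. c N \<rho> \<pi>) * (C / sqrt (real (n N)))" for N
  have ev: "eventually (\<lambda>N. 1 \<le> n N \<and> 1 \<le> p N \<and> 1 \<le> m N) sequentially"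
    using lim by (simp add: filterlim_at_top eventually_conj_iff)
  have c: "(\<lambda>N. c N \<rho> \<pi>) \<longlonglongrightarrow> \<psi> * \<phi> ^ k / (\<psi> ^ card \<rho> * \<phi> ^ card \<pi>)" for \<rho> \<pi>
  proof -
    let ?r = "card \<rho>" and ?s = "card \<pi>"
    \<comment> \<open>Regrouping by the ratios \<open>n / p\<close> and \<open>n / m\<close> leaves
      only factors whose limits are known.\<close>
    let ?d = "\<lambda>N. (real (falling (p N) ?r) / real (p N) ^ ?r) * (real (falling (m N) ?s) / real (m N) ^ ?s) *
      ((real (n N) / real (p N)) * (real (n N) / real (m N)) ^ k /
        ((real (n N) / real (p N)) ^ ?r * (real (n N) / real (m N)) ^ ?s))"
    have "?d \<longlonglongrightarrow> 1 * 1 * (\<psi> * \<phi> ^ k / (\<psi> ^ ?r * \<phi> ^ ?s))"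
      using pos by (intro tendsto_intros falling_ratio_tendsto lim ratio) auto
    moreover have "eventually (\<lambda>N. c N \<rho> \<pi> = ?d N) sequentially"
      using ev
    proof eventually_elim
      case (elim N)
      then have "0 < real (n N)" "0 < real (p N)" "0 < real (m N)" by auto
      then show ?case unfolding c_def by (simp add: power_divide power_add mult_ac)
    qed
    ultimately show ?thesis by (simp add: tendsto_cong)
  qed
  have Tlim: "T \<longlonglongrightarrow> (\<Sum>\<rho>\<in>?A. \<Sum>\<pi>\<in>?A. \<psi> * \<phi> ^ k / (\<psi> ^ card \<rho> * \<phi> ^ card \<pi>) * L \<pi> \<rho>)"
    unfolding T_def by (intro tendsto_intros c)
  have "filterlim (\<lambda>N. sqrt (real (n N))) at_top sequentially"
    by (rule filterlim_compose[OF sqrt_at_top filterlim_compose[OF filterlim_real_sequentially lim(3)]])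
  then have "(\<lambda>N. C / sqrt (real (n N))) \<longlonglongrightarrow> 0"
    by (intro tendsto_divide_0[OF tendsto_const] filterlim_at_top_imp_at_infinity)
  then have "R \<longlonglongrightarrow> (\<Sum>\<rho>\<in>?A. \<Sum>\<pi>\<in>?A. \<psi> * \<phi> ^ k / (\<psi> ^ card \<rho> * \<phi> ^ card \<pi>)) * 0"
    unfolding R_def by (intro tendsto_mult tendsto_sum c)
  then have Rlim: "R \<longlonglongrightarrow> 0" by simp
  have "eventually (\<lambda>N. norm (S N - T N) \<le> R N) sequentially"
    using ev
  proof eventually_elim
    case (elim N)
    let ?n = "real (n N)" and ?Z = "real (p N) * real (m N) ^ k"
    let ?q = "\<lambda>\<rho> \<pi>. ?n ^ (k + 1) / ?n ^ (card \<rho> + card \<pi>)"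
    have n0: "0 < ?n" and Z0: "0 < ?Z" using elim by auto
    have s: "sqrt ?n ^ (2 * k + 1) = ?n ^ (k + 1) / sqrt ?n"
    proof -
      have "sqrt ?n ^ (2 * k + 1) * sqrt ?n = sqrt ?n ^ (2 * (k + 1))" by simp
      also have "\<dots> = ?n ^ (k + 1)" unfolding power_mult by simp
      finally have "sqrt ?n ^ (2 * k + 1) * sqrt ?n = ?n ^ (k + 1)" .
      then show ?thesis using n0 by (simp add: nonzero_eq_divide_eq)
    qed
    have t: "\<bar>w N i j - ?q (kern k i) (kern k j) * L (kern k j) (kern k i)\<bar>
        \<le> ?q (kern k i) (kern k j) * (C / sqrt ?n)"
      if i: "i \<in> ?I N" and j: "j \<in> ?J N" for i j
    proof -
      let ?D = "?n ^ (card (kern k i) + card (kern k j))"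
      have D0: "0 < ?D" using n0 by simp
      have "w N i j - ?q (kern k i) (kern k j) * L (kern k j) (kern k i)
          = (?D * w N i j - ?n ^ (k + 1) * L (kern k j) (kern k i)) / ?D"
        using D0 by (simp add: field_simps)
      then have "\<bar>w N i j - ?q (kern k i) (kern k j) * L (kern k j) (kern k i)\<bar>
          = \<bar>?D * w N i j - ?n ^ (k + 1) * L (kern k j) (kern k i)\<bar> / ?D"
        using D0 by (simp only: abs_divide abs_of_pos)
      also have "\<dots> \<le> C * sqrt ?n ^ (2 * k + 1) / ?D"
        using bound[OF _ i j] elim D0 by (intro divide_right_mono) auto
      finally show ?thesis unfolding s by (simp add: mult.commute)
    qed
    have Tk: "\<And>G. (\<Sum>\<rho>\<in>?A. \<Sum>\<pi>\<in>?A. c N \<rho> \<pi> * G \<rho> \<pi>)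
        = (\<Sum>i\<in>?I N. \<Sum>j\<in>?J N. ?q (kern k i) (kern k j) * G (kern k i) (kern k j)) / ?Z"
    proof -
      fix G :: "nat set set \<Rightarrow> nat set set \<Rightarrow> real"
      show "(\<Sum>\<rho>\<in>?A. \<Sum>\<pi>\<in>?A. c N \<rho> \<pi> * G \<rho> \<pi>)
        = (\<Sum>i\<in>?I N. \<Sum>j\<in>?J N. ?q (kern k i) (kern k j) * G (kern k i) (kern k j)) / ?Z"
        unfolding sum_kern2[where G = "\<lambda>\<rho> \<pi>. ?q \<rho> \<pi> * G \<rho> \<pi>"] c_def
        unfolding sum_divide_distrib by (intro sum.cong refl) (simp add: field_simps)
    qed
    have "S N - T N = (\<Sum>i\<in>?I N. \<Sum>j\<in>?J N. w N i j - ?q (kern k i) (kern k j) * L (kern k j) (kern k i)) / ?Z"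
      unfolding S_def T_def Tk[of "\<lambda>\<rho> \<pi>. L \<pi> \<rho>"] by (simp add: sum_subtractf diff_divide_distrib)
    then have "norm (S N - T N)
        = \<bar>\<Sum>i\<in>?I N. \<Sum>j\<in>?J N. w N i j - ?q (kern k i) (kern k j) * L (kern k j) (kern k i)\<bar> / ?Z"
      using Z0 by (simp only: real_norm_def abs_divide abs_of_pos)
    also have "\<dots> \<le> (\<Sum>i\<in>?I N. \<Sum>j\<in>?J N. ?q (kern k i) (kern k j) * (C / sqrt ?n)) / ?Z"
      using Z0 t by (intro divide_right_mono sum_norm_le[where 'a = real, unfolded real_norm_def]) auto
    also have "\<dots> = R N"
      unfolding R_def Tk[of "\<lambda>_ _. C / sqrt ?n", symmetric] sum_distrib_right ..
    finally show ?case .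
  qed
  then have "(\<lambda>N. S N - T N) \<longlonglongrightarrow> 0" using Rlim by (rule Lim_null_comparison)
  then have "(\<lambda>N. (S N - T N) + T N) \<longlonglongrightarrow> 0 + (\<Sum>\<rho>\<in>?A. \<Sum>\<pi>\<in>?A. \<psi> * \<phi> ^ k / (\<psi> ^ card \<rho> * \<phi> ^ card \<pi>) * L \<pi> \<rho>)"
    using Tlim by (rule tendsto_add)
  then show ?thesis by (simp add: S_def)
qed

text \<open>An image measure instead of a density, so that the degenerate case \<open>c = 0\<close>
  is included.\<close>

definition scaled_normal :: "real \<Rightarrow> real measure"
  where "scaled_normal c = distr std_normal_distribution borel (\<lambda>x. c * x)"

lemma scaled_normal_dist: "real_distribution (scaled_normal c)"
  unfolding scaled_normal_def by (rule std_normal.real_distribution_distr) simp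

lemma char_scaled_normal: "char (scaled_normal c) t = complex_of_real (exp (- (c * t)\<^sup>2 / 2))"
proof -
  have "char (scaled_normal c) t = char std_normal_distribution (t * c)"
    unfolding char_def scaled_normal_def by (subst integral_distr) (auto simp: mult.assoc)
  then show ?thesis by (simp add: char_std_normal_distribution mult.commute)
qed

lemma distr_scaled_normal: "distr (scaled_normal c) borel (\<lambda>x. d * x) = scaled_normal (d * c)"
proof -
  have "(\<lambda>x. d * x) \<circ> (\<lambda>x. c * x) = (\<lambda>x. (d * c) * x)" by (simp add: fun_eq_iff mult.assoc)
  then show ?thesis unfolding scaled_normal_def by (subst distr_distr) simp_all
qed

lemma scaled_normal_symm: "distr (scaled_normal c) borel uminus = scaled_normal c"
proof -
  have "distr (scaled_normal c) borel uminus = scaled_normal (- c)"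
    using distr_scaled_normal[of c "- 1"] by (simp add: fun_eq_iff[symmetric])
  also have "\<dots> = scaled_normal c"
    by (rule Levy_uniqueness[OF scaled_normal_dist scaled_normal_dist]) (simp add: fun_eq_iff char_scaled_normal)
  finally show ?thesis .
qed

text \<open>Symmetry makes the mean of \<open>\<nu>\<close> zero, so that its variance is the second
  moment that the locale asks for.\<close>

lemma entry_laws_normal:
  assumes nu: "real_distribution \<nu>" "distr \<nu> borel uminus = \<nu>" "\<And>r::nat. integrable \<nu> (\<lambda>x. x ^ r)"
    and var: "prob_space.variance \<nu> (\<lambda>x. x) = sx\<^sup>2"
  shows "entry_laws (scaled_normal sw) \<nu> sw sx"
proof (rule entry_laws.intro)
  interpret \<nu>: real_distribution \<nu> by (rule nu(1))
  show "integrable (scaled_normal sw) (\<lambda>x. x ^ r)" for r :: nat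
    unfolding scaled_normal_def
    by (subst integrable_distr_eq)
      (auto simp: power_mult_distrib intro!: integrable_mult_right integrable_std_normal_distribution_moment)
  have "(LINT x|std_normal_distribution. x\<^sup>2) = 1"
    using std_normal_distribution_even_moments(1)[of 1] by (simp add: fact_numeral)
  then show "(LINT x|scaled_normal sw. x\<^sup>2) = sw\<^sup>2"
    unfolding scaled_normal_def by (subst integral_distr) (auto simp: power_mult_distrib)
  have "(LINT x|\<nu>. x) = (LINT x|distr \<nu> borel uminus. x)" by (simp add: nu(2))
  also have "\<dots> = - (LINT x|\<nu>. x)" by (subst integral_distr) auto
  finally have "(LINT x|\<nu>. x) = 0" by simp
  then show "(LINT x|\<nu>. x\<^sup>2) = sx\<^sup>2" using var by simp
qed (fact scaled_normal_dist scaled_normal_symm nu)+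

context entry_laws
begin

lemma distr_entries:
  assumes M: "prob_space M" and K: "K \<noteq> {}"
    and ind: "prob_space.indep_vars M (\<lambda>_. borel) U K"
    and U: "\<And>\<kappa>. \<kappa> \<in> K \<Longrightarrow> distr M borel (U \<kappa>) = law \<kappa>"
  shows "distr M (PiM K (\<lambda>_. borel)) (\<lambda>\<omega>. \<lambda>\<kappa>\<in>K. U \<kappa> \<omega>) = entries K"
proof -
  interpret prob_space M by fact
  have rv: "random_variable borel (U \<kappa>)" if "\<kappa> \<in> K" for \<kappa>
    using ind that by (auto simp: indep_vars_def)
  have "distr M (PiM K (\<lambda>_. borel)) (\<lambda>\<omega>. \<lambda>\<kappa>\<in>K. U \<kappa> \<omega>) = PiM K (\<lambda>\<kappa>. distr M borel (U \<kappa>))"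
    using indep_vars_iff_distr_eq_PiM'[OF K, where M' = "\<lambda>_. borel" and X = U] rv ind by blast
  also have "\<dots> = entries K" by (rule PiM_cong) (simp_all add: U)
  finally show ?thesis .
qed

text \<open>The integrand reads only entries with keys in \<open>K\<close>, so it may be evaluated
  on the restricted family, whose law is the product measure by independence.\<close>

lemma walk_expectation_transfer:
  fixes n :: nat
  assumes M: "prob_space M" and K: "K \<noteq> {}"
    and ind: "prob_space.indep_vars M (\<lambda>_. borel) U K"
    and U: "\<And>\<kappa>. \<kappa> \<in> K \<Longrightarrow> distr M borel (U \<kappa>) = law \<kappa>"
    and K_in: "\<And>a l. a \<in> {1..k} \<Longrightarrow> l < n \<Longrightarrow> Inl (i a, l) \<in> K \<and> Inr (l, j a) \<in> K"
    and fm: "f \<in> borel_measurable borel" and fb: "\<And>x. \<bar>f x\<bar> \<le> b"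
  defines "F \<equiv> \<lambda>\<omega>. \<Prod>a=1..k.
      f (\<Sum>l<n. U (Inl (i a, l)) \<omega> * U (Inr (l, j a)) \<omega> / sqrt n) *
      f (\<Sum>l<n. U (Inl (i (cyc_next k a), l)) \<omega> * U (Inr (l, j a)) \<omega> / sqrt n)"
  shows "integrable M F" "(LINT \<omega>|M. F \<omega>) = walk_expectation f k n K i j"
proof -
  interpret prob_space M by fact
  have rv: "random_variable borel (U \<kappa>)" if "\<kappa> \<in> K" for \<kappa>
    using ind that by (auto simp: indep_vars_def)
  note Kn = K_in K_in[OF cyc_next_in]
  let ?G = "\<lambda>u. \<Prod>a=1..k.
      f (\<Sum>l<n. u (Inl (i a, l)) * u (Inr (l, j a)) / sqrt n) *
      f (\<Sum>l<n. u (Inl (i (cyc_next k a), l)) * u (Inr (l, j a)) / sqrt n)"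
  have Gm: "?G \<in> borel_measurable (PiM K (\<lambda>_. borel))"
    by (intro borel_measurable_prod borel_measurable_times measurable_compose[OF _ fm] borel_measurable_sum
        borel_measurable_divide borel_measurable_const measurable_component_singleton) (use Kn in auto)
  have Um: "(\<lambda>\<omega>. \<lambda>\<kappa>\<in>K. U \<kappa> \<omega>) \<in> measurable M (PiM K (\<lambda>_. borel))"
    by (rule measurable_restrict) (rule rv)
  have FG: "F \<omega> = ?G (\<lambda>\<kappa>\<in>K. U \<kappa> \<omega>)" for \<omega>
    unfolding F_def by (intro prod.cong arg_cong2[where f = "(*)"] arg_cong[where f = f] sum.cong refl) (use Kn in auto)
  have Fm: "F \<in> borel_measurable M"
    using measurable_compose[OF Um Gm] unfolding FG[symmetric] .
  have "norm (F \<omega>) \<le> (\<Prod>a=1..k. b * b)" for \<omega>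
    unfolding F_def real_norm_def abs_prod abs_mult
    by (intro prod_mono conjI mult_mono fb mult_nonneg_nonneg abs_ge_zero order_trans[OF abs_ge_zero fb])
  then show "integrable M F" using Fm by (intro integrable_const_bound) auto
  have "(LINT \<omega>|M. F \<omega>) = (LINT u|distr M (PiM K (\<lambda>_. borel)) (\<lambda>\<omega>. \<lambda>\<kappa>\<in>K. U \<kappa> \<omega>). ?G u)"
    unfolding FG by (rule integral_distr[OF Um Gm, symmetric])
  moreover have "distr M (PiM K (\<lambda>_. borel)) (\<lambda>\<omega>. \<lambda>\<kappa>\<in>K. U \<kappa> \<omega>) = entries K"
    by (rule distr_entries[OF M K ind]) (rule U)
  ultimately show "(LINT \<omega>|M. F \<omega>) = walk_expectation f k n K i j"
    unfolding walk_expectation_def by (rule trans[OF _ arg_cong[where f = "\<lambda>A. LINT u|A. ?G u"]])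
qed

end

theorem lemma4p16:
  fixes P :: "nat \<Rightarrow> 'a measure"
    and W X :: "nat \<Rightarrow> nat \<Rightarrow> nat \<Rightarrow> 'a \<Rightarrow> real"
    and m p n :: "nat \<Rightarrow> nat"
    and \<nu>w :: "nat \<Rightarrow> real measure"
    and \<nu>x :: "real measure"
    and \<sigma>w \<sigma>x \<phi> \<psi> :: real
    and f :: "real \<Rightarrow> real"
    and k :: nat
  assumes prob: "\<And>N. prob_space (P N)"
    and W_law: "\<And>N i l. i < p N \<Longrightarrow> l < n N \<Longrightarrow> distr (P N) borel (W N i l) = \<nu>w (n N)"
    and X_law: "\<And>N l j. l < n N \<Longrightarrow> j < m N \<Longrightarrow> distr (P N) borel (X N l j) = \<nu>x"
    and indep: "\<And>N. prob_space.indep_vars (P N) (\<lambda>_. borel)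
          (case_sum (\<lambda>(i, l). W N i l) (\<lambda>(l, j). X N l j))
          (({..<p N} \<times> {..<n N}) <+> ({..<n N} \<times> {..<m N}))"
    and sigma_w: "\<sigma>w \<ge> 0"
    and nu_w_dist: "\<And>d. d > 0 \<Longrightarrow> real_distribution (\<nu>w d)"
    and nu_w_gauss: "\<And>d t. d > 0 \<Longrightarrow>
          char (\<nu>w d) t = complex_of_real (exp (- (\<sigma>w\<^sup>2 * t\<^sup>2) / (2 * real d)))"
    and sigma_x: "\<sigma>x \<ge> 0"
    and nu_x_dist: "real_distribution \<nu>x"
    and nu_x_symm: "distr \<nu>x borel uminus = \<nu>x"
    and nu_x_moments: "\<And>r::nat. integrable \<nu>x (\<lambda>x. x ^ r)"
    and nu_x_var: "prob_space.variance \<nu>x (\<lambda>x. x) = \<sigma>x\<^sup>2"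
    and f_odd: "\<And>x. f (- x) = - f x"
    and f_smooth: "C_infinity f"
    and f_L1: "\<And>r. integrable lborel ((deriv ^^ r) f)"
    and m_lim: "filterlim m at_top sequentially"
    and p_lim: "filterlim p at_top sequentially"
    and n_lim: "filterlim n at_top sequentially"
    and phi_pos: "\<phi> > 0"
    and psi_pos: "\<psi> > 0"
    and ratio_phi: "(\<lambda>N. real (n N) / real (m N)) \<longlonglongrightarrow> \<phi>"
    and ratio_psi: "(\<lambda>N. real (n N) / real (p N)) \<longlonglongrightarrow> \<psi>"
    and k_pos: "k \<ge> 1"
  shows "(\<lambda>N. prob_space.expectation (P N)
            (\<lambda>\<omega>. 1 / real (p N) * trace_mat
               (M_mat f (m N) (p N) (n N) (\<lambda>i l. W N i l \<omega>) (\<lambda>l j. X N l j \<omega>) ^\<^sub>m k)))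
         \<longlonglongrightarrow> limit_moment \<phi> \<psi> (theta1 \<sigma>w \<sigma>x f) (theta2 \<sigma>w \<sigma>x f) k"
proof -
  let ?t1 = "theta1 \<sigma>w \<sigma>x f" and ?t2 = "theta2 \<sigma>w \<sigma>x f"
  interpret entry_laws "scaled_normal \<sigma>w" \<nu>x \<sigma>w \<sigma>x
    by (rule entry_laws_normal[OF nu_x_dist nu_x_symm nu_x_moments nu_x_var])
  have fs: "smooth_bounded f"
    using f_smooth f_L1 unfolding C_infinity_def by (intro L1_derivatives_smooth_bounded) auto
  obtain b where fb: "\<And>x. \<bar>f x\<bar> \<le> b"
    using fs unfolding smooth_bounded_def by (metis funpow_0)
  have fm: "f \<in> borel_measurable borel" by (rule smooth_bounded_measurable[OF fs])
  have f'm: "deriv f \<in> borel_measurable borel"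
    by (rule smooth_bounded_measurable[OF smooth_bounded_deriv[OF fs]])
  have g: "gauss ((\<sigma>w * \<sigma>x)\<^sup>2) h 0 = (LINT x|lborel. h (\<sigma>w * \<sigma>x * x) * std_normal_density x)"
    if h: "h \<in> borel_measurable borel" for h :: "real \<Rightarrow> real"
  proof -
    have hm: "(\<lambda>x. h (\<sigma>w * \<sigma>x * x)) \<in> borel_measurable borel" by (rule measurable_compose[OF _ h]) simp
    \<comment> \<open>The square root of \<open>(\<sigma>w * \<sigma>x)\<^sup>2\<close> is
      \<open>\<sigma>w * \<sigma>x\<close> because both factors are nonnegative.\<close>
    have "gauss ((\<sigma>w * \<sigma>x)\<^sup>2) h 0 = (LINT x|std_normal_distribution. h (\<sigma>w * \<sigma>x * x))"
      using sigma_w sigma_x by (simp add: gauss_def)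
    then show ?thesis
      using hm by (simp add: integral_density normal_density_nonneg mult.commute)
  qed
  have t1: "gauss ((\<sigma>w * \<sigma>x)\<^sup>2) (\<lambda>x. (f x)\<^sup>2) 0 = ?t1"
    unfolding theta1_def by (rule g) (use fm in simp)
  have t2: "(\<sigma>w * \<sigma>x * gauss ((\<sigma>w * \<sigma>x)\<^sup>2) (deriv f) 0)\<^sup>2 = ?t2"
    unfolding theta2_def g[OF f'm] ..
  obtain C where C: "\<And>n K i j. 1 \<le> n \<Longrightarrow> finite K \<Longrightarrow>
      (\<And>a l. a \<in> {1..k} \<Longrightarrow> l < n \<Longrightarrow> Inl (i a, l) \<in> K \<and> Inr (l, j a) \<in> K) \<Longrightarrow>
      \<bar>real n ^ (card (kern k i) + card (kern k j)) * walk_expectation f k n K i j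
      - real n ^ (k + 1) * kern_limit ?t1 ?t2 k (kern k j) (kern k i)\<bar> \<le> C * sqrt (real n) ^ (2 * k + 1)"
    using walk_expectation_bound[OF fs f_odd k_pos] unfolding t1 t2 by meson
  define K :: "nat \<Rightarrow> entry set" where "K N = ({..<p N} \<times> {..<n N}) <+> ({..<n N} \<times> {..<m N})" for N
  have K_in: "Inl (i a, l) \<in> K N \<and> Inr (l, j a) \<in> K N"
    if "i \<in> PiE {1..k} (\<lambda>_. {..<p N})" "j \<in> PiE {1..k} (\<lambda>_. {..<m N})" "a \<in> {1..k}" "l < n N" for N i j a l
    using PiE_mem[OF that(1,3)] PiE_mem[OF that(2,3)] that(4) by (auto simp: K_def)
  let ?I = "\<lambda>N. PiE {1..k} (\<lambda>_. {..<p N})" and ?J = "\<lambda>N. PiE {1..k} (\<lambda>_. {..<m N})"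
  let ?w = "\<lambda>N i j. walk_expectation f k (n N) (K N) i j"
  have lim: "(\<lambda>N. (\<Sum>i\<in>?I N. \<Sum>j\<in>?J N. ?w N i j) / (real (p N) * real (m N) ^ k))
      \<longlonglongrightarrow> limit_moment \<phi> \<psi> ?t1 ?t2 k"
    unfolding limit_moment_kern[OF k_pos phi_pos psi_pos]
  proof (rule kern_sum_tendsto[OF m_lim p_lim n_lim phi_pos psi_pos ratio_phi ratio_psi])
    fix N i j assume n: "1 \<le> n N" and i: "i \<in> ?I N" and j: "j \<in> ?J N"
    show "\<bar>real (n N) ^ (card (kern k i) + card (kern k j)) * ?w N i j
      - real (n N) ^ (k + 1) * kern_limit ?t1 ?t2 k (kern k j) (kern k i)\<bar> \<le> C * sqrt (real (n N)) ^ (2 * k + 1)"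
      by (rule C[OF n _ K_in[OF i j]]) (simp_all add: K_def)
  qed
  \<comment> \<open>The dimensions may vanish for small \<open>N\<close>; they are positive only
    eventually.\<close>
  have ev: "eventually (\<lambda>N. 1 \<le> n N \<and> 1 \<le> p N \<and> 1 \<le> m N) sequentially"
    using m_lim p_lim n_lim by (simp add: filterlim_at_top eventually_conj_iff)
  have "eventually (\<lambda>N. prob_space.expectation (P N)
            (\<lambda>\<omega>. 1 / real (p N) * trace_mat
               (M_mat f (m N) (p N) (n N) (\<lambda>i l. W N i l \<omega>) (\<lambda>l j. X N l j \<omega>) ^\<^sub>m k))
      = (\<Sum>i\<in>?I N. \<Sum>j\<in>?J N. ?w N i j) / (real (p N) * real (m N) ^ k)) sequentially"
    using ev
  proof eventually_elim
    case (elim N)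
    then have n: "1 \<le> n N" and p: "1 \<le> p N" and m: "1 \<le> m N" by auto
    interpret prob_space "P N" by (rule prob)
    let ?V = "case_sum (\<lambda>(i, l). W N i l) (\<lambda>(l, j). X N l j)"
    \<comment> \<open>Rescaling the weights by \<open>sqrt n\<close> gives them the fixed law
      \<open>scaled_normal \<sigma>w\<close>; the factor cancels the \<open>1 / sqrt n\<close> in
      \<open>walk_expectation\<close>.\<close>
    define d where "d = (\<lambda>\<kappa> :: entry. case \<kappa> of Inl _ \<Rightarrow> sqrt (real (n N)) | Inr _ \<Rightarrow> 1)"
    define U where "U = (\<lambda>\<kappa> \<omega>. d \<kappa> * ?V \<kappa> \<omega>)"
    have ind: "indep_vars (\<lambda>_. borel) ?V (K N)" unfolding K_def by (rule indep)
    have rv: "random_variable borel (?V \<kappa>)" if "\<kappa> \<in> K N" for \<kappa>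
      using ind that unfolding indep_vars_def by blast
    have indU: "indep_vars (\<lambda>_. borel) U (K N)"
      unfolding U_def by (rule indep_vars_compose2[OF ind]) simp
    \<comment> \<open>The hypothesis prescribes a characteristic function, which determines the
      law.\<close>
    have \<nu>w: "\<nu>w (n N) = scaled_normal (\<sigma>w / sqrt (real (n N)))"
      using n by (intro Levy_uniqueness nu_w_dist scaled_normal_dist)
        (auto simp: fun_eq_iff char_scaled_normal nu_w_gauss power_mult_distrib power_divide)
    have U: "distr (P N) borel (U \<kappa>) = law \<kappa>" if \<kappa>: "\<kappa> \<in> K N" for \<kappa>
    proof -
      have "distr (P N) borel (U \<kappa>) = distr (distr (P N) borel (?V \<kappa>)) borel (\<lambda>x. d \<kappa> * x)"
        unfolding U_def by (subst distr_distr) (simp_all add: rv[OF \<kappa>] comp_def)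
      also have "\<dots> = law \<kappa>"
      proof (cases \<kappa>)
        case (Inl a)
        then obtain i l where il: "\<kappa> = Inl (i, l)" "i < p N" "l < n N" using \<kappa> by (auto simp: K_def)
        then show ?thesis using n by (simp add: W_law \<nu>w d_def distr_scaled_normal)
      next
        case (Inr a)
        then obtain l j where lj: "\<kappa> = Inr (l, j)" "l < n N" "j < m N" using \<kappa> by (auto simp: K_def)
        interpret \<nu>: real_distribution \<nu>x by (rule nu_x_dist)
        have "distr \<nu>x borel (\<lambda>x. x) = \<nu>x" by (rule distr_id2) simp
        then show ?thesis using lj by (simp add: X_law d_def)
      qed
      finally show ?thesis .
    qed
    let ?F = "\<lambda>i j \<omega>. \<Prod>a=1..k. f (\<Sum>l<n N. W N (i a) l \<omega> * X N l (j a) \<omega>) *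
      f (\<Sum>l<n N. W N (i (cyc_next k a)) l \<omega> * X N l (j a) \<omega>)"
    have "Inl (0, 0) \<in> K N" using n p unfolding K_def by (intro InlI) auto
    then have Kne: "K N \<noteq> {}" by blast
    have UV: "U (Inl (r, l)) \<omega> * U (Inr (l, c)) \<omega> / sqrt (real (n N)) = W N r l \<omega> * X N l c \<omega>" for r l c \<omega>
      using n by (simp add: U_def d_def)
    have F: "integrable (P N) (?F i j)" "expectation (?F i j) = ?w N i j"
      if i: "i \<in> ?I N" and j: "j \<in> ?J N" for i j
      using walk_expectation_transfer[where k = k and n = "n N" and i = i and j = j, OF prob Kne indU U K_in[OF i j] fm fb]
      unfolding UV by simp_all
    have "expectation (\<lambda>\<omega>. 1 / real (p N) * trace_mat
               (M_mat f (m N) (p N) (n N) (\<lambda>i l. W N i l \<omega>) (\<lambda>l j. X N l j \<omega>) ^\<^sub>m k))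
      = expectation (\<lambda>\<omega>. (\<Sum>i\<in>?I N. \<Sum>j\<in>?J N. ?F i j \<omega>) / (real (p N) * real (m N) ^ k))"
      unfolding trace_M_mat[OF k_pos m] by simp
    also have "\<dots> = (\<Sum>i\<in>?I N. \<Sum>j\<in>?J N. expectation (?F i j)) / (real (p N) * real (m N) ^ k)"
      using F(1) by (simp add: Bochner_Integration.integral_sum del: One_nat_def)
    also have "\<dots> = (\<Sum>i\<in>?I N. \<Sum>j\<in>?J N. ?w N i j) / (real (p N) * real (m N) ^ k)"
      using F(2) by (intro arg_cong2[where f = "(/)"] sum.cong refl)
    finally show ?case .
  qed
  then show ?thesis using lim by (simp only: tendsto_cong)
qed

end
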